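(* Let $n\ge 3$. There is a constant $\delta_1=\delta_1(n)>0$ such that if $V$ is a basic flow (in the sense of the context) with $\|V\|\le\delta_1$, then there exists a family $\{T(t,s)\}_{t\ge s\ge 0}$ of bounded linear operators on $L^2_\sigma$ with the following properties. 1. For every $s\ge 0$ and $f\in L^2_\sigma$, $$T(\cdot,s)f\in L^2(s,T;H^1_\sigma)\cap C([s,\infty);L^2_\sigma),\qquad \partial_tT(\cdot,s)f\in L^2(s,T;(H^1_\sigma)^* )\qquad\text{for all }T\in(s,\infty),\tag{a}$$ together with $$\partial_tT(t,s)f+L(t)T(t,s)f=0\ \text{ in }(H^1_\sigma)^*\text{ for a.e. }t\in(s,\infty),\qquad \lim_{t\to s}\|T(t,s)f-f\|_2=0,$$ and $T(\cdot,s)f$ is the unique solution, within the class (a), of the Cauchy problem $u'(t)+L(t)u(t)=0$ for $t\in(s,\infty)$, $u(s)=f$. Furthermore, $$T(\cdot,s)f\in L^\infty(s,\infty;L^2_\sigma),\qquad \nabla T(\cdot,s)f\in L^2(s,\infty;L^2),$$ with the energy inequality $$\|T(t,s)f\|_2^2+\int_s^t\|\nabla T(\tau,s)f\|_2^2\,d\tau\le\|f\|_2^2\qquad\text{for all }t\ge s.$$ 2. $T(t,\tau)T(\tau,s)=T(t,s)$ as bounded operators on $L^2_\sigma$ for all $0\le s\le\tau\le t$.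
   Context: Notation: $L^q=L^q(\mathbb R^n)$ with norm $\|\cdot\|_q$; $L^{q,r}=L^{q,r}(\mathbb R^n)$ are the Lorentz spaces with norm $\|\cdot\|_{q,r}$ ($L^{q,\infty}$ is weak-$L^q$, the dual of $L^{q',1}$, $1/q+1/q'=1$); the same symbols are used for spaces of vector fields. $C^\infty_{0,\sigma}$ is the set of smooth compactly supported divergence-free vector fields on $\mathbb R^n$; $L^2_\sigma$ and $H^1_\sigma$ are its completions in $L^2$ and $H^1$. $\langle\cdot,\cdot\rangle$ denotes duality pairings, in particular the $L^2$ scalar product. Basic flow: a vector field $V=V(x,t)\in\mathbb R^n$ on $\mathbb R^n\times[0,\infty)$ with $\operatorname{div}V=0$ and $V\in L^\infty(0,\infty;L^{n,\infty})\cap C_w([0,\infty);L^{n,\infty})$, where $C_w([0,\infty);L^{n,\infty})$ is the set of weak*-continuous functions with values in $L^{n,\infty}$. Write $\|V\|:=\sup_{t>0}\|V(t)\|_{n,\infty}$. For $t\ge0$ and $u,w\in H^1_\sigma$ put $$a(t;u,w):=\langle\nabla u,\nabla w\rangle+\langle V(t)\cdot\nabla u,w\rangle-\langle V(t)\otimes u,\nabla w\rangle,\qquad \langle V(t)\otimes u,\nabla w\rangle:=\sum_{j,k=1}^n\int_{\mathbb R^n}V_j(t)u_k\,\partial_kw_j\,dx .$$ This is a bounded bilinear form on $H^1_\sigma$, and $L(t):H^1_\sigma\to(H^1_\sigma)^*$ is the linear operator defined by $\langle L(t)u,w\rangle=a(t;u,w)$. *)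

theory Defs
  imports "HOL-Analysis.Analysis"
begin

section \<open>The Hilbert space of square integrable fields\<close>

definition square_integrable :: "('a::euclidean_space \<Rightarrow> 'b::euclidean_space) \<Rightarrow> bool" where
  "square_integrable f \<longleftrightarrow>
     f \<in> borel_measurable lebesgue \<and> integrable lebesgue (\<lambda>x. (norm (f x))\<^sup>2)"

definition L2rel :: "('a::euclidean_space \<Rightarrow> 'b::euclidean_space) \<Rightarrow> ('a \<Rightarrow> 'b) \<Rightarrow> bool" where
  "L2rel f g \<longleftrightarrow> square_integrable f \<and> square_integrable g \<and> (AE x in lebesgue. f x = g x)"

lemma square_integrable_inner:
  fixes f g :: "'a::euclidean_space \<Rightarrow> 'b::euclidean_space"
  assumes "square_integrable f" "square_integrable g"
  shows "integrable lebesgue (\<lambda>x. f x \<bullet> g x)"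
proof (rule Bochner_Integration.integrable_bound)
  show "integrable lebesgue (\<lambda>x. (norm (f x))\<^sup>2 + (norm (g x))\<^sup>2)"
    using assms by (simp add: square_integrable_def)
  show "(\<lambda>x. f x \<bullet> g x) \<in> borel_measurable lebesgue"
    using assms by (intro borel_measurable_inner) (auto simp: square_integrable_def)
  have "\<bar>f x \<bullet> g x\<bar> \<le> (norm (f x))\<^sup>2 + (norm (g x))\<^sup>2" for x
  proof -
    have "\<bar>f x \<bullet> g x\<bar> \<le> norm (f x) * norm (g x)"
      by (rule Cauchy_Schwarz_ineq2)
    also have "\<dots> \<le> (norm (f x))\<^sup>2 + (norm (g x))\<^sup>2"
    proof -
      have "0 \<le> norm (f x) * norm (g x)" by simp
      then show ?thesis
        using sum_squares_bound[of "norm (f x)" "norm (g x)"] by linarith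
    qed
    finally show ?thesis .
  qed
  then show "AE x in lebesgue. norm (f x \<bullet> g x) \<le> norm ((norm (f x))\<^sup>2 + (norm (g x))\<^sup>2)"
    by simp
qed

lemma square_integrable_zero: "square_integrable (\<lambda>x. 0)"
  by (simp add: square_integrable_def)

lemma square_integrable_scaleR:
  "square_integrable f \<Longrightarrow> square_integrable (\<lambda>x. c *\<^sub>R f x)"
  by (auto simp: square_integrable_def power_mult_distrib intro!: borel_measurable_scaleR)

lemma square_integrable_add:
  fixes f g :: "'a::euclidean_space \<Rightarrow> 'b::euclidean_space"
  assumes "square_integrable f" "square_integrable g"
  shows "square_integrable (\<lambda>x. f x + g x)"
proof -
  have "(norm (f x + g x))\<^sup>2 = (norm (f x))\<^sup>2 + 2 * (f x \<bullet> g x) + (norm (g x))\<^sup>2" for x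
    by (simp add: power2_norm_eq_inner inner_add_left inner_add_right inner_commute)
  then show ?thesis
    using assms square_integrable_inner[OF assms]
    by (auto simp: square_integrable_def intro!: borel_measurable_add)
qed

lemma part_equivp_L2rel: "part_equivp L2rel"
proof (rule part_equivpI)
  show "\<exists>x. L2rel x x"
    by (intro exI[of _ "\<lambda>x. 0"]) (simp add: L2rel_def square_integrable_zero)
  show "symp L2rel"
    by (rule sympI) (auto simp: L2rel_def)
  show "transp L2rel"
    by (rule transpI) (auto simp: L2rel_def elim: AE_mp)
qed

quotient_type (overloaded) ('a, 'b) L2 = "'a::euclidean_space \<Rightarrow> 'b::euclidean_space"
  / partial: L2rel
  morphisms rep_L2 abs_L2
  by (rule part_equivp_L2rel)

instantiation L2 :: (euclidean_space, euclidean_space) real_inner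
begin

lift_definition zero_L2 :: "('a, 'b) L2" is "\<lambda>x. 0"
  by (simp add: L2rel_def square_integrable_zero)

lift_definition plus_L2 :: "('a, 'b) L2 \<Rightarrow> ('a, 'b) L2 \<Rightarrow> ('a, 'b) L2" is "\<lambda>f g x. f x + g x"
  by (auto simp: L2rel_def intro!: square_integrable_add)

lift_definition scaleR_L2 :: "real \<Rightarrow> ('a, 'b) L2 \<Rightarrow> ('a, 'b) L2" is "\<lambda>c f x. c *\<^sub>R f x"
  by (auto simp: L2rel_def intro!: square_integrable_scaleR)

definition uminus_L2 :: "('a, 'b) L2 \<Rightarrow> ('a, 'b) L2" where
  "uminus_L2 u = (-1) *\<^sub>R u"

definition minus_L2 :: "('a, 'b) L2 \<Rightarrow> ('a, 'b) L2 \<Rightarrow> ('a, 'b) L2" where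
  "minus_L2 u v = u + (-1) *\<^sub>R v"

lift_definition inner_L2 :: "('a, 'b) L2 \<Rightarrow> ('a, 'b) L2 \<Rightarrow> real"
  is "\<lambda>f g. LINT x|lebesgue. f x \<bullet> g x"
  by (rule integral_cong_AE) (auto simp: L2rel_def square_integrable_def)

definition norm_L2 :: "('a, 'b) L2 \<Rightarrow> real" where
  "norm_L2 u = sqrt (u \<bullet> u)"

definition sgn_L2 :: "('a, 'b) L2 \<Rightarrow> ('a, 'b) L2" where
  "sgn_L2 u = inverse (norm u) *\<^sub>R u"

definition dist_L2 :: "('a, 'b) L2 \<Rightarrow> ('a, 'b) L2 \<Rightarrow> real" where
  "dist_L2 u v = norm (u - v)"

definition uniformity_L2 :: "(('a, 'b) L2 \<times> ('a, 'b) L2) filter" where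
  "uniformity_L2 = (INF e\<in>{0<..}. principal {(u, v). dist u v < e})"

definition open_L2 :: "('a, 'b) L2 set \<Rightarrow> bool" where
  "open_L2 U \<longleftrightarrow> (\<forall>x\<in>U. \<forall>\<^sub>F (x', y) in uniformity. x' = x \<longrightarrow> y \<in> U)"

instance
proof
  fix u v w :: "('a, 'b) L2" and a b :: real
  note [simp] = L2rel_def square_integrable_add square_integrable_scaleR square_integrable_zero
  show "u + v + w = u + (v + w)" by transfer (simp add: add.assoc)
  show "u + v = v + u" by transfer (simp add: add.commute)
  show "0 + u = u" by transfer simp
  show "- u + u = 0" unfolding uminus_L2_def by transfer simp
  show "u - v = u + - v" by (simp add: minus_L2_def uminus_L2_def)
  show "a *\<^sub>R (u + v) = a *\<^sub>R u + a *\<^sub>R v" by transfer (simp add: scaleR_add_right)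
  show "(a + b) *\<^sub>R u = a *\<^sub>R u + b *\<^sub>R u" by transfer (simp add: scaleR_add_left)
  show "a *\<^sub>R b *\<^sub>R u = (a * b) *\<^sub>R u" by transfer simp
  show "1 *\<^sub>R u = u" by transfer simp
  show "sgn u = inverse (norm u) *\<^sub>R u" by (rule sgn_L2_def)
  show "dist u v = norm (u - v)" by (rule dist_L2_def)
  show "uniformity = (INF e\<in>{0<..}. principal {(u, v :: ('a, 'b) L2). dist u v < e})"
    by (rule uniformity_L2_def)
  show "open U \<longleftrightarrow> (\<forall>x\<in>U. \<forall>\<^sub>F (x', y) in uniformity. x' = x \<longrightarrow> y \<in> U)" for U :: "('a, 'b) L2 set"
    by (rule open_L2_def)
  show "u \<bullet> v = v \<bullet> u" by transfer (simp add: inner_commute)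
  show "(u + v) \<bullet> w = u \<bullet> w + v \<bullet> w"
    by transfer (simp add: inner_add_left square_integrable_inner)
  show "(a *\<^sub>R u) \<bullet> v = a * (u \<bullet> v)" by transfer simp
  show "0 \<le> u \<bullet> u" by transfer simp
  show "u \<bullet> u = 0 \<longleftrightarrow> u = 0"
    by transfer (subst integral_nonneg_eq_0_iff_AE, auto simp: square_integrable_inner)
  show "norm u = sqrt (u \<bullet> u)" by (rule norm_L2_def)
qed

end

section \<open>Test fields\<close>

fun iter_deriv :: "'a::euclidean_space list \<Rightarrow> ('a \<Rightarrow> 'b::real_normed_vector) \<Rightarrow> 'a \<Rightarrow> 'b" where
  "iter_deriv [] f = f"
| "iter_deriv (v # vs) f = (\<lambda>x. frechet_derivative (iter_deriv vs f) (at x) v)"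

text \<open>All iterated directional derivatives exist and are differentiable, hence continuous; this
  is \<open>C\<^sup>\<infinity>\<close>.\<close>

definition smooth :: "('a::euclidean_space \<Rightarrow> 'b::real_normed_vector) \<Rightarrow> bool" where
  "smooth f \<longleftrightarrow> (\<forall>vs x. iter_deriv vs f differentiable (at x))"

definition test_fun :: "'a::euclidean_space set \<Rightarrow> ('a \<Rightarrow> 'b::real_normed_vector) \<Rightarrow> bool" where
  "test_fun S f \<longleftrightarrow> smooth f \<and> compact (closure {x. f x \<noteq> 0}) \<and> closure {x. f x \<noteq> 0} \<subseteq> S"

definition partial :: "'n::finite \<Rightarrow> (real^'n \<Rightarrow> 'b::real_normed_vector) \<Rightarrow> real^'n \<Rightarrow> 'b" where
  "partial j f x = frechet_derivative f (at x) (axis j 1)"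

text \<open>The entry \<open>(j, k)\<close> of the gradient matrix is \<open>\<partial>\<^sub>j u\<^sub>k\<close>; the norm of \<open>real^'n^'n\<close> is the
  Frobenius norm.\<close>

definition gradient :: "(real^'n \<Rightarrow> real^'n) \<Rightarrow> real^'n \<Rightarrow> real^'n^'n::finite" where
  "gradient f x = (\<chi> j k. partial j f x $ k)"

definition test_fields :: "(real^'n \<Rightarrow> real^'n::finite) set" where
  "test_fields = {\<phi>. test_fun UNIV \<phi> \<and> (\<forall>x. (\<Sum>j\<in>UNIV. partial j \<phi> x $ j) = 0)}"

lemma iter_deriv_zero: "iter_deriv vs (\<lambda>x. 0) = (\<lambda>x. 0)"
  by (induction vs) auto

lemma iter_deriv_add:
  assumes "smooth f" "smooth g"
  shows "iter_deriv vs (\<lambda>x. f x + g x) = (\<lambda>x. iter_deriv vs f x + iter_deriv vs g x)"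
proof (induction vs)
  case (Cons v vs)
  have "((\<lambda>x. iter_deriv vs f x + iter_deriv vs g x) has_derivative
     (\<lambda>h. frechet_derivative (iter_deriv vs f) (at x) h
        + frechet_derivative (iter_deriv vs g) (at x) h)) (at x)" for x
    using assms by (auto intro!: has_derivative_add simp: smooth_def frechet_derivative_works)
  from frechet_derivative_at[OF this] show ?case
    by (auto simp: Cons fun_eq_iff dest: fun_cong)
qed simp

lemma iter_deriv_scaleR:
  assumes "smooth f"
  shows "iter_deriv vs (\<lambda>x. c *\<^sub>R f x) = (\<lambda>x. c *\<^sub>R iter_deriv vs f x)"
proof (induction vs)
  case (Cons v vs)
  have "((\<lambda>x. c *\<^sub>R iter_deriv vs f x) has_derivative
     (\<lambda>h. c *\<^sub>R frechet_derivative (iter_deriv vs f) (at x) h)) (at x)" for x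
    using assms by (auto intro!: has_derivative_scaleR_right simp: smooth_def frechet_derivative_works)
  from frechet_derivative_at[OF this] show ?case
    by (auto simp: Cons fun_eq_iff dest: fun_cong)
qed simp

lemma smooth_add: "smooth f \<Longrightarrow> smooth g \<Longrightarrow> smooth (\<lambda>x. f x + g x)"
  by (auto simp: smooth_def[of "\<lambda>x. f x + g x"] iter_deriv_add)
     (auto simp: smooth_def intro!: differentiable_add)

lemma smooth_scaleR: "smooth f \<Longrightarrow> smooth (\<lambda>x. c *\<^sub>R f x)"
  by (auto simp: smooth_def[of "\<lambda>x. c *\<^sub>R f x"] iter_deriv_scaleR)
     (auto simp: smooth_def intro!: differentiable_scaleR)

lemma partial_add:
  assumes "smooth f" "smooth g"
  shows "partial j (\<lambda>x. f x + g x) x = partial j f x + partial j g x"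
  using fun_cong[OF iter_deriv_add[OF assms, where vs = "[axis j 1]"], where x = x] by (simp add: partial_def)

lemma partial_scaleR:
  assumes "smooth f"
  shows "partial j (\<lambda>x. c *\<^sub>R f x) x = c *\<^sub>R partial j f x"
  using fun_cong[OF iter_deriv_scaleR[OF assms, where vs = "[axis j 1]" and c = c], where x = x] by (simp add: partial_def)

lemma gradient_zero: "gradient (\<lambda>x. 0) = (\<lambda>x. 0)"
  by (simp add: gradient_def partial_def fun_eq_iff vec_eq_iff)

lemma gradient_add:
  "smooth f \<Longrightarrow> smooth g \<Longrightarrow> gradient (\<lambda>x. f x + g x) = (\<lambda>x. gradient f x + gradient g x)"
  by (simp add: gradient_def partial_add fun_eq_iff vec_eq_iff)

lemma gradient_scaleR:
  "smooth f \<Longrightarrow> gradient (\<lambda>x. c *\<^sub>R f x) = (\<lambda>x. c *\<^sub>R gradient f x)"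
  by (simp add: gradient_def partial_scaleR fun_eq_iff vec_eq_iff)

lemma test_fields_zero: "(\<lambda>x. 0) \<in> test_fields"
  by (auto simp: test_fields_def test_fun_def smooth_def iter_deriv_zero partial_def)

lemma test_fields_add:
  assumes f: "f \<in> test_fields" and g: "g \<in> test_fields"
  shows "(\<lambda>x. f x + g x) \<in> test_fields"
proof -
  have sub: "closure {x. f x + g x \<noteq> 0} \<subseteq> closure ({x. f x \<noteq> 0} \<union> {x. g x \<noteq> 0})"
    by (rule closure_mono) auto
  have bdd: "bounded (closure ({x. f x \<noteq> 0} \<union> {x. g x \<noteq> 0}))"
    using f g by (simp add: test_fields_def test_fun_def compact_eq_bounded_closed)
  have "compact (closure {x. f x + g x \<noteq> 0})"
    unfolding compact_eq_bounded_closed using bounded_subset[OF bdd sub] closed_closure by (rule conjI)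
  then show ?thesis
    using f g
    by (auto simp: test_fields_def test_fun_def smooth_add partial_add sum.distrib)
qed

lemma test_fields_scaleR:
  assumes f: "f \<in> test_fields"
  shows "(\<lambda>x. c *\<^sub>R f x) \<in> test_fields"
proof -
  have sub: "closure {x. c *\<^sub>R f x \<noteq> 0} \<subseteq> closure {x. f x \<noteq> 0}"
    by (rule closure_mono) auto
  have bdd: "bounded (closure {x. f x \<noteq> 0})"
    using f by (simp add: test_fields_def test_fun_def compact_eq_bounded_closed)
  have "compact (closure {x. c *\<^sub>R f x \<noteq> 0})"
    unfolding compact_eq_bounded_closed using bounded_subset[OF bdd sub] closed_closure by (rule conjI)
  then show ?thesis
    using f
    by (auto simp: test_fields_def test_fun_def smooth_scaleR partial_scaleR
        simp flip: sum_distrib_left)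
qed

lemma square_integrable_continuous:
  fixes f :: "'a::euclidean_space \<Rightarrow> 'b::euclidean_space"
  assumes "continuous_on UNIV f" and K: "compact K" and "\<And>x. x \<notin> K \<Longrightarrow> f x = 0"
  shows "square_integrable f"
proof -
  have "integrable lborel (\<lambda>x. indicator K x *\<^sub>R (norm (f x))\<^sup>2)"
    using assms(1) by (intro borel_integrable_compact K continuous_intros continuous_on_subset[OF assms(1)]) auto
  also have "(\<lambda>x. indicator K x *\<^sub>R (norm (f x))\<^sup>2) = (\<lambda>x. (norm (f x))\<^sup>2)"
    using assms(3) by (auto simp: indicator_def fun_eq_iff)
  finally have "integrable lborel (\<lambda>x. (norm (f x))\<^sup>2)" .
  moreover have "f \<in> borel_measurable borel"
    by (rule borel_measurable_continuous_onI) (rule assms(1))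
  ultimately show ?thesis
    unfolding square_integrable_def by (simp add: integrable_completion measurable_completion)
qed

lemma square_integrable_test_field:
  assumes "\<phi> \<in> test_fields"
  shows "square_integrable \<phi>" "square_integrable (gradient \<phi>)"
proof -
  define K where "K = closure {x. \<phi> x \<noteq> 0}"
  have sm: "smooth \<phi>" and K: "compact K"
    using assms by (auto simp: test_fields_def test_fun_def K_def)
  have cont: "continuous_on UNIV (iter_deriv vs \<phi>)" for vs
    using sm by (simp add: smooth_def continuous_at_imp_continuous_on
        differentiable_imp_continuous_within)
  have out: "\<phi> x = 0" if "x \<notin> K" for x
    using that closure_subset[of "{x. \<phi> x \<noteq> 0}"] unfolding K_def by auto
  show "square_integrable \<phi>"
    by (rule square_integrable_continuous[OF _ K out]) (use cont[of "[]"] in simp)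
  have "continuous_on UNIV (partial j \<phi>)" for j
    using cont[of "[axis j 1]"] by (simp add: partial_def[abs_def])
  then have "continuous_on UNIV (gradient \<phi>)"
    unfolding gradient_def[abs_def] by (intro continuous_intros) auto
  moreover have "gradient \<phi> x = 0" if "x \<notin> K" for x
  proof -
    have "frechet_derivative \<phi> (at x) = frechet_derivative (\<lambda>x. 0) (at x)"
    proof (rule frechet_derivative_transform_within_open)
      show "\<phi> differentiable at x"
        using sm[unfolded smooth_def, rule_format, of "[]" x] by simp
      show "open (- K)"
        using K by (simp add: compact_imp_closed open_Compl)
    qed (use that out in auto)
    then show ?thesis by (simp add: gradient_def partial_def vec_eq_iff)
  qed
  ultimately show "square_integrable (gradient \<phi>)"
    by (rule square_integrable_continuous[OF _ K])
qed

section \<open>The solenoidal spaces\<close>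

text \<open>The completions of \<open>C\<^sup>\<infinity>\<^sub>0\<^sub>,\<^sub>\<sigma>\<close> are realised as closures in the complete spaces \<open>L\<^sup>2\<close>
  and \<open>L\<^sup>2 \<times> L\<^sup>2\<close>. An element of \<open>H\<^sup>1\<^sub>\<sigma>\<close> is the pair \<open>(u, \<nabla>u)\<close>, so that the norm of the product,
  \<open>(\<parallel>u\<parallel>\<^sup>2 + \<parallel>\<nabla>u\<parallel>\<^sup>2)\<^sup>1\<^sup>/\<^sup>2\<close>, is the norm of \<open>H\<^sup>1\<close>.\<close>

definition L2s_set :: "(real^'n, real^'n::finite) L2 set" where
  "L2s_set = closure (abs_L2 ` test_fields)"

definition H1s_set :: "((real^'n, real^'n) L2 \<times> (real^'n, real^'n^'n::finite) L2) set" where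
  "H1s_set = closure ((\<lambda>\<phi>. (abs_L2 \<phi>, abs_L2 (gradient \<phi>))) ` test_fields)"

lemma subspace_closure:
  fixes S :: "'a::real_normed_vector set"
  assumes "subspace S"
  shows "subspace (closure S)"
proof (rule subspaceI)
  show "0 \<in> closure S"
    using assms closure_subset subspace_0 by blast
next
  fix x y assume "x \<in> closure S" "y \<in> closure S"
  then obtain f g where "\<And>n. f n \<in> S" "f \<longlonglongrightarrow> x" "\<And>n. g n \<in> S" "g \<longlonglongrightarrow> y"
    unfolding closure_sequential by blast
  then show "x + y \<in> closure S"
    unfolding closure_sequential using assms
    by (intro exI[of _ "\<lambda>n. f n + g n"]) (auto intro: tendsto_add subspace_add)
next
  fix x and c :: real assume "x \<in> closure S"
  then obtain f where "\<And>n. f n \<in> S" "f \<longlonglongrightarrow> x"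
    unfolding closure_sequential by blast
  then show "c *\<^sub>R x \<in> closure S"
    unfolding closure_sequential using assms
    by (intro exI[of _ "\<lambda>n. c *\<^sub>R f n"]) (auto intro!: tendsto_scaleR subspace_scale)
qed

lemma abs_L2_add:
  "square_integrable f \<Longrightarrow> square_integrable g \<Longrightarrow> abs_L2 (\<lambda>x. f x + g x) = abs_L2 f + abs_L2 g"
  by (rule plus_L2.abs_eq[symmetric]) (auto simp: L2rel_def)

lemma abs_L2_scaleR:
  "square_integrable f \<Longrightarrow> abs_L2 (\<lambda>x. c *\<^sub>R f x) = c *\<^sub>R abs_L2 f"
  by (rule scaleR_L2.abs_eq[symmetric]) (auto simp: L2rel_def)

lemma subspace_L2s_set: "subspace L2s_set"
  unfolding L2s_set_def
proof (rule subspace_closure, rule subspaceI)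
  show "0 \<in> abs_L2 ` test_fields"
    unfolding zero_L2_def using test_fields_zero by (rule imageI)
qed (force simp flip: abs_L2_add abs_L2_scaleR
       simp: square_integrable_test_field intro: test_fields_add test_fields_scaleR)+

lemma subspace_H1s_set:
  "subspace (H1s_set :: ((real^'n, real^'n) L2 \<times> (real^'n, real^'n^'n::finite) L2) set)"
  unfolding H1s_set_def
proof (rule subspace_closure, rule subspaceI)
  show "(0 :: (real^'n, real^'n) L2 \<times> (real^'n, real^'n^'n) L2)
      \<in> (\<lambda>\<phi>. (abs_L2 \<phi>, abs_L2 (gradient \<phi>))) ` test_fields"
    unfolding zero_prod_def zero_L2_def
    by (rule image_eqI[OF _ test_fields_zero]) (simp add: gradient_zero)
next
  fix x y :: "(real^'n, real^'n) L2 \<times> (real^'n, real^'n^'n) L2"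
  assume "x \<in> (\<lambda>\<phi>. (abs_L2 \<phi>, abs_L2 (gradient \<phi>))) ` test_fields"
    and "y \<in> (\<lambda>\<phi>. (abs_L2 \<phi>, abs_L2 (gradient \<phi>))) ` test_fields"
  then obtain f g where fg: "f \<in> test_fields" "g \<in> test_fields"
    and [simp]: "x = (abs_L2 f, abs_L2 (gradient f))" "y = (abs_L2 g, abs_L2 (gradient g))"
    by auto
  moreover have "smooth f" "smooth g"
    using fg by (auto simp: test_fields_def test_fun_def)
  ultimately have "x + y = (abs_L2 (\<lambda>x. f x + g x), abs_L2 (gradient (\<lambda>x. f x + g x)))"
    by (simp add: gradient_add abs_L2_add square_integrable_test_field)
  then show "x + y \<in> (\<lambda>\<phi>. (abs_L2 \<phi>, abs_L2 (gradient \<phi>))) ` test_fields"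
    using test_fields_add[OF fg] by (rule image_eqI)
next
  fix x :: "(real^'n, real^'n) L2 \<times> (real^'n, real^'n^'n) L2" and c :: real
  assume "x \<in> (\<lambda>\<phi>. (abs_L2 \<phi>, abs_L2 (gradient \<phi>))) ` test_fields"
  then obtain f where f: "f \<in> test_fields" and [simp]: "x = (abs_L2 f, abs_L2 (gradient f))"
    by auto
  moreover have "smooth f"
    using f by (auto simp: test_fields_def test_fun_def)
  ultimately have "c *\<^sub>R x = (abs_L2 (\<lambda>x. c *\<^sub>R f x), abs_L2 (gradient (\<lambda>x. c *\<^sub>R f x)))"
    by (simp add: gradient_scaleR abs_L2_scaleR square_integrable_test_field)
  then show "c *\<^sub>R x \<in> (\<lambda>\<phi>. (abs_L2 \<phi>, abs_L2 (gradient \<phi>))) ` test_fields"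
    using test_fields_scaleR[OF f] by (rule image_eqI)
qed

typedef 'n L2s = "L2s_set :: (real^'n, real^'n::finite) L2 set"
  using subspace_0[OF subspace_L2s_set] by blast

typedef 'n H1s = "H1s_set :: ((real^'n, real^'n) L2 \<times> (real^'n, real^'n^'n::finite) L2) set"
  using subspace_0[OF subspace_H1s_set] by blast

setup_lifting type_definition_L2s
setup_lifting type_definition_H1s

instantiation L2s :: (finite) real_inner
begin

lift_definition zero_L2s :: "'a L2s" is 0
  by (rule subspace_0[OF subspace_L2s_set])

lift_definition plus_L2s :: "'a L2s \<Rightarrow> 'a L2s \<Rightarrow> 'a L2s" is "(+)"
  by (rule subspace_add[OF subspace_L2s_set])

lift_definition minus_L2s :: "'a L2s \<Rightarrow> 'a L2s \<Rightarrow> 'a L2s" is "(-)"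
  by (rule subspace_diff[OF subspace_L2s_set])

lift_definition uminus_L2s :: "'a L2s \<Rightarrow> 'a L2s" is uminus
  by (rule subspace_neg[OF subspace_L2s_set])

lift_definition scaleR_L2s :: "real \<Rightarrow> 'a L2s \<Rightarrow> 'a L2s" is "(*\<^sub>R)"
  by (rule subspace_scale[OF subspace_L2s_set])

lift_definition inner_L2s :: "'a L2s \<Rightarrow> 'a L2s \<Rightarrow> real" is "(\<bullet>)" .

lift_definition norm_L2s :: "'a L2s \<Rightarrow> real" is norm .

definition sgn_L2s :: "'a L2s \<Rightarrow> 'a L2s" where
  "sgn_L2s u = inverse (norm u) *\<^sub>R u"

definition dist_L2s :: "'a L2s \<Rightarrow> 'a L2s \<Rightarrow> real" where
  "dist_L2s u v = norm (u - v)"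

definition uniformity_L2s :: "('a L2s \<times> 'a L2s) filter" where
  "uniformity_L2s = (INF e\<in>{0<..}. principal {(u, v). dist u v < e})"

definition open_L2s :: "'a L2s set \<Rightarrow> bool" where
  "open_L2s U \<longleftrightarrow> (\<forall>x\<in>U. \<forall>\<^sub>F (x', y) in uniformity. x' = x \<longrightarrow> y \<in> U)"

instance
proof
  fix u v w :: "'a L2s" and a b :: real
  show "u + v + w = u + (v + w)" by transfer simp
  show "u + v = v + u" by transfer (rule add.commute)
  show "0 + u = u" by transfer simp
  show "- u + u = 0" by transfer simp
  show "u - v = u + - v" by transfer simp
  show "a *\<^sub>R (u + v) = a *\<^sub>R u + a *\<^sub>R v" by transfer (rule scaleR_add_right)
  show "(a + b) *\<^sub>R u = a *\<^sub>R u + b *\<^sub>R u" by transfer (rule scaleR_add_left)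
  show "a *\<^sub>R b *\<^sub>R u = (a * b) *\<^sub>R u" by transfer simp
  show "1 *\<^sub>R u = u" by transfer simp
  show "sgn u = inverse (norm u) *\<^sub>R u" by (rule sgn_L2s_def)
  show "dist u v = norm (u - v)" by (rule dist_L2s_def)
  show "uniformity = (INF e\<in>{0<..}. principal {(u, v :: 'a L2s). dist u v < e})"
    by (rule uniformity_L2s_def)
  show "open U \<longleftrightarrow> (\<forall>x\<in>U. \<forall>\<^sub>F (x', y) in uniformity. x' = x \<longrightarrow> y \<in> U)" for U :: "'a L2s set"
    by (rule open_L2s_def)
  show "u \<bullet> v = v \<bullet> u" by transfer (simp add: inner_commute)
  show "(u + v) \<bullet> w = u \<bullet> w + v \<bullet> w" by transfer (simp add: inner_add_left)
  show "(a *\<^sub>R u) \<bullet> v = a * (u \<bullet> v)" by transfer (simp add: distrib_left)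
  show "0 \<le> u \<bullet> u" by transfer simp
  show "u \<bullet> u = 0 \<longleftrightarrow> u = 0" by transfer (simp add: zero_prod_def add_nonneg_eq_0_iff)
  show "norm u = sqrt (u \<bullet> u)" by transfer (simp add: norm_eq_sqrt_inner norm_prod_def)
qed

end

instantiation H1s :: (finite) real_inner
begin

lift_definition zero_H1s :: "'a H1s" is 0
  by (rule subspace_0[OF subspace_H1s_set])

lift_definition plus_H1s :: "'a H1s \<Rightarrow> 'a H1s \<Rightarrow> 'a H1s" is "(+)"
  by (rule subspace_add[OF subspace_H1s_set])

lift_definition minus_H1s :: "'a H1s \<Rightarrow> 'a H1s \<Rightarrow> 'a H1s" is "(-)"
  by (rule subspace_diff[OF subspace_H1s_set])

lift_definition uminus_H1s :: "'a H1s \<Rightarrow> 'a H1s" is uminus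
  by (rule subspace_neg[OF subspace_H1s_set])

lift_definition scaleR_H1s :: "real \<Rightarrow> 'a H1s \<Rightarrow> 'a H1s" is "(*\<^sub>R)"
  by (rule subspace_scale[OF subspace_H1s_set])

lift_definition inner_H1s :: "'a H1s \<Rightarrow> 'a H1s \<Rightarrow> real" is "(\<bullet>)" .

lift_definition norm_H1s :: "'a H1s \<Rightarrow> real" is norm .

definition sgn_H1s :: "'a H1s \<Rightarrow> 'a H1s" where
  "sgn_H1s u = inverse (norm u) *\<^sub>R u"

definition dist_H1s :: "'a H1s \<Rightarrow> 'a H1s \<Rightarrow> real" where
  "dist_H1s u v = norm (u - v)"

definition uniformity_H1s :: "('a H1s \<times> 'a H1s) filter" where
  "uniformity_H1s = (INF e\<in>{0<..}. principal {(u, v). dist u v < e})"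

definition open_H1s :: "'a H1s set \<Rightarrow> bool" where
  "open_H1s U \<longleftrightarrow> (\<forall>x\<in>U. \<forall>\<^sub>F (x', y) in uniformity. x' = x \<longrightarrow> y \<in> U)"

instance
proof
  fix u v w :: "'a H1s" and a b :: real
  show "u + v + w = u + (v + w)" by transfer simp
  show "u + v = v + u" by transfer (rule add.commute)
  show "0 + u = u" by transfer simp
  show "- u + u = 0" by transfer simp
  show "u - v = u + - v" by transfer simp
  show "a *\<^sub>R (u + v) = a *\<^sub>R u + a *\<^sub>R v" by transfer (rule scaleR_add_right)
  show "(a + b) *\<^sub>R u = a *\<^sub>R u + b *\<^sub>R u" by transfer (rule scaleR_add_left)
  show "a *\<^sub>R b *\<^sub>R u = (a * b) *\<^sub>R u" by transfer simp
  show "1 *\<^sub>R u = u" by transfer simp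
  show "sgn u = inverse (norm u) *\<^sub>R u" by (rule sgn_H1s_def)
  show "dist u v = norm (u - v)" by (rule dist_H1s_def)
  show "uniformity = (INF e\<in>{0<..}. principal {(u, v :: 'a H1s). dist u v < e})"
    by (rule uniformity_H1s_def)
  show "open U \<longleftrightarrow> (\<forall>x\<in>U. \<forall>\<^sub>F (x', y) in uniformity. x' = x \<longrightarrow> y \<in> U)" for U :: "'a H1s set"
    by (rule open_H1s_def)
  show "u \<bullet> v = v \<bullet> u" by transfer (simp add: inner_commute)
  show "(u + v) \<bullet> w = u \<bullet> w + v \<bullet> w" by transfer (simp add: inner_add_left)
  show "(a *\<^sub>R u) \<bullet> v = a * (u \<bullet> v)" by transfer (simp add: distrib_left)
  show "0 \<le> u \<bullet> u" by transfer simp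
  show "u \<bullet> u = 0 \<longleftrightarrow> u = 0" by transfer (simp add: zero_prod_def add_nonneg_eq_0_iff)
  show "norm u = sqrt (u \<bullet> u)" by transfer (simp add: norm_eq_sqrt_inner norm_prod_def)
qed

end

definition grad :: "'n::finite H1s \<Rightarrow> (real^'n, real^'n^'n) L2" where
  "grad u = snd (Rep_H1s u)"

definition emb :: "'n::finite H1s \<Rightarrow> 'n L2s" where
  "emb u = Abs_L2s (fst (Rep_H1s u))"

lemma Rep_L2s_emb: "Rep_L2s (emb u) = fst (Rep_H1s u)"
proof -
  obtain q where q: "\<And>k. q k \<in> (\<lambda>\<phi>. (abs_L2 \<phi>, abs_L2 (gradient \<phi>))) ` test_fields"
    and lim: "q \<longlonglongrightarrow> Rep_H1s u"
    using Rep_H1s[of u] unfolding H1s_set_def closure_sequential by blast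
  have "fst (q k) \<in> abs_L2 ` test_fields" for k
    using q[of k] by auto
  moreover have "(\<lambda>k. fst (q k)) \<longlonglongrightarrow> fst (Rep_H1s u)"
    using lim by (rule tendsto_fst)
  ultimately have "fst (Rep_H1s u) \<in> L2s_set"
    unfolding L2s_set_def closure_sequential by (intro exI[of _ "\<lambda>k. fst (q k)"] conjI allI)
  then show ?thesis
    by (simp add: emb_def Abs_L2s_inverse)
qed

definition H1s_fun :: "'n::finite H1s \<Rightarrow> real^'n \<Rightarrow> real^'n" where
  "H1s_fun u = rep_L2 (Rep_L2s (emb u))"

definition H1s_grad :: "'n::finite H1s \<Rightarrow> real^'n \<Rightarrow> real^'n^'n" where
  "H1s_grad u = rep_L2 (grad u)"

section \<open>Lorentz spaces\<close>

definition distribution_fun :: "('a::euclidean_space \<Rightarrow> 'b::euclidean_space) \<Rightarrow> real \<Rightarrow> ennreal" where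
  "distribution_fun f r = emeasure lebesgue {x. r < norm (f x)}"

definition rearrangement :: "('a::euclidean_space \<Rightarrow> 'b::euclidean_space) \<Rightarrow> real \<Rightarrow> ennreal" where
  "rearrangement f t = Inf {ennreal r |r. 0 \<le> r \<and> distribution_fun f r \<le> ennreal t}"

definition average_rearrangement :: "('a::euclidean_space \<Rightarrow> 'b::euclidean_space) \<Rightarrow> real \<Rightarrow> ennreal" where
  "average_rearrangement f t = (\<integral>\<^sup>+\<tau>\<in>{0..t}. rearrangement f \<tau> \<partial>lborel) / ennreal t"

text \<open>The norms of \<open>L\<^sup>q\<^sup>,\<^sup>\<infinity>\<close> and \<open>L\<^sup>q\<^sup>,\<^sup>1\<close> for \<open>1 < q < \<infinity>\<close>. They use the averaged rearrangement
  \<open>f\<^sup>*\<^sup>*\<close>, because with the rearrangement \<open>f\<^sup>*\<close> itself the former is only a quasi-norm.\<close>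

definition weak_norm :: "real \<Rightarrow> ('a::euclidean_space \<Rightarrow> 'b::euclidean_space) \<Rightarrow> ennreal" where
  "weak_norm q f = (SUP t\<in>{0<..}. ennreal (t powr (1 / q)) * average_rearrangement f t)"

definition lorentz1_norm :: "real \<Rightarrow> ('a::euclidean_space \<Rightarrow> 'b::euclidean_space) \<Rightarrow> ennreal" where
  "lorentz1_norm q f =
     (\<integral>\<^sup>+t\<in>{0<..}. ennreal (t powr (1 / q - 1)) * average_rearrangement f t \<partial>lborel)"

definition in_weak_L :: "real \<Rightarrow> ('a::euclidean_space \<Rightarrow> 'b::euclidean_space) \<Rightarrow> bool" where
  "in_weak_L q f \<longleftrightarrow> f \<in> borel_measurable lebesgue \<and> weak_norm q f < \<infinity>"

definition in_lorentz1 :: "real \<Rightarrow> ('a::euclidean_space \<Rightarrow> 'b::euclidean_space) \<Rightarrow> bool" where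
  "in_lorentz1 q f \<longleftrightarrow> f \<in> borel_measurable lebesgue \<and> lorentz1_norm q f < \<infinity>"

section \<open>Basic flows\<close>

definition solenoidal :: "(real^'n \<Rightarrow> real^'n::finite) \<Rightarrow> bool" where
  "solenoidal v \<longleftrightarrow> (\<forall>\<phi> :: real^'n \<Rightarrow> real. test_fun UNIV \<phi> \<longrightarrow>
     (LINT x|lebesgue. (\<Sum>j\<in>UNIV. v x $ j * partial j \<phi> x)) = 0)"

text \<open>Weak* continuity is tested with the predual \<open>L\<^sup>q\<^sup>'\<^sup>,\<^sup>1\<close> of \<open>L\<^sup>q\<^sup>,\<^sup>\<infinity>\<close>.\<close>

definition weak_star_continuous ::
  "real \<Rightarrow> (real \<Rightarrow> 'a::euclidean_space \<Rightarrow> 'b::euclidean_space) \<Rightarrow> bool" where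
  "weak_star_continuous q V \<longleftrightarrow> (\<forall>t\<ge>0. in_weak_L q (V t)) \<and>
     (\<forall>g. in_lorentz1 (q / (q - 1)) g \<longrightarrow>
        continuous_on {0..} (\<lambda>t. LINT x|lebesgue. V t x \<bullet> g x))"

text \<open>Measurability of \<open>V\<close> in time, as a function with values in the nonseparable space
  \<open>L\<^sup>n\<^sup>,\<^sup>\<infinity>\<close>, is understood in the weak* sense and is implied by weak* continuity. Hence
  membership in \<open>L\<^sup>\<infinity>(0,\<infinity>; L\<^sup>n\<^sup>,\<^sup>\<infinity>)\<close> only adds the essential bound.\<close>

definition basic_flow :: "(real \<Rightarrow> real^'n \<Rightarrow> real^'n::finite) \<Rightarrow> bool" where
  "basic_flow V \<longleftrightarrow>
     (\<forall>t\<ge>0. solenoidal (V t)) \<and>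
     weak_star_continuous (real CARD('n)) V \<and>
     (\<exists>C::real. AE t in lebesgue_on {0<..}. weak_norm (real CARD('n)) (V t) \<le> ennreal C)"

definition flow_norm :: "(real \<Rightarrow> real^'n \<Rightarrow> real^'n::finite) \<Rightarrow> ennreal" where
  "flow_norm V = (SUP t\<in>{0<..}. weak_norm (real CARD('n)) (V t))"

text \<open>In the next two definitions the first argument is the field \<open>V(t)\<close> at a fixed time.\<close>

definition form :: "(real^'n \<Rightarrow> real^'n) \<Rightarrow> 'n::finite H1s \<Rightarrow> 'n H1s \<Rightarrow> real" where
  "form v u w =
     grad u \<bullet> grad w
     + (LINT x|lebesgue. (\<Sum>j\<in>UNIV. v x $ j *\<^sub>R H1s_grad u x $ j) \<bullet> H1s_fun w x)
     - (\<Sum>j\<in>UNIV. \<Sum>k\<in>UNIV. LINT x|lebesgue. v x $ j * H1s_fun u x $ k * H1s_grad w x $ k $ j)"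

text \<open>\<open>Blinfun\<close> is meaningful here since the form is bounded on \<open>H\<^sup>1\<^sub>\<sigma>\<close> when
  \<open>v \<in> L\<^sup>n\<^sup>,\<^sup>\<infinity>\<close> and \<open>n \<ge> 3\<close>.\<close>

definition L_op :: "(real^'n \<Rightarrow> real^'n) \<Rightarrow> 'n::finite H1s \<Rightarrow> ('n H1s \<Rightarrow>\<^sub>L real)" where
  "L_op v u = Blinfun (form v u)"

section \<open>Functions of time\<close>

text \<open>All value spaces used below are separable, so Borel measurability agrees with strong
  measurability and these are the Bochner spaces \<open>L\<^sup>2(I; X)\<close> and \<open>L\<^sup>\<infinity>(I; X)\<close>.\<close>

definition bochner_L2 :: "real set \<Rightarrow> (real \<Rightarrow> 'x::real_normed_vector) \<Rightarrow> bool" where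
  "bochner_L2 I g \<longleftrightarrow> g \<in> borel_measurable (lebesgue_on I)
     \<and> integrable (lebesgue_on I) (\<lambda>t. (norm (g t))\<^sup>2)"

definition bochner_Linf :: "real set \<Rightarrow> (real \<Rightarrow> 'x::real_normed_vector) \<Rightarrow> bool" where
  "bochner_Linf I g \<longleftrightarrow> g \<in> borel_measurable (lebesgue_on I)
     \<and> (\<exists>C. AE t in lebesgue_on I. norm (g t) \<le> C)"

text \<open>The distributional derivative on \<open>(a, b)\<close>, with values in \<open>(H\<^sup>1\<^sub>\<sigma>)\<^sup>*\<close>, of a function with
  values in \<open>L\<^sup>2\<^sub>\<sigma> \<subseteq> (H\<^sup>1\<^sub>\<sigma>)\<^sup>*\<close>. The identity between the two integrals in \<open>(H\<^sup>1\<^sub>\<sigma>)\<^sup>*\<close> is evaluated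
  at each \<open>w \<in> H\<^sup>1\<^sub>\<sigma>\<close>.\<close>

definition weak_time_deriv ::
  "real \<Rightarrow> real \<Rightarrow> (real \<Rightarrow> 'n::finite L2s) \<Rightarrow> (real \<Rightarrow> ('n H1s \<Rightarrow>\<^sub>L real)) \<Rightarrow> bool" where
  "weak_time_deriv a b u d \<longleftrightarrow>
     (\<forall>\<theta> :: real \<Rightarrow> real. test_fun {a<..<b} \<theta> \<longrightarrow>
       (\<forall>w. (LINT t|lebesgue_on {a<..<b}. deriv \<theta> t * (u t \<bullet> emb w))
          = - (LINT t|lebesgue_on {a<..<b}. \<theta> t * blinfun_apply (d t) w)))"

text \<open>The regularity class of the Cauchy problem; \<open>v\<close> is \<open>u\<close> regarded as a function with values
  in \<open>H\<^sup>1\<^sub>\<sigma>\<close> and \<open>d\<close> is the time derivative of \<open>u\<close>. Both are determined by \<open>u\<close> almost everywhere.\<close>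

definition regularity_class ::
  "real \<Rightarrow> (real \<Rightarrow> 'n::finite L2s) \<Rightarrow> (real \<Rightarrow> 'n H1s) \<Rightarrow> (real \<Rightarrow> ('n H1s \<Rightarrow>\<^sub>L real)) \<Rightarrow> bool" where
  "regularity_class s u v d \<longleftrightarrow>
     continuous_on {s..} u \<and>
     (AE t in lebesgue_on {s<..}. u t = emb (v t)) \<and>
     (\<forall>b>s. bochner_L2 {s<..<b} v \<and> bochner_L2 {s<..<b} d \<and> weak_time_deriv s b u d)"

definition cauchy_solution ::
  "(real \<Rightarrow> real^'n \<Rightarrow> real^'n) \<Rightarrow> real \<Rightarrow> 'n::finite L2s \<Rightarrow>
   (real \<Rightarrow> 'n L2s) \<Rightarrow> (real \<Rightarrow> 'n H1s) \<Rightarrow> (real \<Rightarrow> ('n H1s \<Rightarrow>\<^sub>L real)) \<Rightarrow> bool" where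
  "cauchy_solution V s f u v d \<longleftrightarrow>
     regularity_class s u v d \<and>
     (AE t in lebesgue_on {s<..}. d t + L_op (V t) (v t) = 0) \<and>
     u s = f"

end

theory Submission
  imports Defs "HOL-Computational_Algebra.Polynomial"
begin

text \<open>The smallness of \<open>V\<close> enters only through a Hardy inequality: a field \<open>v\<close> whose distribution
  function is bounded by \<open>(d / r)\<^sup>n\<close> satisfies \<open>\<integral> |v|\<^sup>2 |u|\<^sup>2 \<le> C d\<^sup>2 \<integral> |\<nabla>u|\<^sup>2\<close>. It follows, without
  Sobolev or Lorentz embeddings, from a capacity estimate for the dyadic level sets of \<open>|u|\<close>. The
  transport terms of the form are then dominated by \<open>\<parallel>\<nabla>u\<parallel>\<^sub>2 \<parallel>\<nabla>w\<parallel>\<^sub>2 / 2\<close>, so that the form is coercive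
  up to the \<open>L\<^sup>2\<close> inner product, and it depends measurably on time by weak* continuity. Existence
  is Lions' projection argument in \<open>L\<^sup>2(s, \<infinity>; H\<^sup>1\<^sub>\<sigma>)\<close>. Mollification in time gives the energy equality for
  every solution in the regularity class; it yields uniqueness, hence linearity and the semigroup
  property, and the energy inequality.\<close>

section \<open>Completeness and representation in Hilbert spaces\<close>

text \<open>A drift in weak-\<open>L^n\<close> scales exactly like the Laplacian: its transport
  terms are not of lower order and can only be absorbed when they are small. This explains the
  explicit constants: a weak norm of at most \<delta> bounds the distribution function with
  \<open>d = 2 \<delta>\<close>, each of the two transport terms then costs at most a quarter of the
  gradient term, and the remaining half becomes, after doubling, the dissipation in the energy
  inequality. The absorbed form controls the gradient of \<open>u\<close> but not \<open>u\<close>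
  itself; adding the \<open>L^2\<close> inner product, which amounts to solving for
  \<open>exp (- (t - s)) u\<close>, supplies the missing norm on an infinite time interval and is
  undone afterwards. As \<open>V\<close> is merely weak* continuous in time, the existence argument
  asks only for measurability of the form in \<open>t\<close>. The price is a solution that lives in
  an \<open>L^2\<close> space in time and has no value at \<open>s\<close>. Even reflection across
  \<open>s\<close> removes the endpoint, so that mollification yields a continuous representative
  there; its value at \<open>s\<close> is then read off from test functions that concentrate at
  \<open>s\<close>.\<close>

lemma riesz_fischer:
  fixes f :: "nat \<Rightarrow> 'a \<Rightarrow> 'b::{banach, second_countable_topology}"
  assumes [measurable]: "\<And>k. f k \<in> borel_measurable M"
    and cauchy: "\<And>\<epsilon>. \<epsilon> > 0 \<Longrightarrow>
      \<exists>N. \<forall>k\<ge>N. \<forall>l\<ge>N. (\<integral>\<^sup>+x. ennreal ((norm (f k x - f l x))\<^sup>2) \<partial>M) \<le> ennreal \<epsilon>"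
  obtains g where "g \<in> borel_measurable M"
    "\<And>\<epsilon>. \<epsilon> > 0 \<Longrightarrow> \<exists>N. \<forall>k\<ge>N. (\<integral>\<^sup>+x. ennreal ((norm (f k x - g x))\<^sup>2) \<partial>M) \<le> ennreal \<epsilon>"
proof -
  \<comment> \<open>Squared distances of at most \<open>4^(-j)\<close> leave room for the weights
    \<open>2^j\<close> in \<open>S\<close>: the integral of \<open>S\<close> stays below the sum of
    \<open>2^(-j)\<close>, and wherever \<open>S\<close> is finite the increments of the subsequence
    decay geometrically.\<close>
  have "\<forall>j. \<exists>N. \<forall>k\<ge>N. \<forall>l\<ge>N. (\<integral>\<^sup>+x. ennreal ((norm (f k x - f l x))\<^sup>2) \<partial>M) \<le> ennreal ((1/4)^j)"
    using cauchy by simp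
  from choice[OF this] obtain N where "\<forall>j. \<forall>k\<ge>N j. \<forall>l\<ge>N j.
      (\<integral>\<^sup>+x. ennreal ((norm (f k x - f l x))\<^sup>2) \<partial>M) \<le> ennreal ((1/4)^j)" ..
  then have N: "(\<integral>\<^sup>+x. ennreal ((norm (f k x - f l x))\<^sup>2) \<partial>M) \<le> ennreal ((1/4)^j)"
    if "k \<ge> N j" "l \<ge> N j" for j k l using that by simp
  \<comment> \<open>The sum makes \<open>r\<close> increasing and at least \<open>N j\<close>; the
    summand \<open>j\<close> forces it to infinity.\<close>
  define r where "r j = (\<Sum>i\<le>j. N i) + j" for j
  have rN: "N j \<le> r j" for j
    unfolding r_def by (simp add: lessThan_Suc_atMost[symmetric])
  have rS: "r j \<le> r (Suc j)" for j
    unfolding r_def by simp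
  have rj: "j \<le> r j" for j unfolding r_def by simp
  define g where "g x = lim (\<lambda>j. f (r j) x)" for x
  have [measurable]: "g \<in> borel_measurable M"
    unfolding g_def[abs_def] by measurable
  define S where "S x = (\<Sum>j. ennreal (2^j * (norm (f (r (Suc j)) x - f (r j) x))\<^sup>2))" for x
  have "(\<integral>\<^sup>+x. S x \<partial>M) = (\<Sum>j. (\<integral>\<^sup>+x. ennreal (2^j * (norm (f (r (Suc j)) x - f (r j) x))\<^sup>2) \<partial>M))"
    unfolding S_def by (rule nn_integral_suminf) measurable
  also have "\<dots> \<le> (\<Sum>j. ennreal ((1/2)^j))"
  proof (rule suminf_le)
    fix j
    have "(\<integral>\<^sup>+x. ennreal (2^j * (norm (f (r (Suc j)) x - f (r j) x))\<^sup>2) \<partial>M)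
       = ennreal (2^j) * (\<integral>\<^sup>+x. ennreal ((norm (f (r (Suc j)) x - f (r j) x))\<^sup>2) \<partial>M)"
      by (subst nn_integral_cmult[symmetric]) (auto simp: ennreal_mult)
    also have "\<dots> \<le> ennreal (2^j) * ennreal ((1/4)^j)"
      by (intro mult_left_mono N) (use rN[of j] rS[of j] in auto)
    also have "\<dots> = ennreal (2^j * (1/4)^j)" by (simp add: ennreal_mult)
    also have "(2::real)^j * (1/4)^j = (1/2)^j" by (simp add: power_mult_distrib[symmetric])
    finally show "(\<integral>\<^sup>+x. ennreal (2^j * (norm (f (r (Suc j)) x - f (r j) x))\<^sup>2) \<partial>M) \<le> ennreal ((1/2)^j)" .
  qed auto
  also have "\<dots> = ennreal (\<Sum>j. (1/2)^j)"
    by (rule suminf_ennreal2) (auto intro: summable_geometric)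
  also have "\<dots> < \<infinity>" by simp
  finally have "(\<integral>\<^sup>+x. S x \<partial>M) \<noteq> \<infinity>" by simp
  moreover have [measurable]: "S \<in> borel_measurable M" unfolding S_def by measurable
  ultimately have AE_S: "AE x in M. S x \<noteq> \<infinity>"
    by (intro nn_integral_noteq_infinite) auto
  have conv: "(\<lambda>j. f (r j) x) \<longlonglongrightarrow> g x" if Sx: "S x \<noteq> \<infinity>" for x
  proof -
    obtain C where C: "S x = ennreal C" "C \<ge> 0" using Sx by (cases "S x" rule: ennreal_cases) simp_all
    have b: "norm (f (r (Suc j)) x - f (r j) x) \<le> sqrt C * (sqrt (1/2))^j" for j
    proof -
      have "ennreal (2^j * (norm (f (r (Suc j)) x - f (r j) x))\<^sup>2) \<le> S x"
      proof -
        have "(\<Sum>i\<in>{j}. ennreal (2^i * (norm (f (r (Suc i)) x - f (r i) x))\<^sup>2)) \<le> S x"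
          unfolding S_def by (rule sum_le_suminf) auto
        then show ?thesis by simp
      qed
      then have "2^j * (norm (f (r (Suc j)) x - f (r j) x))\<^sup>2 \<le> C"
        using C by simp
      then have "(norm (f (r (Suc j)) x - f (r j) x))\<^sup>2 \<le> C / 2^j"
        by (subst pos_le_divide_eq) (simp_all add: mult.commute)
      then have "(norm (f (r (Suc j)) x - f (r j) x))\<^sup>2 \<le> C * (1/2)^j"
        by (simp add: power_divide)
      then have "norm (f (r (Suc j)) x - f (r j) x) \<le> sqrt (C * (1/2)^j)"
        by (rule real_le_rsqrt)
      then show ?thesis by (simp add: real_sqrt_mult real_sqrt_power)
    qed
    have s: "summable (\<lambda>j. sqrt C * (sqrt (1/2))^j)"
      by (intro summable_mult summable_geometric) (simp add: real_sqrt_divide)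
    have "summable (\<lambda>j. f (r (Suc j)) x - f (r j) x)"
      by (rule summable_comparison_test'[OF s, of 0]) (rule b)
    then have "(\<lambda>n. \<Sum>j<n. f (r (Suc j)) x - f (r j) x) \<longlonglongrightarrow> (\<Sum>j. f (r (Suc j)) x - f (r j) x)"
      by (rule summable_LIMSEQ)
    then have "(\<lambda>n. f (r n) x - f (r 0) x) \<longlonglongrightarrow> (\<Sum>j. f (r (Suc j)) x - f (r j) x)"
      by (simp add: sum_lessThan_telescope[of "\<lambda>n. f (r n) x"])
    from tendsto_add[OF this tendsto_const[of "f (r 0) x"]]
    have "convergent (\<lambda>n. f (r n) x)" by (auto simp: convergent_def)
    then show ?thesis unfolding g_def by (simp add: convergent_LIMSEQ_iff)
  qed
  show ?thesis
  proof (rule that)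
    fix \<epsilon> :: real assume "\<epsilon> > 0"
    from cauchy[OF this] obtain K where K: "\<And>k l. k \<ge> K \<Longrightarrow> l \<ge> K \<Longrightarrow>
        (\<integral>\<^sup>+x. ennreal ((norm (f k x - f l x))\<^sup>2) \<partial>M) \<le> ennreal \<epsilon>"
      by blast
    have "(\<integral>\<^sup>+x. ennreal ((norm (f k x - g x))\<^sup>2) \<partial>M) \<le> ennreal \<epsilon>" if "k \<ge> K" for k
    proof -
      have "(\<integral>\<^sup>+x. ennreal ((norm (f k x - g x))\<^sup>2) \<partial>M)
        = (\<integral>\<^sup>+x. liminf (\<lambda>j. ennreal ((norm (f k x - f (r j) x))\<^sup>2)) \<partial>M)"
      proof (rule nn_integral_cong_AE)
        show "AE x in M. ennreal ((norm (f k x - g x))\<^sup>2)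
            = liminf (\<lambda>j. ennreal ((norm (f k x - f (r j) x))\<^sup>2))"
          using AE_S
        proof eventually_elim
          case (elim x)
          have "(\<lambda>j. ennreal ((norm (f k x - f (r j) x))\<^sup>2)) \<longlonglongrightarrow> ennreal ((norm (f k x - g x))\<^sup>2)"
            by (intro tendsto_intros conv elim)
          then show ?case by (rule lim_imp_Liminf[OF sequentially_bot, symmetric])
        qed
      qed
      \<comment> \<open>Fatou's lemma in the second index: \<open>k\<close> is fixed, and the Cauchy
        bound applies as soon as \<open>r j\<close> has passed \<open>K\<close>.\<close>
      also have "\<dots> \<le> liminf (\<lambda>j. \<integral>\<^sup>+x. ennreal ((norm (f k x - f (r j) x))\<^sup>2) \<partial>M)"
        by (rule nn_integral_liminf) measurable
      also have "\<dots> \<le> limsup (\<lambda>j. \<integral>\<^sup>+x. ennreal ((norm (f k x - f (r j) x))\<^sup>2) \<partial>M)"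
        by (rule Liminf_le_Limsup) simp
      also have "\<dots> \<le> ennreal \<epsilon>"
      proof (rule Limsup_bounded)
        show "\<forall>\<^sub>F j in sequentially. (\<integral>\<^sup>+x. ennreal ((norm (f k x - f (r j) x))\<^sup>2) \<partial>M) \<le> ennreal \<epsilon>"
          using eventually_ge_at_top[of K]
        proof eventually_elim
          case (elim j)
          then have "K \<le> r j" using rj[of j] by linarith
          then show ?case by (rule K[OF that])
        qed
      qed
      finally show ?thesis .
    qed
    then show "\<exists>N. \<forall>k\<ge>N. (\<integral>\<^sup>+x. ennreal ((norm (f k x - g x))\<^sup>2) \<partial>M) \<le> ennreal \<epsilon>"
      by (intro exI[of _ K] allI impI)
  qed fact
qed

text \<open>The functional is represented by a minimizing sequence of \<open>q \<phi> \<phi> - 2 L \<phi>\<close>, which is Cauchy by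
  the parallelogram law; no completeness is assumed.\<close>

lemma riesz_minimizing_sequence:
  fixes q :: "'i \<Rightarrow> 'i \<Rightarrow> real" and comb :: "'i \<Rightarrow> real \<Rightarrow> 'i \<Rightarrow> 'i"
  assumes ne: "P \<noteq> {}"
    and comb: "\<And>\<phi> c \<psi>. \<phi> \<in> P \<Longrightarrow> \<psi> \<in> P \<Longrightarrow> comb \<phi> c \<psi> \<in> P"
    and q_comb: "\<And>\<phi> c \<psi> \<eta>. \<phi> \<in> P \<Longrightarrow> \<psi> \<in> P \<Longrightarrow> \<eta> \<in> P \<Longrightarrow> q (comb \<phi> c \<psi>) \<eta> = q \<phi> \<eta> + c * q \<psi> \<eta>"
    and q_sym: "\<And>\<phi> \<psi>. \<phi> \<in> P \<Longrightarrow> \<psi> \<in> P \<Longrightarrow> q \<phi> \<psi> = q \<psi> \<phi>"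
    and q_pos: "\<And>\<phi>. \<phi> \<in> P \<Longrightarrow> 0 \<le> q \<phi> \<phi>"
    and L_comb: "\<And>\<phi> c \<psi>. \<phi> \<in> P \<Longrightarrow> \<psi> \<in> P \<Longrightarrow> L (comb \<phi> c \<psi>) = L \<phi> + c * L \<psi>"
    and L_bound: "\<And>\<phi>. \<phi> \<in> P \<Longrightarrow> (L \<phi>)\<^sup>2 \<le> C * q \<phi> \<phi>"
  obtains \<Phi> where "\<And>k::nat. \<Phi> k \<in> P"
    "\<And>\<epsilon>. \<epsilon> > 0 \<Longrightarrow> \<exists>N. \<forall>k\<ge>N. \<forall>l\<ge>N. q (comb (\<Phi> k) (-1) (\<Phi> l)) (comb (\<Phi> k) (-1) (\<Phi> l)) \<le> \<epsilon>"
    "\<And>\<psi>. \<psi> \<in> P \<Longrightarrow> (\<lambda>k. q (\<Phi> k) \<psi>) \<longlonglongrightarrow> L \<psi>"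
proof -
  define F where "F \<phi> = q \<phi> \<phi> - 2 * L \<phi>" for \<phi>
  \<comment> \<open>Young's inequality bounds \<open>2 * L \<phi>\<close> by
    \<open>\<bar>C\<bar> + q \<phi> \<phi>\<close>, which makes the infimum finite.\<close>
  have F_ge: "F \<phi> \<ge> - \<bar>C\<bar>" if "\<phi> \<in> P" for \<phi>
  proof -
    have "(L \<phi>)\<^sup>2 \<le> \<bar>C\<bar> * q \<phi> \<phi>"
      using L_bound[OF that] mult_right_mono[OF abs_ge_self[of C] q_pos[OF that]] by linarith
    moreover have "4 * (\<bar>C\<bar> * q \<phi> \<phi>) \<le> (\<bar>C\<bar> + q \<phi> \<phi>)\<^sup>2"
      using zero_le_power2[of "\<bar>C\<bar> - q \<phi> \<phi>"] unfolding power2_sum power2_diff by linarith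
    moreover have "(2 * L \<phi>)\<^sup>2 = 4 * (L \<phi>)\<^sup>2" by (simp add: power_mult_distrib)
    ultimately have "(2 * L \<phi>)\<^sup>2 \<le> (\<bar>C\<bar> + q \<phi> \<phi>)\<^sup>2" by linarith
    then have "2 * L \<phi> \<le> \<bar>C\<bar> + q \<phi> \<phi>"
      using q_pos[OF that] by (auto intro: power2_le_imp_le)
    then show ?thesis unfolding F_def by linarith
  qed
  define d where "d = (INF \<phi>\<in>P. F \<phi>)"
  have bdd: "bdd_below (F ` P)" using F_ge by (intro bdd_belowI[of _ "-\<bar>C\<bar>"]) auto
  have d_le: "d \<le> F \<phi>" if "\<phi> \<in> P" for \<phi>
    unfolding d_def using bdd that by (rule cINF_lower)
  have "\<exists>\<phi>\<in>P. F \<phi> < d + 1 / real (Suc k)" for k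
    using cINF_less_iff[OF ne bdd, of "d + 1 / real (Suc k)"] unfolding d_def by simp
  then obtain \<Phi> where \<Phi>: "\<And>k. \<Phi> k \<in> P" "\<And>k. F (\<Phi> k) < d + 1 / real (Suc k)"
    by metis
  have F_comb: "F (comb \<phi> c \<psi>) = F \<phi> + 2 * c * (q \<phi> \<psi> - L \<psi>) + c\<^sup>2 * q \<psi> \<psi>" if "\<phi> \<in> P" "\<psi> \<in> P" for \<phi> \<psi> c
    using that by (simp add: F_def q_comb L_comb comb q_sym[of \<phi> "comb \<phi> c \<psi>"] q_sym[of \<psi> "comb \<phi> c \<psi>"]
        q_sym[of \<psi> \<phi>] power2_eq_square algebra_simps)
  have cau: "q (comb (\<Phi> k) (-1) (\<Phi> l)) (comb (\<Phi> k) (-1) (\<Phi> l)) \<le> 2 * (1 / real (Suc k) + 1 / real (Suc l))" for k l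
  proof -
    let ?D = "comb (\<Phi> k) (-1) (\<Phi> l)"
    have "?D \<in> P" by (intro comb \<Phi>)
    have qD: "q ?D ?D = q (\<Phi> k) (\<Phi> k) - 2 * q (\<Phi> l) (\<Phi> k) + q (\<Phi> l) (\<Phi> l)"
      using \<Phi> by (simp add: q_comb comb q_sym[of "\<Phi> k" ?D] q_sym[of "\<Phi> l" ?D] q_sym[of "\<Phi> k" "\<Phi> l"])
    \<comment> \<open>This is the midpoint of \<open>\<Phi> k\<close> and \<open>\<Phi> l\<close>.
      The infimum bounds \<open>F\<close> from below there, while the parallelogram identity
      expresses this value as the mean of the two nearly minimal values minus
      \<open>q ?D ?D / 4\<close>.\<close>
    have "d \<le> F (comb (\<Phi> l) (1/2) ?D)" by (intro d_le comb \<Phi>)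
    also have "\<dots> = F (\<Phi> l) + (q (\<Phi> l) (\<Phi> k) - q (\<Phi> l) (\<Phi> l) - (L (\<Phi> k) - L (\<Phi> l))) + q ?D ?D / 4"
      using \<Phi> by (simp add: F_comb \<open>?D \<in> P\<close> q_sym[of "\<Phi> l" ?D] q_comb L_comb power2_eq_square
          q_sym[of "\<Phi> l" "\<Phi> k"])
    also have "\<dots> = (F (\<Phi> k) + F (\<Phi> l)) / 2 - q ?D ?D / 4"
      unfolding qD F_def by (simp add: field_simps)
    finally have "q ?D ?D \<le> 2 * (F (\<Phi> k) - d + (F (\<Phi> l) - d))" by (simp add: field_simps)
    also have "\<dots> \<le> 2 * (1 / real (Suc k) + 1 / real (Suc l))"
      using \<Phi>(2)[of k] \<Phi>(2)[of l] by (intro mult_left_mono add_mono) auto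
    finally show ?thesis .
  qed
  show ?thesis
  proof (rule that)
    show "\<Phi> k \<in> P" for k by (rule \<Phi>)
    show "\<exists>N. \<forall>k\<ge>N. \<forall>l\<ge>N. q (comb (\<Phi> k) (-1) (\<Phi> l)) (comb (\<Phi> k) (-1) (\<Phi> l)) \<le> \<epsilon>" if "\<epsilon> > 0" for \<epsilon>
    proof -
      have "\<epsilon> / 4 > 0" using that by simp
      then obtain N where N: "1 / real (Suc N) < \<epsilon> / 4" by (rule nat_approx_posE)
      have *: "1 / real (Suc k) \<le> \<epsilon> / 4" if "k \<ge> N" for k
      proof -
        have "1 / real (Suc k) \<le> 1 / real (Suc N)"
          using that by (intro divide_left_mono) auto
        then show ?thesis using N by linarith
      qed
      show ?thesis
      proof (intro exI allI impI)
        fix k l assume "N \<le> k" "N \<le> l"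
        note cau[of k l]
        also have "2 * (1 / real (Suc k) + 1 / real (Suc l)) \<le> 2 * (\<epsilon> / 4 + \<epsilon> / 4)"
          by (intro mult_left_mono add_mono *) (use \<open>N \<le> k\<close> \<open>N \<le> l\<close> in auto)
        also have "\<dots> = \<epsilon>" by simp
        finally show "q (comb (\<Phi> k) (-1) (\<Phi> l)) (comb (\<Phi> k) (-1) (\<Phi> l)) \<le> \<epsilon>" .
      qed
    qed
    fix \<psi> assume \<psi>: "\<psi> \<in> P"
    \<comment> \<open>The summand \<open>1\<close> keeps \<open>Q\<close> positive even if
      \<open>q \<psi> \<psi>\<close> vanishes. The choice \<open>c = - x / Q\<close> below is nearly
      the minimizer of \<open>F\<close> on the line through \<open>\<Phi> k\<close> in direction
      \<psi>, so a large residual \<open>x\<close> would push \<open>F\<close> below its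
      infimum.\<close>
    define Q where "Q = q \<psi> \<psi> + 1"
    have Q: "Q > 0" using q_pos[OF \<psi>] by (simp add: Q_def)
    have "(q (\<Phi> k) \<psi> - L \<psi>)\<^sup>2 \<le> Q * (1 / real (Suc k))" for k
    proof -
      define x where "x = q (\<Phi> k) \<psi> - L \<psi>"
      define c where "c = - x / Q"
      have xc: "x = - c * Q" using Q by (simp add: c_def)
      have "d \<le> F (comb (\<Phi> k) c \<psi>)" by (intro d_le comb \<Phi> \<psi>)
      also have "\<dots> = F (\<Phi> k) + 2 * c * x + c\<^sup>2 * (Q - 1)"
        using F_comb[OF \<Phi>(1)[of k] \<psi>, of c] by (simp add: x_def Q_def)
      also have "\<dots> = F (\<Phi> k) - c\<^sup>2 * Q - c\<^sup>2"
        unfolding xc by (simp add: power2_eq_square algebra_simps)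
      finally have "c\<^sup>2 * Q \<le> 1 / real (Suc k)"
        using \<Phi>(2)[of k] zero_le_power2[of c] by linarith
      then have "Q * (c\<^sup>2 * Q) \<le> Q * (1 / real (Suc k))"
        using Q by (intro mult_left_mono) auto
      moreover have "x\<^sup>2 = Q * (c\<^sup>2 * Q)" unfolding xc by (simp add: power2_eq_square)
      ultimately show ?thesis unfolding x_def by simp
    qed
    moreover have "(\<lambda>k. Q * (1 / real (Suc k))) \<longlonglongrightarrow> Q * 0"
      by (intro tendsto_intros LIMSEQ_Suc[OF lim_1_over_n])
    ultimately have "(\<lambda>k. (q (\<Phi> k) \<psi> - L \<psi>)\<^sup>2) \<longlonglongrightarrow> 0"
      using tendsto_sandwich[of "\<lambda>k. 0" "\<lambda>k. (q (\<Phi> k) \<psi> - L \<psi>)\<^sup>2" sequentially "\<lambda>k. Q * (1 / real (Suc k))" 0]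
      by simp
    from tendsto_real_sqrt[OF this] have "(\<lambda>k. \<bar>q (\<Phi> k) \<psi> - L \<psi>\<bar>) \<longlonglongrightarrow> 0" by simp
    then show "(\<lambda>k. q (\<Phi> k) \<psi>) \<longlonglongrightarrow> L \<psi>"
      by (simp add: tendsto_rabs_zero_iff LIM_zero_iff)
  qed
qed

text \<open>Here the form is the inner product of the whole space, so the minimizing sequence is
  Cauchy in norm; completeness gives it a limit, and the limit is the representing vector.\<close>

lemma riesz_representation:
  fixes L :: "'v::{real_inner, complete_space} \<Rightarrow> real"
  assumes "bounded_linear L"
  obtains y where "\<And>w. L w = y \<bullet> w"
proof -
  interpret L: bounded_linear L by fact
  obtain C where C: "\<And>w. norm (L w) \<le> norm w * C" using L.bounded by blast
  have "(L w)\<^sup>2 \<le> C\<^sup>2 * (w \<bullet> w)" for w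
  proof -
    have "\<bar>L w\<bar>\<^sup>2 \<le> (norm w * C)\<^sup>2" using C[of w] by (intro power_mono) auto
    then show ?thesis by (simp add: power_mult_distrib power2_norm_eq_inner mult.commute)
  qed
  note L2 = this
  have "\<exists>\<Phi>. (\<forall>\<epsilon>>0. \<exists>N. \<forall>k\<ge>N. \<forall>l\<ge>N. (norm (\<Phi> k - \<Phi> l))\<^sup>2 \<le> \<epsilon>) \<and>
      (\<forall>\<psi>. (\<lambda>k::nat. \<Phi> k \<bullet> \<psi>) \<longlonglongrightarrow> L \<psi>)"
  proof (rule riesz_minimizing_sequence[of UNIV "\<lambda>x c y. x + c *\<^sub>R y" "(\<bullet>)" L "C\<^sup>2"])
    show "x \<bullet> y = y \<bullet> x" for x y :: 'v by (rule inner_commute)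
    fix \<Phi> :: "nat \<Rightarrow> 'v"
    assume "\<And>\<epsilon>. \<epsilon> > 0 \<Longrightarrow> \<exists>N. \<forall>k\<ge>N. \<forall>l\<ge>N.
        (\<Phi> k + (-1) *\<^sub>R \<Phi> l) \<bullet> (\<Phi> k + (-1) *\<^sub>R \<Phi> l) \<le> \<epsilon>"
      "\<And>\<psi>. \<psi> \<in> UNIV \<Longrightarrow> (\<lambda>k. \<Phi> k \<bullet> \<psi>) \<longlonglongrightarrow> L \<psi>"
    then show ?thesis
      by (intro exI[of _ \<Phi>]) (simp add: power2_norm_eq_inner)
  qed (auto simp: inner_add_left L.add L.scaleR L2)
  then obtain \<Phi> where \<Phi>: "\<forall>\<epsilon>>0. \<exists>N. \<forall>k\<ge>N. \<forall>l\<ge>N. (norm (\<Phi> k - \<Phi> l))\<^sup>2 \<le> \<epsilon>"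
      and lim: "\<And>\<psi>. (\<lambda>k::nat. \<Phi> k \<bullet> \<psi>) \<longlonglongrightarrow> L \<psi>"
    by auto
  have "Cauchy \<Phi>"
  proof (rule CauchyI)
    fix e :: real assume "e > 0"
    then have "(e/2)\<^sup>2 > 0" by simp
    with \<Phi> obtain N where N: "\<forall>k\<ge>N. \<forall>l\<ge>N. (norm (\<Phi> k - \<Phi> l))\<^sup>2 \<le> (e/2)\<^sup>2" by blast
    have "norm (\<Phi> m - \<Phi> n) < e" if "m \<ge> N" "n \<ge> N" for m n
    proof -
      have "(norm (\<Phi> m - \<Phi> n))\<^sup>2 \<le> (e/2)\<^sup>2" using N that by simp
      then have "norm (\<Phi> m - \<Phi> n) \<le> e/2" using \<open>e > 0\<close> by (auto intro: power2_le_imp_le)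
      then show ?thesis using \<open>e > 0\<close> by linarith
    qed
    then show "\<exists>M. \<forall>m\<ge>M. \<forall>n\<ge>M. norm (\<Phi> m - \<Phi> n) < e" by blast
  qed
  then have "convergent \<Phi>" by (simp add: Cauchy_convergent)
  then obtain y where y: "\<Phi> \<longlonglongrightarrow> y" by (auto simp: convergent_def)
  have "L w = y \<bullet> w" for w
    by (rule LIMSEQ_unique[OF lim tendsto_inner[OF y tendsto_const]])
  then show ?thesis by (rule that)
qed

text \<open>Pettis' theorem in the separable case. Membership in a closed ball is decided by the
  inequalities \<open>y \<bullet> w \<le> r * norm w\<close> for \<open>w\<close> in a countable
  dense set, so closed balls have measurable preimages; an open set of a separable space is a
  countable union of closed balls.\<close>

lemma borel_measurable_weak:
  fixes f :: "'a \<Rightarrow> 'v::{real_inner, second_countable_topology}"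
  assumes [measurable]: "\<And>w. (\<lambda>x. f x \<bullet> w) \<in> borel_measurable M"
  shows "f \<in> borel_measurable M"
proof (rule borel_measurableI)
  obtain D :: "'v set" where D: "countable D" and dense: "\<And>X. open X \<Longrightarrow> X \<noteq> {} \<Longrightarrow> \<exists>d\<in>D. d \<in> X"
    using countable_dense_setE by blast
  have near: "\<exists>d\<in>D. dist x d < e" if "e > 0" for x :: 'v and e
    using dense[of "ball x e"] that by auto
  have norm_le: "norm y \<le> r \<longleftrightarrow> (\<forall>w\<in>D. y \<bullet> w \<le> r * norm w)" if "r \<ge> 0" for y :: 'v and r
  proof safe
    fix w assume "norm y \<le> r"
    have "y \<bullet> w \<le> norm y * norm w" by (rule norm_cauchy_schwarz)
    also have "\<dots> \<le> r * norm w" using \<open>norm y \<le> r\<close> by (intro mult_right_mono) auto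
    finally show "y \<bullet> w \<le> r * norm w" .
  next
    assume *: "\<forall>w\<in>D. y \<bullet> w \<le> r * norm w"
    have "\<forall>k. \<exists>d\<in>D. dist y d < 1 / real (Suc k)" using near by simp
    then obtain w where w: "\<And>k. w k \<in> D" "\<And>k. dist y (w k) < 1 / real (Suc k)" by metis
    have "w \<longlonglongrightarrow> y"
    proof (rule metric_LIMSEQ_I)
      fix e :: real assume "e > 0"
      then obtain N where N: "1 / real (Suc N) < e" using nat_approx_posE by blast
      have "dist (w n) y < e" if "n \<ge> N" for n
      proof -
        have "1 / real (Suc n) \<le> 1 / real (Suc N)" using that by (intro divide_left_mono) auto
        then show ?thesis using N w(2)[of n] by (simp add: dist_commute)
      qed
      then show "\<exists>no. \<forall>n\<ge>no. dist (w n) y < e" by blast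
    qed
    then have "(\<lambda>k. y \<bullet> w k) \<longlonglongrightarrow> y \<bullet> y" "(\<lambda>k. r * norm (w k)) \<longlonglongrightarrow> r * norm y"
      by (intro tendsto_intros; assumption)+
    then have "y \<bullet> y \<le> r * norm y"
      by (rule LIMSEQ_le) (use * w in auto)
    then have "norm y * norm y \<le> r * norm y" by (simp add: power2_norm_eq_inner[symmetric] power2_eq_square)
    then show "norm y \<le> r" using that by (cases "y = 0") auto
  qed
  fix S :: "'v set" assume S: "open S"
  let ?I = "{(d, q). d \<in> D \<and> q \<in> \<rat> \<and> q \<ge> 0 \<and> cball d q \<subseteq> S}"
  have "countable ?I"
    by (rule countable_subset[of _ "D \<times> \<rat>"]) (auto intro: countable_SIGMA D countable_rat)
  have "S = (\<Union>(d, q)\<in>?I. cball d q)"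
  proof (intro equalityI subsetI)
    fix x assume "x \<in> S"
    then obtain e where e: "e > 0" "ball x e \<subseteq> S" using S openE by blast
    obtain d where d: "d \<in> D" "dist x d < e / 3" using near[of "e/3" x] e by auto
    obtain q where q: "q \<in> \<rat>" "e / 3 < q" "q < 2 * e / 3" using Rats_dense_in_real[of "e/3" "2*e/3"] e by auto
    have "cball d q \<subseteq> ball x e"
    proof
      fix y assume "y \<in> cball d q"
      then have "dist d y \<le> q" by simp
      then show "y \<in> ball x e" using dist_triangle[of x y d] d(2) q(3) by simp
    qed
    then have "(d, q) \<in> ?I" using d q e by auto
    moreover have "x \<in> cball d q" using d q by (simp add: dist_commute)
    ultimately show "x \<in> (\<Union>(d, q)\<in>?I. cball d q)" by blast
  qed auto
  then have "f -` S \<inter> space M = f -` (\<Union>(d, q)\<in>?I. cball d q) \<inter> space M" by simp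
  also have "\<dots> = (\<Union>(d, q)\<in>?I. f -` cball d q \<inter> space M)" by auto
  also have "\<dots> \<in> sets M"
  proof (rule sets.countable_UN'[OF \<open>countable ?I\<close>], clarsimp)
    fix d :: 'v and q :: real assume q: "0 \<le> q"
    have "f -` cball d q \<inter> space M = {x \<in> space M. \<forall>w\<in>D. f x \<bullet> w - d \<bullet> w \<le> q * norm w}"
      using norm_le[OF q, of "f _ - d"] by (auto simp: dist_norm norm_minus_commute inner_diff_left)
    also have "\<dots> \<in> sets M" 
    proof -
      have "{x \<in> space M. \<forall>w\<in>D. f x \<bullet> w - d \<bullet> w \<le> q * norm w}
          = space M - (\<Union>w\<in>D. {x \<in> space M. \<not> f x \<bullet> w - d \<bullet> w \<le> q * norm w})" by auto
      also have "\<dots> \<in> sets M" by (intro sets.Diff sets.top sets.countable_UN' D) (auto, measurable)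
      finally show ?thesis .
    qed
    finally show "f -` cball d q \<inter> space M \<in> sets M" .
  qed
  finally show "f -` S \<inter> space M \<in> sets M" .
qed

section \<open>Mollifiers\<close>

text \<open>Smoothness by coinduction: a class closed under differentiation contains all iterated
  derivatives of its members. Closure under scalars is required because \<open>iter_deriv\<close>
  takes derivatives in arbitrary directions, which on the line multiply the derivative by a
  constant.\<close>

lemma smooth_real_coinduct:
  fixes f :: "real \<Rightarrow> real"
  assumes deriv: "\<And>f. f \<in> C \<Longrightarrow> \<exists>f'\<in>C. \<forall>x. (f has_real_derivative f' x) (at x)"
    and scale: "\<And>f c. f \<in> C \<Longrightarrow> (\<lambda>x. c * f x) \<in> C"
    and f: "f \<in> C"
  shows "smooth f"
proof -
  have "iter_deriv vs f \<in> C" for vs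
  proof (induction vs)
    case (Cons v vs)
    then obtain f' where f': "f' \<in> C" "\<And>x. (iter_deriv vs f has_real_derivative f' x) (at x)"
      using deriv by blast
    have "frechet_derivative (iter_deriv vs f) (at x) = (*) (f' x)" for x
      using frechet_derivative_at[OF f'(2)[unfolded has_field_derivative_def]] by simp
    then have "iter_deriv (v # vs) f = (\<lambda>x. v * f' x)" by (auto simp: mult.commute)
    then show ?case using scale f' by simp
  qed (use f in simp)
  moreover have "g differentiable at x" if "g \<in> C" for g x
    using deriv[OF that] by (auto simp: real_differentiable_def)
  ultimately show ?thesis unfolding smooth_def by blast
qed

text \<open>The polynomial and the exponent make the class of these functions closed under differentiation.\<close>

definition bump_term :: "real poly \<Rightarrow> nat \<Rightarrow> real \<Rightarrow> real" where
  "bump_term p k x =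
    (if x\<^sup>2 < 1 then poly p x * (1 / (1 - x\<^sup>2)) ^ k * exp (- 1 / (1 - x\<^sup>2)) else 0)"

lemma power_le_fact_exp:
  fixes y :: real
  assumes "y \<ge> 0"
  shows "y ^ n \<le> fact n * exp y"
proof -
  have "inverse (fact n) * y ^ n \<le> (\<Sum>n. inverse (fact n) * y ^ n)"
    using sum_le_suminf[OF summable_exp[of y], of "{n}"] assms by simp
  also have "\<dots> = exp y" by (simp add: exp_def scaleR_conv_of_real)
  finally show ?thesis by (simp add: field_simps)
qed

text \<open>With \<open>y = 1 / (1 - x^2)\<close> the term is a bounded factor times
  \<open>y^k exp (- y)\<close>. Comparing \<open>exp y\<close> with the term of order
  \<open>k + 2\<close> of its series leaves two negative powers of \<open>y\<close>, and the
  resulting second order vanishing at the boundary of the support is what makes the derivative exist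
  there.\<close>

lemma bump_term_bound:
  obtains M where "M \<ge> 0" "\<And>x. \<bar>bump_term p k x\<bar> \<le> M * (max 0 (1 - x\<^sup>2))\<^sup>2"
proof -
  have "bounded (poly p ` {-1..1})"
    by (intro compact_imp_bounded compact_continuous_image continuous_intros compact_Icc)
  then obtain B where B: "\<And>x. x \<in> {-1..1} \<Longrightarrow> \<bar>poly p x\<bar> \<le> B"
    unfolding bounded_iff by (metis imageI real_norm_def)
  have "B \<ge> 0" using B[of 0] by auto
  have "\<bar>bump_term p k x\<bar> \<le> (B * fact (k + 2)) * (max 0 (1 - x\<^sup>2))\<^sup>2" for x
  proof (cases "x\<^sup>2 < 1")
    case True
    define y where "y = 1 / (1 - x\<^sup>2)"
    have y: "y > 0" using True by (simp add: y_def)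
    have "\<bar>x\<bar> < 1" using True by (simp add: abs_square_less_1)
    then have "\<bar>poly p x\<bar> \<le> B" by (intro B) auto
    have "y ^ k * exp (- y) = y ^ (k + 2) * exp (- y) * (1 / y)\<^sup>2"
      using y by (simp add: power_add power2_eq_square field_simps)
    also have "\<dots> \<le> fact (k + 2) * (1 / y)\<^sup>2"
    proof (rule mult_right_mono)
      have "y ^ (k + 2) * exp (- y) \<le> fact (k + 2) * exp y * exp (- y)"
        using power_le_fact_exp[of y "k + 2"] y by (intro mult_right_mono) auto
      also have "\<dots> = fact (k + 2)" by (simp add: exp_minus)
      finally show "y ^ (k + 2) * exp (- y) \<le> fact (k + 2)" .
    qed simp
    finally have *: "y ^ k * exp (- y) \<le> fact (k + 2) * (1 / y)\<^sup>2" .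
    have "\<bar>bump_term p k x\<bar> = \<bar>poly p x\<bar> * (y ^ k * exp (- y))"
      using True y unfolding bump_term_def y_def by (simp add: abs_mult)
    also have "\<dots> \<le> B * (fact (k + 2) * (1 / y)\<^sup>2)"
      using y by (intro mult_mono[OF \<open>\<bar>poly p x\<bar> \<le> B\<close> *] \<open>B \<ge> 0\<close>) auto
    also have "1 / y = max 0 (1 - x\<^sup>2)" using True by (simp add: y_def)
    finally show ?thesis by (simp add: mult.assoc)
  next
    case False
    then show ?thesis by (simp add: bump_term_def \<open>B \<ge> 0\<close>)
  qed
  then show ?thesis using that[of "B * fact (k + 2)"] \<open>B \<ge> 0\<close> by simp
qed

text \<open>For \<open>y = 1 / (1 - x^2)\<close> one has \<open>y' = 2 x y^2\<close>, so the
  derivative contains \<open>y\<close> to the powers \<open>k\<close>, \<open>k + 1\<close> and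
  \<open>k + 2\<close>. Factoring out the highest power turns the others into powers of
  \<open>1 - x^2\<close>, the polynomial \<open>[:1, 0, -1:]\<close>. Where \<open>x^2\<close> is at
  least 1 the quadratic bound forces the derivative to vanish.\<close>

lemma bump_term_deriv:
  "(bump_term p k has_real_derivative
     bump_term (pderiv p * [:1, 0, -1:]\<^sup>2 + [:0, 2 * real k:] * [:1, 0, -1:] * p - [:0, 2:] * p) (k + 2) x) (at x)"
proof (cases "x\<^sup>2 < 1")
  case True
  define y where "y = 1 / (1 - x\<^sup>2)"
  have y0: "1 - x\<^sup>2 \<noteq> 0" "y > 0" using True by (auto simp: y_def)
  have ydef: "1 - x\<^sup>2 = 1 / y" by (simp add: y_def)
  define f where "f x = poly p x * (1 / (1 - x\<^sup>2)) ^ k * exp (- 1 / (1 - x\<^sup>2))" for x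
  have d1: "((\<lambda>x. 1 / (1 - x\<^sup>2)) has_real_derivative 2 * x * y\<^sup>2) (at x)"
    using y0 by (auto intro!: derivative_eq_intros simp: y_def power2_eq_square)
  have d2: "((\<lambda>x. (1 / (1 - x\<^sup>2)) ^ k) has_real_derivative real k * y ^ (k - 1) * (2 * x * y\<^sup>2)) (at x)"
    using DERIV_power[OF d1, of k] by (simp add: y_def mult_ac)
  have d3: "((\<lambda>x. exp (- 1 / (1 - x\<^sup>2))) has_real_derivative exp (- y) * - (2 * x * y\<^sup>2)) (at x)"
    using DERIV_fun_exp[OF DERIV_minus[OF d1]] by (simp add: y_def)
  have d4: "(f has_real_derivative
      (poly (pderiv p) x * y ^ k + real k * y ^ (k - 1) * (2 * x * y\<^sup>2) * poly p x) * exp (- y)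
      + exp (- y) * - (2 * x * y\<^sup>2) * (poly p x * y ^ k)) (at x)"
    unfolding f_def[abs_def] using DERIV_mult[OF DERIV_mult[OF poly_DERIV d2] d3] by (simp add: y_def)
  have ky: "real k * y ^ (k - 1) * y\<^sup>2 = real k * y ^ (k + 1)"
    by (cases k) (auto simp: power2_eq_square)
  have yy: "y * (1 / y) = 1" using y0 by simp
  have k0: "y ^ k = y ^ (k + 2) * (1 / y)\<^sup>2" "y ^ (k + 1) = y ^ (k + 2) * (1 / y)"
    using y0 by (simp_all add: power_add power2_eq_square)
  have gen: "(P * a' + K * b' * 2 * X * p' - 2 * X * p' * A) * e' = (P * z\<^sup>2 + 2 * K * X * z * p' - 2 * X * p') * A * e'"
    if "a' = A * z\<^sup>2" "b' = A * z" for P K X p' A a' b' z e' :: real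
    using that by (simp add: algebra_simps)
  have "(poly (pderiv p) x * y ^ k + real k * y ^ (k - 1) * (2 * x * y\<^sup>2) * poly p x) * exp (- y)
      + exp (- y) * - (2 * x * y\<^sup>2) * (poly p x * y ^ k)
    = (poly (pderiv p) x * y ^ k + (real k * y ^ (k - 1) * y\<^sup>2) * 2 * x * poly p x
       - 2 * x * poly p x * y ^ (k + 2)) * exp (- y)"
    by (simp add: algebra_simps power_add power2_eq_square)
  also have "\<dots> = (poly (pderiv p) x * (1 - x\<^sup>2)\<^sup>2 + 2 * real k * x * (1 - x\<^sup>2) * poly p x - 2 * x * poly p x)
      * y ^ (k + 2) * exp (- y)"
    unfolding ky ydef by (rule gen[OF k0])
  also have "\<dots> = bump_term (pderiv p * [:1, 0, -1:]\<^sup>2 + [:0, 2 * real k:] * [:1, 0, -1:] * p - [:0, 2:] * p) (k + 2) x"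
  proof -
    have "poly (pderiv p * [:1, 0, -1:]\<^sup>2 + [:0, 2 * real k:] * [:1, 0, -1:] * p - [:0, 2:] * p) x
      = poly (pderiv p) x * (1 - x\<^sup>2)\<^sup>2 + 2 * real k * x * (1 - x\<^sup>2) * poly p x - 2 * x * poly p x"
      by (simp add: power2_eq_square algebra_simps)
    then show ?thesis using True unfolding bump_term_def y_def by simp
  qed
  finally have "(f has_real_derivative
      bump_term (pderiv p * [:1, 0, -1:]\<^sup>2 + [:0, 2 * real k:] * [:1, 0, -1:] * p - [:0, 2:] * p) (k + 2) x) (at x)"
    using d4 by simp
  moreover have "\<forall>\<^sub>F z in nhds x. bump_term p k z = f z"
  proof -
    have "open {z::real. z\<^sup>2 < 1}" by (intro open_Collect_less continuous_intros)
    then have "\<forall>\<^sub>F z in nhds x. z\<^sup>2 < 1"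
      using True eventually_nhds_in_open[of "{z::real. z\<^sup>2 < 1}" x] by simp
    then show ?thesis by eventually_elim (simp add: bump_term_def f_def)
  qed
  ultimately show ?thesis using DERIV_cong_ev[OF refl _ refl] by blast
next
  case False
  obtain M where M: "M \<ge> 0" "\<And>x. \<bar>bump_term p k x\<bar> \<le> M * (max 0 (1 - x\<^sup>2))\<^sup>2"
    using bump_term_bound by blast
  \<comment> \<open>Only points \<open>z\<close> inside the support matter, and for them
    \<open>1 - z^2\<close> is at most \<open>x^2 - z^2 = (x - z) (x + z)\<close>, which is linear in
    the distance to \<open>x\<close>.\<close>
  have bd: "\<bar>bump_term p k z\<bar> \<le> M * (\<bar>x\<bar> + 1)\<^sup>2 * (z - x)\<^sup>2" for z
  proof (cases "z\<^sup>2 < 1")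
    case True
    have "1 - z\<^sup>2 \<le> x\<^sup>2 - z\<^sup>2" using False by simp
    also have "\<dots> = (x - z) * (x + z)" by (simp add: power2_eq_square algebra_simps)
    also have "\<dots> \<le> \<bar>x - z\<bar> * \<bar>x + z\<bar>" by (metis abs_ge_self abs_mult)
    also have "\<dots> \<le> \<bar>x - z\<bar> * (\<bar>x\<bar> + 1)"
      using True abs_square_less_1[of z] by (intro mult_left_mono) auto
    finally have "max 0 (1 - z\<^sup>2) \<le> \<bar>x - z\<bar> * (\<bar>x\<bar> + 1)" by simp
    then have "(max 0 (1 - z\<^sup>2))\<^sup>2 \<le> (\<bar>x - z\<bar> * (\<bar>x\<bar> + 1))\<^sup>2" by (intro power_mono) auto
    also have "\<dots> = (\<bar>x\<bar> + 1)\<^sup>2 * (z - x)\<^sup>2" by (simp add: power_mult_distrib power2_commute)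
    finally show ?thesis using M(2)[of z] M(1)
      by (smt (verit) mult.assoc mult_left_mono)
  qed (simp add: bump_term_def M)
  have "((\<lambda>z. bump_term p k z) has_real_derivative 0) (at x)"
    unfolding has_field_derivative_iff
  proof (rule Lim_null_comparison)
    have b0: "bump_term p k x = 0" using False by (simp add: bump_term_def)
    show "\<forall>\<^sub>F z in at x. norm ((bump_term p k z - bump_term p k x) / (z - x)) \<le> M * (\<bar>x\<bar> + 1)\<^sup>2 * \<bar>z - x\<bar>"
    proof (rule eventually_at_topological[THEN iffD2], intro exI[of _ UNIV] conjI ballI impI, goal_cases)
      case (3 z)
      then have "\<bar>bump_term p k z\<bar> / \<bar>z - x\<bar> \<le> M * (\<bar>x\<bar> + 1)\<^sup>2 * (z - x)\<^sup>2 / \<bar>z - x\<bar>"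
        using bd[of z] by (intro divide_right_mono) auto
      also have "\<dots> = M * (\<bar>x\<bar> + 1)\<^sup>2 * \<bar>z - x\<bar>"
      proof -
        have "(z - x)\<^sup>2 / \<bar>z - x\<bar> = \<bar>z - x\<bar>"
          using 3 by (metis abs_eq_0 eq_iff_diff_eq_0 nonzero_mult_div_cancel_right power2_abs power2_eq_square)
        then show ?thesis by (simp only: times_divide_eq_right[symmetric])
      qed
      finally show ?case by (simp add: b0 abs_divide)
    qed auto
    show "((\<lambda>z. M * (\<bar>x\<bar> + 1)\<^sup>2 * \<bar>z - x\<bar>) \<longlongrightarrow> 0) (at x)"
      by (auto intro!: tendsto_eq_intros)
  qed
  moreover have "bump_term q l x = 0" for q l using False by (simp add: bump_term_def)
  ultimately show ?thesis by simp
qed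

text \<open>The inner factor \<open>b\<close> of the chain rule and the scalars coming from
  directions are both absorbed into the polynomial, so the affine substitution does not leave the
  class.\<close>

lemma smooth_bump_term_affine: "smooth (\<lambda>x. bump_term p k (a + b * x))"
proof (rule smooth_real_coinduct[of "{f. \<exists>p k. f = (\<lambda>x. bump_term p k (a + b * x))}"])
  fix f assume "f \<in> {f. \<exists>p k. f = (\<lambda>x. bump_term p k (a + b * x))}"
  then obtain p k where f: "f = (\<lambda>x. bump_term p k (a + b * x))" by blast
  have sm: "c * bump_term q l z = bump_term (smult c q) l z" for c q l z by (simp add: bump_term_def)
  show "(\<lambda>x. c * f x) \<in> {f. \<exists>p k. f = (\<lambda>x. bump_term p k (a + b * x))}" for c
    unfolding f sm by blast
  define q where "q = pderiv p * [:1, 0, -1:]\<^sup>2 + [:0, 2 * real k:] * [:1, 0, -1:] * p - [:0, 2:] * p"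
  have "(f has_real_derivative bump_term q (k + 2) (a + b * x) * b) (at x)" for x
    unfolding f q_def by (rule DERIV_chain'[OF _ bump_term_deriv]) (auto intro!: derivative_eq_intros)
  then have "(f has_real_derivative bump_term (smult b q) (k + 2) (a + b * x)) (at x)" for x
    by (simp only: sm[symmetric] mult.commute[of b])
  then show "\<exists>f'\<in>{f. \<exists>p k. f = (\<lambda>x. bump_term p k (a + b * x))}. \<forall>x. (f has_real_derivative f' x) (at x)"
    by (intro bexI[of _ "\<lambda>x. bump_term (smult b q) (k + 2) (a + b * x)"]) auto
qed blast

text \<open>The kernel comes with two derivatives, because convolutions are differentiated through a
  second order Taylor estimate. The last property regards the kernel as a function of the
  integration variable, in which it serves as a test function for the weak equation.\<close>

lemma mollifier_exists:
  obtains \<kappa> \<kappa>' \<kappa>'' :: "real \<Rightarrow> real" where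
    "\<And>x. 0 \<le> \<kappa> x" "\<And>x. 1 \<le> \<bar>x\<bar> \<Longrightarrow> \<kappa> x = 0" "\<And>x. 1 \<le> \<bar>x\<bar> \<Longrightarrow> \<kappa>' x = 0"
    "(LINT x|lborel. \<kappa> x) = 1"
    "\<And>x. (\<kappa> has_real_derivative \<kappa>' x) (at x)" "\<And>x. (\<kappa>' has_real_derivative \<kappa>'' x) (at x)"
    "continuous_on UNIV \<kappa>''" "\<And>x. 1 \<le> \<bar>x\<bar> \<Longrightarrow> \<kappa>'' x = 0"
    "\<And>h t I. h > 0 \<Longrightarrow> {t - h..t + h} \<subseteq> I \<Longrightarrow> test_fun I (\<lambda>\<tau>. \<kappa> ((t - \<tau>) / h))"
proof -
  have cont: "continuous_on S (bump_term p k)" for S p k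
    using bump_term_deriv DERIV_isCont by (blast intro: continuous_at_imp_continuous_on)
  define b where "b = bump_term 1 0"
  have b_pos: "0 \<le> b x" for x by (simp add: b_def bump_term_def)
  have sq: "\<not> x\<^sup>2 < 1" if "1 \<le> \<bar>x\<bar>" for x :: real
    using that abs_square_less_1[of x] by auto
  have b_int: "integrable lborel b"
  proof -
    have "integrable lborel (\<lambda>x. indicator {-1..1} x *\<^sub>R b x)"
      unfolding b_def by (intro borel_integrable_compact compact_Icc cont)
    moreover have "(\<lambda>x. indicator {-1..1} x *\<^sub>R b x) = b"
      by (auto simp: b_def bump_term_def fun_eq_iff indicator_def abs_square_less_1)
    ultimately show ?thesis by simp
  qed
  define c where "c = (LINT x|lborel. b x)"
  \<comment> \<open>A vanishing integral would make \<open>b\<close> zero almost everywhere,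
    although it is positive on an interval of length one.\<close>
  have "c > 0"
  proof (rule ccontr)
    assume "\<not> c > 0"
    moreover have "c \<ge> 0" unfolding c_def by (rule Bochner_Integration.integral_nonneg) (rule b_pos)
    ultimately have "c = 0" by simp
    then have "AE x in lborel. b x = 0"
      using integral_nonneg_eq_0_iff_AE[OF b_int] b_pos by (simp add: c_def)
    then have "emeasure lborel {x. b x \<noteq> 0} = 0"
      using b_int by (subst (asm) AE_iff_measurable[of _ _ "\<lambda>x. b x = 0"]) auto
    moreover have "{-1/2..1/2} \<subseteq> {x. b x \<noteq> 0}"
    proof
      fix x :: real assume "x \<in> {-1/2..1/2}"
      then have "x\<^sup>2 < 1" by (auto simp: abs_square_less_1)
      then show "x \<in> {x. b x \<noteq> 0}" by (simp add: b_def bump_term_def)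
    qed
    moreover have "{x. b x \<noteq> 0} \<in> sets lborel"
      using cont[of UNIV 1 0] unfolding b_def sets_lborel
      by (intro borel_open open_Collect_neq) (auto simp: continuous_on_const)
    ultimately have "emeasure lborel {-1/2..1/2::real} = 0"
      by (metis emeasure_mono le_zero_eq)
    then show False by simp
  qed
  have smult: "r * bump_term q l z = bump_term (smult r q) l z" for r q l z
    by (simp add: bump_term_def)
  define p1 where "p1 = [:1 / c:]"
  define D where "D p k = pderiv p * [:1, 0, -1:]\<^sup>2 + [:0, 2 * real k:] * [:1, 0, -1:] * p - [:0, 2:] * p" for p k
  define \<kappa> where "\<kappa> = bump_term p1 0"
  have \<kappa>b: "\<kappa> x = b x / c" for x by (simp add: \<kappa>_def b_def p1_def bump_term_def)
  show ?thesis
  proof (rule that[of \<kappa> "bump_term (D p1 0) 2" "bump_term (D (D p1 0) 2) (2 + 2)"])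
    show "0 \<le> \<kappa> x" for x using b_pos \<open>c > 0\<close> by (simp add: \<kappa>b)
    show "\<kappa> x = 0" "bump_term (D p1 0) 2 x = 0" "bump_term (D (D p1 0) 2) (2 + 2) x = 0" if "1 \<le> \<bar>x\<bar>" for x
      using sq[OF that] by (auto simp: \<kappa>_def bump_term_def)
    show "(LINT x|lborel. \<kappa> x) = 1" unfolding \<kappa>b using \<open>c > 0\<close> by (simp add: c_def)
    show "(\<kappa> has_real_derivative bump_term (D p1 0) 2 x) (at x)" for x
      using bump_term_deriv[of p1 0 x] by (simp add: \<kappa>_def D_def numeral_2_eq_2)
    show "(bump_term (D p1 0) 2 has_real_derivative bump_term (D (D p1 0) 2) (2 + 2) x) (at x)" for x
      using bump_term_deriv[of "D p1 0" 2 x] unfolding D_def .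
    show "continuous_on UNIV (bump_term (D (D p1 0) 2) (2 + 2))" by (rule cont)
    show "test_fun I (\<lambda>\<tau>. \<kappa> ((t - \<tau>) / h))" if h: "h > 0" and I: "{t - h..t + h} \<subseteq> I" for h t I
    proof -
      have "(t - \<tau>) / h = t / h + (- 1 / h) * \<tau>" for \<tau> by (simp add: diff_divide_distrib)
      then have sm: "smooth (\<lambda>\<tau>. \<kappa> ((t - \<tau>) / h))"
        unfolding \<kappa>_def by (simp only: smooth_bump_term_affine)
      have "{\<tau>. \<kappa> ((t - \<tau>) / h) \<noteq> 0} \<subseteq> {t - h..t + h}"
      proof
        fix \<tau> assume "\<tau> \<in> {\<tau>. \<kappa> ((t - \<tau>) / h) \<noteq> 0}"
        then have "\<not> 1 \<le> \<bar>(t - \<tau>) / h\<bar>" using sq[of "(t - \<tau>) / h"] by (auto simp: \<kappa>_def bump_term_def)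
        then show "\<tau> \<in> {t - h..t + h}" using h by (auto simp: abs_divide divide_simps)
      qed
      then have sub: "closure {\<tau>. \<kappa> ((t - \<tau>) / h) \<noteq> 0} \<subseteq> {t - h..t + h}"
        by (rule closure_minimal) auto
      then have "compact (closure {\<tau>. \<kappa> ((t - \<tau>) / h) \<noteq> 0})"
        unfolding compact_eq_bounded_closed using bounded_subset[OF bounded_closed_interval] by auto
      then show ?thesis using sm sub I unfolding test_fun_def by auto
    qed
  qed
qed

section \<open>Mollification of Hilbert space valued functions\<close>

lemma norm_add_square_le:
  fixes a b :: "'v::real_normed_vector"
  shows "(norm (a + b))\<^sup>2 \<le> 2 * (norm a)\<^sup>2 + 2 * (norm b)\<^sup>2"
proof -
  have "(norm (a + b))\<^sup>2 \<le> (norm a + norm b)\<^sup>2" by (intro power_mono norm_triangle_ineq) simp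
  also have "\<dots> \<le> 2 * (norm a)\<^sup>2 + 2 * (norm b)\<^sup>2"
    using zero_le_power2[of "norm a - norm b"] unfolding power2_sum power2_diff by linarith
  finally show ?thesis .
qed

lemma nn_integral_norm_add_square_le:
  fixes f g :: "'a \<Rightarrow> 'v::{real_normed_vector, second_countable_topology}"
  assumes [measurable]: "f \<in> borel_measurable M" "g \<in> borel_measurable M"
  shows "(\<integral>\<^sup>+x. ennreal ((norm (f x + g x))\<^sup>2) \<partial>M)
    \<le> 2 * (\<integral>\<^sup>+x. ennreal ((norm (f x))\<^sup>2) \<partial>M) + 2 * (\<integral>\<^sup>+x. ennreal ((norm (g x))\<^sup>2) \<partial>M)"
proof -
  have "(\<integral>\<^sup>+x. ennreal ((norm (f x + g x))\<^sup>2) \<partial>M)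
      \<le> (\<integral>\<^sup>+x. 2 * ennreal ((norm (f x))\<^sup>2) + 2 * ennreal ((norm (g x))\<^sup>2) \<partial>M)"
  proof (rule nn_integral_mono)
    fix x
    have "ennreal ((norm (f x + g x))\<^sup>2) \<le> ennreal (2 * (norm (f x))\<^sup>2 + 2 * (norm (g x))\<^sup>2)"
      by (intro ennreal_leI norm_add_square_le)
    then show "ennreal ((norm (f x + g x))\<^sup>2) \<le> 2 * ennreal ((norm (f x))\<^sup>2) + 2 * ennreal ((norm (g x))\<^sup>2)"
      by (simp add: ennreal_mult)
  qed
  then show ?thesis by (simp add: nn_integral_add nn_integral_cmult)
qed

section \<open>Continuity of translations in the square mean\<close>

definition translation_continuous :: "(real \<Rightarrow> 'v::{real_normed_vector, second_countable_topology}) \<Rightarrow> bool" where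
  "translation_continuous v \<longleftrightarrow> (\<forall>\<epsilon>>0. \<exists>\<delta>>0. \<forall>\<sigma>. \<bar>\<sigma>\<bar> < \<delta> \<longrightarrow>
     (\<integral>\<^sup>+t. ennreal ((norm (v (t + \<sigma>) - v t))\<^sup>2) \<partial>lborel) \<le> ennreal \<epsilon>)"

lemma nn_integral_lborel_shift:
  fixes f :: "real \<Rightarrow> ennreal"
  assumes "f \<in> borel_measurable borel"
  shows "(\<integral>\<^sup>+t. f (t + \<sigma>) \<partial>lborel) = (\<integral>\<^sup>+t. f t \<partial>lborel)"
  using nn_integral_real_affine[OF assms, of 1 \<sigma>] by (simp add: add.commute)

text \<open>The set is squeezed between a compact \<open>T\<close> and an open \<open>U\<close>. A
  shift shorter than the distance from \<open>T\<close> to the complement of \<open>U\<close> keeps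
  \<open>T\<close> inside \<open>U\<close>, so the indicator can change only if one of the two
  points lies in \<open>A - T\<close> or in \<open>U - A\<close>, and these sets are small.\<close>

lemma translation_continuous_indicator:
  fixes A :: "real set" and y :: "'v::{real_normed_vector, second_countable_topology}"
  assumes A: "A \<in> sets borel" "bounded A"
  shows "translation_continuous (\<lambda>t. indicator A t *\<^sub>R y)"
  unfolding translation_continuous_def
proof (intro allI impI)
  fix \<epsilon> :: real assume "\<epsilon> > 0"
  \<comment> \<open>The factor 4 counts two thin sets at two points; the \<open>1\<close> in the
    denominator covers \<open>y = 0\<close>.\<close>
  define e where "e = \<epsilon> / (4 * ((norm y)\<^sup>2 + 1))"
  have e: "e > 0" "4 * e * (norm y)\<^sup>2 \<le> \<epsilon>"
  proof -
    have "(norm y)\<^sup>2 + 1 > 0" by (simp add: add_nonneg_pos)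
    then show "e > 0" "4 * e * (norm y)\<^sup>2 \<le> \<epsilon>" using \<open>\<epsilon> > 0\<close>
      by (auto simp: e_def divide_simps intro!: mult_left_mono)
  qed
  have AL: "A \<in> sets lebesgue" using A by simp
  obtain U where U: "open U" "A \<subseteq> U" "emeasure lebesgue (U - A) < ennreal e"
    using sets_lebesgue_outer_open[OF AL e(1)] by metis
  obtain T where T: "closed T" "T \<subseteq> A" "emeasure lebesgue (A - T) < ennreal e"
    using sets_lebesgue_inner_closed[OF AL e(1)] by metis
  have "compact T" using T A bounded_subset by (auto simp: compact_eq_bounded_closed)
  then obtain \<delta> where \<delta>: "\<delta> > 0" "(\<Union>x\<in>T. ball x \<delta>) \<subseteq> U"
    using compact_subset_open_imp_ball_epsilon_subset[of T U] U T by blast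
  note [measurable] = A(1) borel_open[OF U(1)] borel_closed[OF T(1)]
  have meas: "emeasure lborel (U - A) \<le> ennreal e" "emeasure lborel (A - T) \<le> ennreal e"
    using U T A by (auto simp: less_imp_le emeasure_completion)
  have "(\<integral>\<^sup>+t. ennreal ((norm (indicator A (t + \<sigma>) *\<^sub>R y - indicator A t *\<^sub>R y))\<^sup>2) \<partial>lborel) \<le> ennreal \<epsilon>"
    if \<sigma>: "\<bar>\<sigma>\<bar> < \<delta>" for \<sigma>
  proof -
    define g where "g t = indicator (A - T) t + (indicator (U - A) t :: ennreal)" for t
    have [measurable]: "g \<in> borel_measurable borel" unfolding g_def[abs_def] by measurable
    have g_int: "(\<integral>\<^sup>+t. g t \<partial>lborel) \<le> ennreal (2 * e)"
    proof -
      have "(\<integral>\<^sup>+t. g t \<partial>lborel) = emeasure lborel (A - T) + emeasure lborel (U - A)"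
        unfolding g_def by (subst nn_integral_add) auto
      also have "\<dots> \<le> ennreal e + ennreal e" by (intro add_mono meas)
      finally show ?thesis using e by (simp add: ennreal_plus[symmetric] del: ennreal_plus)
    qed
    have TU: "x + \<sigma> \<in> U" "x - \<sigma> \<in> U" if "x \<in> T" for x
    proof -
      have "ball x \<delta> \<subseteq> U" using \<delta>(2) that by blast
      moreover have "x + \<sigma> \<in> ball x \<delta>" "x - \<sigma> \<in> ball x \<delta>" using \<sigma> by (auto simp: dist_real_def)
      ultimately show "x + \<sigma> \<in> U" "x - \<sigma> \<in> U" by blast+
    qed
    have "(\<integral>\<^sup>+t. ennreal ((norm (indicator A (t + \<sigma>) *\<^sub>R y - indicator A t *\<^sub>R y))\<^sup>2) \<partial>lborel)
      \<le> (\<integral>\<^sup>+t. ennreal ((norm y)\<^sup>2) * (g t + g (t + \<sigma>)) \<partial>lborel)"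
    proof (rule nn_integral_mono)
      fix t
      have one: "1 \<le> g t + g (t + \<sigma>)" if "(t \<in> A) \<noteq> (t + \<sigma> \<in> A)"
      proof -
        have "t \<in> A - T \<or> t \<in> U - A \<or> t + \<sigma> \<in> A - T \<or> t + \<sigma> \<in> U - A"
          using that TU(1)[of t] TU(2)[of "t + \<sigma>"] by auto
        then have "1 \<le> g t \<or> 1 \<le> g (t + \<sigma>)" unfolding g_def by (auto simp: indicator_def)
        then show ?thesis by (auto simp: add_increasing add_increasing2)
      qed
      show "ennreal ((norm (indicator A (t + \<sigma>) *\<^sub>R y - indicator A t *\<^sub>R y))\<^sup>2)
          \<le> ennreal ((norm y)\<^sup>2) * (g t + g (t + \<sigma>))"
        using mult_left_mono[OF one, of "ennreal ((norm y)\<^sup>2)"] by (auto simp: indicator_def)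
    qed
    also have "\<dots> = ennreal ((norm y)\<^sup>2) * ((\<integral>\<^sup>+t. g t \<partial>lborel) + (\<integral>\<^sup>+t. g (t + \<sigma>) \<partial>lborel))"
      by (subst nn_integral_cmult) (auto simp: nn_integral_add)
    also have "(\<integral>\<^sup>+t. g (t + \<sigma>) \<partial>lborel) = (\<integral>\<^sup>+t. g t \<partial>lborel)"
      by (rule nn_integral_lborel_shift) simp
    also have "ennreal ((norm y)\<^sup>2) * ((\<integral>\<^sup>+t. g t \<partial>lborel) + (\<integral>\<^sup>+t. g t \<partial>lborel))
        \<le> ennreal ((norm y)\<^sup>2) * (ennreal (2 * e) + ennreal (2 * e))"
      by (intro mult_left_mono add_mono g_int) simp
    also have "\<dots> = ennreal (4 * e * (norm y)\<^sup>2)"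
      using e by (simp add: ennreal_plus[symmetric] ennreal_mult[symmetric] mult.commute del: ennreal_plus)
    also have "\<dots> \<le> ennreal \<epsilon>" using e by (intro ennreal_leI)
    finally show ?thesis .
  qed
  then show "\<exists>\<delta>>0. \<forall>\<sigma>. \<bar>\<sigma>\<bar> < \<delta> \<longrightarrow>
      (\<integral>\<^sup>+t. ennreal ((norm (indicator A (t + \<sigma>) *\<^sub>R y - indicator A t *\<^sub>R y))\<^sup>2) \<partial>lborel) \<le> ennreal \<epsilon>"
    using \<delta> by blast
qed

lemma translation_continuous_add:
  fixes v w :: "real \<Rightarrow> 'v::{real_normed_vector, second_countable_topology}"
  assumes [measurable]: "v \<in> borel_measurable borel" "w \<in> borel_measurable borel"
    and v: "translation_continuous v" and w: "translation_continuous w"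
  shows "translation_continuous (\<lambda>t. v t + w t)"
  unfolding translation_continuous_def
proof (intro allI impI)
  fix \<epsilon> :: real assume "\<epsilon> > 0"
  then have "\<epsilon>/4 > 0" by simp
  obtain d1 where d1: "d1 > 0"
    "\<And>\<sigma>. \<bar>\<sigma>\<bar> < d1 \<Longrightarrow> (\<integral>\<^sup>+t. ennreal ((norm (v (t + \<sigma>) - v t))\<^sup>2) \<partial>lborel) \<le> ennreal (\<epsilon>/4)"
    using v \<open>\<epsilon>/4 > 0\<close> unfolding translation_continuous_def by blast
  obtain d2 where d2: "d2 > 0"
    "\<And>\<sigma>. \<bar>\<sigma>\<bar> < d2 \<Longrightarrow> (\<integral>\<^sup>+t. ennreal ((norm (w (t + \<sigma>) - w t))\<^sup>2) \<partial>lborel) \<le> ennreal (\<epsilon>/4)"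
    using w \<open>\<epsilon>/4 > 0\<close> unfolding translation_continuous_def by blast
  note d = d1 d2
  have "(\<integral>\<^sup>+t. ennreal ((norm (v (t + \<sigma>) + w (t + \<sigma>) - (v t + w t)))\<^sup>2) \<partial>lborel) \<le> ennreal \<epsilon>"
    if \<sigma>: "\<bar>\<sigma>\<bar> < min d1 d2" for \<sigma>
  proof -
    have "(\<integral>\<^sup>+t. ennreal ((norm (v (t + \<sigma>) + w (t + \<sigma>) - (v t + w t)))\<^sup>2) \<partial>lborel)
       = (\<integral>\<^sup>+t. ennreal ((norm ((v (t + \<sigma>) - v t) + (w (t + \<sigma>) - w t)))\<^sup>2) \<partial>lborel)"
      by (simp add: algebra_simps)
    also have "\<dots> \<le> 2 * (\<integral>\<^sup>+t. ennreal ((norm (v (t + \<sigma>) - v t))\<^sup>2) \<partial>lborel)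
        + 2 * (\<integral>\<^sup>+t. ennreal ((norm (w (t + \<sigma>) - w t))\<^sup>2) \<partial>lborel)"
      by (rule nn_integral_norm_add_square_le) measurable
    also have "\<dots> \<le> 2 * ennreal (\<epsilon>/4) + 2 * ennreal (\<epsilon>/4)"
      using \<sigma> by (intro add_mono mult_left_mono d) auto
    also have "\<dots> = ennreal (2 * (\<epsilon>/4) + 2 * (\<epsilon>/4))"
      using \<open>\<epsilon> > 0\<close> by (simp add: ennreal_mult[symmetric] ennreal_plus[symmetric]
        flip: ennreal_numeral del: ennreal_plus)
    also have "\<dots> = ennreal \<epsilon>" by simp
    finally show ?thesis .
  qed
  then show "\<exists>\<delta>>0. \<forall>\<sigma>. \<bar>\<sigma>\<bar> < \<delta> \<longrightarrow>
      (\<integral>\<^sup>+t. ennreal ((norm (v (t + \<sigma>) + w (t + \<sigma>) - (v t + w t)))\<^sup>2) \<partial>lborel) \<le> ennreal \<epsilon>"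
    using d by (intro exI[of _ "min d1 d2"]) auto
qed

text \<open>The difference \<open>v (t + \<sigma>) - v t\<close> is that of \<open>w\<close> plus
  the approximation error at \<open>t + \<sigma>\<close> and at \<open>t\<close>; both errors have
  the same integral by translation invariance. The values \<epsilon>/4 and \<epsilon>/16 account for
  applying the inequality for the square of a sum twice.\<close>

lemma translation_continuous_approx:
  fixes v :: "real \<Rightarrow> 'v::{real_normed_vector, second_countable_topology}"
  assumes [measurable]: "v \<in> borel_measurable borel"
    and approx: "\<And>\<epsilon>. \<epsilon> > 0 \<Longrightarrow> \<exists>w\<in>borel_measurable borel. translation_continuous w \<and>
      (\<integral>\<^sup>+t. ennreal ((norm (v t - w t))\<^sup>2) \<partial>lborel) \<le> ennreal \<epsilon>"
  shows "translation_continuous v"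
  unfolding translation_continuous_def
proof (intro allI impI)
  fix \<epsilon> :: real assume "\<epsilon> > 0"
  then obtain w where [measurable]: "w \<in> borel_measurable borel" and w: "translation_continuous w"
    "(\<integral>\<^sup>+t. ennreal ((norm (v t - w t))\<^sup>2) \<partial>lborel) \<le> ennreal (\<epsilon>/16)"
    using approx[of "\<epsilon>/16"] by auto
  obtain d where d: "d > 0"
    "\<And>\<sigma>. \<bar>\<sigma>\<bar> < d \<Longrightarrow> (\<integral>\<^sup>+t. ennreal ((norm (w (t + \<sigma>) - w t))\<^sup>2) \<partial>lborel) \<le> ennreal (\<epsilon>/4)"
    using w(1) \<open>\<epsilon> > 0\<close> unfolding translation_continuous_def by (metis divide_pos_pos zero_less_numeral)
  have "(\<integral>\<^sup>+t. ennreal ((norm (v (t + \<sigma>) - v t))\<^sup>2) \<partial>lborel) \<le> ennreal \<epsilon>" if \<sigma>: "\<bar>\<sigma>\<bar> < d" for \<sigma>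
  proof -
    have "(\<integral>\<^sup>+t. ennreal ((norm (v (t + \<sigma>) - v t))\<^sup>2) \<partial>lborel)
      = (\<integral>\<^sup>+t. ennreal ((norm ((w (t + \<sigma>) - w t) + ((v (t + \<sigma>) - w (t + \<sigma>)) + - (v t - w t))))\<^sup>2) \<partial>lborel)"
      by (simp add: algebra_simps)
    also have "\<dots> \<le> 2 * (\<integral>\<^sup>+t. ennreal ((norm (w (t + \<sigma>) - w t))\<^sup>2) \<partial>lborel)
        + 2 * (\<integral>\<^sup>+t. ennreal ((norm ((v (t + \<sigma>) - w (t + \<sigma>)) + - (v t - w t)))\<^sup>2) \<partial>lborel)"
      by (rule nn_integral_norm_add_square_le) measurable
    also have "\<dots> \<le> 2 * (\<integral>\<^sup>+t. ennreal ((norm (w (t + \<sigma>) - w t))\<^sup>2) \<partial>lborel)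
        + 2 * (2 * (\<integral>\<^sup>+t. ennreal ((norm (v (t + \<sigma>) - w (t + \<sigma>)))\<^sup>2) \<partial>lborel)
          + 2 * (\<integral>\<^sup>+t. ennreal ((norm (- (v t - w t)))\<^sup>2) \<partial>lborel))"
      by (intro add_mono mult_left_mono order_refl nn_integral_norm_add_square_le) measurable
    also have "(\<integral>\<^sup>+t. ennreal ((norm (v (t + \<sigma>) - w (t + \<sigma>)))\<^sup>2) \<partial>lborel)
        = (\<integral>\<^sup>+t. ennreal ((norm (v t - w t))\<^sup>2) \<partial>lborel)"
      by (rule nn_integral_lborel_shift) measurable
    also have "2 * (\<integral>\<^sup>+t. ennreal ((norm (w (t + \<sigma>) - w t))\<^sup>2) \<partial>lborel)
        + 2 * (2 * (\<integral>\<^sup>+t. ennreal ((norm (v t - w t))\<^sup>2) \<partial>lborel)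
          + 2 * (\<integral>\<^sup>+t. ennreal ((norm (- (v t - w t)))\<^sup>2) \<partial>lborel))
        \<le> 2 * ennreal (\<epsilon>/4) + 2 * (2 * ennreal (\<epsilon>/16) + 2 * ennreal (\<epsilon>/16))"
      unfolding norm_minus_cancel by (intro add_mono mult_left_mono w d \<sigma>) auto
    also have "\<dots> = ennreal (2 * (\<epsilon>/4) + 2 * (2 * (\<epsilon>/16) + 2 * (\<epsilon>/16)))"
      using \<open>\<epsilon> > 0\<close> by (simp add: ennreal_mult[symmetric] ennreal_plus[symmetric]
        flip: ennreal_numeral del: ennreal_plus)
    also have "\<dots> \<le> ennreal \<epsilon>" using \<open>\<epsilon> > 0\<close> by (intro ennreal_leI) simp
    finally show ?thesis .
  qed
  then show "\<exists>\<delta>>0. \<forall>\<sigma>. \<bar>\<sigma>\<bar> < \<delta> \<longrightarrow>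
      (\<integral>\<^sup>+t. ennreal ((norm (v (t + \<sigma>) - v t))\<^sup>2) \<partial>lborel) \<le> ennreal \<epsilon>"
    using d by blast
qed

text \<open>Reduction to indicators: simple functions cut off to bounded intervals converge to
  \<open>v\<close> in the square mean by dominated convergence. The dominating factor 9 stems from
  \<open>norm (w i t) \<le> 2 * norm (v t)\<close>.\<close>

lemma translation_continuous_L2:
  fixes v :: "real \<Rightarrow> 'v::{banach, second_countable_topology}"
  assumes v[measurable]: "v \<in> borel_measurable borel"
    and fin: "(\<integral>\<^sup>+t. ennreal ((norm (v t))\<^sup>2) \<partial>lborel) < \<infinity>"
  shows "translation_continuous v"
proof (rule translation_continuous_approx[OF v])
  fix \<epsilon> :: real assume "\<epsilon> > 0"
  have "v \<in> borel_measurable lborel" by simp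
  from borel_measurable_implies_sequence_metric[OF this, of 0]
  obtain s where s: "\<And>i. simple_function lborel (s i)" "\<And>t. (\<lambda>i. s i t) \<longlonglongrightarrow> v t"
    "\<And>i t. norm (s i t) \<le> 2 * norm (v t)" by (auto simp: dist_norm)
  \<comment> \<open>The cut-off makes all level sets bounded, as required for translating their
    indicators.\<close>
  define w where "w i t = indicator (cball 0 (real i)) t *\<^sub>R s i t" for i t
  have sb[measurable]: "s i \<in> borel_measurable borel" for i
    using borel_measurable_simple_function[OF s(1)[of i]] by simp
  have [measurable]: "w i \<in> borel_measurable borel" for i 
    unfolding w_def[abs_def] by (intro borel_measurable_scaleR borel_measurable_indicator sb) simp
  have w_le: "norm (w i t) \<le> 2 * norm (v t)" for i t
    using s(3)[of i t] by (auto simp: w_def indicator_def)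
  have w_lim: "(\<lambda>i. w i t) \<longlonglongrightarrow> v t" for t
  proof (rule Lim_transform_eventually[OF s(2)])
    obtain N :: nat where N: "\<bar>t\<bar> \<le> real N" using real_arch_simple by blast
    show "\<forall>\<^sub>F i in sequentially. s i t = w i t"
      using eventually_ge_at_top[of N]
    proof eventually_elim
      case (elim i)
      then have "\<bar>t\<bar> \<le> real i" using N by linarith
      then show ?case by (simp add: w_def)
    qed
  qed
  have "(\<lambda>i. \<integral>\<^sup>+t. ennreal ((norm (v t - w i t))\<^sup>2) \<partial>lborel) \<longlonglongrightarrow> (\<integral>\<^sup>+t. 0 \<partial>(lborel :: real measure))"
  proof (rule nn_integral_dominated_convergence[where w = "\<lambda>t. ennreal (9 * (norm (v t))\<^sup>2)"])
    show "(\<integral>\<^sup>+t. ennreal (9 * (norm (v t))\<^sup>2) \<partial>lborel) < \<infinity>"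
      using fin by (simp add: ennreal_mult nn_integral_cmult ennreal_mult_less_top)
    show "AE t in lborel. ennreal ((norm (v t - w i t))\<^sup>2) \<le> ennreal (9 * (norm (v t))\<^sup>2)" for i
    proof (intro AE_I2 ennreal_leI)
      fix t
      have "norm (v t - w i t) \<le> 3 * norm (v t)"
        using norm_triangle_ineq4[of "v t" "w i t"] w_le[of i t] by linarith
      then have "(norm (v t - w i t))\<^sup>2 \<le> (3 * norm (v t))\<^sup>2" by (intro power_mono) auto
      then show "(norm (v t - w i t))\<^sup>2 \<le> 9 * (norm (v t))\<^sup>2" by (simp add: power_mult_distrib)
    qed
    show "AE t in lborel. (\<lambda>i. ennreal ((norm (v t - w i t))\<^sup>2)) \<longlonglongrightarrow> 0"
    proof (intro AE_I2)
      fix t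
      have "(\<lambda>i. ennreal ((norm (v t - w i t))\<^sup>2)) \<longlonglongrightarrow> ennreal ((norm (v t - v t))\<^sup>2)"
        by (intro tendsto_intros w_lim)
      then show "(\<lambda>i. ennreal ((norm (v t - w i t))\<^sup>2)) \<longlonglongrightarrow> 0" by simp
    qed
  qed measurable
  then have "(\<lambda>i. \<integral>\<^sup>+t. ennreal ((norm (v t - w i t))\<^sup>2) \<partial>lborel) \<longlonglongrightarrow> 0" by simp
  moreover have "0 < ennreal \<epsilon>" using \<open>\<epsilon> > 0\<close> by simp
  ultimately have "\<forall>\<^sub>F i in sequentially. (\<integral>\<^sup>+t. ennreal ((norm (v t - w i t))\<^sup>2) \<partial>lborel) < ennreal \<epsilon>"
    by (rule order_tendstoD)
  then obtain i where i: "(\<integral>\<^sup>+t. ennreal ((norm (v t - w i t))\<^sup>2) \<partial>lborel) \<le> ennreal \<epsilon>"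
    using eventually_happens'[OF sequentially_bot] less_imp_le by blast
  have "translation_continuous (w i)"
  proof -
    define Y where "Y = s i ` space lborel"
    have "finite Y" unfolding Y_def using s(1) by (rule simple_functionD)
    have lvl[measurable]: "s i -` {y} \<in> sets borel" for y
      using measurable_sets[OF sb[of i], of "{y}"] by simp
    have eq: "w i = (\<lambda>t. \<Sum>y\<in>Y. indicator (s i -` {y} \<inter> cball 0 (real i)) t *\<^sub>R y)"
    proof
      fix t
      have "(\<Sum>y\<in>Y. indicator (s i -` {y} \<inter> cball 0 (real i)) t *\<^sub>R y)
          = (\<Sum>y\<in>Y. indicator (cball 0 (real i)) t *\<^sub>R (indicator (s i -` {y} \<inter> space lborel) t *\<^sub>R y))"
        by (intro sum.cong) (auto simp: indicator_def)
      also have "\<dots> = w i t"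
        unfolding w_def simple_function_indicator_representation_banach[OF s(1)[of i], of t, simplified]
        by (simp add: scaleR_sum_right Y_def)
      finally show "w i t = (\<Sum>y\<in>Y. indicator (s i -` {y} \<inter> cball 0 (real i)) t *\<^sub>R y)" ..
    qed
    have "translation_continuous (\<lambda>t. \<Sum>y\<in>Z. indicator (s i -` {y} \<inter> cball 0 (real i)) t *\<^sub>R y)"
      if "finite Z" for Z
      using that
    proof (induction Z)
      case empty
      show ?case by (auto simp: translation_continuous_def intro!: exI[of _ "1::real"])
    next
      case (insert y Z)
      have "translation_continuous (\<lambda>t. indicator (s i -` {y} \<inter> cball 0 (real i)) t *\<^sub>R y)"
        by (rule translation_continuous_indicator) (auto intro: bounded_Int)
      note add = translation_continuous_add[OF _ _ this insert.IH]
      have "translation_continuous (\<lambda>t. indicator (s i -` {y} \<inter> cball 0 (real i)) t *\<^sub>R y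
          + (\<Sum>y\<in>Z. indicator (s i -` {y} \<inter> cball 0 (real i)) t *\<^sub>R y))"
        by (rule add) (auto intro!: borel_measurable_sum borel_measurable_scaleR borel_measurable_indicator)
      then show ?case by (simp only: sum.insert[OF insert.hyps])
    qed
    from this[OF \<open>finite Y\<close>] show ?thesis unfolding eq .
  qed
  with i show "\<exists>w\<in>borel_measurable borel. translation_continuous w \<and>
      (\<integral>\<^sup>+t. ennreal ((norm (v t - w t))\<^sup>2) \<partial>lborel) \<le> ennreal \<epsilon>"
    by (intro bexI[of _ "w i"]) auto
qed

section \<open>Square integrable functions with values in a Hilbert space\<close>

text \<open>Elements of \<open>L^2(M; 'v)\<close> are kept as plain functions rather than classes.
  The measure is a parameter because the same facts are applied in the time variable and, over
  \<open>lebesgue\<close>, in space.\<close>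

definition sq_int :: "'a measure \<Rightarrow> ('a \<Rightarrow> 'v::{real_inner, banach, second_countable_topology}) \<Rightarrow> bool" where
  "sq_int M f \<longleftrightarrow> f \<in> borel_measurable M \<and> integrable M (\<lambda>x. (norm (f x))\<^sup>2)"

lemma sq_intD: "sq_int M f \<Longrightarrow> f \<in> borel_measurable M" "sq_int M f \<Longrightarrow> integrable M (\<lambda>x. (norm (f x))\<^sup>2)"
  by (auto simp: sq_int_def)

lemma sq_int_iff_nn:
  "sq_int M f \<longleftrightarrow> f \<in> borel_measurable M \<and> (\<integral>\<^sup>+x. ennreal ((norm (f x))\<^sup>2) \<partial>M) < \<infinity>"
  by (auto simp: sq_int_def integrable_iff_bounded)

lemma sq_int_nn_eq: "sq_int M f \<Longrightarrow> (\<integral>\<^sup>+x. ennreal ((norm (f x))\<^sup>2) \<partial>M) = ennreal (LINT x|M. (norm (f x))\<^sup>2)"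
  by (rule nn_integral_eq_integral) (auto simp: sq_int_def)

lemma abs_inner_le_squares:
  fixes a b :: "'v::real_inner"
  assumes "\<eta> > 0"
  shows "\<bar>a \<bullet> b\<bar> \<le> \<eta> * (norm a)\<^sup>2 + (1 / \<eta>) * (norm b)\<^sup>2"
proof -
  have "\<bar>a \<bullet> b\<bar> \<le> norm a * norm b" by (rule Cauchy_Schwarz_ineq2)
  also have "\<dots> = (sqrt \<eta> * norm a) * (norm b / sqrt \<eta>)" using assms by simp
  also have "\<dots> \<le> (sqrt \<eta> * norm a)\<^sup>2 + (norm b / sqrt \<eta>)\<^sup>2"
  proof -
    have "0 \<le> (sqrt \<eta> * norm a) * (norm b / sqrt \<eta>)" using assms by simp
    then show ?thesis using sum_squares_bound[of "sqrt \<eta> * norm a" "norm b / sqrt \<eta>"] by linarith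
  qed
  also have "\<dots> = \<eta> * (norm a)\<^sup>2 + (1 / \<eta>) * (norm b)\<^sup>2"
    using assms by (simp add: power_mult_distrib power_divide)
  finally show ?thesis .
qed

lemma sq_int_bound:
  assumes "sq_int M f" "g \<in> borel_measurable M" "\<And>x. x \<in> space M \<Longrightarrow> norm (g x) \<le> C * norm (f x)"
  shows "sq_int M g"
proof -
  have "integrable M (\<lambda>x. (norm (g x))\<^sup>2)"
  proof (rule Bochner_Integration.integrable_bound)
    show "integrable M (\<lambda>x. C\<^sup>2 * (norm (f x))\<^sup>2)" using sq_intD(2)[OF assms(1)] by simp
    show "AE x in M. norm ((norm (g x))\<^sup>2) \<le> norm (C\<^sup>2 * (norm (f x))\<^sup>2)"
    proof (intro AE_I2)
      fix x assume "x \<in> space M"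
      then have "(norm (g x))\<^sup>2 \<le> (C * norm (f x))\<^sup>2" by (intro power_mono assms) auto
      then show "norm ((norm (g x))\<^sup>2) \<le> norm (C\<^sup>2 * (norm (f x))\<^sup>2)" by (simp add: power_mult_distrib)
    qed
  qed (use assms in measurable)
  then show ?thesis using assms by (simp add: sq_int_def)
qed

lemma sq_int_inner:
  assumes "sq_int M f" "sq_int M g"
  shows "integrable M (\<lambda>x. f x \<bullet> g x)"
proof (rule Bochner_Integration.integrable_bound)
  show "integrable M (\<lambda>x. (norm (f x))\<^sup>2 + (norm (g x))\<^sup>2)"
    using assms by (auto simp: sq_int_def)
  show "(\<lambda>x. f x \<bullet> g x) \<in> borel_measurable M"
    using assms by (intro borel_measurable_inner) (auto simp: sq_int_def)
  show "AE x in M. norm (f x \<bullet> g x) \<le> norm ((norm (f x))\<^sup>2 + (norm (g x))\<^sup>2)"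
    using abs_inner_le_squares[of 1 "f _" "g _"] by simp
qed

lemma sq_int_scaleR: "sq_int M f \<Longrightarrow> sq_int M (\<lambda>x. c *\<^sub>R f x)"
  by (rule sq_int_bound[where C = "\<bar>c\<bar>"]) (auto dest: sq_intD)

lemma sq_int_add:
  assumes "sq_int M f" "sq_int M g"
  shows "sq_int M (\<lambda>x. f x + g x)"
proof -
  have "(norm (f x + g x))\<^sup>2 = (norm (f x))\<^sup>2 + 2 * (f x \<bullet> g x) + (norm (g x))\<^sup>2" for x
    by (simp add: power2_norm_eq_inner inner_add_left inner_add_right inner_commute)
  then show ?thesis
    using assms sq_int_inner[OF assms] by (auto simp: sq_int_def)
qed

lemma sq_int_diff: "sq_int M f \<Longrightarrow> sq_int M g \<Longrightarrow> sq_int M (\<lambda>x. f x - g x)"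
  using sq_int_add[of M f "\<lambda>x. (-1) *\<^sub>R g x"] sq_int_scaleR[of M g "-1"] by simp

lemma sq_int_indicator: "sq_int M f \<Longrightarrow> A \<in> sets M \<Longrightarrow> sq_int M (\<lambda>x. indicator A x *\<^sub>R f x)"
  by (rule sq_int_bound[where C = 1])
     (auto dest!: sq_intD(1) intro: borel_measurable_scaleR simp: indicator_times_eq_if indicator_def)

text \<open>The error \<open>F \<bullet> G - f \<bullet> g\<close> equals \<open>(F - f) \<bullet>
  (G - g) + g \<bullet> (F - f) + f \<bullet> (G - g)\<close>. Young's inequality with a small
  weight \<eta> on the fixed functions bounds its integral by \<eta> times a constant plus a
  multiple of the two vanishing distances.\<close>

lemma sq_int_inner_tendsto:
  fixes f g :: "'a \<Rightarrow> 'v::{real_inner, banach, second_countable_topology}"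
  assumes fm: "\<And>m::nat. sq_int M (F m)" and gm: "\<And>m. sq_int M (G m)"
    and f: "sq_int M f" and g: "sq_int M g"
    and F: "(\<lambda>m. LINT x|M. (norm (F m x - f x))\<^sup>2) \<longlonglongrightarrow> 0"
    and G: "(\<lambda>m. LINT x|M. (norm (G m x - g x))\<^sup>2) \<longlonglongrightarrow> 0"
  shows "(\<lambda>m. LINT x|M. F m x \<bullet> G m x) \<longlonglongrightarrow> (LINT x|M. f x \<bullet> g x)"
proof (rule LIM_zero_cancel, rule LIMSEQ_I)
  fix \<epsilon> :: real assume "\<epsilon> > 0"
  define a where "a m = (LINT x|M. (norm (F m x - f x))\<^sup>2)" for m
  define b where "b m = (LINT x|M. (norm (G m x - g x))\<^sup>2)" for m
  \<comment> \<open>The \<open>1\<close> makes \<open>K\<close> positive, so that \<eta> is well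
    defined also for \<open>f = g = 0\<close>.\<close>
  define K where "K = (LINT x|M. (norm (f x))\<^sup>2) + (LINT x|M. (norm (g x))\<^sup>2) + 1"
  have K: "K > 0" unfolding K_def by (intro add_nonneg_pos add_nonneg_nonneg integral_nonneg) auto
  define \<eta> where "\<eta> = \<epsilon> / (2 * K)"
  have \<eta>: "\<eta> > 0" using \<open>\<epsilon> > 0\<close> K by (simp add: \<eta>_def)
  note sd = sq_int_diff[OF fm f] sq_int_diff[OF gm g]
  have est: "\<bar>(LINT x|M. F m x \<bullet> G m x) - (LINT x|M. f x \<bullet> g x)\<bar>
      \<le> (a m + b m) * (1 + 1 / \<eta>) + \<eta> * (K - 1)" for m
  proof -
    note i = sq_intD(2)[OF sd(1)[of m]] sq_intD(2)[OF sd(2)[of m]] sq_intD(2)[OF f] sq_intD(2)[OF g]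
    have "(LINT x|M. F m x \<bullet> G m x) - (LINT x|M. f x \<bullet> g x) = (LINT x|M. F m x \<bullet> G m x - f x \<bullet> g x)"
      by (rule Bochner_Integration.integral_diff[symmetric]) (intro sq_int_inner fm gm f g)+
    also have "\<bar>\<dots>\<bar> \<le> (LINT x|M. \<bar>F m x \<bullet> G m x - f x \<bullet> g x\<bar>)"
      by (rule integral_abs_bound)
    also have "\<dots> \<le> (LINT x|M. (norm (F m x - f x))\<^sup>2 + (norm (G m x - g x))\<^sup>2
        + (\<eta> * (norm (g x))\<^sup>2 + (1 / \<eta>) * (norm (F m x - f x))\<^sup>2)
        + (\<eta> * (norm (f x))\<^sup>2 + (1 / \<eta>) * (norm (G m x - g x))\<^sup>2))"
    proof (rule integral_mono)
      show "integrable M (\<lambda>x. \<bar>F m x \<bullet> G m x - f x \<bullet> g x\<bar>)"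
        by (intro integrable_abs Bochner_Integration.integrable_diff sq_int_inner fm gm f g)
      show "integrable M (\<lambda>x. (norm (F m x - f x))\<^sup>2 + (norm (G m x - g x))\<^sup>2
        + (\<eta> * (norm (g x))\<^sup>2 + (1 / \<eta>) * (norm (F m x - f x))\<^sup>2)
        + (\<eta> * (norm (f x))\<^sup>2 + (1 / \<eta>) * (norm (G m x - g x))\<^sup>2))"
        by (intro Bochner_Integration.integrable_add integrable_mult_right i)
      fix x
      have "F m x \<bullet> G m x - f x \<bullet> g x
          = (F m x - f x) \<bullet> (G m x - g x) + g x \<bullet> (F m x - f x) + f x \<bullet> (G m x - g x)"
        by (simp add: inner_diff_left inner_diff_right inner_commute)
      then show "\<bar>F m x \<bullet> G m x - f x \<bullet> g x\<bar> \<le> (norm (F m x - f x))\<^sup>2 + (norm (G m x - g x))\<^sup>2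
        + (\<eta> * (norm (g x))\<^sup>2 + (1 / \<eta>) * (norm (F m x - f x))\<^sup>2)
        + (\<eta> * (norm (f x))\<^sup>2 + (1 / \<eta>) * (norm (G m x - g x))\<^sup>2)"
        using abs_inner_le_squares[of 1 "F m x - f x" "G m x - g x"]
          abs_inner_le_squares[OF \<eta>, of "g x" "F m x - f x"]
          abs_inner_le_squares[OF \<eta>, of "f x" "G m x - g x"] by simp
    qed
    also have "\<dots> = (a m + b m) * (1 + 1 / \<eta>) + \<eta> * (K - 1)"
      using i by (simp add: a_def b_def K_def distrib_left distrib_right add_divide_distrib)
    finally show ?thesis .
  qed
  have ab: "a m \<ge> 0" "b m \<ge> 0" for m unfolding a_def b_def by (auto intro!: integral_nonneg)
  have "(\<lambda>m. (a m + b m) * (1 + 1 / \<eta>)) \<longlonglongrightarrow> (0 + 0) * (1 + 1 / \<eta>)"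
    unfolding a_def b_def by (intro tendsto_intros F G)
  then have "(\<lambda>m. (a m + b m) * (1 + 1 / \<eta>)) \<longlonglongrightarrow> 0" by simp
  from LIMSEQ_D[OF this, of "\<epsilon>/2"] \<open>\<epsilon> > 0\<close> obtain N where
    N: "\<And>m. m \<ge> N \<Longrightarrow> \<bar>(a m + b m) * (1 + 1 / \<eta>)\<bar> < \<epsilon>/2" by auto
  show "\<exists>no. \<forall>m\<ge>no. norm ((LINT x|M. F m x \<bullet> G m x) - (LINT x|M. f x \<bullet> g x) - 0) < \<epsilon>"
  proof (intro exI allI impI)
    fix m assume "N \<le> m"
    have "\<eta> * (K - 1) \<le> \<eta> * K" using \<eta> by simp
    also have "\<dots> = \<epsilon> / 2" using K by (simp add: \<eta>_def)
    finally show "norm ((LINT x|M. F m x \<bullet> G m x) - (LINT x|M. f x \<bullet> g x) - 0) < \<epsilon>"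
      using est[of m] N[OF \<open>N \<le> m\<close>] unfolding real_norm_def diff_0_right by linarith
  qed
qed

lemma sq_int_integrable_finite:
  assumes f: "sq_int M f" and A: "A \<in> sets M" "emeasure M A < \<infinity>"
  shows "integrable M (\<lambda>x. indicator A x *\<^sub>R f x)"
proof (rule Bochner_Integration.integrable_bound)
  show "integrable M (\<lambda>x. indicator A x + (norm (f x))\<^sup>2)"
    using A f by (intro Bochner_Integration.integrable_add integrable_real_indicator) (auto simp: sq_int_def)
  show "(\<lambda>x. indicator A x *\<^sub>R f x) \<in> borel_measurable M"
    using A f by (auto simp: sq_int_def)
  have "norm (f x) \<le> 1 + (norm (f x))\<^sup>2" for x
    using sum_squares_bound[of 1 "norm (f x)"] norm_ge_zero[of "f x"] by (simp del: norm_ge_zero)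
  then show "AE x in M. norm (indicator A x *\<^sub>R f x) \<le> norm (indicator A x + (norm (f x))\<^sup>2)"
    by (intro AE_I2) (simp add: indicator_def)
qed

section \<open>Convolution with compactly supported kernels\<close>

lemma square_div_abs:
  fixes x :: real
  shows "x \<noteq> 0 \<Longrightarrow> x\<^sup>2 / \<bar>x\<bar> = \<bar>x\<bar>"
  by (metis abs_eq_0 nonzero_mult_div_cancel_right power2_abs power2_eq_square)

lemma kernel_integrable:
  fixes v :: "real \<Rightarrow> 'v::{banach, second_countable_topology}"
  assumes loc: "\<And>a b. set_integrable lborel {a..b} v"
    and [measurable]: "g \<in> borel_measurable borel"
    and B: "\<And>x. \<bar>g x\<bar> \<le> B" and supp: "\<And>x. R \<le> \<bar>x\<bar> \<Longrightarrow> g x = 0"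
  shows "integrable lborel (\<lambda>\<tau>. g (t - \<tau>) *\<^sub>R v \<tau>)"
proof -
  have i: "integrable lborel (\<lambda>\<tau>. indicator {t - R..t + R} \<tau> *\<^sub>R v \<tau>)"
    using loc[of "t - R" "t + R"] by (simp add: set_integrable_def)
  have eq: "g (t - \<tau>) *\<^sub>R v \<tau> = g (t - \<tau>) *\<^sub>R (indicator {t - R..t + R} \<tau> *\<^sub>R v \<tau>)" for \<tau>
    by (cases "\<tau> \<in> {t - R..t + R}") (auto intro!: supp)
  have "integrable lborel (\<lambda>\<tau>. g (t - \<tau>) *\<^sub>R (indicator {t - R..t + R} \<tau> *\<^sub>R v \<tau>))"
  proof (rule Bochner_Integration.integrable_bound)
    show "integrable lborel (\<lambda>\<tau>. B * norm (indicator {t - R..t + R} \<tau> *\<^sub>R v \<tau>))"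
      using i by (intro integrable_mult_right integrable_norm)
    show "(\<lambda>\<tau>. g (t - \<tau>) *\<^sub>R (indicator {t - R..t + R} \<tau> *\<^sub>R v \<tau>)) \<in> borel_measurable lborel"
      by (intro borel_measurable_scaleR borel_measurable_integrable[OF i]) measurable
    have "0 \<le> B" using B[of 0] by linarith
    show "AE \<tau> in lborel. norm (g (t - \<tau>) *\<^sub>R (indicator {t - R..t + R} \<tau> *\<^sub>R v \<tau>))
        \<le> norm (B * norm (indicator {t - R..t + R} \<tau> *\<^sub>R v \<tau>))"
    proof (intro AE_I2)
      fix \<tau>
      have "\<bar>g (t - \<tau>)\<bar> * norm (indicator {t - R..t + R} \<tau> *\<^sub>R v \<tau>) \<le> B * norm (indicator {t - R..t + R} \<tau> *\<^sub>R v \<tau>)"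
        by (intro mult_right_mono B) simp
      then show "norm (g (t - \<tau>) *\<^sub>R (indicator {t - R..t + R} \<tau> *\<^sub>R v \<tau>))
        \<le> norm (B * norm (indicator {t - R..t + R} \<tau> *\<^sub>R v \<tau>))"
        using \<open>0 \<le> B\<close> by (simp add: abs_mult)
    qed
  qed
  then show ?thesis unfolding eq[symmetric] .
qed

text \<open>The mean value inequality is used twice, for \<open>k'\<close> and then for
  \<open>k y - y * k' x\<close>. This gives \<open>C\<close> instead of \<open>C / 2\<close>, which
  is sharp enough.\<close>

lemma taylor2_bound:
  fixes k k' k'' :: "real \<Rightarrow> real"
  assumes d: "\<And>x. (k has_real_derivative k' x) (at x)" "\<And>x. (k' has_real_derivative k'' x) (at x)"
    and C: "\<And>x. \<bar>k'' x\<bar> \<le> C"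
  shows "\<bar>k (x + d) - k x - d * k' x\<bar> \<le> C * d\<^sup>2"
proof -
  have C0: "C \<ge> 0" using C[of 0] by linarith
  have lip: "\<bar>k' y - k' x\<bar> \<le> C * \<bar>y - x\<bar>" for y
    using field_differentiable_bound[of UNIV k' k'' C y x] d(2) C
    by (auto simp: has_field_derivative_at_within)
  have "\<bar>(k (x + d) - (x + d) * k' x) - (k x - x * k' x)\<bar> \<le> (C * \<bar>d\<bar>) * \<bar>(x + d) - x\<bar>"
  proof (rule field_differentiable_bound[where S = "closed_segment x (x + d)" and f' = "\<lambda>y. k' y - k' x", unfolded real_norm_def])
    fix y assume y: "y \<in> closed_segment x (x + d)"
    show "((\<lambda>y. k y - y * k' x) has_field_derivative k' y - k' x) (at y within closed_segment x (x + d))"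
      by (rule has_field_derivative_at_within) (auto intro!: derivative_eq_intros d(1))
    have "\<bar>y - x\<bar> \<le> \<bar>d\<bar>" using y by (auto simp: closed_segment_eq_real_ivl split: if_splits)
    then have "C * \<bar>y - x\<bar> \<le> C * \<bar>d\<bar>" using C0 by (intro mult_left_mono)
    with lip[of y] show "\<bar>k' y - k' x\<bar> \<le> C * \<bar>d\<bar>" by linarith
  qed auto
  also have "(C * \<bar>d\<bar>) * \<bar>(x + d) - x\<bar> = C * d\<^sup>2" by (simp add: power2_eq_square mult.assoc)
  also have "(k (x + d) - (x + d) * k' x) - (k x - x * k' x) = k (x + d) - k x - d * k' x"
    by (simp add: algebra_simps)
  finally show ?thesis .
qed

text \<open>The Taylor remainder of the kernel is at most \<open>C (s - t)^2\<close> uniformly in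
  \<tau>, and for \<open>\<bar>s - t\<bar> < 1\<close> all kernels involved live in one fixed window
  on which \<open>v\<close> is integrable. The difference quotient therefore converges at a linear
  rate.\<close>

lemma convolution_has_vector_derivative:
  fixes v :: "real \<Rightarrow> 'v::{banach, second_countable_topology}" and k k' k'' :: "real \<Rightarrow> real"
  assumes loc: "\<And>a b. set_integrable lborel {a..b} v"
    and d: "\<And>x. (k has_real_derivative k' x) (at x)" "\<And>x. (k' has_real_derivative k'' x) (at x)"
    and B: "\<And>x. \<bar>k x\<bar> \<le> B" and B': "\<And>x. \<bar>k' x\<bar> \<le> B'" and C: "\<And>x. \<bar>k'' x\<bar> \<le> C"
    and supp: "\<And>x. R \<le> \<bar>x\<bar> \<Longrightarrow> k x = 0" and supp': "\<And>x. R \<le> \<bar>x\<bar> \<Longrightarrow> k' x = 0"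
  shows "((\<lambda>t. LINT \<tau>|lborel. k (t - \<tau>) *\<^sub>R v \<tau>) has_vector_derivative
    (LINT \<tau>|lborel. k' (t - \<tau>) *\<^sub>R v \<tau>)) (at t)"
proof -
  have meas: "k \<in> borel_measurable borel" "k' \<in> borel_measurable borel"
    using d by (auto intro!: borel_measurable_continuous_onI continuous_at_imp_continuous_on DERIV_isCont)
  note ki = kernel_integrable[OF loc meas(1) B supp]
  note ki' = kernel_integrable[OF loc meas(2) B' supp']
  have C0: "C \<ge> 0" using C[of 0] by linarith
  define K where "K = C * (LINT \<tau>|lborel. norm (indicator {t - \<bar>R\<bar> - 1..t + \<bar>R\<bar> + 1} \<tau> *\<^sub>R v \<tau>))"
  have iv: "integrable lborel (\<lambda>\<tau>. norm (indicator {t - \<bar>R\<bar> - 1..t + \<bar>R\<bar> + 1} \<tau> *\<^sub>R v \<tau>))"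
    using loc[of "t - \<bar>R\<bar> - 1" "t + \<bar>R\<bar> + 1"] by (intro integrable_norm) (simp add: set_integrable_def)
  define F where "F t = (LINT \<tau>|lborel. k (t - \<tau>) *\<^sub>R v \<tau>)" for t
  define G where "G = (LINT \<tau>|lborel. k' (t - \<tau>) *\<^sub>R v \<tau>)"
  have est: "norm (F s - F t - (s - t) *\<^sub>R G) \<le> K * (s - t)\<^sup>2" if s: "\<bar>s - t\<bar> < 1" for s
  proof -
    have "norm (F s - F t - (s - t) *\<^sub>R G)
        = norm (LINT \<tau>|lborel. k (s - \<tau>) *\<^sub>R v \<tau> - k (t - \<tau>) *\<^sub>R v \<tau> - (s - t) *\<^sub>R (k' (t - \<tau>) *\<^sub>R v \<tau>))"
      unfolding F_def G_def
      by (simp only: Bochner_Integration.integral_diff[OF Bochner_Integration.integrable_diff[OF ki ki] integrable_scaleR_right[OF ki']]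
          Bochner_Integration.integral_diff[OF ki ki] integral_scaleR_right)
    also have "\<dots> \<le> (LINT \<tau>|lborel. (C * (s - t)\<^sup>2) * norm (indicator {t - \<bar>R\<bar> - 1..t + \<bar>R\<bar> + 1} \<tau> *\<^sub>R v \<tau>))"
    proof (rule Bochner_Integration.integral_norm_bound_integral)
      show "integrable lborel (\<lambda>\<tau>. k (s - \<tau>) *\<^sub>R v \<tau> - k (t - \<tau>) *\<^sub>R v \<tau> - (s - t) *\<^sub>R (k' (t - \<tau>) *\<^sub>R v \<tau>))"
        by (intro Bochner_Integration.integrable_diff ki ki' integrable_scaleR_right)
      show "integrable lborel (\<lambda>\<tau>. C * (s - t)\<^sup>2 * norm (indicator {t - \<bar>R\<bar> - 1..t + \<bar>R\<bar> + 1} \<tau> *\<^sub>R v \<tau>))"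
        using iv by (rule integrable_mult_right)
      fix \<tau>
      have "k (s - \<tau>) *\<^sub>R v \<tau> - k (t - \<tau>) *\<^sub>R v \<tau> - (s - t) *\<^sub>R (k' (t - \<tau>) *\<^sub>R v \<tau>)
          = (k ((t - \<tau>) + (s - t)) - k (t - \<tau>) - (s - t) * k' (t - \<tau>)) *\<^sub>R v \<tau>"
        by (simp add: scaleR_diff_left)
      then have eq: "norm (k (s - \<tau>) *\<^sub>R v \<tau> - k (t - \<tau>) *\<^sub>R v \<tau> - (s - t) *\<^sub>R (k' (t - \<tau>) *\<^sub>R v \<tau>))
          = \<bar>k ((t - \<tau>) + (s - t)) - k (t - \<tau>) - (s - t) * k' (t - \<tau>)\<bar> * norm (v \<tau>)" by simp
      show "norm (k (s - \<tau>) *\<^sub>R v \<tau> - k (t - \<tau>) *\<^sub>R v \<tau> - (s - t) *\<^sub>R (k' (t - \<tau>) *\<^sub>R v \<tau>))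
          \<le> C * (s - t)\<^sup>2 * norm (indicator {t - \<bar>R\<bar> - 1..t + \<bar>R\<bar> + 1} \<tau> *\<^sub>R v \<tau>)"
      proof (cases "\<tau> \<in> {t - \<bar>R\<bar> - 1..t + \<bar>R\<bar> + 1}")
        case True
        then show ?thesis unfolding eq using taylor2_bound[OF d C, of "t - \<tau>" "s - t"]
          by (simp add: mult_right_mono)
      next
        case False
        then have "R \<le> \<bar>s - \<tau>\<bar>" "R \<le> \<bar>t - \<tau>\<bar>" using s by auto
        then show ?thesis using supp supp' False by simp
      qed
    qed
    also have "\<dots> = K * (s - t)\<^sup>2"
      unfolding K_def by (subst integral_mult_right_zero) (simp only: mult_ac)
    finally show ?thesis .
  qed
  have "(F has_vector_derivative G) (at t)"
    unfolding has_vector_derivative_def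
  proof (rule has_derivativeI_sandwich[where e = 1 and H = "\<lambda>s. K * \<bar>s - t\<bar>"])
    show "bounded_linear (\<lambda>x. x *\<^sub>R G)" by (rule bounded_linear_scaleR_left)
    fix s assume s: "s \<noteq> t" "dist s t < 1"
    then have "norm (F s - F t - (s - t) *\<^sub>R G) / norm (s - t) \<le> K * (s - t)\<^sup>2 / norm (s - t)"
      using est[of s] by (intro divide_right_mono) (auto simp: dist_real_def)
    also have "\<dots> = K * \<bar>s - t\<bar>"
      using square_div_abs[of "s - t"] s(1)
      by (simp only: real_norm_def times_divide_eq_right[symmetric] right_minus_eq not_False_eq_True simp_thms)
    finally show "norm (F s - F t - (s - t) *\<^sub>R G) / norm (s - t) \<le> K * \<bar>s - t\<bar>" .
  next
    show "((\<lambda>s. K * \<bar>s - t\<bar>) \<longlongrightarrow> 0) (at t)" by (auto intro!: tendsto_eq_intros)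
  qed auto
  then show ?thesis unfolding F_def[abs_def] G_def .
qed

text \<open>Jensen's inequality for the square, as nonnegativity of the variance of \<open>y\<close>
  under the probability density \<kappa>. If the right hand side is infinite there is nothing to
  prove.\<close>

lemma weighted_average_square_le:
  fixes y \<kappa> :: "real \<Rightarrow> real"
  assumes \<kappa>: "\<And>x. 0 \<le> \<kappa> x" "integrable lborel \<kappa>" "(LINT x|lborel. \<kappa> x) = 1"
    and i: "integrable lborel (\<lambda>x. \<kappa> x * y x)" and [measurable]: "y \<in> borel_measurable borel"
  shows "ennreal ((LINT x|lborel. \<kappa> x * y x)\<^sup>2) \<le> (\<integral>\<^sup>+x. ennreal (\<kappa> x * (y x)\<^sup>2) \<partial>lborel)"
proof (cases "(\<integral>\<^sup>+x. ennreal (\<kappa> x * (y x)\<^sup>2) \<partial>lborel) < \<infinity>")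
  case True
  have [measurable]: "\<kappa> \<in> borel_measurable borel" using borel_measurable_integrable[OF \<kappa>(2)] by simp
  have i2: "integrable lborel (\<lambda>x. \<kappa> x * (y x)\<^sup>2)"
    using True \<kappa>(1) by (intro integrableI_bounded) (auto simp: abs_mult)
  define m where "m = (LINT x|lborel. \<kappa> x * y x)"
  have "0 \<le> (LINT x|lborel. \<kappa> x * (y x - m)\<^sup>2)"
    using \<kappa>(1) by (intro Bochner_Integration.integral_nonneg) auto
  also have "\<dots> = (LINT x|lborel. \<kappa> x * (y x)\<^sup>2 - (2 * m) * (\<kappa> x * y x) + m\<^sup>2 * \<kappa> x)"
    by (intro Bochner_Integration.integral_cong) (auto simp: power2_eq_square algebra_simps)
  also have "\<dots> = (LINT x|lborel. \<kappa> x * (y x)\<^sup>2) - m\<^sup>2"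
    using i i2 \<kappa> by (simp add: m_def[symmetric] power2_eq_square)
  finally have "m\<^sup>2 \<le> (LINT x|lborel. \<kappa> x * (y x)\<^sup>2)" by simp
  moreover have "(\<integral>\<^sup>+x. ennreal (\<kappa> x * (y x)\<^sup>2) \<partial>lborel) = ennreal (LINT x|lborel. \<kappa> x * (y x)\<^sup>2)"
    using \<kappa>(1) by (intro nn_integral_eq_integral i2) auto
  ultimately show ?thesis by (simp add: m_def ennreal_leI)
next
  case False
  then show ?thesis by (simp add: not_less top_unique)
qed

lemma sq_int_set_integrable:
  fixes v :: "real \<Rightarrow> 'v::{real_inner, banach, second_countable_topology}"
  shows "sq_int lborel v \<Longrightarrow> set_integrable lborel {a..b} v"
  unfolding set_integrable_def by (rule sq_int_integrable_finite) (auto simp: emeasure_lborel_Icc_eq)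

text \<open>After the substitution \<open>\<tau> = t - h \<sigma>\<close> the error is the
  \<kappa>-average of \<open>v (t - h \<sigma>) - v t\<close>. Jensen's inequality and Tonelli's
  theorem bound its square integral by the \<kappa>-average of translation errors, where only shifts
  of size at most \<open>h\<close> occur.\<close>

lemma mollification_L2:
  fixes v :: "real \<Rightarrow> 'v::{real_inner, banach, second_countable_topology}"
  assumes v: "sq_int lborel v"
    and \<kappa>: "\<And>x. 0 \<le> \<kappa> x" "(LINT x|lborel. \<kappa> x) = 1" "\<And>x. 1 \<le> \<bar>x\<bar> \<Longrightarrow> \<kappa> x = 0" "continuous_on UNIV \<kappa>"
    and "\<epsilon> > 0"
  obtains H where "H > 0" "\<And>h. 0 < h \<Longrightarrow> h < H \<Longrightarrow>
    (\<integral>\<^sup>+t. ennreal ((norm ((LINT \<tau>|lborel. (\<kappa> ((t - \<tau>) / h) / h) *\<^sub>R v \<tau>) - v t))\<^sup>2) \<partial>lborel) \<le> ennreal \<epsilon>"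
proof -
  have vm[measurable]: "v \<in> borel_measurable borel" using sq_intD(1)[OF v] by simp
  have \<kappa>m[measurable]: "\<kappa> \<in> borel_measurable borel"
    by (rule borel_measurable_continuous_onI[OF \<kappa>(4)])
  have "bounded (\<kappa> ` {-1..1})"
    by (intro compact_imp_bounded compact_continuous_image continuous_on_subset[OF \<kappa>(4)]) auto
  then obtain B0 where B0: "\<And>x. x \<in> {-1..1} \<Longrightarrow> \<bar>\<kappa> x\<bar> \<le> B0"
    unfolding bounded_iff by (metis imageI real_norm_def)
  have B: "\<bar>\<kappa> x\<bar> \<le> B0" for x
    using B0[of x] B0[of 0] \<kappa>(3)[of x] by (cases "x \<in> {-1..1}") auto
  have \<kappa>i: "integrable lborel \<kappa>"
    using \<kappa>(2) not_integrable_integral_eq by fastforce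
  obtain \<delta> where \<delta>: "\<delta> > 0" "\<And>\<sigma>. \<bar>\<sigma>\<bar> < \<delta> \<Longrightarrow>
      (\<integral>\<^sup>+t. ennreal ((norm (v (t + \<sigma>) - v t))\<^sup>2) \<partial>lborel) \<le> ennreal \<epsilon>"
    using translation_continuous_L2[OF vm] v \<open>\<epsilon> > 0\<close> unfolding translation_continuous_def sq_int_iff_nn by blast
  have "(\<integral>\<^sup>+t. ennreal ((norm ((LINT \<tau>|lborel. (\<kappa> ((t - \<tau>) / h) / h) *\<^sub>R v \<tau>) - v t))\<^sup>2) \<partial>lborel) \<le> ennreal \<epsilon>"
    if h: "0 < h" "h < \<delta>" for h
  proof -
    have sub: "(LINT \<tau>|lborel. (\<kappa> ((t - \<tau>) / h) / h) *\<^sub>R v \<tau>) = (LINT \<sigma>|lborel. \<kappa> \<sigma> *\<^sub>R v (t - h * \<sigma>))" for t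
      using h by (subst lborel_integral_real_affine[where c = "-h" and t = t]) (auto simp flip: integral_scaleR_right)
    have i1: "integrable lborel (\<lambda>\<sigma>. \<kappa> \<sigma> *\<^sub>R v (t - h * \<sigma>))" for t
    proof -
      have "integrable lborel (\<lambda>\<tau>. \<kappa> ((t - \<tau>) / h) *\<^sub>R v \<tau>)"
      proof (rule kernel_integrable[of v "\<lambda>x. \<kappa> (x / h)" B0 h])
        show "\<kappa> (x / h) = 0" if "h \<le> \<bar>x\<bar>" for x
          using h that by (intro \<kappa>(3)) (auto simp: abs_divide)
      qed (use B sq_int_set_integrable[OF v] in auto)
      from lborel_integrable_real_affine[OF this, of "-h" t] show ?thesis using h by simp
    qed
    have i2: "integrable lborel (\<lambda>\<sigma>. \<kappa> \<sigma> *\<^sub>R v t)" for t using \<kappa>i by (rule integrable_scaleR_left)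
    have "ennreal ((norm ((LINT \<tau>|lborel. (\<kappa> ((t - \<tau>) / h) / h) *\<^sub>R v \<tau>) - v t))\<^sup>2)
        \<le> (\<integral>\<^sup>+\<sigma>. ennreal (\<kappa> \<sigma> * (norm (v (t - h * \<sigma>) - v t))\<^sup>2) \<partial>lborel)" for t
    proof -
      have "(LINT \<tau>|lborel. (\<kappa> ((t - \<tau>) / h) / h) *\<^sub>R v \<tau>) - v t
          = (LINT \<sigma>|lborel. \<kappa> \<sigma> *\<^sub>R v (t - h * \<sigma>)) - (LINT \<sigma>|lborel. \<kappa> \<sigma> *\<^sub>R v t)"
        using \<kappa> \<kappa>i unfolding sub by simp
      also have "\<dots> = (LINT \<sigma>|lborel. \<kappa> \<sigma> *\<^sub>R (v (t - h * \<sigma>) - v t))"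
        by (subst Bochner_Integration.integral_diff[symmetric, OF i1 i2]) (simp add: scaleR_diff_right)
      finally have "norm ((LINT \<tau>|lborel. (\<kappa> ((t - \<tau>) / h) / h) *\<^sub>R v \<tau>) - v t)
          \<le> (LINT \<sigma>|lborel. norm (\<kappa> \<sigma> *\<^sub>R (v (t - h * \<sigma>) - v t)))" by (simp del: norm_scaleR)
      also have "\<dots> = (LINT \<sigma>|lborel. \<kappa> \<sigma> * norm (v (t - h * \<sigma>) - v t))"
        using \<kappa>(1) by simp
      finally have "(norm ((LINT \<tau>|lborel. (\<kappa> ((t - \<tau>) / h) / h) *\<^sub>R v \<tau>) - v t))\<^sup>2
          \<le> (LINT \<sigma>|lborel. \<kappa> \<sigma> * norm (v (t - h * \<sigma>) - v t))\<^sup>2" by (intro power_mono) auto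
      then have "ennreal ((norm ((LINT \<tau>|lborel. (\<kappa> ((t - \<tau>) / h) / h) *\<^sub>R v \<tau>) - v t))\<^sup>2)
          \<le> ennreal ((LINT \<sigma>|lborel. \<kappa> \<sigma> * norm (v (t - h * \<sigma>) - v t))\<^sup>2)" by (rule ennreal_leI)
      also have "\<dots> \<le> (\<integral>\<^sup>+\<sigma>. ennreal (\<kappa> \<sigma> * (norm (v (t - h * \<sigma>) - v t))\<^sup>2) \<partial>lborel)"
      proof (rule weighted_average_square_le[OF \<kappa>(1) \<kappa>i \<kappa>(2)])
        have "integrable lborel (\<lambda>\<sigma>. norm (\<kappa> \<sigma> *\<^sub>R v (t - h * \<sigma>) - \<kappa> \<sigma> *\<^sub>R v t))"
          by (intro integrable_norm Bochner_Integration.integrable_diff i1 i2)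
        also have "(\<lambda>\<sigma>. norm (\<kappa> \<sigma> *\<^sub>R v (t - h * \<sigma>) - \<kappa> \<sigma> *\<^sub>R v t)) = (\<lambda>\<sigma>. \<kappa> \<sigma> * norm (v (t - h * \<sigma>) - v t))"
          using \<kappa>(1) by (simp add: fun_eq_iff flip: scaleR_diff_right)
        finally show "integrable lborel (\<lambda>\<sigma>. \<kappa> \<sigma> * norm (v (t - h * \<sigma>) - v t))" .
      qed measurable
      finally show ?thesis .
    qed
    then have "(\<integral>\<^sup>+t. ennreal ((norm ((LINT \<tau>|lborel. (\<kappa> ((t - \<tau>) / h) / h) *\<^sub>R v \<tau>) - v t))\<^sup>2) \<partial>lborel)
        \<le> (\<integral>\<^sup>+t. (\<integral>\<^sup>+\<sigma>. ennreal (\<kappa> \<sigma> * (norm (v (t - h * \<sigma>) - v t))\<^sup>2) \<partial>lborel) \<partial>lborel)"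
      by (intro nn_integral_mono)
    also have "\<dots> = (\<integral>\<^sup>+\<sigma>. (\<integral>\<^sup>+t. ennreal (\<kappa> \<sigma> * (norm (v (t - h * \<sigma>) - v t))\<^sup>2) \<partial>lborel) \<partial>lborel)"
      by (rule lborel_pair.Fubini') measurable
    also have "\<dots> \<le> (\<integral>\<^sup>+\<sigma>. ennreal (\<kappa> \<sigma>) * ennreal \<epsilon> \<partial>lborel)"
    proof (rule nn_integral_mono)
      fix \<sigma> :: real
      have "(\<integral>\<^sup>+t. ennreal (\<kappa> \<sigma> * (norm (v (t - h * \<sigma>) - v t))\<^sup>2) \<partial>lborel)
          = ennreal (\<kappa> \<sigma>) * (\<integral>\<^sup>+t. ennreal ((norm (v (t - h * \<sigma>) - v t))\<^sup>2) \<partial>lborel)"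
        using \<kappa>(1) by (subst nn_integral_cmult[symmetric]) (auto simp: ennreal_mult)
      also have "\<dots> \<le> ennreal (\<kappa> \<sigma>) * ennreal \<epsilon>"
      proof (cases "1 \<le> \<bar>\<sigma>\<bar>")
        case True then show ?thesis using \<kappa>(3) by simp
      next
        case False
        then have "\<bar>h * \<sigma>\<bar> \<le> h" using h by (simp add: abs_mult mult_le_cancel_left1)
        then have "\<bar>- (h * \<sigma>)\<bar> < \<delta>" using h by linarith
        from \<delta>(2)[OF this] show ?thesis by (intro mult_left_mono) auto
      qed
      finally show "(\<integral>\<^sup>+t. ennreal (\<kappa> \<sigma> * (norm (v (t - h * \<sigma>) - v t))\<^sup>2) \<partial>lborel)
          \<le> ennreal (\<kappa> \<sigma>) * ennreal \<epsilon>" .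
    qed
    also have "\<dots> = ennreal \<epsilon>"
      using \<kappa> \<kappa>i by (simp add: nn_integral_multc nn_integral_eq_integral)
    finally show ?thesis .
  qed
  then show ?thesis using that \<delta>(1) by blast
qed

section \<open>The energy equality for weak derivatives\<close>

lemma sq_int_bounded_linear:
  assumes "sq_int M f" "bounded_linear T"
  shows "sq_int M (\<lambda>x. T (f x))"
proof -
  obtain K where K: "\<And>x. norm (T x) \<le> norm x * K" using bounded_linear.bounded[OF assms(2)] by blast
  have [measurable]: "T \<in> borel_measurable borel"
    by (intro borel_measurable_continuous_onI linear_continuous_on assms)
  show ?thesis
  proof (rule sq_int_bound[OF assms(1), where C = K])
    show "(\<lambda>x. T (f x)) \<in> borel_measurable M" using sq_intD(1)[OF assms(1)] by measurable
    show "norm (T (f x)) \<le> K * norm (f x)" for x using K[of "f x"] by (simp add: mult.commute)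
  qed
qed

lemma norm_square_has_real_derivative:
  fixes U :: "real \<Rightarrow> 'h::real_inner"
  assumes "(U has_vector_derivative U') (at t)"
  shows "((\<lambda>t. (norm (U t))\<^sup>2) has_real_derivative 2 * (U' \<bullet> U t)) (at t)"
proof -
  have "((\<lambda>t. U t \<bullet> U t) has_derivative (\<lambda>h. U t \<bullet> (h *\<^sub>R U') + (h *\<^sub>R U') \<bullet> U t)) (at t)"
    using assms unfolding has_vector_derivative_def by (intro has_derivative_inner)
  moreover have "(\<lambda>h. U t \<bullet> (h *\<^sub>R U') + (h *\<^sub>R U') \<bullet> U t) = (*) (2 * (U' \<bullet> U t))"
    by (auto simp: inner_commute)
  ultimately show ?thesis unfolding has_field_derivative_def power2_norm_eq_inner by simp
qed

text \<open>The weak derivative lies in the dual of \<open>'v\<close> and is given by its Riesz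
  representative \<open>r\<close>. Away from the ends of \<open>I\<close> the mollified functions
  satisfy the equation pointwise, hence the energy equality holds for them and for their
  differences. The differences show that the mollifications form a uniform Cauchy sequence on
  compact subintervals; the limit is the continuous representative and inherits the
  equality.\<close>

lemma weak_derivative_energy:
  fixes v r :: "real \<Rightarrow> 'v::{real_inner, banach, second_countable_topology}"
    and e :: "'v \<Rightarrow> 'h::{real_inner, banach, second_countable_topology}"
  assumes e: "bounded_linear e" and v: "sq_int lborel v" and r: "sq_int lborel r"
    and I: "open I" "\<And>a b. a \<in> I \<Longrightarrow> b \<in> I \<Longrightarrow> {a..b} \<subseteq> I"
    and weak: "\<And>\<theta> w. test_fun I \<theta> \<Longrightarrow>
      (LINT t|lborel. deriv \<theta> t * (e (v t) \<bullet> e w)) = - (LINT t|lborel. \<theta> t * (r t \<bullet> w))"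
  obtains u where "continuous_on I u" "AE t in lborel. t \<in> I \<longrightarrow> u t = e (v t)"
    "\<And>t1 t2. t1 \<in> I \<Longrightarrow> t2 \<in> I \<Longrightarrow> t1 \<le> t2 \<Longrightarrow>
      (norm (u t2))\<^sup>2 - (norm (u t1))\<^sup>2 = 2 * (LINT t|lborel. indicator {t1..t2} t * (r t \<bullet> v t))"
proof -
  interpret e: bounded_linear e by fact
  obtain \<kappa> \<kappa>' \<kappa>'' :: "real \<Rightarrow> real" where \<kappa>_pos: "\<And>x. 0 \<le> \<kappa> x"
    and supp0: "\<And>x. 1 \<le> \<bar>x\<bar> \<Longrightarrow> \<kappa> x = 0" and supp1: "\<And>x. 1 \<le> \<bar>x\<bar> \<Longrightarrow> \<kappa>' x = 0"
    and \<kappa>_int: "(LINT x|lborel. \<kappa> x) = 1"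
    and der: "\<And>x. (\<kappa> has_real_derivative \<kappa>' x) (at x)" "\<And>x. (\<kappa>' has_real_derivative \<kappa>'' x) (at x)"
    and cont2: "continuous_on UNIV \<kappa>''" and supp2: "\<And>x. 1 \<le> \<bar>x\<bar> \<Longrightarrow> \<kappa>'' x = 0"
    and test: "\<And>h t I. h > 0 \<Longrightarrow> {t - h..t + h} \<subseteq> I \<Longrightarrow> test_fun I (\<lambda>\<tau>. \<kappa> ((t - \<tau>) / h))"
    by (rule mollifier_exists) (rule that)
  note supp = supp0 supp1 supp2
  have cont: "continuous_on UNIV \<kappa>" "continuous_on UNIV \<kappa>'"
    using der by (auto intro: continuous_at_imp_continuous_on DERIV_isCont)
  have bounded: "\<exists>B. \<forall>x. \<bar>f x\<bar> \<le> B" if f: "continuous_on UNIV f" "\<And>x. 1 \<le> \<bar>x\<bar> \<Longrightarrow> f x = 0" for f :: "real \<Rightarrow> real"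
  proof -
    have "bounded (f ` {-1..1})"
      by (intro compact_imp_bounded compact_continuous_image continuous_on_subset[OF f(1)]) auto
    then obtain B where B: "\<forall>y\<in>f ` {-1..1}. norm y \<le> B"
      unfolding bounded_iff by blast
    have "\<bar>f x\<bar> \<le> max B 0" for x
      using B f(2)[of x] by (cases "x \<in> {-1..1}") (auto simp: le_max_iff_disj)
    then show ?thesis by blast
  qed
  obtain B0 where B0: "\<And>x. \<bar>\<kappa> x\<bar> \<le> B0" using bounded[OF cont(1) supp(1)] by blast
  obtain B1 where B1: "\<And>x. \<bar>\<kappa>' x\<bar> \<le> B1" using bounded[OF cont(2) supp(2)] by blast
  obtain B2 where B2: "\<And>x. \<bar>\<kappa>'' x\<bar> \<le> B2" using bounded[OF cont2 supp(3)] by blast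
  define h where "h m = 1 / real (Suc m)" for m
  have h: "h m > 0" for m by (simp add: h_def)
  have h_lim: "h \<longlonglongrightarrow> 0" unfolding h_def[abs_def] by (rule LIMSEQ_Suc[OF lim_1_over_n])
  define k where "k m x = \<kappa> (x / h m) / h m" for m x
  define k' where "k' m x = \<kappa>' (x / h m) / (h m)\<^sup>2" for m x
  define k'' where "k'' m x = \<kappa>'' (x / h m) / (h m)^3" for m x
  have kd: "(k m has_real_derivative k' m x) (at x)" "(k' m has_real_derivative k'' m x) (at x)" for m x
    using DERIV_cdivide[OF DERIV_chain2[OF der(1) DERIV_cdivide[OF DERIV_ident, of "h m"]], of "h m" x]
      DERIV_cdivide[OF DERIV_chain2[OF der(2) DERIV_cdivide[OF DERIV_ident, of "h m"]], of "(h m)\<^sup>2" x]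
    by (auto simp: k_def[abs_def] k'_def[abs_def] k''_def power2_eq_square power3_eq_cube mult.assoc)
  have kb: "\<bar>k m x\<bar> \<le> B0 / h m" "\<bar>k' m x\<bar> \<le> B1 / (h m)\<^sup>2" "\<bar>k'' m x\<bar> \<le> B2 / (h m)^3" for m x
    using h[of m] B0 B1 B2 by (auto simp: k_def k'_def k''_def abs_divide intro!: divide_right_mono)
  have ks: "k m x = 0" "k' m x = 0" if "h m \<le> \<bar>x\<bar>" for m x
    using h[of m] that supp(1,2)[of "x / h m"] by (auto simp: k_def k'_def abs_divide)
  have km: "k m \<in> borel_measurable borel" "k' m \<in> borel_measurable borel" for m
    using kd[of m] by (auto intro!: borel_measurable_continuous_onI continuous_at_imp_continuous_on DERIV_isCont)
  define M where "M f m t = (LINT \<tau>|lborel. k m (t - \<tau>) *\<^sub>R f \<tau>)" for f :: "real \<Rightarrow> 'v" and m t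
  define V' where "V' m t = (LINT \<tau>|lborel. k' m (t - \<tau>) *\<^sub>R v \<tau>)" for m t
  have M_der: "(M f m has_vector_derivative (LINT \<tau>|lborel. k' m (t - \<tau>) *\<^sub>R f \<tau>)) (at t)"
    if "sq_int lborel f" for f m t
    unfolding M_def[abs_def]
    by (rule convolution_has_vector_derivative[OF sq_int_set_integrable[OF that] kd kb ks])
  have M_cont: "continuous_on UNIV (M f m)" if "sq_int lborel f" for f m
    using M_der[OF that] by (auto intro!: continuous_at_imp_continuous_on has_vector_derivative_continuous)
  have M_lim: "(\<lambda>m. \<integral>\<^sup>+t. ennreal ((norm (M f m t - f t))\<^sup>2) \<partial>lborel) \<longlonglongrightarrow> 0" if f: "sq_int lborel f" for f
  proof (rule order_tendstoI)
    fix a :: ennreal assume "0 < a"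
    then obtain b where b: "0 < b" "b < a" using dense by blast
    then obtain \<epsilon> where "b = ennreal \<epsilon>" by (cases b rule: ennreal_cases) auto
    with b have \<epsilon>: "0 < \<epsilon>" "ennreal \<epsilon> < a" by auto
    obtain H where H: "H > 0" "\<And>h. 0 < h \<Longrightarrow> h < H \<Longrightarrow>
      (\<integral>\<^sup>+t. ennreal ((norm ((LINT \<tau>|lborel. (\<kappa> ((t - \<tau>) / h) / h) *\<^sub>R f \<tau>) - f t))\<^sup>2) \<partial>lborel) \<le> ennreal \<epsilon>"
      using mollification_L2[OF f \<kappa>_pos \<kappa>_int supp(1) cont(1) \<epsilon>(1)] by blast
    have "\<forall>\<^sub>F m in sequentially. h m < H" using order_tendstoD(2)[OF h_lim H(1)] .
    then show "\<forall>\<^sub>F m in sequentially. (\<integral>\<^sup>+t. ennreal ((norm (M f m t - f t))\<^sup>2) \<partial>lborel) < a"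
    proof eventually_elim
      case (elim m)
      from H(2)[OF h elim] show ?case
        unfolding M_def k_def using \<epsilon>(2) by (rule order_le_less_trans)
    qed
  qed simp
  have Mm[measurable]: "M f m \<in> borel_measurable borel" if "sq_int lborel f" for f m
    using M_cont[OF that] by (rule borel_measurable_continuous_onI)
  have "\<forall>\<^sub>F m in sequentially. (\<integral>\<^sup>+t. ennreal ((norm (M v m t - v t))\<^sup>2) \<partial>lborel) < 1
      \<and> (\<integral>\<^sup>+t. ennreal ((norm (M r m t - r t))\<^sup>2) \<partial>lborel) < 1"
    by (intro eventually_conj order_tendstoD(2)[OF M_lim] v r) simp_all
  then obtain N0 where N0: "\<And>m. m \<ge> N0 \<Longrightarrow> (\<integral>\<^sup>+t. ennreal ((norm (M v m t - v t))\<^sup>2) \<partial>lborel) < 1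
      \<and> (\<integral>\<^sup>+t. ennreal ((norm (M r m t - r t))\<^sup>2) \<partial>lborel) < 1"
    unfolding eventually_sequentially by blast
  \<comment> \<open>From index \<open>N0\<close> on, the distance to \<open>v\<close> and
    \<open>r\<close> in the square mean is finite, and this is how the mollified functions are seen
    to be square integrable.\<close>
  define vm where "vm m = M v (m + N0)" for m
  define rm where "rm m = M r (m + N0)" for m
  define dm where "dm m = V' (m + N0)" for m
  define hm where "hm m = h (m + N0)" for m
  have hm: "hm m > 0" for m by (simp add: hm_def h)
  have hm_lim: "hm \<longlonglongrightarrow> 0" unfolding hm_def[abs_def] by (rule LIMSEQ_ignore_initial_segment[OF h_lim])
  have [measurable]: "v \<in> borel_measurable borel" "r \<in> borel_measurable borel"
    using sq_intD(1)[OF v] sq_intD(1)[OF r] by auto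
  have sq_d: "sq_int lborel (\<lambda>t. vm m t - v t)" "sq_int lborel (\<lambda>t. rm m t - r t)" for m
    using N0[of "m + N0"] Mm[OF v] Mm[OF r] unfolding sq_int_iff_nn vm_def rm_def
    by (auto simp: less_trans[OF _ ennreal_one_less_top])
  have sqv: "sq_int lborel (vm m)" for m using sq_int_add[OF sq_d(1)[of m] v] by simp
  have sqr: "sq_int lborel (rm m)" for m using sq_int_add[OF sq_d(2)[of m] r] by simp
  have lim_v: "(\<lambda>m. LINT t|lborel. (norm (vm m t - v t))\<^sup>2) \<longlonglongrightarrow> 0"
  proof (rule tendsto_ennrealD)
    show "(\<lambda>m. ennreal (LINT t|lborel. (norm (vm m t - v t))\<^sup>2)) \<longlonglongrightarrow> ennreal 0"
      using LIMSEQ_ignore_initial_segment[OF M_lim[OF v], of N0]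
      unfolding vm_def[symmetric] sq_int_nn_eq[OF sq_d(1)] by simp
  qed auto
  have lim_r: "(\<lambda>m. LINT t|lborel. (norm (rm m t - r t))\<^sup>2) \<longlonglongrightarrow> 0"
  proof (rule tendsto_ennrealD)
    show "(\<lambda>m. ennreal (LINT t|lborel. (norm (rm m t - r t))\<^sup>2)) \<longlonglongrightarrow> ennreal 0"
      using LIMSEQ_ignore_initial_segment[OF M_lim[OF r], of N0]
      unfolding rm_def[symmetric] sq_int_nn_eq[OF sq_d(2)] by simp
  qed auto
  define U where "U m t = e (vm m t)" for m t
  have U_der: "(U m has_vector_derivative e (dm m t)) (at t)" for m t
    unfolding U_def[abs_def] vm_def dm_def V'_def
    by (rule e.has_vector_derivative[OF M_der[OF v]])
  have cont_m: "continuous_on S (vm m)" "continuous_on S (rm m)" for m S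
    using M_cont[OF v] M_cont[OF r] continuous_on_subset unfolding vm_def rm_def by blast+
  have cont_U: "continuous_on S (U m)" for m S
    unfolding U_def[abs_def] by (intro e.continuous_on cont_m)
  \<comment> \<open>The weak equation is tested with the reflected kernel centred at
    \<open>t\<close>, admissible because its support lies in \<open>I\<close>. The derivative with
    respect to \<tau> turns into \<open>- k'\<close>, so the two sides are the derivative of the
    mollified \<open>v\<close> and the mollified \<open>r\<close>.\<close>
  have key: "e (dm m t) \<bullet> e w = rm m t \<bullet> w" if t: "{t - hm m..t + hm m} \<subseteq> I" for m t w
  proof -
    have iv: "integrable lborel (\<lambda>\<tau>. k' (m + N0) (t - \<tau>) *\<^sub>R v \<tau>)"
      by (rule kernel_integrable[OF sq_int_set_integrable[OF v] km(2) kb(2) ks(2)])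
    have ir: "integrable lborel (\<lambda>\<tau>. k (m + N0) (t - \<tau>) *\<^sub>R r \<tau>)"
      by (rule kernel_integrable[OF sq_int_set_integrable[OF r] km(1) kb(1) ks(1)])
    define \<theta> where "\<theta> = (\<lambda>\<tau>. \<kappa> ((t - \<tau>) / hm m))"
    have \<theta>: "test_fun I \<theta>" unfolding \<theta>_def by (rule test[OF hm t])
    have "(\<theta> has_real_derivative \<kappa>' ((t - \<tau>) / hm m) * (- 1 / hm m)) (at \<tau>)" for \<tau>
      unfolding \<theta>_def
      by (rule DERIV_chain2[OF der(1)]) (auto intro!: derivative_eq_intros simp: less_imp_neq[OF hm, symmetric])
    then have "deriv \<theta> \<tau> = \<kappa>' ((t - \<tau>) / hm m) * (- 1 / hm m)" for \<tau>
      by (rule DERIV_imp_deriv)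
    then have deriv: "deriv \<theta> \<tau> = - hm m * k' (m + N0) (t - \<tau>)" for \<tau>
      using hm[of m] by (simp add: k'_def hm_def[symmetric] power2_eq_square)
    have \<theta>k: "\<theta> \<tau> = hm m * k (m + N0) (t - \<tau>)" for \<tau>
      using hm[of m] by (simp add: \<theta>_def k_def hm_def[symmetric])
    have bl: "bounded_linear (\<lambda>x. e x \<bullet> e w)"
      by (rule bounded_linear_compose[OF bounded_linear_inner_left e])
    have "e (dm m t) \<bullet> e w = (LINT \<tau>|lborel. e (k' (m + N0) (t - \<tau>) *\<^sub>R v \<tau>) \<bullet> e w)"
      unfolding dm_def V'_def by (rule integral_bounded_linear[OF bl iv, symmetric])
    then have 1: "e (dm m t) \<bullet> e w = (LINT \<tau>|lborel. k' (m + N0) (t - \<tau>) * (e (v \<tau>) \<bullet> e w))"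
      by (simp add: e.scaleR)
    have "rm m t \<bullet> w = (LINT \<tau>|lborel. (k (m + N0) (t - \<tau>) *\<^sub>R r \<tau>) \<bullet> w)"
      unfolding rm_def M_def by (rule integral_bounded_linear[OF bounded_linear_inner_left ir, symmetric])
    then have 2: "rm m t \<bullet> w = (LINT \<tau>|lborel. k (m + N0) (t - \<tau>) * (r \<tau> \<bullet> w))" by simp
    have "(LINT \<tau>|lborel. (- hm m) * (k' (m + N0) (t - \<tau>) * (e (v \<tau>) \<bullet> e w)))
        = - (LINT \<tau>|lborel. hm m * (k (m + N0) (t - \<tau>) * (r \<tau> \<bullet> w)))"
      using weak[OF \<theta>, of w] unfolding deriv \<theta>k by (simp only: mult.assoc)
    then have "(- hm m) * (e (dm m t) \<bullet> e w) = - (hm m * (rm m t \<bullet> w))"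
      unfolding 1 2 integral_mult_right_zero .
    then show ?thesis using hm[of m] by simp
  qed
  \<comment> \<open>The parameter \<open>c\<close> serves two purposes: \<open>c = 1\<close> gives
    the Cauchy estimate, \<open>c = 0\<close> the equality for a single mollification.\<close>
  have energy: "(norm (U m t2 - c *\<^sub>R U n t2))\<^sup>2 - (norm (U m t1 - c *\<^sub>R U n t1))\<^sup>2
      = 2 * (LINT t|lborel. indicator {t1..t2} t * ((rm m t - c *\<^sub>R rm n t) \<bullet> (vm m t - c *\<^sub>R vm n t)))"
    if t12: "t1 \<le> t2" and mI: "{t1 - hm m..t2 + hm m} \<subseteq> I" and nI: "{t1 - hm n..t2 + hm n} \<subseteq> I" for m n c t1 t2
  proof -
    have "(LINT t|lborel. indicator {t1..t2} t *\<^sub>R (2 * ((rm m t - c *\<^sub>R rm n t) \<bullet> (vm m t - c *\<^sub>R vm n t))))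
        = (norm (U m t2 - c *\<^sub>R U n t2))\<^sup>2 - (norm (U m t1 - c *\<^sub>R U n t1))\<^sup>2"
    proof (rule integral_FTC_atLeastAtMost[OF t12])
      fix t assume t: "t1 \<le> t" "t \<le> t2"
      then have "{t - hm m..t + hm m} \<subseteq> I" "{t - hm n..t + hm n} \<subseteq> I" using mI nI by auto
      note keys = key[OF this(1)] key[OF this(2)]
      have "((\<lambda>t. U m t - c *\<^sub>R U n t) has_vector_derivative e (dm m t) - c *\<^sub>R e (dm n t)) (at t)"
        by (intro has_vector_derivative_diff bounded_linear.has_vector_derivative[OF bounded_linear_scaleR_right] U_der)
      from norm_square_has_real_derivative[OF this]
      have "((\<lambda>t. (norm (U m t - c *\<^sub>R U n t))\<^sup>2) has_real_derivative
          2 * ((e (dm m t) - c *\<^sub>R e (dm n t)) \<bullet> (U m t - c *\<^sub>R U n t))) (at t)" .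
      also have "(e (dm m t) - c *\<^sub>R e (dm n t)) \<bullet> (U m t - c *\<^sub>R U n t)
          = (e (dm m t) - c *\<^sub>R e (dm n t)) \<bullet> e (vm m t - c *\<^sub>R vm n t)"
        by (simp add: U_def e.diff e.scaleR)
      also have "\<dots> = (rm m t - c *\<^sub>R rm n t) \<bullet> (vm m t - c *\<^sub>R vm n t)"
        unfolding inner_diff_left inner_scaleR_left keys ..
      finally show "((\<lambda>t. (norm (U m t - c *\<^sub>R U n t))\<^sup>2) has_vector_derivative
          2 * ((rm m t - c *\<^sub>R rm n t) \<bullet> (vm m t - c *\<^sub>R vm n t))) (at t within {t1..t2})"
        by (simp add: has_real_derivative_iff_has_vector_derivative has_vector_derivative_at_within)
    next
      show "continuous_on {t1..t2} (\<lambda>t. 2 * ((rm m t - c *\<^sub>R rm n t) \<bullet> (vm m t - c *\<^sub>R vm n t)))"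
        by (intro continuous_intros cont_m)
    qed
    moreover have "(LINT t|lborel. indicator {t1..t2} t *\<^sub>R (2 * ((rm m t - c *\<^sub>R rm n t) \<bullet> (vm m t - c *\<^sub>R vm n t))))
        = 2 * (LINT t|lborel. indicator {t1..t2} t * ((rm m t - c *\<^sub>R rm n t) \<bullet> (vm m t - c *\<^sub>R vm n t)))"
      by (subst integral_mult_right_zero[symmetric]) (simp add: mult.left_commute)
    ultimately show ?thesis by simp
  qed
  have margin: "\<exists>N. \<forall>m\<ge>N. {\<alpha> - hm m..\<beta> + hm m} \<subseteq> I" if ab: "\<alpha> \<in> I" "\<beta> \<in> I" for \<alpha> \<beta>
  proof -
    obtain d1 where d1: "d1 > 0" "ball \<alpha> d1 \<subseteq> I" using openE[OF I(1) ab(1)] by blast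
    obtain d2 where d2: "d2 > 0" "ball \<beta> d2 \<subseteq> I" using openE[OF I(1) ab(2)] by blast
    note d = d1 d2
    have "\<forall>\<^sub>F m in sequentially. hm m < min d1 d2"
      using d by (intro order_tendstoD(2)[OF hm_lim]) auto
    then obtain N where N: "\<And>m. m \<ge> N \<Longrightarrow> hm m < min d1 d2" unfolding eventually_sequentially by blast
    have "{\<alpha> - hm m..\<beta> + hm m} \<subseteq> I" if "m \<ge> N" for m
    proof (rule I(2))
      have "\<alpha> - hm m \<in> ball \<alpha> d1" "\<beta> + hm m \<in> ball \<beta> d2"
        using N[OF that] hm[of m] by (auto simp: dist_real_def)
      then show "\<alpha> - hm m \<in> I" "\<beta> + hm m \<in> I" using d by auto
    qed
    then show ?thesis by blast
  qed
  obtain Ke where Ke: "Ke > 0" "\<And>x. norm (e x) \<le> norm x * Ke" using e.pos_bounded by blast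
  define a where "a m = (LINT t|lborel. (norm (vm m t - v t))\<^sup>2) + (LINT t|lborel. (norm (rm m t - r t))\<^sup>2)" for m
  have a_lim: "a \<longlonglongrightarrow> 0" unfolding a_def[abs_def] using tendsto_add[OF lim_v lim_r] by simp
  define J where "J m n = (LINT t|lborel. (norm (rm m t - rm n t))\<^sup>2 + (norm (vm m t - vm n t))\<^sup>2)" for m n
  have sq_mn: "sq_int lborel (\<lambda>t. rm m t - rm n t)" "sq_int lborel (\<lambda>t. vm m t - vm n t)" for m n
    by (intro sq_int_diff sqr sqv)+
  have iJ: "integrable lborel (\<lambda>t. (norm (rm m t - rm n t))\<^sup>2 + (norm (vm m t - vm n t))\<^sup>2)" for m n
    by (intro Bochner_Integration.integrable_add sq_intD(2) sq_mn)
  have J_le: "J m n \<le> 2 * (a m + a n)" for m n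
  proof -
    have "J m n \<le> (LINT t|lborel. 2 * ((norm (vm m t - v t))\<^sup>2 + (norm (rm m t - r t))\<^sup>2)
        + 2 * ((norm (vm n t - v t))\<^sup>2 + (norm (rm n t - r t))\<^sup>2))"
      unfolding J_def
    proof (rule integral_mono[OF iJ])
      show "integrable lborel (\<lambda>t. 2 * ((norm (vm m t - v t))\<^sup>2 + (norm (rm m t - r t))\<^sup>2)
        + 2 * ((norm (vm n t - v t))\<^sup>2 + (norm (rm n t - r t))\<^sup>2))"
        by (intro Bochner_Integration.integrable_add integrable_mult_right sq_intD(2) sq_d)
      show "(norm (rm m t - rm n t))\<^sup>2 + (norm (vm m t - vm n t))\<^sup>2
        \<le> 2 * ((norm (vm m t - v t))\<^sup>2 + (norm (rm m t - r t))\<^sup>2)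
        + 2 * ((norm (vm n t - v t))\<^sup>2 + (norm (rm n t - r t))\<^sup>2)" for t
        using norm_add_square_le[of "vm m t - v t" "- (vm n t - v t)"]
          norm_add_square_le[of "rm m t - r t" "- (rm n t - r t)"]
        unfolding norm_minus_cancel by (simp add: algebra_simps)
    qed
    also have "\<dots> = 2 * (a m + a n)"
      using sq_intD(2)[OF sq_d(1)] sq_intD(2)[OF sq_d(2)] by (simp add: a_def algebra_simps)
    finally show ?thesis .
  qed
  \<comment> \<open>The value at a point is at most the mean over \<open>{\<alpha>..\<beta>}\<close>
    plus the oscillation. The mean is controlled by the boundedness of \<open>e\<close>, the
    oscillation by the energy equality.\<close>
  have unif_bound: "(norm (U m t - U n t))\<^sup>2 \<le> (Ke\<^sup>2 / (\<beta> - \<alpha>) + 1) * J m n"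
    if ab: "\<alpha> < \<beta>" and t: "t \<in> {\<alpha>..\<beta>}" and mI: "{\<alpha> - hm m..\<beta> + hm m} \<subseteq> I" and nI: "{\<alpha> - hm n..\<beta> + hm n} \<subseteq> I"
    for \<alpha> \<beta> t m n
  proof -
    have osc: "\<bar>(norm (U m t2 - U n t2))\<^sup>2 - (norm (U m t1 - U n t1))\<^sup>2\<bar> \<le> J m n"
      if "\<alpha> \<le> t1" "t1 \<le> t2" "t2 \<le> \<beta>" for t1 t2
    proof -
      have "{t1 - hm m..t2 + hm m} \<subseteq> I" "{t1 - hm n..t2 + hm n} \<subseteq> I" using mI nI that by auto
      from energy[OF \<open>t1 \<le> t2\<close> this, of 1]
      have "\<bar>(norm (U m t2 - U n t2))\<^sup>2 - (norm (U m t1 - U n t1))\<^sup>2\<bar>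
        = \<bar>LINT t|lborel. 2 * (indicator {t1..t2} t * ((rm m t - rm n t) \<bullet> (vm m t - vm n t)))\<bar>" by simp
      also have "\<dots> \<le> J m n"
        unfolding J_def real_norm_def[symmetric]
      proof (rule Bochner_Integration.integral_norm_bound_integral[OF _ iJ])
        show "integrable lborel (\<lambda>t. 2 * (indicator {t1..t2} t * ((rm m t - rm n t) \<bullet> (vm m t - vm n t))))"
          using integrable_mult_indicator[OF _ sq_int_inner[OF sq_mn(1) sq_mn(2)], of "{t1..t2}" m n m n]
          by (intro integrable_mult_right) simp
        fix t
        have "\<bar>2 * ((rm m t - rm n t) \<bullet> (vm m t - vm n t))\<bar> \<le> (norm (rm m t - rm n t))\<^sup>2 + (norm (vm m t - vm n t))\<^sup>2"
          using Cauchy_Schwarz_ineq2[of "rm m t - rm n t" "vm m t - vm n t"]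
            sum_squares_bound[of "norm (rm m t - rm n t)" "norm (vm m t - vm n t)"] by (simp add: abs_mult)
        then show "norm (2 * (indicator {t1..t2} t * ((rm m t - rm n t) \<bullet> (vm m t - vm n t))))
            \<le> (norm (rm m t - rm n t))\<^sup>2 + (norm (vm m t - vm n t))\<^sup>2"
          by (auto simp: indicator_def)
      qed
      finally show ?thesis .
    qed
    have le: "(norm (U m t - U n t))\<^sup>2 \<le> (norm (U m s - U n s))\<^sup>2 + J m n" if "s \<in> {\<alpha>..\<beta>}" for s
      using osc[of s t] osc[of t s] that t by (cases "s \<le> t") auto
    have "(\<beta> - \<alpha>) * (norm (U m t - U n t))\<^sup>2 = (LINT s|lborel. indicator {\<alpha>..\<beta>} s *\<^sub>R (norm (U m t - U n t))\<^sup>2)"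
      using ab by simp
    also have "\<dots> \<le> (LINT s|lborel. Ke\<^sup>2 * (norm (vm m s - vm n s))\<^sup>2 + indicator {\<alpha>..\<beta>} s * J m n)"
    proof (rule integral_mono)
      show "integrable lborel (\<lambda>s. Ke\<^sup>2 * (norm (vm m s - vm n s))\<^sup>2 + indicator {\<alpha>..\<beta>} s * J m n)"
        by (intro Bochner_Integration.integrable_add integrable_mult_right sq_intD(2) sq_mn integrable_mult_left
            integrable_real_indicator) (auto simp: emeasure_lborel_Icc_eq)
      fix s
      have "norm (U m s - U n s) \<le> Ke * norm (vm m s - vm n s)"
        using Ke(2)[of "vm m s - vm n s"] by (simp add: U_def e.diff mult.commute)
      then have "(norm (U m s - U n s))\<^sup>2 \<le> Ke\<^sup>2 * (norm (vm m s - vm n s))\<^sup>2"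
        by (metis norm_ge_zero power_mono power_mult_distrib)
      then show "indicator {\<alpha>..\<beta>} s *\<^sub>R (norm (U m t - U n t))\<^sup>2
          \<le> Ke\<^sup>2 * (norm (vm m s - vm n s))\<^sup>2 + indicator {\<alpha>..\<beta>} s * J m n"
        using le[of s] by (auto simp: indicator_def)
    qed (auto simp: emeasure_lborel_Icc_eq)
    also have "\<dots> = Ke\<^sup>2 * (LINT s|lborel. (norm (vm m s - vm n s))\<^sup>2) + (\<beta> - \<alpha>) * J m n"
      using ab sq_intD(2)[OF sq_mn(2)[of m n]]
      by (subst Bochner_Integration.integral_add) (auto simp: emeasure_lborel_Icc_eq)
    also have "\<dots> \<le> Ke\<^sup>2 * J m n + (\<beta> - \<alpha>) * J m n"
    proof -
      have "(LINT s|lborel. (norm (vm m s - vm n s))\<^sup>2) \<le> J m n"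
        unfolding J_def by (intro integral_mono iJ sq_intD(2) sq_mn) auto
      then show ?thesis by (simp add: mult_left_mono)
    qed
    also have "\<dots> = (\<beta> - \<alpha>) * ((Ke\<^sup>2 / (\<beta> - \<alpha>) + 1) * J m n)"
      using ab by (simp add: distrib_left distrib_right)
    finally have "(\<beta> - \<alpha>) * (norm (U m t - U n t))\<^sup>2 \<le> (\<beta> - \<alpha>) * ((Ke\<^sup>2 / (\<beta> - \<alpha>) + 1) * J m n)" .
    then show ?thesis using ab by simp
  qed
  define u where "u t = lim (\<lambda>m. U m t)" for t
  have unif: "uniform_limit {\<alpha>..\<beta>} U u sequentially" if ab: "\<alpha> \<in> I" "\<beta> \<in> I" "\<alpha> < \<beta>" for \<alpha> \<beta>
  proof -
    obtain N1 where N1: "\<And>m. m \<ge> N1 \<Longrightarrow> {\<alpha> - hm m..\<beta> + hm m} \<subseteq> I" using margin[OF ab(1,2)] by blast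
    define C where "C = Ke\<^sup>2 / (\<beta> - \<alpha>) + 1"
    have C: "C > 0" using ab Ke by (auto simp: C_def intro!: add_nonneg_pos)
    have "uniformly_Cauchy_on {\<alpha>..\<beta>} U"
      unfolding uniformly_Cauchy_on_def
    proof (intro allI impI)
      fix \<epsilon> :: real assume "\<epsilon> > 0"
      then have "\<epsilon>\<^sup>2 / (4 * C) > 0" using C by simp
      from order_tendstoD(2)[OF a_lim this] obtain N2 where N2: "\<And>m. m \<ge> N2 \<Longrightarrow> a m < \<epsilon>\<^sup>2 / (4 * C)"
        unfolding eventually_sequentially by blast
      have "dist (U m x) (U n x) < \<epsilon>" if "x \<in> {\<alpha>..\<beta>}" "m \<ge> max N1 N2" "n \<ge> max N1 N2" for x m n
      proof -
        have "(norm (U m x - U n x))\<^sup>2 \<le> C * J m n"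
          unfolding C_def using that by (intro unif_bound ab N1) auto
        also have "\<dots> \<le> C * (2 * (a m + a n))" using C by (intro mult_left_mono J_le) auto
        also have "\<dots> < C * (2 * (\<epsilon>\<^sup>2 / (4 * C) + \<epsilon>\<^sup>2 / (4 * C)))"
          using C that by (intro mult_strict_left_mono add_strict_mono N2) auto
        also have "\<dots> = \<epsilon>\<^sup>2" using C by simp
        finally show ?thesis unfolding dist_norm
          by (rule power2_less_imp_less) (use \<open>\<epsilon> > 0\<close> in simp)
      qed
      then show "\<exists>M. \<forall>x\<in>{\<alpha>..\<beta>}. \<forall>m\<ge>M. \<forall>n\<ge>M. dist (U m x) (U n x) < \<epsilon>" by blast
    qed
    then have "uniformly_convergent_on {\<alpha>..\<beta>} U" by (rule Cauchy_uniformly_convergent)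
    then show ?thesis unfolding uniformly_convergent_uniform_limit_iff u_def .
  qed
  have pt_lim: "(\<lambda>m. U m t) \<longlonglongrightarrow> u t" if "t \<in> I" for t
  proof -
    obtain d where d: "d > 0" "ball t d \<subseteq> I" using openE[OF I(1) \<open>t \<in> I\<close>] by blast
    then have "t - d/2 \<in> I" "t + d/2 \<in> I" by (auto simp: subset_iff dist_real_def)
    from tendsto_uniform_limitI[OF unif[OF this], of t] d show ?thesis by simp
  qed
  show ?thesis
  proof (rule that[of u])
    show "continuous_on I u"
    proof (rule continuous_at_imp_continuous_on, rule ballI)
      fix t assume "t \<in> I"
      then obtain d where d: "d > 0" "ball t d \<subseteq> I" using openE[OF I(1)] by blast
      then have "t - d/2 \<in> I" "t + d/2 \<in> I" by (auto simp: subset_iff dist_real_def)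
      from unif[OF this] d(1) have "uniform_limit {t - d/2..t + d/2} U u sequentially" by simp
      then have "continuous_on {t - d/2..t + d/2} u"
        by (rule uniform_limit_theorem[rotated]) (auto intro: cont_U always_eventually)
      then have "continuous_on {t - d/2<..<t + d/2} u" by (rule continuous_on_subset) auto
      then show "isCont u t" using d(1) by (auto simp: continuous_on_eq_continuous_at)
    qed
    have ind: "indicator {t1..t2} t * (x \<bullet> y) = (indicator {t1..t2} t *\<^sub>R x) \<bullet> y" for t1 t2 t :: real and x y :: 'v
      by simp
    show "(norm (u t2))\<^sup>2 - (norm (u t1))\<^sup>2 = 2 * (LINT t|lborel. indicator {t1..t2} t * (r t \<bullet> v t))"
      if t: "t1 \<in> I" "t2 \<in> I" "t1 \<le> t2" for t1 t2
    proof (rule LIMSEQ_unique)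
      show "(\<lambda>m. (norm (U m t2))\<^sup>2 - (norm (U m t1))\<^sup>2) \<longlonglongrightarrow> (norm (u t2))\<^sup>2 - (norm (u t1))\<^sup>2"
        by (intro tendsto_intros pt_lim t)
      have "(\<lambda>m. LINT t|lborel. (indicator {t1..t2} t *\<^sub>R rm m t) \<bullet> vm m t)
          \<longlonglongrightarrow> (LINT t|lborel. (indicator {t1..t2} t *\<^sub>R r t) \<bullet> v t)"
      proof (rule sq_int_inner_tendsto)
        show "(\<lambda>m. LINT t|lborel. (norm (indicator {t1..t2} t *\<^sub>R rm m t - indicator {t1..t2} t *\<^sub>R r t))\<^sup>2) \<longlonglongrightarrow> 0"
        proof (rule tendsto_sandwich[OF _ _ tendsto_const lim_r])
          show "\<forall>\<^sub>F m in sequentially. (LINT t|lborel. (norm (indicator {t1..t2} t *\<^sub>R rm m t - indicator {t1..t2} t *\<^sub>R r t))\<^sup>2)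
              \<le> (LINT t|lborel. (norm (rm m t - r t))\<^sup>2)"
          proof (intro always_eventually allI integral_mono sq_intD(2) sq_d)
            fix m
            show "sq_int lborel (\<lambda>t. indicator {t1..t2} t *\<^sub>R rm m t - indicator {t1..t2} t *\<^sub>R r t)"
              by (intro sq_int_diff sq_int_indicator sqr r) auto
          qed (auto simp: indicator_def)
        qed auto
      qed (auto intro!: sq_int_indicator sqr sqv r v lim_v)
      then have lim: "(\<lambda>m. 2 * (LINT t|lborel. indicator {t1..t2} t * (rm m t \<bullet> vm m t)))
          \<longlonglongrightarrow> 2 * (LINT t|lborel. indicator {t1..t2} t * (r t \<bullet> v t))"
        unfolding ind by (intro tendsto_mult_left)
      obtain N where N: "\<And>m. m \<ge> N \<Longrightarrow> {t1 - hm m..t2 + hm m} \<subseteq> I" using margin[OF t(1,2)] by blast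
      have "\<forall>\<^sub>F m in sequentially. 2 * (LINT t|lborel. indicator {t1..t2} t * (rm m t \<bullet> vm m t))
          = (norm (U m t2))\<^sup>2 - (norm (U m t1))\<^sup>2"
        using eventually_ge_at_top[of N]
      proof eventually_elim
        case (elim m)
        from energy[OF t(3) N[OF elim] N[OF elim], of 0] show ?case by simp
      qed
      then show "(\<lambda>m. (norm (U m t2))\<^sup>2 - (norm (U m t1))\<^sup>2)
          \<longlonglongrightarrow> 2 * (LINT t|lborel. indicator {t1..t2} t * (r t \<bullet> v t))"
        by (rule Lim_transform_eventually[OF lim])
    qed
    have u_meas: "(\<lambda>t. indicator I t *\<^sub>R u t) \<in> borel_measurable borel"
    proof (rule borel_measurable_LIMSEQ_metric)
      show "(\<lambda>t. indicator I t *\<^sub>R U m t) \<in> borel_measurable borel" for m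
        using I(1) by (intro borel_measurable_scaleR borel_measurable_indicator borel_open
            borel_measurable_continuous_onI cont_U)
      show "(\<lambda>m. indicator I t *\<^sub>R U m t) \<longlonglongrightarrow> indicator I t *\<^sub>R u t" for t
        using pt_lim[of t] by (cases "t \<in> I") auto
    qed
    have [measurable]: "e \<in> borel_measurable borel"
      by (intro borel_measurable_continuous_onI linear_continuous_on e)
    have [measurable]: "I \<in> sets borel" using I(1) by simp
    \<comment> \<open>Fatou's lemma identifies the pointwise limit with \<open>e (v t)\<close>: the
      square mean distance of \<open>U m\<close> to it tends to zero.\<close>
    have "(\<integral>\<^sup>+t. ennreal ((norm (indicator I t *\<^sub>R (u t - e (v t))))\<^sup>2) \<partial>lborel)
        = (\<integral>\<^sup>+t. liminf (\<lambda>m. ennreal ((norm (indicator I t *\<^sub>R (U m t - e (v t))))\<^sup>2)) \<partial>lborel)"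
    proof (intro nn_integral_cong)
      fix t
      have "(\<lambda>m. indicator I t *\<^sub>R (U m t - e (v t))) \<longlonglongrightarrow> indicator I t *\<^sub>R (u t - e (v t))"
        using pt_lim[of t] by (cases "t \<in> I") (auto intro!: tendsto_intros)
      then have "(\<lambda>m. ennreal ((norm (indicator I t *\<^sub>R (U m t - e (v t))))\<^sup>2))
          \<longlonglongrightarrow> ennreal ((norm (indicator I t *\<^sub>R (u t - e (v t))))\<^sup>2)"
        by (intro tendsto_ennrealI tendsto_power tendsto_norm)
      then show "ennreal ((norm (indicator I t *\<^sub>R (u t - e (v t))))\<^sup>2)
          = liminf (\<lambda>m. ennreal ((norm (indicator I t *\<^sub>R (U m t - e (v t))))\<^sup>2))"
        by (rule lim_imp_Liminf[OF sequentially_bot, symmetric])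
    qed
    also have "\<dots> \<le> liminf (\<lambda>m. \<integral>\<^sup>+t. ennreal ((norm (indicator I t *\<^sub>R (U m t - e (v t))))\<^sup>2) \<partial>lborel)"
    proof (rule nn_integral_liminf)
      have [measurable]: "U m \<in> borel_measurable borel" for m
        by (rule borel_measurable_continuous_onI[OF cont_U])
      show "(\<lambda>t. ennreal ((norm (indicator I t *\<^sub>R (U m t - e (v t))))\<^sup>2)) \<in> borel_measurable lborel" for m
        by measurable
    qed
    also have "\<dots> \<le> liminf (\<lambda>m. ennreal (Ke\<^sup>2 * (LINT t|lborel. (norm (vm m t - v t))\<^sup>2)))"
    proof (intro Liminf_mono always_eventually allI)
      fix m
      have "(\<integral>\<^sup>+t. ennreal ((norm (indicator I t *\<^sub>R (U m t - e (v t))))\<^sup>2) \<partial>lborel)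
          \<le> (\<integral>\<^sup>+t. ennreal (Ke\<^sup>2 * (norm (vm m t - v t))\<^sup>2) \<partial>lborel)"
      proof (intro nn_integral_mono ennreal_leI)
        fix t
        have "norm (U m t - e (v t)) \<le> Ke * norm (vm m t - v t)"
          using Ke(2)[of "vm m t - v t"] by (simp add: U_def e.diff mult.commute)
        then have "(norm (U m t - e (v t)))\<^sup>2 \<le> Ke\<^sup>2 * (norm (vm m t - v t))\<^sup>2"
          by (metis norm_ge_zero power_mono power_mult_distrib)
        then show "(norm (indicator I t *\<^sub>R (U m t - e (v t))))\<^sup>2 \<le> Ke\<^sup>2 * (norm (vm m t - v t))\<^sup>2"
          by (auto simp: indicator_def)
      qed
      also have "\<dots> = ennreal (Ke\<^sup>2 * (LINT t|lborel. (norm (vm m t - v t))\<^sup>2))"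
        using sq_intD(2)[OF sq_d(1)[of m]] by (subst nn_integral_eq_integral) auto
      finally show "(\<integral>\<^sup>+t. ennreal ((norm (indicator I t *\<^sub>R (U m t - e (v t))))\<^sup>2) \<partial>lborel)
          \<le> ennreal (Ke\<^sup>2 * (LINT t|lborel. (norm (vm m t - v t))\<^sup>2))" .
    qed
    also have "\<dots> = 0"
    proof (rule lim_imp_Liminf[OF sequentially_bot])
      have "(\<lambda>m. ennreal (Ke\<^sup>2 * (LINT t|lborel. (norm (vm m t - v t))\<^sup>2))) \<longlonglongrightarrow> ennreal (Ke\<^sup>2 * 0)"
        by (intro tendsto_ennrealI tendsto_mult_left lim_v)
      then show "(\<lambda>m. ennreal (Ke\<^sup>2 * (LINT t|lborel. (norm (vm m t - v t))\<^sup>2))) \<longlonglongrightarrow> 0" by simp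
    qed
    finally have "(\<integral>\<^sup>+t. ennreal ((norm (indicator I t *\<^sub>R (u t - e (v t))))\<^sup>2) \<partial>lborel) = 0" by simp
    moreover have "(\<lambda>t. ennreal ((norm (indicator I t *\<^sub>R (u t - e (v t))))\<^sup>2)) \<in> borel_measurable lborel"
    proof -
      have "(\<lambda>t. indicator I t *\<^sub>R u t - indicator I t *\<^sub>R e (v t)) \<in> borel_measurable borel"
        using u_meas by measurable
      then show ?thesis by (simp add: scaleR_diff_right)
    qed
    ultimately have "AE t in lborel. ennreal ((norm (indicator I t *\<^sub>R (u t - e (v t))))\<^sup>2) = 0"
      by (subst (asm) nn_integral_0_iff_AE)
    then show "AE t in lborel. t \<in> I \<longrightarrow> u t = e (v t)"
      by eventually_elim auto
  qed
qed

section \<open>Lions' existence theorem\<close>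

text \<open>A Caratheodory function composed with a measurable function. For a simple function the
  composition is a finite sum over its level sets; continuity in the second argument passes to the
  limit.\<close>

lemma caratheodory_measurable:
  fixes b :: "'a \<Rightarrow> 'v::{metric_space, second_countable_topology} \<Rightarrow> real"
  assumes b: "\<And>y. (\<lambda>x. b x y) \<in> borel_measurable M"
    and cont: "\<And>x. x \<in> space M \<Longrightarrow> continuous_on UNIV (b x)"
    and \<phi>: "\<phi> \<in> borel_measurable M"
  shows "(\<lambda>x. b x (\<phi> x)) \<in> borel_measurable M"
proof -
  obtain s where s: "\<And>i. simple_function M (s i)" "\<And>x. x \<in> space M \<Longrightarrow> (\<lambda>i. s i x) \<longlonglongrightarrow> \<phi> x"
    using borel_measurable_implies_sequence_metric[OF \<phi>, of undefined] by blast
  show ?thesis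
  proof (rule borel_measurable_LIMSEQ_metric)
    fix i
    have fin: "finite (s i ` space M)" using s(1) by (rule simple_functionD)
    have lvl: "s i -` {y} \<inter> space M \<in> sets M" for y using s(1) by (rule simple_functionD)
    have "(\<lambda>x. \<Sum>y\<in>s i ` space M. indicator (s i -` {y} \<inter> space M) x * b x y) \<in> borel_measurable M"
      using lvl b by (intro borel_measurable_sum borel_measurable_times borel_measurable_indicator)
    moreover have "(\<Sum>y\<in>s i ` space M. indicator (s i -` {y} \<inter> space M) x * b x y) = b x (s i x)"
      if "x \<in> space M" for x
    proof -
      have "(\<Sum>y\<in>s i ` space M. indicator (s i -` {y} \<inter> space M) x * b x y)
          = (\<Sum>y\<in>s i ` space M. if s i x = y then b x y else 0)"
        using that by (intro sum.cong) (auto simp: indicator_def)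
      then show ?thesis using fin that by simp
    qed
    ultimately show "(\<lambda>x. b x (s i x)) \<in> borel_measurable M"
      by (subst measurable_cong[symmetric]) auto
  next
    fix x assume x: "x \<in> space M"
    show "(\<lambda>i. b x (s i x)) \<longlonglongrightarrow> b x (\<phi> x)"
      by (rule continuous_on_tendsto_compose[OF cont[OF x] s(2)[OF x]]) auto
  qed
qed

text \<open>The simplest cut-off with one continuous derivative. It supplies the test functions that
  concentrate at the initial time and the smooth truncation of level sets.\<close>

lemma max_zero_square_deriv:
  "((\<lambda>y::real. (max 0 y)\<^sup>2) has_real_derivative 2 * max 0 y) (at y)"
proof -
  have "((\<lambda>y::real. (max 0 y)\<^sup>2) has_derivative (\<lambda>h. 2 * max 0 y * h)) (at y)"
  proof (rule has_derivativeI_sandwich[where e = 1 and H = "\<lambda>z. \<bar>z - y\<bar>"])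
    fix z :: real assume z: "z \<noteq> y"
    have "\<bar>(max 0 z)\<^sup>2 - (max 0 y)\<^sup>2 - 2 * max 0 y * (z - y)\<bar> \<le> (z - y)\<^sup>2"
    proof -
      consider "z \<ge> 0 \<and> y \<ge> 0" | "z \<ge> 0 \<and> y < 0" | "z < 0 \<and> y \<ge> 0" | "z < 0 \<and> y < 0" by linarith
      then show ?thesis
      proof cases
        case 1
        moreover have "z\<^sup>2 - y\<^sup>2 - 2 * y * (z - y) = (z - y)\<^sup>2" by (simp add: power2_eq_square algebra_simps)
        ultimately show ?thesis by simp
      next
        case 2
        then have "z\<^sup>2 \<le> (z - y)\<^sup>2" by (intro power_mono) auto
        then show ?thesis using 2 by simp
      next
        case 3
        then have "0 \<le> y * (y - 2 * z)" by (intro mult_nonneg_nonneg) auto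
        moreover have "(z - y)\<^sup>2 = z\<^sup>2 + y * (y - 2 * z)" by (simp add: power2_eq_square algebra_simps)
        moreover have "- y\<^sup>2 - 2 * y * (z - y) = y * (y - 2 * z)" by (simp add: power2_eq_square algebra_simps)
        ultimately show ?thesis using 3 zero_le_power2[of z] by (simp add: max_def)
      qed simp
    qed
    then have "norm ((max 0 z)\<^sup>2 - (max 0 y)\<^sup>2 - 2 * max 0 y * (z - y)) / norm (z - y) \<le> (z - y)\<^sup>2 / \<bar>z - y\<bar>"
      unfolding real_norm_def by (intro divide_right_mono) auto
    also have "\<dots> = \<bar>z - y\<bar>" by (rule square_div_abs) (use z in simp)
    finally show "norm ((max 0 z)\<^sup>2 - (max 0 y)\<^sup>2 - 2 * max 0 y * (z - y)) / norm (z - y) \<le> \<bar>z - y\<bar>" .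
  next
    show "((\<lambda>z. \<bar>z - y\<bar>) \<longlongrightarrow> 0) (at y)" by (auto intro!: tendsto_eq_intros)
  qed (auto intro: bounded_linear_mult_right)
  then show ?thesis unfolding has_field_derivative_def .
qed

lemma riesz_ex:
  fixes L :: "'v::{real_inner, complete_space} \<Rightarrow> real"
  assumes "bounded_linear L"
  shows "\<exists>y. \<forall>w. L w = y \<bullet> w"
  using riesz_representation[OF assms] by metis

lemma norm_le_of_inner_le:
  fixes y :: "'a::real_inner"
  assumes "y \<bullet> y \<le> C * norm y"
  shows "norm y \<le> max C 0"
proof (cases "y = 0")
  case False
  have "norm y * norm y \<le> C * norm y" using assms by (simp add: power2_norm_eq_inner[symmetric] power2_eq_square)
  then have "norm y \<le> C" using False by simp
  then show ?thesis by simp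
qed simp

lemma eq_of_inner_eq: "(\<And>w. x \<bullet> w = y \<bullet> w) \<Longrightarrow> x = (y::'a::real_inner)"
  by (metis inner_diff_left inner_eq_zero_iff right_minus_eq)

text \<open>The abstract variational setting: \<open>'v\<close> stands for the energy space,
  \<open>'h\<close> for the pivot space and \<open>e\<close> for the dense embedding. The bounds are
  uniform in \<open>t\<close>, and the dependence on \<open>t\<close> is only measurable.\<close>

locale coercive_family =
  fixes e :: "'v::{real_inner, banach, second_countable_topology} \<Rightarrow> 'h::{real_inner, banach, second_countable_topology}"
    and B :: "real \<Rightarrow> 'v \<Rightarrow> 'v \<Rightarrow> real" and M c :: real
  assumes e: "bounded_linear e" and dense: "closure (range e) = UNIV"
    and add_left: "B t (u + u') w = B t u w + B t u' w"
    and scale_left: "B t (x *\<^sub>R u) w = x * B t u w"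
    and add_right: "B t u (w + w') = B t u w + B t u w'"
    and scale_right: "B t u (x *\<^sub>R w) = x * B t u w"
    and bound: "\<bar>B t u w\<bar> \<le> M * norm u * norm w"
    and coercive: "c * (norm u)\<^sup>2 \<le> B t u u" and c: "c > 0"
    and meas: "(\<lambda>t. B t u w) \<in> borel_measurable borel"
begin

sublocale e: bounded_linear e by (rule e)

lemma bilinear: "bounded_bilinear (B t)"
proof
  show "\<exists>K. \<forall>a b. norm (B t a b) \<le> norm a * norm b * K"
    using bound[of t] by (intro exI[of _ M]) (simp add: mult_ac)
qed (simp_all add: add_left add_right scale_left scale_right)

sublocale B: bounded_bilinear "B t" for t by (rule bilinear)

lemma ex_adj: "\<exists>y. \<forall>u. B t u \<phi> = y \<bullet> u"
  by (rule riesz_ex[OF B.bounded_linear_left])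

lemma ex_op: "\<exists>y. \<forall>w. B t u w = y \<bullet> w"
  by (rule riesz_ex[OF B.bounded_linear_right])

lemma ex_S: "\<exists>y. \<forall>w. e x \<bullet> e w = y \<bullet> w"
  by (rule riesz_ex) (rule bounded_linear_compose[OF bounded_linear_inner_right e])

text \<open>The dual of \<open>'v\<close> is identified with \<open>'v\<close> by Riesz
  representation. \<open>op t\<close> is the operator of the form, \<open>adj t\<close> its adjoint,
  and \<open>S\<close> is \<open>e\<close> followed by its adjoint, through which the time
  derivative acts.\<close>

definition adj where "adj t \<phi> = (SOME y. \<forall>u. B t u \<phi> = y \<bullet> u)"
definition op where "op t u = (SOME y. \<forall>w. B t u w = y \<bullet> w)"
definition S where "S x = (SOME y. \<forall>w. e x \<bullet> e w = y \<bullet> w)"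

lemma adj: "adj t \<phi> \<bullet> u = B t u \<phi>"
  unfolding adj_def by (rule someI_ex[OF ex_adj, THEN spec, symmetric])
lemma op: "op t u \<bullet> w = B t u w"
  unfolding op_def by (rule someI_ex[OF ex_op, THEN spec, symmetric])
lemma S: "S x \<bullet> w = e x \<bullet> e w"
  unfolding S_def by (rule someI_ex[OF ex_S, THEN spec, symmetric])

lemma norm_adj: "norm (adj t \<phi>) \<le> \<bar>M\<bar> * norm \<phi>"
proof -
  have "adj t \<phi> \<bullet> adj t \<phi> \<le> (\<bar>M\<bar> * norm \<phi>) * norm (adj t \<phi>)"
    unfolding adj using bound[of t "adj t \<phi>" \<phi>]
      mult_right_mono[OF abs_ge_self[of M], of "norm (adj t \<phi>) * norm \<phi>"] by (simp add: mult_ac)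
  from norm_le_of_inner_le[OF this] show ?thesis by simp
qed

lemma norm_op: "norm (op t u) \<le> \<bar>M\<bar> * norm u"
proof -
  have "op t u \<bullet> op t u \<le> (\<bar>M\<bar> * norm u) * norm (op t u)"
    unfolding op using bound[of t u "op t u"]
      mult_right_mono[OF abs_ge_self[of M], of "norm (op t u) * norm u"] by (simp add: mult_ac)
  from norm_le_of_inner_le[OF this] show ?thesis by simp
qed

lemma adj_add: "adj t (\<phi> + \<psi>) = adj t \<phi> + adj t \<psi>"
  by (rule eq_of_inner_eq) (simp add: adj inner_add_left add_right)
lemma adj_scale: "adj t (x *\<^sub>R \<phi>) = x *\<^sub>R adj t \<phi>"
  by (rule eq_of_inner_eq) (simp add: adj scale_right)
lemma S_add: "S (\<phi> + \<psi>) = S \<phi> + S \<psi>"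
  by (rule eq_of_inner_eq) (simp add: S inner_add_left e.add)
lemma S_scale: "S (x *\<^sub>R \<phi>) = x *\<^sub>R S \<phi>"
  by (rule eq_of_inner_eq) (simp add: S e.scaleR)

lemma norm_S: "\<exists>K. \<forall>x. norm (S x) \<le> K * norm x"
proof -
  obtain K where K: "K > 0" "\<And>x. norm (e x) \<le> norm x * K" using e.pos_bounded by blast
  have "norm (S x) \<le> K * K * norm x" for x
  proof -
    have "S x \<bullet> S x \<le> norm (e x) * norm (e (S x))" unfolding S by (rule norm_cauchy_schwarz)
    also have "\<dots> \<le> (norm x * K) * (norm (S x) * K)" using K by (intro mult_mono K) auto
    finally have "S x \<bullet> S x \<le> (K * K * norm x) * norm (S x)" by (simp add: mult_ac)
    from norm_le_of_inner_le[OF this] show ?thesis using K by simp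
  qed
  then show ?thesis by blast
qed

lemma B_continuous: "continuous_on UNIV (B t u)" "continuous_on UNIV (\<lambda>u. B t u w)"
  using linear_continuous_on[OF B.bounded_linear_right] linear_continuous_on[OF B.bounded_linear_left] by blast+

lemma adj_measurable:
  assumes "\<phi> \<in> borel_measurable borel"
  shows "(\<lambda>t. adj t (\<phi> t)) \<in> borel_measurable borel"
proof (rule borel_measurable_weak)
  show "(\<lambda>t. adj t (\<phi> t) \<bullet> w) \<in> borel_measurable borel" for w
    unfolding adj by (rule caratheodory_measurable[OF meas B_continuous(1) assms])
qed

lemma op_measurable:
  assumes "\<phi> \<in> borel_measurable borel"
  shows "(\<lambda>t. op t (\<phi> t)) \<in> borel_measurable borel"
proof (rule borel_measurable_weak)
  show "(\<lambda>t. op t (\<phi> t) \<bullet> w) \<in> borel_measurable borel" for w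
    unfolding op by (rule caratheodory_measurable[OF meas B_continuous(2) assms])
qed

lemma S_measurable:
  assumes [measurable]: "\<phi> \<in> borel_measurable borel"
  shows "(\<lambda>t. S (\<phi> t)) \<in> borel_measurable borel"
proof (rule borel_measurable_weak)
  have [measurable]: "e \<in> borel_measurable borel"
    by (intro borel_measurable_continuous_onI linear_continuous_on e)
  show "(\<lambda>t. S (\<phi> t) \<bullet> w) \<in> borel_measurable borel" for w
    unfolding S by measurable
qed

section \<open>Lions' projection argument\<close>

text \<open>There is no condition at the initial time: the boundary term at \<open>s\<close> is what
  encodes the initial value. Vanishing for large times removes the boundary term at
  infinity.\<close>

definition trial :: "(real \<Rightarrow> 'v) set" where
  "trial = {\<phi>. (\<forall>t. (\<phi> has_vector_derivative vector_derivative \<phi> (at t)) (at t)) \<and>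
     continuous_on UNIV (\<lambda>t. vector_derivative \<phi> (at t)) \<and> (\<exists>T. \<forall>t\<ge>T. \<phi> t = 0)}"

lemma trialI:
  assumes "\<And>t. (\<phi> has_vector_derivative \<phi>' t) (at t)" "continuous_on UNIV \<phi>'" "\<And>t. T \<le> t \<Longrightarrow> \<phi> t = 0"
  shows "\<phi> \<in> trial" "vector_derivative \<phi> (at t) = \<phi>' t"
proof -
  have eq: "vector_derivative \<phi> (at t) = \<phi>' t" for t using assms(1) by (rule vector_derivative_at)
  then show "vector_derivative \<phi> (at t) = \<phi>' t" .
  show "\<phi> \<in> trial" using assms unfolding trial_def by (auto simp: eq)
qed

lemma trialD:
  assumes "\<phi> \<in> trial"
  shows "(\<phi> has_vector_derivative vector_derivative \<phi> (at t)) (at t)"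
    "continuous_on X (\<lambda>t. vector_derivative \<phi> (at t))" "continuous_on X \<phi>"
    "\<exists>T. (\<forall>t\<ge>T. \<phi> t = 0) \<and> (\<forall>t\<ge>T. vector_derivative \<phi> (at t) = 0)"
proof -
  show d: "(\<phi> has_vector_derivative vector_derivative \<phi> (at t)) (at t)" for t using assms by (auto simp: trial_def)
  show "continuous_on X (\<lambda>t. vector_derivative \<phi> (at t))"
    using assms continuous_on_subset unfolding trial_def by blast
  show "continuous_on X \<phi>"
    using d by (auto intro!: continuous_at_imp_continuous_on has_vector_derivative_continuous)
  obtain T where T: "\<And>t. t \<ge> T \<Longrightarrow> \<phi> t = 0" using assms by (auto simp: trial_def)
  have "vector_derivative \<phi> (at t) = 0" if "t \<ge> T + 1" for t
  proof -
    have "((\<lambda>t. 0) has_vector_derivative 0) (at t)" by (rule has_vector_derivative_const)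
    then have "(\<phi> has_vector_derivative 0) (at t)"
      by (rule has_vector_derivative_transform_within_open[of _ _ _ "{T<..}"]) (use that T in auto)
    then show ?thesis by (rule vector_derivative_at)
  qed
  then show "\<exists>T. (\<forall>t\<ge>T. \<phi> t = 0) \<and> (\<forall>t\<ge>T. vector_derivative \<phi> (at t) = 0)"
    using T by (intro exI[of _ "T + 1"]) auto
qed

lemma trial_comb:
  assumes "\<phi> \<in> trial" "\<psi> \<in> trial"
  shows "(\<lambda>t. \<phi> t + x *\<^sub>R \<psi> t) \<in> trial"
    "vector_derivative (\<lambda>t. \<phi> t + x *\<^sub>R \<psi> t) (at t) = vector_derivative \<phi> (at t) + x *\<^sub>R vector_derivative \<psi> (at t)"
proof -
  obtain T1 T2 where T: "\<And>t. t \<ge> T1 \<Longrightarrow> \<phi> t = 0" "\<And>t. t \<ge> T2 \<Longrightarrow> \<psi> t = 0"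
    using assms by (auto simp: trial_def)
  have d: "((\<lambda>t. \<phi> t + x *\<^sub>R \<psi> t) has_vector_derivative vector_derivative \<phi> (at t) + x *\<^sub>R vector_derivative \<psi> (at t)) (at t)" for t
    by (intro has_vector_derivative_add bounded_linear.has_vector_derivative[OF bounded_linear_scaleR_right] trialD assms)
  show "(\<lambda>t. \<phi> t + x *\<^sub>R \<psi> t) \<in> trial"
  proof (rule trialI(1)[where T = "max T1 T2"])
    show "((\<lambda>t. \<phi> t + x *\<^sub>R \<psi> t) has_vector_derivative vector_derivative \<phi> (at t) + x *\<^sub>R vector_derivative \<psi> (at t)) (at t)" for t
      by (rule d)
    show "continuous_on UNIV (\<lambda>t. vector_derivative \<phi> (at t) + x *\<^sub>R vector_derivative \<psi> (at t))"
      by (intro continuous_on_add continuous_on_scaleR continuous_on_const trialD(2) assms)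
  qed (simp add: T)
  show "vector_derivative (\<lambda>t. \<phi> t + x *\<^sub>R \<psi> t) (at t) = vector_derivative \<phi> (at t) + x *\<^sub>R vector_derivative \<psi> (at t)"
    using d by (rule vector_derivative_at)
qed

text \<open>\<open>K s \<phi>\<close> represents \<open>u \<mapsto> \<integral>\<^sub>s\<^sup>\<infinity> (B t (u t) (\<phi> t) - e (u t) \<bullet> e (\<phi>' t)) dt\<close> in \<open>L\<^sup>2\<close>.\<close>

definition K :: "real \<Rightarrow> (real \<Rightarrow> 'v) \<Rightarrow> real \<Rightarrow> 'v" where
  "K s \<phi> t = indicator {s<..} t *\<^sub>R (adj t (\<phi> t) - S (vector_derivative \<phi> (at t)))"

lemma K_comb:
  "\<phi> \<in> trial \<Longrightarrow> \<psi> \<in> trial \<Longrightarrow> K s (\<lambda>t. \<phi> t + x *\<^sub>R \<psi> t) t = K s \<phi> t + x *\<^sub>R K s \<psi> t"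
  unfolding K_def by (simp add: trial_comb adj_add adj_scale S_add S_scale algebra_simps)

lemma sq_int_compact_support:
  fixes \<phi> :: "real \<Rightarrow> 'v"
  assumes "\<phi> \<in> borel_measurable borel" "\<And>t. norm (\<phi> t) \<le> C * indicator {a..b} t"
  shows "sq_int lborel \<phi>"
proof (rule sq_int_bound[where C = 1])
  show "sq_int lborel (\<lambda>t. C * indicator {a..b} t)"
    unfolding sq_int_def
  proof
    have "(\<lambda>t. (norm (C * indicator {a..b} t))\<^sup>2) = (\<lambda>t::real. C\<^sup>2 * indicator {a..b} t)"
      by (auto simp: power_mult_distrib indicator_def)
    moreover have "integrable lborel (\<lambda>t::real. C\<^sup>2 * indicator {a..b} t)"
      by (intro integrable_mult_right integrable_real_indicator) (auto simp: emeasure_lborel_Icc_eq)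
    ultimately show "integrable lborel (\<lambda>t. (norm (C * indicator {a..b} t))\<^sup>2)" by simp
  qed simp
  show "norm (\<phi> t) \<le> 1 * norm (C * indicator {a..b} t)" for t
    using assms(2)[of t] by simp
qed (use assms in simp)

lemma trial_sq_int:
  assumes \<phi>: "\<phi> \<in> trial"
  shows "sq_int lborel (K s \<phi>)" "sq_int lborel (\<lambda>t. indicator {s<..} t *\<^sub>R \<phi> t)"
proof -
  obtain T where T: "\<And>t. t \<ge> T \<Longrightarrow> \<phi> t = 0" "\<And>t. t \<ge> T \<Longrightarrow> vector_derivative \<phi> (at t) = 0"
    using trialD(4)[OF \<phi>] by blast
  have "bounded (\<phi> ` {s..T})" "bounded ((\<lambda>t. vector_derivative \<phi> (at t)) ` {s..T})"
    by (intro compact_imp_bounded compact_continuous_image trialD[OF \<phi>] compact_Icc)+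
  then obtain C1 C2 where C: "\<And>t. t \<in> {s..T} \<Longrightarrow> norm (\<phi> t) \<le> C1"
    "\<And>t. t \<in> {s..T} \<Longrightarrow> norm (vector_derivative \<phi> (at t)) \<le> C2"
    unfolding bounded_iff by blast
  obtain KS where KS: "\<And>x. norm (S x) \<le> KS * norm x" using norm_S by blast
  have m: "\<phi> \<in> borel_measurable borel" "(\<lambda>t. vector_derivative \<phi> (at t)) \<in> borel_measurable borel"
    by (intro borel_measurable_continuous_onI trialD[OF \<phi>])+
  show "sq_int lborel (K s \<phi>)"
  proof (rule sq_int_compact_support[where C = "\<bar>M\<bar> * C1 + \<bar>KS\<bar> * C2" and a = s and b = T])
    show "K s \<phi> \<in> borel_measurable borel"
      unfolding K_def[abs_def]
      by (intro borel_measurable_scaleR borel_measurable_diff adj_measurable S_measurable m borel_measurable_indicator) simp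
    fix t
    have "norm (adj t (\<phi> t) - S (vector_derivative \<phi> (at t))) \<le> \<bar>M\<bar> * C1 + \<bar>KS\<bar> * C2" if "t \<in> {s..T}"
    proof -
      have "norm (adj t (\<phi> t) - S (vector_derivative \<phi> (at t)))
          \<le> norm (adj t (\<phi> t)) + norm (S (vector_derivative \<phi> (at t)))" by (rule norm_triangle_ineq4)
      also have "norm (adj t (\<phi> t)) \<le> \<bar>M\<bar> * C1"
        using norm_adj[of t "\<phi> t"] mult_left_mono[OF C(1)[OF that], of "\<bar>M\<bar>"] by linarith
      also have "norm (S (vector_derivative \<phi> (at t))) \<le> \<bar>KS\<bar> * C2"
      proof -
        have "norm (S (vector_derivative \<phi> (at t))) \<le> \<bar>KS\<bar> * norm (vector_derivative \<phi> (at t))"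
          using KS[of "vector_derivative \<phi> (at t)"] mult_right_mono[OF abs_ge_self[of KS], of "norm (vector_derivative \<phi> (at t))"]
          by simp
        also have "\<dots> \<le> \<bar>KS\<bar> * C2" by (intro mult_left_mono C that) simp
        finally show ?thesis .
      qed
      finally show ?thesis by simp
    qed
    moreover have "adj t (\<phi> t) - S (vector_derivative \<phi> (at t)) = 0" if "t \<ge> T"
      using T[OF that] adj_scale[of t 0 0] S_scale[of 0 0] by simp
    ultimately show "norm (K s \<phi> t) \<le> (\<bar>M\<bar> * C1 + \<bar>KS\<bar> * C2) * indicator {s..T} t"
      unfolding K_def by (cases "t \<le> T") (auto simp: indicator_def intro: order_trans[OF norm_ge_zero])
  qed
  show "sq_int lborel (\<lambda>t. indicator {s<..} t *\<^sub>R \<phi> t)"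
  proof (rule sq_int_compact_support[where C = C1 and a = s and b = T])
    show "norm (indicator {s<..} t *\<^sub>R \<phi> t) \<le> C1 * indicator {s..T} t" for t
      using C(1)[of t] T(1)[of t] by (auto simp: indicator_def intro: order_trans[OF norm_ge_zero])
  qed (intro borel_measurable_scaleR m borel_measurable_indicator, simp)
qed

text \<open>Pairing \<open>K s \<phi>\<close> with \<phi> over \<open>{s<..}\<close> gives at least
  \<open>c\<close> times the square integral of \<phi> plus half of
  \<open>(norm (e (\<phi> s)))^2\<close>, by coercivity and because \<phi> vanishes for large times.
  Young's inequality with weight \<open>1 / c\<close> cancels the \<phi> term exactly, whence the
  constant \<open>2 / c\<close>.\<close>

lemma initial_value_bound:
  assumes \<phi>: "\<phi> \<in> trial"
  shows "(norm (e (\<phi> s)))\<^sup>2 \<le> (2 / c) * (LINT t|lborel. K s \<phi> t \<bullet> K s \<phi> t)"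
proof -
  obtain T0 where T0: "\<And>t. t \<ge> T0 \<Longrightarrow> \<phi> t = 0" "\<And>t. t \<ge> T0 \<Longrightarrow> vector_derivative \<phi> (at t) = 0"
    using trialD(4)[OF \<phi>] by blast
  define T where "T = max T0 s"
  have T: "s \<le> T" "\<And>t. t \<ge> T \<Longrightarrow> \<phi> t = 0" "\<And>t. t \<ge> T \<Longrightarrow> vector_derivative \<phi> (at t) = 0"
    using T0 by (auto simp: T_def)
  define \<phi>' where "\<phi>' t = vector_derivative \<phi> (at t)" for t
  define p where "p t = indicator {s<..} t *\<^sub>R \<phi> t" for t
  have sq: "sq_int lborel (K s \<phi>)" "sq_int lborel p"
    using trial_sq_int[OF \<phi>] unfolding p_def[abs_def] by auto
  have contp: "continuous_on X \<phi>" "continuous_on X \<phi>'" for X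
    using trialD[OF \<phi>] unfolding \<phi>'_def by auto
  have ec: "continuous_on X (\<lambda>t. e (\<phi> t))" "continuous_on X (\<lambda>t. e (\<phi>' t))" for X
    by (intro e.continuous_on contp)+
  have int1: "(LINT t|lborel. indicator {s..T} t *\<^sub>R (2 * (e (\<phi>' t) \<bullet> e (\<phi> t)))) = - (norm (e (\<phi> s)))\<^sup>2"
  proof -
    have "(LINT t|lborel. indicator {s..T} t *\<^sub>R (2 * (e (\<phi>' t) \<bullet> e (\<phi> t))))
        = (norm (e (\<phi> T)))\<^sup>2 - (norm (e (\<phi> s)))\<^sup>2"
    proof (rule integral_FTC_atLeastAtMost[OF T(1)])
      fix t
      have "((\<lambda>t. e (\<phi> t)) has_vector_derivative e (\<phi>' t)) (at t)"
        unfolding \<phi>'_def by (intro e.has_vector_derivative trialD[OF \<phi>])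
      from norm_square_has_real_derivative[OF this]
      show "((\<lambda>t. (norm (e (\<phi> t)))\<^sup>2) has_vector_derivative 2 * (e (\<phi>' t) \<bullet> e (\<phi> t))) (at t within {s..T})"
        by (simp add: has_real_derivative_iff_has_vector_derivative has_vector_derivative_at_within)
    next
      show "continuous_on {s..T} (\<lambda>t. 2 * (e (\<phi>' t) \<bullet> e (\<phi> t)))" by (intro continuous_intros ec)
    qed
    also have "e (\<phi> T) = 0" using T(2)[of T] e.zero by simp
    finally show ?thesis by simp
  qed
  have i1: "integrable lborel (\<lambda>t. indicator {s..T} t *\<^sub>R (2 * (e (\<phi>' t) \<bullet> e (\<phi> t))))"
    by (intro borel_integrable_compact compact_Icc continuous_intros ec)
  have i2: "integrable lborel (\<lambda>t. (norm (p t))\<^sup>2)" "integrable lborel (\<lambda>t. (norm (K s \<phi> t))\<^sup>2)"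
    using sq by (auto dest: sq_intD(2))
  \<comment> \<open>Almost everywhere only because the fundamental theorem is applied on the closed
    interval \<open>{s..T}\<close>, while \<open>K\<close> carries the indicator of
    \<open>{s<..}\<close>.\<close>
  have "AE t in lborel. c * (norm (p t))\<^sup>2 - (1/2) * (indicator {s..T} t *\<^sub>R (2 * (e (\<phi>' t) \<bullet> e (\<phi> t)))) \<le>
      (1 / c) * (norm (K s \<phi> t))\<^sup>2 + c * (norm (p t))\<^sup>2"
    using AE_lborel_singleton[of s]
  proof eventually_elim
    case (elim t)
    have "K s \<phi> t \<bullet> p t = indicator {s<..} t * (B t (\<phi> t) (\<phi> t) - e (\<phi>' t) \<bullet> e (\<phi> t))"
      by (simp add: K_def p_def adj S inner_diff_left \<phi>'_def indicator_def)
    moreover have "c * (norm (p t))\<^sup>2 \<le> indicator {s<..} t * B t (\<phi> t) (\<phi> t)"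
      using coercive[of "\<phi> t" t] by (simp add: p_def indicator_def)
    moreover have "indicator {s<..} t * (e (\<phi>' t) \<bullet> e (\<phi> t)) = indicator {s..T} t * (e (\<phi>' t) \<bullet> e (\<phi> t))"
      using T(2)[of t] elim e.zero by (auto simp: indicator_def)
    moreover have "K s \<phi> t \<bullet> p t \<le> (1 / c) * (norm (K s \<phi> t))\<^sup>2 + c * (norm (p t))\<^sup>2"
      using abs_inner_le_squares[of "1 / c" "K s \<phi> t" "p t"] c by simp
    ultimately show ?case by (simp add: right_diff_distrib)
  qed
  then have "(LINT t|lborel. c * (norm (p t))\<^sup>2 - (1/2) * (indicator {s..T} t *\<^sub>R (2 * (e (\<phi>' t) \<bullet> e (\<phi> t)))))
      \<le> (LINT t|lborel. (1 / c) * (norm (K s \<phi> t))\<^sup>2 + c * (norm (p t))\<^sup>2)"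
    by (intro integral_mono_AE Bochner_Integration.integrable_add Bochner_Integration.integrable_diff
        integrable_mult_right i1 i2)
  also have "(LINT t|lborel. c * (norm (p t))\<^sup>2 - (1/2) * (indicator {s..T} t *\<^sub>R (2 * (e (\<phi>' t) \<bullet> e (\<phi> t)))))
      = c * (LINT t|lborel. (norm (p t))\<^sup>2) + (1/2) * (norm (e (\<phi> s)))\<^sup>2"
  proof -
    have "(LINT t|lborel. (1/2) * (indicator {s..T} t *\<^sub>R (2 * (e (\<phi>' t) \<bullet> e (\<phi> t))))) = (1/2) * (- (norm (e (\<phi> s)))\<^sup>2)"
      unfolding int1[symmetric] by (rule integral_mult_right_zero)
    then show ?thesis
      unfolding Bochner_Integration.integral_diff[OF integrable_mult_right[OF i2(1)] integrable_mult_right[OF i1]]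
      by (simp only: integral_mult_right_zero)
  qed
  also have "(LINT t|lborel. (1 / c) * (norm (K s \<phi> t))\<^sup>2 + c * (norm (p t))\<^sup>2)
      = (1 / c) * (LINT t|lborel. (norm (K s \<phi> t))\<^sup>2) + c * (LINT t|lborel. (norm (p t))\<^sup>2)"
    by (subst Bochner_Integration.integral_add[OF integrable_mult_right[OF i2(2)] integrable_mult_right[OF i2(1)]])
       (simp only: integral_mult_right_zero)
  finally have "(norm (e (\<phi> s)))\<^sup>2 \<le> 2 * ((1 / c) * (LINT t|lborel. (norm (K s \<phi> t))\<^sup>2))" by linarith
  then show ?thesis by (simp add: power2_norm_eq_inner)
qed

text \<open>By \<open>initial_value_bound\<close> the functional
  \<open>K s \<phi> \<mapsto> f \<bullet> e (\<phi> s)\<close> is well defined and bounded in the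
  square mean. Minimization takes place over trial functions with the form \<open>q\<close>; only
  the images \<open>K s (\<Phi> k)\<close> converge, not the trial functions, and their limit in
  \<open>L^2\<close> is \<open>g\<close>.\<close>

lemma lions:
  fixes f :: 'h
  obtains g where "sq_int lborel g"
    "\<And>\<phi>. \<phi> \<in> trial \<Longrightarrow> (LINT t|lborel. g t \<bullet> K s \<phi> t) = f \<bullet> e (\<phi> s)"
proof -
  define q where "q \<phi> \<psi> = (LINT t|lborel. K s \<phi> t \<bullet> K s \<psi> t)" for \<phi> \<psi>
  note sq = trial_sq_int(1)
  have "\<exists>\<Phi>. (\<forall>k::nat. \<Phi> k \<in> trial) \<and>
      (\<forall>\<epsilon>>0. \<exists>N. \<forall>k\<ge>N. \<forall>l\<ge>N. q (\<lambda>t. \<Phi> k t + (-1) *\<^sub>R \<Phi> l t) (\<lambda>t. \<Phi> k t + (-1) *\<^sub>R \<Phi> l t) \<le> \<epsilon>) \<and>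
      (\<forall>\<psi>\<in>trial. (\<lambda>k. q (\<Phi> k) \<psi>) \<longlonglongrightarrow> f \<bullet> e (\<psi> s))"
  proof (rule riesz_minimizing_sequence[of trial "\<lambda>\<phi> x \<psi> t. \<phi> t + x *\<^sub>R \<psi> t" q "\<lambda>\<phi>. f \<bullet> e (\<phi> s)" "(norm f)\<^sup>2 * (2 / c)"])
    show "trial \<noteq> {}"
      using trialI(1)[of "\<lambda>t. 0" "\<lambda>t. 0" 0] by (auto intro: has_vector_derivative_const)
    show "(\<lambda>t. \<phi> t + x *\<^sub>R \<psi> t) \<in> trial" if "\<phi> \<in> trial" "\<psi> \<in> trial" for \<phi> \<psi> x using that by (rule trial_comb)
    show "q (\<lambda>t. \<phi> t + x *\<^sub>R \<psi> t) \<eta> = q \<phi> \<eta> + x * q \<psi> \<eta>" if "\<phi> \<in> trial" "\<psi> \<in> trial" "\<eta> \<in> trial" for \<phi> \<psi> \<eta> x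
    proof -
      have "q (\<lambda>t. \<phi> t + x *\<^sub>R \<psi> t) \<eta> = (LINT t|lborel. K s \<phi> t \<bullet> K s \<eta> t + x * (K s \<psi> t \<bullet> K s \<eta> t))"
        unfolding q_def K_comb[OF that(1,2)] by (simp add: inner_add_left)
      also have "\<dots> = q \<phi> \<eta> + x * q \<psi> \<eta>"
        unfolding q_def using that by (subst Bochner_Integration.integral_add) (auto intro: sq_int_inner sq)
      finally show ?thesis .
    qed
    show "q \<phi> \<psi> = q \<psi> \<phi>" for \<phi> \<psi> unfolding q_def by (simp add: inner_commute)
    show "0 \<le> q \<phi> \<phi>" for \<phi> unfolding q_def by (intro Bochner_Integration.integral_nonneg) simp
    show "f \<bullet> e (\<phi> s + x *\<^sub>R \<psi> s) = f \<bullet> e (\<phi> s) + x * (f \<bullet> e (\<psi> s))" for \<phi> \<psi> :: "real \<Rightarrow> 'v" and x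
      by (simp add: e.add e.scaleR inner_add_right)
    show "(f \<bullet> e (\<phi> s))\<^sup>2 \<le> (norm f)\<^sup>2 * (2 / c) * q \<phi> \<phi>" if "\<phi> \<in> trial" for \<phi>
    proof -
      have "(f \<bullet> e (\<phi> s))\<^sup>2 \<le> (norm f)\<^sup>2 * (norm (e (\<phi> s)))\<^sup>2"
        using Cauchy_Schwarz_ineq[of f "e (\<phi> s)"] by (simp add: power2_norm_eq_inner)
      also have "\<dots> \<le> (norm f)\<^sup>2 * ((2 / c) * q \<phi> \<phi>)"
        unfolding q_def by (intro mult_left_mono initial_value_bound that) simp
      finally show ?thesis by (simp only: mult.assoc)
    qed
    fix \<Phi> :: "nat \<Rightarrow> real \<Rightarrow> 'v"
    assume "\<And>k. \<Phi> k \<in> trial"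
      "\<And>\<epsilon>. \<epsilon> > 0 \<Longrightarrow> \<exists>N. \<forall>k\<ge>N. \<forall>l\<ge>N. q (\<lambda>t. \<Phi> k t + (-1) *\<^sub>R \<Phi> l t) (\<lambda>t. \<Phi> k t + (-1) *\<^sub>R \<Phi> l t) \<le> \<epsilon>"
      "\<And>\<psi>. \<psi> \<in> trial \<Longrightarrow> (\<lambda>k. q (\<Phi> k) \<psi>) \<longlonglongrightarrow> f \<bullet> e (\<psi> s)"
    then show ?thesis by (intro exI[of _ \<Phi>]) blast
  qed
  then obtain \<Phi> where \<Phi>: "\<And>k::nat. \<Phi> k \<in> trial"
    and cau: "\<forall>\<epsilon>>0. \<exists>N. \<forall>k\<ge>N. \<forall>l\<ge>N. q (\<lambda>t. \<Phi> k t + (-1) *\<^sub>R \<Phi> l t) (\<lambda>t. \<Phi> k t + (-1) *\<^sub>R \<Phi> l t) \<le> \<epsilon>"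
    and lim: "\<And>\<psi>. \<psi> \<in> trial \<Longrightarrow> (\<lambda>k. q (\<Phi> k) \<psi>) \<longlonglongrightarrow> f \<bullet> e (\<psi> s)" by blast
  have diff: "K s (\<lambda>t. \<Phi> k t + (-1) *\<^sub>R \<Phi> l t) t = K s (\<Phi> k) t - K s (\<Phi> l) t" for k l t
    unfolding K_comb[OF \<Phi> \<Phi>] by simp
  have "\<exists>N. \<forall>k\<ge>N. \<forall>l\<ge>N. (\<integral>\<^sup>+t. ennreal ((norm (K s (\<Phi> k) t - K s (\<Phi> l) t))\<^sup>2) \<partial>lborel) \<le> ennreal \<epsilon>"
    if "\<epsilon> > 0" for \<epsilon>
  proof -
    obtain N where N: "\<forall>k\<ge>N. \<forall>l\<ge>N. q (\<lambda>t. \<Phi> k t + (-1) *\<^sub>R \<Phi> l t) (\<lambda>t. \<Phi> k t + (-1) *\<^sub>R \<Phi> l t) \<le> \<epsilon>"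
      using cau \<open>\<epsilon> > 0\<close> by blast
    show ?thesis
    proof (intro exI allI impI)
      fix k l assume kl: "N \<le> k" "N \<le> l"
      have "(\<integral>\<^sup>+t. ennreal ((norm (K s (\<Phi> k) t - K s (\<Phi> l) t))\<^sup>2) \<partial>lborel)
          = ennreal (LINT t|lborel. (norm (K s (\<Phi> k) t - K s (\<Phi> l) t))\<^sup>2)"
        by (intro sq_int_nn_eq sq_int_diff sq \<Phi>)
      also have "\<dots> \<le> ennreal \<epsilon>"
        using N kl unfolding q_def diff by (auto simp: power2_norm_eq_inner intro: ennreal_leI)
      finally show "(\<integral>\<^sup>+t. ennreal ((norm (K s (\<Phi> k) t - K s (\<Phi> l) t))\<^sup>2) \<partial>lborel) \<le> ennreal \<epsilon>" .
    qed
  qed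
  note cauchy = this
  obtain g where gm: "g \<in> borel_measurable lborel" and g: "\<And>\<epsilon>. \<epsilon> > 0 \<Longrightarrow>
      \<exists>N. \<forall>k\<ge>N. (\<integral>\<^sup>+t. ennreal ((norm (K s (\<Phi> k) t - g t))\<^sup>2) \<partial>lborel) \<le> ennreal \<epsilon>"
    using riesz_fischer[of "\<lambda>k. K s (\<Phi> k)" lborel] cauchy sq_intD(1)[OF sq[OF \<Phi>]] by blast
  \<comment> \<open>A finite distance to one square integrable function already makes
    \<open>g\<close> square integrable.\<close>
  obtain N1 where N1: "\<And>k. k \<ge> N1 \<Longrightarrow> (\<integral>\<^sup>+t. ennreal ((norm (K s (\<Phi> k) t - g t))\<^sup>2) \<partial>lborel) \<le> ennreal 1"
    using g[of 1] by auto
  have sqd: "sq_int lborel (\<lambda>t. K s (\<Phi> (k + N1)) t - g t)" for k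
    unfolding sq_int_iff_nn
  proof
    show "(\<lambda>t. K s (\<Phi> (k + N1)) t - g t) \<in> borel_measurable lborel"
      by (intro borel_measurable_diff gm sq_intD(1)[OF sq[OF \<Phi>]])
    show "(\<integral>\<^sup>+t. ennreal ((norm (K s (\<Phi> (k + N1)) t - g t))\<^sup>2) \<partial>lborel) < \<infinity>"
      using N1[of "k + N1"] by (simp add: le_less_trans[OF _ ennreal_one_less_top])
  qed
  have sqg: "sq_int lborel g"
    using sq_int_diff[OF sq[OF \<Phi>, of s N1] sqd[of 0]] by simp
  have lim0: "(\<lambda>k. LINT t|lborel. (norm (K s (\<Phi> (k + N1)) t - g t))\<^sup>2) \<longlonglongrightarrow> 0"
  proof (rule LIMSEQ_I)
    fix \<epsilon> :: real assume "\<epsilon> > 0"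
    then obtain N where N: "\<And>k. k \<ge> N \<Longrightarrow> (\<integral>\<^sup>+t. ennreal ((norm (K s (\<Phi> k) t - g t))\<^sup>2) \<partial>lborel) \<le> ennreal (\<epsilon>/2)"
      using g[of "\<epsilon>/2"] by auto
    show "\<exists>no. \<forall>k\<ge>no. norm ((LINT t|lborel. (norm (K s (\<Phi> (k + N1)) t - g t))\<^sup>2) - 0) < \<epsilon>"
    proof (intro exI allI impI)
      fix k assume "N \<le> k"
      have "ennreal (LINT t|lborel. (norm (K s (\<Phi> (k + N1)) t - g t))\<^sup>2) \<le> ennreal (\<epsilon>/2)"
        unfolding sq_int_nn_eq[OF sqd, symmetric] using \<open>N \<le> k\<close> by (intro N) simp
      then have "(LINT t|lborel. (norm (K s (\<Phi> (k + N1)) t - g t))\<^sup>2) \<le> \<epsilon>/2"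
        using \<open>\<epsilon> > 0\<close> by (subst (asm) ennreal_le_iff) auto
      moreover have "0 \<le> (LINT t|lborel. (norm (K s (\<Phi> (k + N1)) t - g t))\<^sup>2)"
        by (intro Bochner_Integration.integral_nonneg) simp
      ultimately show "norm ((LINT t|lborel. (norm (K s (\<Phi> (k + N1)) t - g t))\<^sup>2) - 0) < \<epsilon>"
        using \<open>\<epsilon> > 0\<close> unfolding real_norm_def diff_0_right by linarith
    qed
  qed
  show ?thesis
  proof (rule that[OF sqg])
    fix \<psi> assume \<psi>: "\<psi> \<in> trial"
    have "(\<lambda>k. LINT t|lborel. K s (\<Phi> (k + N1)) t \<bullet> K s \<psi> t) \<longlonglongrightarrow> (LINT t|lborel. g t \<bullet> K s \<psi> t)"
      by (rule sq_int_inner_tendsto[OF sq[OF \<Phi>] sq[OF \<psi>] sqg sq[OF \<psi>] lim0]) simp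
    moreover have "(\<lambda>k. LINT t|lborel. K s (\<Phi> (k + N1)) t \<bullet> K s \<psi> t) \<longlonglongrightarrow> f \<bullet> e (\<psi> s)"
      using LIMSEQ_ignore_initial_segment[OF lim[OF \<psi>], of N1] unfolding q_def .
    ultimately show "(LINT t|lborel. g t \<bullet> K s \<psi> t) = f \<bullet> e (\<psi> s)" by (rule LIMSEQ_unique)
  qed
qed

end

section \<open>Test functions in time and reflection\<close>

lemma test_fun_real:
  fixes \<theta> :: "real \<Rightarrow> real"
  assumes "test_fun I \<theta>"
  shows "(\<theta> has_real_derivative deriv \<theta> t) (at t)" "continuous_on X \<theta>" "continuous_on X (deriv \<theta>)"
    "t \<notin> I \<Longrightarrow> \<theta> t = 0" "\<exists>R. \<forall>t. R \<le> \<bar>t\<bar> \<longrightarrow> \<theta> t = 0 \<and> deriv \<theta> t = 0"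
proof -
  have sm: "iter_deriv vs \<theta> differentiable (at x)" for vs x
    using assms by (simp add: test_fun_def smooth_def)
  have d: "(\<theta> has_real_derivative deriv \<theta> t) (at t)" for t
  proof -
    obtain D where "(\<theta> has_real_derivative D) (at t)"
      using sm[of "[]" t] by (auto simp: real_differentiable_def)
    then show ?thesis using DERIV_imp_deriv by metis
  qed
  then show "(\<theta> has_real_derivative deriv \<theta> t) (at t)" .
  show "continuous_on X \<theta>"
    using d by (auto intro!: continuous_at_imp_continuous_on DERIV_isCont)
  have "iter_deriv [1] \<theta> = deriv \<theta>"
  proof
    fix x
    have "frechet_derivative \<theta> (at x) = (*) (deriv \<theta> x)"
      using frechet_derivative_at[OF d[of x, unfolded has_field_derivative_def]] by simp
    then show "iter_deriv [1] \<theta> x = deriv \<theta> x" by simp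
  qed
  then have "deriv \<theta> differentiable (at x)" for x using sm[of "[1]" x] by simp
  then show "continuous_on X (deriv \<theta>)"
    by (auto intro!: continuous_at_imp_continuous_on differentiable_imp_continuous_within)
  have "{x. \<theta> x \<noteq> 0} \<subseteq> I"
    by (rule order_trans[OF closure_subset]) (use assms in \<open>simp add: test_fun_def\<close>)
  then show "t \<notin> I \<Longrightarrow> \<theta> t = 0" by blast
  have "bounded {x. \<theta> x \<noteq> 0}"
  proof (rule bounded_subset[OF compact_imp_bounded closure_subset])
    show "compact (closure {x. \<theta> x \<noteq> 0})" using assms by (simp add: test_fun_def)
  qed
  then obtain R where R: "\<And>x. \<theta> x \<noteq> 0 \<Longrightarrow> \<bar>x\<bar> \<le> R" unfolding bounded_iff by auto
  have z: "\<theta> x = 0" if "R < \<bar>x\<bar>" for x using R[of x] that by force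
  have "deriv \<theta> t = 0" if "R + 1 \<le> \<bar>t\<bar>" for t
  proof -
    have "open {t. R < \<bar>t\<bar>}" by (intro open_Collect_less continuous_intros)
    then have "\<forall>\<^sub>F x in nhds t. R < \<bar>x\<bar>"
      using that eventually_nhds_in_open[of "{t. R < \<bar>t\<bar>}" t] by simp
    then have "\<forall>\<^sub>F x in nhds t. \<theta> x = 0" by eventually_elim (rule z)
    then have "deriv \<theta> t = deriv (\<lambda>x. 0) t" by (intro deriv_cong_ev) auto
    then show ?thesis by simp
  qed
  then show "\<exists>R. \<forall>t. R \<le> \<bar>t\<bar> \<longrightarrow> \<theta> t = 0 \<and> deriv \<theta> t = 0"
    using z by (intro exI[of _ "R + 1"]) auto
qed

lemma sq_int_continuous_compact:
  fixes p :: "real \<Rightarrow> real"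
  assumes "continuous_on UNIV p" "\<And>t. R \<le> \<bar>t\<bar> \<Longrightarrow> p t = 0"
  shows "sq_int lborel p"
  unfolding sq_int_def
proof
  show "p \<in> borel_measurable lborel" using borel_measurable_continuous_onI[OF assms(1)] by simp
  have "integrable lborel (\<lambda>t. indicator {-R..R} t *\<^sub>R (norm (p t))\<^sup>2)"
    by (intro borel_integrable_compact compact_Icc continuous_intros continuous_on_subset[OF assms(1)]) auto
  moreover have "indicator {-R..R} t *\<^sub>R (norm (p t))\<^sup>2 = (norm (p t))\<^sup>2" for t
    using assms(2)[of t] by (cases "t \<in> {-R..R}") auto
  ultimately show "integrable lborel (\<lambda>t. (norm (p t))\<^sup>2)" by (simp only:)
qed

lemma sq_int_reflect:
  fixes f :: "real \<Rightarrow> 'v::{real_inner, banach, second_countable_topology}"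
  assumes "sq_int lborel f"
  shows "sq_int lborel (\<lambda>t. f (a - t))"
  unfolding sq_int_def
proof
  have [measurable]: "f \<in> borel_measurable borel" using sq_intD(1)[OF assms] by simp
  show "(\<lambda>t. f (a - t)) \<in> borel_measurable lborel" by measurable
  show "integrable lborel (\<lambda>t. (norm (f (a - t)))\<^sup>2)"
    using lborel_integrable_real_affine[OF sq_intD(2)[OF assms], of "-1" a] by simp
qed

lemma integral_reflect:
  fixes f :: "real \<Rightarrow> real"
  shows "(LINT t|lborel. f (a - t)) = (LINT t|lborel. f t)"
  using lborel_integral_real_affine[of "-1" f a] by simp

context coercive_family
begin

text \<open>The products \<open>\<theta> t *\<^sub>R w\<close> are the only trial functions needed
  from here on. \<theta> need not vanish at \<open>s\<close>, so the identity still contains the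
  initial value.\<close>

lemma weak_lions:
  fixes f :: 'h
  obtains g where "sq_int lborel g"
    "\<And>\<theta> \<theta>' T w. (\<And>t. (\<theta> has_real_derivative \<theta>' t) (at t)) \<Longrightarrow> continuous_on UNIV \<theta>' \<Longrightarrow>
      (\<And>t. T \<le> t \<Longrightarrow> \<theta> t = 0) \<Longrightarrow>
      (LINT t|lborel. indicator {s<..} t * (\<theta> t * B t (g t) w - \<theta>' t * (e (g t) \<bullet> e w))) = \<theta> s * (f \<bullet> e w)"
proof -
  obtain g where g: "sq_int lborel g"
    "\<And>\<phi>. \<phi> \<in> trial \<Longrightarrow> (LINT t|lborel. g t \<bullet> K s \<phi> t) = f \<bullet> e (\<phi> s)"
    using lions[where f = f and s = s] by blast
  show ?thesis
  proof (rule that[OF g(1)])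
    fix \<theta> \<theta>' :: "real \<Rightarrow> real" and T and w :: 'v
    assume \<theta>: "\<And>t. (\<theta> has_real_derivative \<theta>' t) (at t)" "continuous_on UNIV \<theta>'" "\<And>t. T \<le> t \<Longrightarrow> \<theta> t = 0"
    have d: "((\<lambda>t. \<theta> t *\<^sub>R w) has_vector_derivative \<theta>' t *\<^sub>R w) (at t)" for t
      using bounded_linear.has_vector_derivative[OF bounded_linear_scaleR_left
          \<theta>(1)[unfolded has_real_derivative_iff_has_vector_derivative], of w t] .
    have c: "continuous_on UNIV (\<lambda>t. \<theta>' t *\<^sub>R w)" by (intro continuous_intros \<theta>)
    have tr: "(\<lambda>t. \<theta> t *\<^sub>R w) \<in> trial" "vector_derivative (\<lambda>t. \<theta> t *\<^sub>R w) (at t) = \<theta>' t *\<^sub>R w" for t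
      using trialI[of "\<lambda>t. \<theta> t *\<^sub>R w" "\<lambda>t. \<theta>' t *\<^sub>R w" T, OF d c] \<theta>(3) by auto
    have "g t \<bullet> K s (\<lambda>t. \<theta> t *\<^sub>R w) t
        = indicator {s<..} t * (\<theta> t * B t (g t) w - \<theta>' t * (e (g t) \<bullet> e w))" for t
      unfolding K_def tr(2)
      by (simp add: adj_scale S_scale inner_diff_right inner_commute[of "g t"] adj S inner_commute[of "e w"])
    then show "(LINT t|lborel. indicator {s<..} t * (\<theta> t * B t (g t) w - \<theta>' t * (e (g t) \<bullet> e w)))
        = \<theta> s * (f \<bullet> e w)"
      using g(2)[OF tr(1)] by (simp add: e.scaleR)
  qed
qed

section \<open>Attainment of the initial value\<close>

text \<open>The weight is minus the derivative of \<open>(max 0 (1 - (t - s) N))^2\<close> with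
  \<open>N = n + 1\<close>. On \<open>{s<..}\<close> it has mass one and lives on an interval of
  length \<open>1 / N\<close>; the substitution \<open>\<sigma> = (t - s) N\<close> turns it into
  the fixed density \<open>2 (1 - \<sigma>)\<close> on the unit interval.\<close>

lemma initial_layer_limit:
  fixes F :: "real \<Rightarrow> real"
  assumes F: "continuous_on UNIV F"
  shows "(\<lambda>n. LINT t|lborel. indicator {s<..} t * ((2 * real (Suc n) * max 0 (1 - (t - s) * real (Suc n))) * F t))
    \<longlonglongrightarrow> F s"
proof -
  have Fm[measurable]: "F \<in> borel_measurable borel" by (rule borel_measurable_continuous_onI[OF F])
  have "bounded (F ` {s..s + 1})"
    by (intro compact_imp_bounded compact_continuous_image continuous_on_subset[OF F]) auto
  then obtain C where C: "\<And>t. t \<in> {s..s + 1} \<Longrightarrow> \<bar>F t\<bar> \<le> C"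
    unfolding bounded_iff real_norm_def by blast
  have eq: "(LINT t|lborel. indicator {s<..} t * ((2 * real (Suc n) * max 0 (1 - (t - s) * real (Suc n))) * F t))
      = (LINT \<sigma>|lborel. indicator {0<..<1} \<sigma> * (2 * (1 - \<sigma>) * F (s + \<sigma> / real (Suc n))))" for n
  proof -
    define N where "N = real (Suc n)"
    have N: "N > 0" by (simp add: N_def)
    have "(LINT t|lborel. indicator {s<..} t * ((2 * N * max 0 (1 - (t - s) * N)) * F t))
        = \<bar>1 / N\<bar> *\<^sub>R (LINT \<sigma>|lborel. indicator {s<..} (s + (1 / N) * \<sigma>)
          * ((2 * N * max 0 (1 - (s + (1 / N) * \<sigma> - s) * N)) * F (s + (1 / N) * \<sigma>)))"
      using N by (intro lborel_integral_real_affine) auto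
    also have "\<dots> = (LINT \<sigma>|lborel. (1 / N) * (indicator {s<..} (s + (1 / N) * \<sigma>)
          * ((2 * N * max 0 (1 - (s + (1 / N) * \<sigma> - s) * N)) * F (s + (1 / N) * \<sigma>))))"
      using N by (simp only: integral_mult_right_zero real_scaleR_def) simp
    also have "\<dots> = (LINT \<sigma>|lborel. indicator {0<..<1} \<sigma> * (2 * (1 - \<sigma>) * F (s + \<sigma> / N)))"
    proof (intro Bochner_Integration.integral_cong refl)
      fix \<sigma> :: real
      have "(indicator {s<..} (s + (1 / N) * \<sigma>) :: real) = indicator {0<..} \<sigma>"
        using N by (auto simp: indicator_def zero_less_divide_iff)
      then show "(1 / N) * (indicator {s<..} (s + (1 / N) * \<sigma>)
          * ((2 * N * max 0 (1 - (s + (1 / N) * \<sigma> - s) * N)) * F (s + (1 / N) * \<sigma>)))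
        = indicator {0<..<1} \<sigma> * (2 * (1 - \<sigma>) * F (s + \<sigma> / N))"
        using N by (auto simp: indicator_def max_def)
    qed
    finally show ?thesis unfolding N_def .
  qed
  have "(\<lambda>n. LINT \<sigma>|lborel. indicator {0<..<1} \<sigma> * (2 * (1 - \<sigma>) * F (s + \<sigma> / real (Suc n))))
      \<longlonglongrightarrow> (LINT \<sigma>|lborel. indicator {0<..<1} \<sigma> * (2 * (1 - \<sigma>) * F s))"
  proof (rule integral_dominated_convergence[where w = "\<lambda>\<sigma>. indicator {0<..<1} \<sigma> * (2 * C)"])
    show "integrable lborel (\<lambda>\<sigma>::real. indicator {0<..<1} \<sigma> * (2 * C))"
      by (intro integrable_mult_left integrable_real_indicator) auto
    show "AE \<sigma> in lborel. (\<lambda>n. indicator {0<..<1} \<sigma> * (2 * (1 - \<sigma>) * F (s + \<sigma> / real (Suc n))))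
        \<longlonglongrightarrow> indicator {0<..<1} \<sigma> * (2 * (1 - \<sigma>) * F s)"
    proof (intro AE_I2 tendsto_mult_left)
      fix \<sigma> :: real
      have "(\<lambda>n. s + \<sigma> * (1 / real (Suc n))) \<longlonglongrightarrow> s + \<sigma> * 0"
        by (intro tendsto_intros LIMSEQ_Suc[OF lim_1_over_n])
      then have "(\<lambda>n. s + \<sigma> / real (Suc n)) \<longlonglongrightarrow> s" by simp
      from continuous_on_tendsto_compose[OF F this] show "(\<lambda>n. F (s + \<sigma> / real (Suc n))) \<longlonglongrightarrow> F s" by simp
    qed
    show "AE \<sigma> in lborel. norm (indicator {0<..<1} \<sigma> * (2 * (1 - \<sigma>) * F (s + \<sigma> / real (Suc n))))
        \<le> indicator {0<..<1} \<sigma> * (2 * C)" for n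
    proof (intro AE_I2)
      fix \<sigma> :: real
      have "\<bar>2 * (1 - \<sigma>) * F (s + \<sigma> / real (Suc n))\<bar> \<le> 2 * C" if "0 < \<sigma>" "\<sigma> < 1"
        unfolding abs_mult
      proof (rule mult_mono)
        have "\<sigma> / real (Suc n) \<le> 1" using that by (simp add: divide_le_eq)
        then show "\<bar>F (s + \<sigma> / real (Suc n))\<bar> \<le> C" using that by (intro C) auto
      qed (use that in auto)
      then show "norm (indicator {0<..<1} \<sigma> * (2 * (1 - \<sigma>) * F (s + \<sigma> / real (Suc n))))
        \<le> indicator {0<..<1} \<sigma> * (2 * C)"
        by (auto simp: indicator_def)
    qed
  qed measurable
  moreover have "(LINT \<sigma>|lborel. indicator {0<..<1} \<sigma> * (2 * (1 - \<sigma>) * F s)) = F s"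
  proof -
    have "(LINT \<sigma>|lborel. indicator {0..1} \<sigma> *\<^sub>R (2 * (1 - \<sigma>))) = (2 * 1 - 1\<^sup>2) - (2 * 0 - 0\<^sup>2 :: real)"
      by (rule integral_FTC_atLeastAtMost)
         (auto intro!: continuous_intros derivative_eq_intros simp flip: has_real_derivative_iff_has_vector_derivative)
    moreover have "(LINT \<sigma>|lborel. indicator {0<..<1} \<sigma> * (2 * (1 - \<sigma>) * F s))
        = (LINT \<sigma>|lborel. (indicator {0..1} \<sigma> *\<^sub>R (2 * (1 - \<sigma>))) * F s)"
    proof (rule integral_cong_AE)
      show "AE \<sigma> in lborel. indicator {0<..<1} \<sigma> * (2 * (1 - \<sigma>) * F s)
          = (indicator {0..1} \<sigma> *\<^sub>R (2 * (1 - \<sigma>))) * F s"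
        using AE_lborel_singleton[of 0] AE_lborel_singleton[of 1]
        by eventually_elim (auto simp: indicator_def)
    qed measurable
    ultimately show ?thesis by simp
  qed
  ultimately show ?thesis unfolding eq by simp
qed

text \<open>Three steps follow Lions' solution \<open>g\<close>. Its even reflection about
  \<open>s\<close> solves an equation on the whole line and so has a continuous representative
  \<open>u\<close>; concentrating test functions identify \<open>u s\<close> with \<open>f\<close>;
  multiplication by \<open>exp (t - s)\<close> removes the inner product of \<open>'h\<close>
  contained in \<open>B\<close>, at the price of square integrability on bounded intervals
  only.\<close>

theorem solution_exists:
  fixes f :: 'h
  obtains u v where "continuous_on {s..} u" "u s = f" "v \<in> borel_measurable borel"
    "\<And>b. integrable lborel (\<lambda>t. indicator {s<..<b} t * (norm (v t))\<^sup>2)"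
    "AE t in lborel. s < t \<longrightarrow> u t = e (v t)"
    "\<And>\<theta> w. test_fun {s<..} \<theta> \<Longrightarrow>
      (LINT t|lborel. indicator {s<..} t * (deriv \<theta> t * (e (v t) \<bullet> e w)))
      = (LINT t|lborel. indicator {s<..} t * (\<theta> t * (B t (v t) w - e (v t) \<bullet> e w)))"
proof -
  obtain g where g: "sq_int lborel g" and weak:
    "\<And>\<theta> \<theta>' T w. (\<And>t. (\<theta> has_real_derivative \<theta>' t) (at t)) \<Longrightarrow> continuous_on UNIV \<theta>' \<Longrightarrow>
      (\<And>t. T \<le> t \<Longrightarrow> \<theta> t = 0) \<Longrightarrow>
      (LINT t|lborel. indicator {s<..} t * (\<theta> t * B t (g t) w - \<theta>' t * (e (g t) \<bullet> e w))) = \<theta> s * (f \<bullet> e w)"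
  proof (rule weak_lions[where f = f and s = s])
    fix g assume "sq_int lborel g"
      "\<And>\<theta> \<theta>' T w. (\<And>t. (\<theta> has_real_derivative \<theta>' t) (at t)) \<Longrightarrow> continuous_on UNIV \<theta>' \<Longrightarrow>
      (\<And>t. T \<le> t \<Longrightarrow> \<theta> t = 0) \<Longrightarrow>
      (LINT t|lborel. indicator {s<..} t * (\<theta> t * B t (g t) w - \<theta>' t * (e (g t) \<bullet> e w))) = \<theta> s * (f \<bullet> e w)"
    from that[OF this] show thesis .
  qed
  have gm[measurable]: "g \<in> borel_measurable borel" using sq_intD(1)[OF g] by simp
  define G where "G t = indicator {s<..} t *\<^sub>R g t" for t
  define H where "H t = indicator {s<..} t *\<^sub>R op t (g t)" for t
  have G: "sq_int lborel G" unfolding G_def[abs_def] using g by (rule sq_int_indicator) simp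
  have "sq_int lborel (\<lambda>t. op t (g t))"
    using op_measurable[OF gm] norm_op by (intro sq_int_bound[OF g, where C = "\<bar>M\<bar>"]) auto
  then have H: "sq_int lborel H" unfolding H_def[abs_def] by (rule sq_int_indicator) simp
  \<comment> \<open>The reflection of \<open>g\<close> is even, hence the derivative is reflected
    with the opposite sign: \<open>- H\<close> after time \<open>s\<close> and \<open>+ H\<close>
    before.\<close>
  define v2 where "v2 t = G t + G (2 * s - t)" for t
  define r where "r t = H (2 * s - t) - H t" for t
  have v2: "sq_int lborel v2" unfolding v2_def[abs_def] by (intro sq_int_add G sq_int_reflect)
  have r: "sq_int lborel r" unfolding r_def[abs_def] by (intro sq_int_diff H sq_int_reflect)
  have eG: "sq_int lborel (\<lambda>t. e (G t) \<bullet> e w)" for w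
    using sq_int_bounded_linear[OF G bounded_linear_compose[OF bounded_linear_inner_left e, of "e w"]] by simp
  have Hw: "sq_int lborel (\<lambda>t. H t \<bullet> w)" for w
    using sq_int_bounded_linear[OF H bounded_linear_inner_left] .
  have prod: "integrable lborel (\<lambda>t. p t * q t)" if "sq_int lborel p" "sq_int lborel q" for p q :: "real \<Rightarrow> real"
    using sq_int_inner[OF that] by simp
  have GH: "indicator {s<..} t * (p * B t (g t) w - p' * (e (g t) \<bullet> e w)) = p * (H t \<bullet> w) - p' * (e (G t) \<bullet> e w)"
    for t p p' w
    by (auto simp: G_def H_def op indicator_def e.zero)
  have reflected: "(LINT t|lborel. deriv \<theta> t * (e (v2 t) \<bullet> e w)) = - (LINT t|lborel. \<theta> t * (r t \<bullet> w))"
    if \<theta>: "test_fun UNIV \<theta>" for \<theta> w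
  proof -
    note tf = test_fun_real[OF \<theta>]
    obtain R where R: "\<And>t. R \<le> \<bar>t\<bar> \<Longrightarrow> \<theta> t = 0 \<and> deriv \<theta> t = 0" using tf(5) by blast
    have sq: "sq_int lborel \<theta>" "sq_int lborel (deriv \<theta>)"
      by (rule sq_int_continuous_compact[OF tf(2), of R] sq_int_continuous_compact[OF tf(3), of R], simp add: R)+
    \<comment> \<open>Pairing an even function with the derivative of \<theta> over the line equals
      pairing \<open>g\<close> with the derivative of the odd part of \<theta> over the half-line.
      The odd part vanishes at \<open>s\<close>, so the initial value drops out.\<close>
    define \<psi> where "\<psi> t = \<theta> t - \<theta> (2 * s - t)" for t
    define \<psi>' where "\<psi>' t = deriv \<theta> t + deriv \<theta> (2 * s - t)" for t
    have sq\<psi>: "sq_int lborel \<psi>" "sq_int lborel \<psi>'"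
      unfolding \<psi>_def[abs_def] \<psi>'_def[abs_def] by (intro sq_int_diff sq_int_add sq sq_int_reflect)+
    have "(LINT t|lborel. indicator {s<..} t * (\<psi> t * B t (g t) w - \<psi>' t * (e (g t) \<bullet> e w))) = \<psi> s * (f \<bullet> e w)"
    proof (rule weak)
      fix t
      have "((\<lambda>t. \<theta> (2 * s - t)) has_real_derivative deriv \<theta> (2 * s - t) * (-1)) (at t)"
        by (rule DERIV_chain2[OF tf(1)]) (auto intro!: derivative_eq_intros)
      from DERIV_diff[OF tf(1) this] show "(\<psi> has_real_derivative \<psi>' t) (at t)"
        unfolding \<psi>_def[abs_def] \<psi>'_def by simp
    next
      show "continuous_on UNIV \<psi>'"
        unfolding \<psi>'_def by (intro continuous_on_add tf(3) continuous_on_compose2[OF tf(3)[of UNIV]] continuous_intros) auto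
      show "\<psi> t = 0" if "\<bar>R\<bar> + \<bar>2 * s\<bar> \<le> t" for t
        unfolding \<psi>_def using R[of t] R[of "2 * s - t"] that by auto
    qed
    then have "(LINT t|lborel. \<psi> t * (H t \<bullet> w) - \<psi>' t * (e (G t) \<bullet> e w)) = 0"
      unfolding GH by (simp add: \<psi>_def)
    then have eq: "(LINT t|lborel. \<psi> t * (H t \<bullet> w)) = (LINT t|lborel. \<psi>' t * (e (G t) \<bullet> e w))"
      using Bochner_Integration.integral_diff[OF prod[OF sq\<psi>(1) Hw] prod[OF sq\<psi>(2) eG], of w w] by simp
    have refl1: "(LINT t|lborel. p (2 * s - t) * q t) = (LINT t|lborel. p t * q (2 * s - t))" for p q :: "real \<Rightarrow> real"
      using integral_reflect[of "\<lambda>t. p t * q (2 * s - t)" "2 * s"] by simp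
    have "(LINT t|lborel. \<psi>' t * (e (G t) \<bullet> e w))
        = (LINT t|lborel. deriv \<theta> t * (e (G t) \<bullet> e w)) + (LINT t|lborel. deriv \<theta> (2 * s - t) * (e (G t) \<bullet> e w))"
      unfolding \<psi>'_def distrib_right
      by (intro Bochner_Integration.integral_add prod sq eG sq_int_reflect)
    also have "\<dots> = (LINT t|lborel. deriv \<theta> t * (e (G t) \<bullet> e w)) + (LINT t|lborel. deriv \<theta> t * (e (G (2 * s - t)) \<bullet> e w))"
      by (subst refl1) rule
    also have "\<dots> = (LINT t|lborel. deriv \<theta> t * (e (G t) \<bullet> e w) + deriv \<theta> t * (e (G (2 * s - t)) \<bullet> e w))"
      by (intro Bochner_Integration.integral_add[symmetric] prod sq eG sq_int_reflect[OF eG])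
    also have "\<dots> = (LINT t|lborel. deriv \<theta> t * (e (v2 t) \<bullet> e w))"
      by (simp add: v2_def e.add inner_add_left distrib_left)
    finally have 1: "(LINT t|lborel. \<psi>' t * (e (G t) \<bullet> e w)) = (LINT t|lborel. deriv \<theta> t * (e (v2 t) \<bullet> e w))" .
    have "(LINT t|lborel. \<psi> t * (H t \<bullet> w))
        = (LINT t|lborel. \<theta> t * (H t \<bullet> w)) - (LINT t|lborel. \<theta> (2 * s - t) * (H t \<bullet> w))"
      unfolding \<psi>_def left_diff_distrib
      by (intro Bochner_Integration.integral_diff prod sq Hw sq_int_reflect)
    also have "\<dots> = (LINT t|lborel. \<theta> t * (H t \<bullet> w)) - (LINT t|lborel. \<theta> t * (H (2 * s - t) \<bullet> w))"
      by (subst refl1) rule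
    also have "\<dots> = (LINT t|lborel. \<theta> t * (H t \<bullet> w) - \<theta> t * (H (2 * s - t) \<bullet> w))"
      by (intro Bochner_Integration.integral_diff[symmetric] prod sq Hw sq_int_reflect[OF Hw])
    also have "\<dots> = (LINT t|lborel. - (\<theta> t * (r t \<bullet> w)))"
      by (simp add: r_def inner_diff_left right_diff_distrib)
    also have "\<dots> = - (LINT t|lborel. \<theta> t * (r t \<bullet> w))" by simp
    finally show ?thesis using eq 1 by simp
  qed
  obtain u where u: "continuous_on UNIV u" "AE t in lborel. u t = e (v2 t)"
  proof (rule weak_derivative_energy[OF e v2 r open_UNIV subset_UNIV reflected])
    fix u assume "continuous_on UNIV u" "AE t in lborel. t \<in> UNIV \<longrightarrow> u t = e (v2 t)"
    then show thesis by (intro that[of u]) simp_all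
  qed
  have um[measurable]: "u \<in> borel_measurable borel" by (rule borel_measurable_continuous_onI[OF u(1)])
  have v2G: "v2 t = G t" if "s < t" for t using that by (simp add: v2_def G_def)
  have uG: "AE t in lborel. indicator {s<..} t *\<^sub>R u t = e (G t)"
    using u(2) by eventually_elim (auto simp: indicator_def v2G G_def e.zero)
  have init: "u s \<bullet> e w = f \<bullet> e w" for w
  proof (rule LIMSEQ_unique)
    \<comment> \<open>All these functions equal 1 at \<open>s\<close> and their supports in
      \<open>{s<..}\<close> shrink to \<open>s\<close>. The term with \<open>H\<close> tends to zero
      by dominated convergence, while the term with the derivative tends to
      \<open>u s \<bullet> e w\<close>.\<close>
    define \<theta> where "\<theta> n t = (max 0 (1 - (t - s) * real (Suc n)))\<^sup>2" for n t
    define \<theta>' where "\<theta>' n t = - (2 * real (Suc n) * max 0 (1 - (t - s) * real (Suc n)))" for n t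
    have \<theta>1: "\<theta> n t = 0" "\<theta>' n t = 0" if "s + 1 \<le> t" for n t
    proof -
      have "1 * 1 \<le> (t - s) * real (Suc n)" using that by (intro mult_mono) auto
      then show "\<theta> n t = 0" "\<theta>' n t = 0" by (auto simp: \<theta>_def \<theta>'_def max_def)
    qed
    have c\<theta>': "continuous_on UNIV (\<theta>' n)" for n unfolding \<theta>'_def by (intro continuous_intros)
    have w1: "(LINT t|lborel. \<theta> n t * (H t \<bullet> w) - \<theta>' n t * (e (G t) \<bullet> e w)) = f \<bullet> e w" for n
    proof -
      have "(LINT t|lborel. indicator {s<..} t * (\<theta> n t * B t (g t) w - \<theta>' n t * (e (g t) \<bullet> e w))) = \<theta> n s * (f \<bullet> e w)"
      proof (rule weak[OF _ c\<theta>' \<theta>1(1)])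
        show "(\<theta> n has_real_derivative \<theta>' n t) (at t)" for t
        proof -
          have "((\<lambda>t. 1 - (t - s) * real (Suc n)) has_real_derivative - real (Suc n)) (at t)"
            by (auto intro!: derivative_eq_intros)
          from DERIV_chain2[OF max_zero_square_deriv this] show ?thesis
            unfolding \<theta>_def[abs_def] by (rule DERIV_cong) (simp only: \<theta>'_def mult_minus_right mult_ac)
        qed
      qed
      then show ?thesis unfolding GH by (simp add: \<theta>_def)
    qed
    have i1: "integrable lborel (\<lambda>t. \<theta> n t * (H t \<bullet> w))" "integrable lborel (\<lambda>t. \<theta>' n t * (e (G t) \<bullet> e w))" for n
    proof -
      \<comment> \<open>To the left of \<open>s\<close> the functions grow; there \<open>G\<close>
        and \<open>H\<close> vanish, so a cut-off to \<open>{s..s + 1}\<close> changes no product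
        and restores square integrability.\<close>
      define cut where "cut p t = indicator {s..s + 1} t *\<^sub>R p t" for p :: "real \<Rightarrow> real" and t
      have sqc: "sq_int lborel (cut p)" if p: "continuous_on UNIV p" for p
        unfolding sq_int_def
      proof
        have [measurable]: "p \<in> borel_measurable borel" by (rule borel_measurable_continuous_onI[OF p])
        show "cut p \<in> borel_measurable lborel" unfolding cut_def[abs_def] by measurable
        have "integrable lborel (\<lambda>t. indicator {s..s + 1} t *\<^sub>R (norm (p t))\<^sup>2)"
          by (intro borel_integrable_compact compact_Icc continuous_intros continuous_on_subset[OF p]) auto
        then show "integrable lborel (\<lambda>t. (norm (cut p t))\<^sup>2)"
          by (rule Bochner_Integration.integrable_cong[THEN iffD1, rotated -1]) (auto simp: cut_def indicator_def)
      qed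
      have "continuous_on UNIV (\<theta> n)" unfolding \<theta>_def by (intro continuous_intros)
      from prod[OF sqc[OF this] Hw, of w]
      show "integrable lborel (\<lambda>t. \<theta> n t * (H t \<bullet> w))"
        by (rule Bochner_Integration.integrable_cong[THEN iffD1, rotated -1])
           (auto simp: cut_def H_def \<theta>1 indicator_def)
      from prod[OF sqc[OF c\<theta>'] eG, of n w]
      show "integrable lborel (\<lambda>t. \<theta>' n t * (e (G t) \<bullet> e w))"
        by (rule Bochner_Integration.integrable_cong[THEN iffD1, rotated -1])
           (auto simp: cut_def G_def \<theta>1 indicator_def e.zero)
    qed
    have lim1: "(\<lambda>n. LINT t|lborel. \<theta> n t * (H t \<bullet> w)) \<longlonglongrightarrow> (LINT t|(lborel::real measure). 0)"
    proof (rule integral_dominated_convergence[where w = "\<lambda>t. \<bar>indicator {s..s + 1} t *\<^sub>R (H t \<bullet> w)\<bar>"])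
      show "integrable lborel (\<lambda>t. \<bar>indicator {s..s + 1} t *\<^sub>R (H t \<bullet> w)\<bar>)"
        by (intro integrable_abs sq_int_integrable_finite[OF Hw]) (auto simp: emeasure_lborel_Icc_eq)
      show "AE t in lborel. norm (\<theta> n t * (H t \<bullet> w)) \<le> \<bar>indicator {s..s + 1} t *\<^sub>R (H t \<bullet> w)\<bar>" for n
      proof (intro AE_I2)
        fix t
        show "norm (\<theta> n t * (H t \<bullet> w)) \<le> \<bar>indicator {s..s + 1} t *\<^sub>R (H t \<bullet> w)\<bar>"
        proof (cases "s < t \<and> t < s + 1")
          case True
          then have "max 0 (1 - (t - s) * real (Suc n)) \<le> 1" by simp
          then have "\<theta> n t \<le> 1" unfolding \<theta>_def by (intro power_le_one) auto
          moreover have "\<theta> n t \<ge> 0" by (simp add: \<theta>_def)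
          ultimately show ?thesis using True by (simp add: abs_mult mult_left_le_one_le)
        next
          case False
          then show ?thesis using \<theta>1(1)[of t n] by (auto simp: H_def indicator_def)
        qed
      qed
      show "AE t in lborel. (\<lambda>n. \<theta> n t * (H t \<bullet> w)) \<longlonglongrightarrow> 0"
      proof (intro AE_I2)
        fix t
        show "(\<lambda>n. \<theta> n t * (H t \<bullet> w)) \<longlonglongrightarrow> 0"
        proof (cases "s < t")
          case True
          obtain N :: nat where N: "1 / (t - s) \<le> real N" using real_arch_simple by blast
          have "\<forall>\<^sub>F n in sequentially. \<theta> n t * (H t \<bullet> w) = 0"
            using eventually_ge_at_top[of N]
          proof eventually_elim
            case (elim n)
            then have "1 / (t - s) \<le> real (Suc n)" using N by linarith
            then have "1 \<le> (t - s) * real (Suc n)" using True by (simp add: field_simps)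
            then show ?case by (simp add: \<theta>_def max_def)
          qed
          then show ?thesis by (rule tendsto_eventually)
        qed (simp add: H_def)
      qed
      show "(\<lambda>t. \<theta> n t * (H t \<bullet> w)) \<in> borel_measurable lborel" for n
        using i1(1) by (rule borel_measurable_integrable)
    qed simp
    have eq2: "- (LINT t|lborel. \<theta>' n t * (e (G t) \<bullet> e w))
        = (LINT t|lborel. indicator {s<..} t * ((2 * real (Suc n) * max 0 (1 - (t - s) * real (Suc n))) * (u t \<bullet> e w)))" for n
    proof -
      have "(LINT t|lborel. - (\<theta>' n t * (e (G t) \<bullet> e w)))
        = (LINT t|lborel. indicator {s<..} t * ((2 * real (Suc n) * max 0 (1 - (t - s) * real (Suc n))) * (u t \<bullet> e w)))"
      proof (rule integral_cong_AE)
        show "(\<lambda>t. - (\<theta>' n t * (e (G t) \<bullet> e w))) \<in> borel_measurable lborel"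
          using i1(2)[of n] by (intro borel_measurable_uminus borel_measurable_integrable)
        show "AE t in lborel. - (\<theta>' n t * (e (G t) \<bullet> e w))
          = indicator {s<..} t * ((2 * real (Suc n) * max 0 (1 - (t - s) * real (Suc n))) * (u t \<bullet> e w))"
          using uG
        proof eventually_elim
          case (elim t)
          show ?case unfolding elim[symmetric] \<theta>'_def by (simp add: mult_ac)
        qed
      qed measurable
      then show ?thesis by simp
    qed
    have "(\<lambda>n. (LINT t|lborel. \<theta> n t * (H t \<bullet> w)) + - (LINT t|lborel. \<theta>' n t * (e (G t) \<bullet> e w))) \<longlonglongrightarrow> 0 + u s \<bullet> e w"
      unfolding eq2 using lim1
      by (intro tendsto_add initial_layer_limit continuous_intros u(1)) simp
    moreover have "(LINT t|lborel. \<theta> n t * (H t \<bullet> w)) + - (LINT t|lborel. \<theta>' n t * (e (G t) \<bullet> e w)) = f \<bullet> e w" for n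
      using w1[of n] Bochner_Integration.integral_diff[OF i1(1)[of n] i1(2)[of n]] by simp
    ultimately show "(\<lambda>n::nat. f \<bullet> e w) \<longlonglongrightarrow> u s \<bullet> e w" by simp
  qed (rule tendsto_const)
  \<comment> \<open>The vectors \<open>e w\<close> are dense, and the orthogonal complement of a
    vector is closed.\<close>
  have us: "u s = f"
  proof -
    have "closure (range e) \<subseteq> {x. (u s - f) \<bullet> x = 0}"
      using init by (intro closure_minimal closed_hyperplane) (auto simp: inner_diff_left)
    then have "(u s - f) \<bullet> (u s - f) = 0" unfolding dense by blast
    then show ?thesis by simp
  qed
  \<comment> \<open>Testing the shifted equation with \<open>exp (t - s) * \<theta> t\<close>
    produces an extra term from the derivative of the exponential, which is the one that subtracts
    \<open>e (v t) \<bullet> e w\<close>.\<close>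
  define v where "v t = exp (t - s) *\<^sub>R g t" for t
  show ?thesis
  proof (rule that[of "\<lambda>t. exp (t - s) *\<^sub>R u t" v])
    show "continuous_on {s..} (\<lambda>t. exp (t - s) *\<^sub>R u t)"
      by (intro continuous_intros continuous_on_subset[OF u(1)]) auto
    show "exp (s - s) *\<^sub>R u s = f" using us by simp
    show vm: "v \<in> borel_measurable borel" unfolding v_def[abs_def] by measurable
    show "integrable lborel (\<lambda>t. indicator {s<..<b} t * (norm (v t))\<^sup>2)" for b
    proof (rule Bochner_Integration.integrable_bound)
      show "integrable lborel (\<lambda>t. (exp (b - s))\<^sup>2 * (norm (g t))\<^sup>2)"
        using sq_intD(2)[OF g] by simp
      show "AE t in lborel. norm (indicator {s<..<b} t * (norm (v t))\<^sup>2) \<le> norm ((exp (b - s))\<^sup>2 * (norm (g t))\<^sup>2)"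
      proof (intro AE_I2)
        fix t
        show "norm (indicator {s<..<b} t * (norm (v t))\<^sup>2) \<le> norm ((exp (b - s))\<^sup>2 * (norm (g t))\<^sup>2)"
        proof (cases "t \<in> {s<..<b}")
          case True
          then have "(exp (t - s))\<^sup>2 \<le> (exp (b - s))\<^sup>2" by (intro power_mono) auto
          then show ?thesis using True by (simp add: v_def power_mult_distrib mult_right_mono)
        qed simp
      qed
    qed (use vm in measurable)
    show "AE t in lborel. s < t \<longrightarrow> exp (t - s) *\<^sub>R u t = e (v t)"
      using uG by eventually_elim (auto simp: v_def e.scaleR G_def)
    show "(LINT t|lborel. indicator {s<..} t * (deriv \<theta> t * (e (v t) \<bullet> e w)))
        = (LINT t|lborel. indicator {s<..} t * (\<theta> t * (B t (v t) w - e (v t) \<bullet> e w)))"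
      if \<theta>: "test_fun {s<..} \<theta>" for \<theta> w
    proof -
      note tf = test_fun_real[OF \<theta>]
      obtain R where R: "\<And>t. R \<le> \<bar>t\<bar> \<Longrightarrow> \<theta> t = 0 \<and> deriv \<theta> t = 0" using tf(5) by blast
      define E where "E t = exp (t - s)" for t
      have cE: "continuous_on UNIV E" unfolding E_def by (intro continuous_intros)
      have sq: "sq_int lborel (\<lambda>t. E t * \<theta> t)" "sq_int lborel (\<lambda>t. E t * deriv \<theta> t)"
        by (rule sq_int_continuous_compact[where R = R], intro continuous_on_mult cE tf, simp add: R)+
      have "(LINT t|lborel. indicator {s<..} t * ((E t * \<theta> t) * B t (g t) w
          - (E t * \<theta> t + E t * deriv \<theta> t) * (e (g t) \<bullet> e w))) = (E s * \<theta> s) * (f \<bullet> e w)"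
      proof (rule weak)
        show "((\<lambda>t. E t * \<theta> t) has_real_derivative E t * \<theta> t + E t * deriv \<theta> t) (at t)" for t
          unfolding E_def by (auto intro!: derivative_eq_intros tf)
        show "continuous_on UNIV (\<lambda>t. E t * \<theta> t + E t * deriv \<theta> t)" by (intro continuous_intros cE tf)
        show "E t * \<theta> t = 0" if "\<bar>R\<bar> \<le> t" for t using R[of t] that by simp
      qed
      then have "(LINT t|lborel. ((E t * \<theta> t) * (H t \<bullet> w) - (E t * \<theta> t) * (e (G t) \<bullet> e w))
          - (E t * deriv \<theta> t) * (e (G t) \<bullet> e w)) = 0"
        unfolding GH using tf(4)[of s] by (simp add: algebra_simps)
      then have eq: "(LINT t|lborel. (E t * \<theta> t) * (H t \<bullet> w) - (E t * \<theta> t) * (e (G t) \<bullet> e w))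
          = (LINT t|lborel. (E t * deriv \<theta> t) * (e (G t) \<bullet> e w))"
        using Bochner_Integration.integral_diff[OF Bochner_Integration.integrable_diff[OF
            prod[OF sq(1) Hw] prod[OF sq(1) eG]] prod[OF sq(2) eG], of w w w] by simp
      have "(LINT t|lborel. indicator {s<..} t * (deriv \<theta> t * (e (v t) \<bullet> e w)))
          = (LINT t|lborel. (E t * deriv \<theta> t) * (e (G t) \<bullet> e w))"
        by (intro Bochner_Integration.integral_cong) (auto simp: indicator_def v_def G_def E_def e.scaleR e.zero)
      also have "\<dots> = (LINT t|lborel. (E t * \<theta> t) * (H t \<bullet> w) - (E t * \<theta> t) * (e (G t) \<bullet> e w))"
        by (rule eq[symmetric])
      also have "\<dots> = (LINT t|lborel. indicator {s<..} t * (\<theta> t * (B t (v t) w - e (v t) \<bullet> e w)))"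
        by (intro Bochner_Integration.integral_cong)
           (auto simp: indicator_def v_def G_def H_def E_def e.scaleR e.zero op scale_left algebra_simps)
      finally show ?thesis .
    qed
  qed
qed

end

section \<open>The propagator of a dissipative family\<close>

lemma test_fun_deriv_zero:
  fixes \<theta> :: "real \<Rightarrow> real"
  assumes "test_fun I \<theta>" "t \<notin> I"
  shows "deriv \<theta> t = 0"
proof -
  have "t \<in> - closure {x. \<theta> x \<noteq> 0}" using assms by (auto simp: test_fun_def)
  moreover have "\<theta> x = 0" if "x \<in> - closure {x. \<theta> x \<noteq> 0}" for x
    using that closure_subset[of "{x. \<theta> x \<noteq> 0}"] by auto
  ultimately have "(\<theta> has_real_derivative 0) (at t)"
  proof -
    assume t: "t \<in> - closure {x. \<theta> x \<noteq> 0}" and z: "\<And>x. x \<in> - closure {x. \<theta> x \<noteq> 0} \<Longrightarrow> \<theta> x = 0"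
    show "(\<theta> has_real_derivative 0) (at t)"
      by (rule has_field_derivative_transform_within_open[OF DERIV_const open_Compl[OF closed_closure] t]) (rule z[symmetric])
  qed
  then show ?thesis by (rule DERIV_imp_deriv)
qed

lemma continuous_AE_eq_open:
  fixes f g :: "real \<Rightarrow> 'b::t2_space"
  assumes I: "open I" and f: "continuous_on I f" and g: "continuous_on I g"
    and ae: "AE t in lborel. t \<in> I \<longrightarrow> f t = g t" and t: "t \<in> I"
  shows "f t = g t"
proof (rule ccontr)
  assume ne: "f t \<noteq> g t"
  have "open {x \<in> I. f x \<noteq> g x}"
  proof -
    have "continuous_on I (\<lambda>x. (f x, g x))" by (intro continuous_intros f g)
    moreover have "open {p. fst p \<noteq> (snd p :: 'b)}" using open_diagonal_complement by (simp add: case_prod_beta')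
    ultimately have "open ((\<lambda>x. (f x, g x)) -` {p. fst p \<noteq> snd p} \<inter> I)"
      using I continuous_on_open_vimage by blast
    moreover have "(\<lambda>x. (f x, g x)) -` {p. fst p \<noteq> snd p} \<inter> I = {x \<in> I. f x \<noteq> g x}" by auto
    ultimately show ?thesis by simp
  qed
  then obtain d where d: "d > 0" "ball t d \<subseteq> {x \<in> I. f x \<noteq> g x}"
    using t ne openE[of "{x \<in> I. f x \<noteq> g x}" t] by blast
  have "AE x in lborel. x \<notin> ball t d" using ae by eventually_elim (use d(2) in auto)
  then have "emeasure lborel {x \<in> space lborel. \<not> x \<notin> ball t d} = 0"
    by (intro AE_E2) auto
  moreover have "{x \<in> space lborel. \<not> x \<notin> ball t d} = {t - d<..<t + d}"
    by (auto simp: ball_eq_greaterThanLessThan)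
  ultimately show False using d(1) by simp
qed

lemma sq_int_bounded_linear_indicator:
  "bounded_linear h \<Longrightarrow> sq_int M (\<lambda>t. indicator A t *\<^sub>R v t) \<Longrightarrow> sq_int M (\<lambda>t. indicator A t *\<^sub>R h (v t))"
  using sq_int_bounded_linear[of M "\<lambda>t. indicator A t *\<^sub>R v t" h] by (simp add: linear_simps)

text \<open>\<open>g\<close> stands for the gradient. The assumption says that the form without the
  added inner product dominates half of \<open>(norm (g u))^2\<close>; since the energy equality
  carries a factor 2, the energy inequality gets coefficient one.\<close>

locale dissipative_family = coercive_family e B M c
  for e :: "'v::{real_inner, banach, second_countable_topology} \<Rightarrow> 'h::{real_inner, banach, second_countable_topology}"
    and B :: "real \<Rightarrow> 'v \<Rightarrow> 'v \<Rightarrow> real" and M c :: real +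
  fixes g :: "'v \<Rightarrow> 'g::real_normed_vector"
  assumes bounded_linear_g: "bounded_linear g"
    and dissipative: "(norm (g u))\<^sup>2 \<le> 2 * (B t u u - (norm (e u))\<^sup>2)"
begin

text \<open>The generator belongs to the unshifted form: \<open>B\<close> is coercive only because it contains the
  inner product of \<open>'h\<close>.\<close>

definition gen :: "real \<Rightarrow> 'v \<Rightarrow> 'v" where "gen t u = op t u - S u"

lemma gen: "gen t u \<bullet> w = B t u w - e u \<bullet> e w"
  by (simp add: gen_def inner_diff_left op S)

lemma gen_add: "gen t (u + u') = gen t u + gen t u'"
  by (rule eq_of_inner_eq) (simp add: gen inner_add_left add_left e.add)

lemma gen_scale: "gen t (x *\<^sub>R u) = x *\<^sub>R gen t u"
  by (rule eq_of_inner_eq) (simp add: gen scale_left e.scaleR algebra_simps)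

lemma norm_gen: "\<exists>K. \<forall>t u. norm (gen t u) \<le> K * norm u"
proof -
  obtain K where K: "\<And>x. norm (S x) \<le> K * norm x" using norm_S by blast
  have "norm (gen t u) \<le> (\<bar>M\<bar> + K) * norm u" for t u
    unfolding gen_def using norm_triangle_ineq4[of "op t u" "S u"] norm_op[of t u] K[of u]
    by (simp add: algebra_simps)
  then show ?thesis by blast
qed

lemma gen_measurable: "\<phi> \<in> borel_measurable borel \<Longrightarrow> (\<lambda>t. gen t (\<phi> t)) \<in> borel_measurable borel"
  unfolding gen_def by (intro borel_measurable_diff op_measurable S_measurable)

text \<open>The working notion of solution: \<open>v\<close> is a Borel function defined everywhere,
  all integrals are over \<open>lborel\<close>, and the derivative has already been replaced by
  \<open>- gen t (v t)\<close>, which explains the equal signs on both sides of the weak identity.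
  The classes of the Cauchy problem are compared with it at the end.\<close>

definition solution :: "real \<Rightarrow> 'h \<Rightarrow> (real \<Rightarrow> 'h) \<Rightarrow> (real \<Rightarrow> 'v) \<Rightarrow> bool" where
  "solution s f u v \<longleftrightarrow> continuous_on {s..} u \<and> u s = f \<and> v \<in> borel_measurable borel \<and>
     (\<forall>b. sq_int lborel (\<lambda>t. indicator {s<..<b} t *\<^sub>R v t)) \<and>
     (AE t in lborel. s < t \<longrightarrow> u t = e (v t)) \<and>
     (\<forall>b \<theta> w. test_fun {s<..<b} \<theta> \<longrightarrow>
       (LINT t|lborel. indicator {s<..<b} t * (deriv \<theta> t * (e (v t) \<bullet> e w)))
       = (LINT t|lborel. indicator {s<..<b} t * (\<theta> t * (gen t (v t) \<bullet> w))))"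

lemma solutionD:
  assumes "solution s f u v"
  shows "continuous_on {s..} u" "u s = f" "v \<in> borel_measurable borel"
    "sq_int lborel (\<lambda>t. indicator {s<..<b} t *\<^sub>R v t)"
    "AE t in lborel. s < t \<longrightarrow> u t = e (v t)"
    "test_fun {s<..<b} \<theta> \<Longrightarrow>
       (LINT t|lborel. indicator {s<..<b} t * (deriv \<theta> t * (e (v t) \<bullet> e w)))
       = (LINT t|lborel. indicator {s<..<b} t * (\<theta> t * (gen t (v t) \<bullet> w)))"
  using assms by (auto simp: solution_def)

lemma sq_int_gen:
  assumes v: "v \<in> borel_measurable borel" and "sq_int lborel (\<lambda>t. indicator A t *\<^sub>R v t)" and A: "A \<in> sets borel"
  shows "sq_int lborel (\<lambda>t. indicator A t *\<^sub>R gen t (v t))"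
proof -
  obtain K where K: "\<And>t u. norm (gen t u) \<le> K * norm u" using norm_gen by blast
  show ?thesis
  proof (rule sq_int_bound[OF assms(2), where C = K])
    show "(\<lambda>t. indicator A t *\<^sub>R gen t (v t)) \<in> borel_measurable lborel"
      using gen_measurable[OF v] A by measurable
    show "norm (indicator A t *\<^sub>R gen t (v t)) \<le> K * norm (indicator A t *\<^sub>R v t)" for t
      using K[of t "v t"] by (auto simp: indicator_def)
  qed
qed

lemma test_integrable:
  assumes v: "v \<in> borel_measurable borel" "sq_int lborel (\<lambda>t. indicator {s<..<b} t *\<^sub>R v t)" and \<theta>: "test_fun I \<theta>"
  shows "integrable lborel (\<lambda>t. indicator {s<..<b} t * (deriv \<theta> t * (e (v t) \<bullet> e w)))"
    "integrable lborel (\<lambda>t. indicator {s<..<b} t * (\<theta> t * (gen t (v t) \<bullet> w)))"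
proof -
  obtain R where R: "\<And>t. R \<le> \<bar>t\<bar> \<Longrightarrow> \<theta> t = 0 \<and> deriv \<theta> t = 0" using test_fun_real(5)[OF \<theta>] by blast
  have p: "sq_int lborel \<theta>" "sq_int lborel (deriv \<theta>)"
    by (rule sq_int_continuous_compact[where R = R], use R test_fun_real(2,3)[OF \<theta>] in auto)+
  have pw: "sq_int lborel (\<lambda>t. p t *\<^sub>R y)" if "sq_int lborel p" for p :: "real \<Rightarrow> real" and y :: "'k::{real_inner, banach, second_countable_topology}"
    by (rule sq_int_bound[OF that, where C = "norm y"]) (use sq_intD(1)[OF that] in \<open>auto intro!: borel_measurable_scaleR\<close>)
  from sq_int_inner[OF sq_int_bounded_linear_indicator[OF e v(2)] pw[OF p(2)], of "e w"]
  show "integrable lborel (\<lambda>t. indicator {s<..<b} t * (deriv \<theta> t * (e (v t) \<bullet> e w)))" by (simp add: mult_ac)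
  from sq_int_inner[OF sq_int_gen[OF v] pw[OF p(1)], of w]
  show "integrable lborel (\<lambda>t. indicator {s<..<b} t * (\<theta> t * (gen t (v t) \<bullet> w)))" by (simp add: mult_ac)
qed

lemma solution_combination:
  assumes 1: "solution s f1 u1 v1" and 2: "solution s f2 u2 v2"
  shows "solution s (f1 + x *\<^sub>R f2) (\<lambda>t. u1 t + x *\<^sub>R u2 t) (\<lambda>t. v1 t + x *\<^sub>R v2 t)"
  unfolding solution_def
proof (intro conjI allI impI)
  show "continuous_on {s..} (\<lambda>t. u1 t + x *\<^sub>R u2 t)"
    by (intro continuous_intros solutionD(1)[OF 1] solutionD(1)[OF 2])
  show "u1 s + x *\<^sub>R u2 s = f1 + x *\<^sub>R f2" by (simp add: solutionD(2)[OF 1] solutionD(2)[OF 2])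
  show "(\<lambda>t. v1 t + x *\<^sub>R v2 t) \<in> borel_measurable borel"
    using solutionD(3)[OF 1] solutionD(3)[OF 2] by measurable
  show "sq_int lborel (\<lambda>t. indicator {s<..<b} t *\<^sub>R (v1 t + x *\<^sub>R v2 t))" for b
    using sq_int_add[OF solutionD(4)[OF 1, of b] sq_int_scaleR[OF solutionD(4)[OF 2, of b], of x]]
    by (simp add: scaleR_add_right mult.commute)
  show "AE t in lborel. s < t \<longrightarrow> u1 t + x *\<^sub>R u2 t = e (v1 t + x *\<^sub>R v2 t)"
    using solutionD(5)[OF 1] solutionD(5)[OF 2] by eventually_elim (simp add: e.add e.scaleR)
  fix b and \<theta> :: "real \<Rightarrow> real" and w assume \<theta>: "test_fun {s<..<b} \<theta>"
  note int1 = test_integrable[OF solutionD(3)[OF 1] solutionD(4)[OF 1, of b] \<theta>, of w]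
  note int2 = test_integrable[OF solutionD(3)[OF 2] solutionD(4)[OF 2, of b] \<theta>, of w]
  have "(LINT t|lborel. indicator {s<..<b} t * (deriv \<theta> t * (e (v1 t + x *\<^sub>R v2 t) \<bullet> e w)))
      = (LINT t|lborel. indicator {s<..<b} t * (deriv \<theta> t * (e (v1 t) \<bullet> e w))
          + x * (indicator {s<..<b} t * (deriv \<theta> t * (e (v2 t) \<bullet> e w))))"
    by (simp add: e.add e.scaleR inner_add_left algebra_simps)
  also have "\<dots> = (LINT t|lborel. indicator {s<..<b} t * (\<theta> t * (gen t (v1 t) \<bullet> w))
          + x * (indicator {s<..<b} t * (\<theta> t * (gen t (v2 t) \<bullet> w))))"
    using int1 int2 by (simp add: solutionD(6)[OF 1 \<theta>] solutionD(6)[OF 2 \<theta>])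
  also have "\<dots> = (LINT t|lborel. indicator {s<..<b} t * (\<theta> t * (gen t (v1 t + x *\<^sub>R v2 t) \<bullet> w)))"
    by (simp add: gen_add gen_scale inner_add_left algebra_simps)
  finally show "(LINT t|lborel. indicator {s<..<b} t * (deriv \<theta> t * (e (v1 t + x *\<^sub>R v2 t) \<bullet> e w)))
      = (LINT t|lborel. indicator {s<..<b} t * (\<theta> t * (gen t (v1 t + x *\<^sub>R v2 t) \<bullet> w)))" .
qed

lemma solution_restrict:
  assumes sol: "solution s f u v" and \<tau>: "s \<le> \<tau>"
  shows "solution \<tau> (u \<tau>) u v"
  unfolding solution_def
proof (intro conjI allI impI)
  show "continuous_on {\<tau>..} u" using continuous_on_subset[OF solutionD(1)[OF sol]] \<tau> by auto
  show "v \<in> borel_measurable borel" by (rule solutionD(3)[OF sol])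
  show "sq_int lborel (\<lambda>t. indicator {\<tau><..<b} t *\<^sub>R v t)" for b
  proof -
    have "(\<lambda>t. indicator {\<tau><..<b} t *\<^sub>R v t) = (\<lambda>t. indicator {\<tau><..<b} t *\<^sub>R (indicator {s<..<b} t *\<^sub>R v t))"
      using \<tau> by (auto simp: indicator_def)
    then show ?thesis using sq_int_indicator[OF solutionD(4)[OF sol, of b], of "{\<tau><..<b}"] by simp
  qed
  show "AE t in lborel. \<tau> < t \<longrightarrow> u t = e (v t)"
    using solutionD(5)[OF sol] by eventually_elim (use \<tau> in auto)
  fix b and \<theta> :: "real \<Rightarrow> real" and w assume \<theta>: "test_fun {\<tau><..<b} \<theta>"
  then have \<theta>': "test_fun {s<..<b} \<theta>" using \<tau> unfolding test_fun_def by (auto dest: subsetD)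
  have *: "indicator {\<tau><..<b} t * (deriv \<theta> t * y) = indicator {s<..<b} t * (deriv \<theta> t * y)"
    "indicator {\<tau><..<b} t * (\<theta> t * y) = indicator {s<..<b} t * (\<theta> t * y)" for t y
    using test_fun_deriv_zero[OF \<theta>, of t] test_fun_real(4)[OF \<theta>, of t] \<tau> by (auto simp: indicator_def)
  then show "(LINT t|lborel. indicator {\<tau><..<b} t * (deriv \<theta> t * (e (v t) \<bullet> e w)))
      = (LINT t|lborel. indicator {\<tau><..<b} t * (\<theta> t * (gen t (v t) \<bullet> w)))"
    using solutionD(6)[OF sol \<theta>', of w] by (simp only: *)
qed simp

lemma solution_ex: "\<exists>u v. solution s f u v"
proof -
  obtain u v where uv: "continuous_on {s..} u" "u s = f" "v \<in> borel_measurable borel"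
    "\<And>b. integrable lborel (\<lambda>t. indicator {s<..<b} t * (norm (v t))\<^sup>2)"
    "AE t in lborel. s < t \<longrightarrow> u t = e (v t)"
    and weak: "\<And>\<theta> w. test_fun {s<..} \<theta> \<Longrightarrow>
      (LINT t|lborel. indicator {s<..} t * (deriv \<theta> t * (e (v t) \<bullet> e w)))
      = (LINT t|lborel. indicator {s<..} t * (\<theta> t * (B t (v t) w - e (v t) \<bullet> e w)))"
    by (rule solution_exists[where f = f and s = s]) (rule that)
  have "solution s f u v"
    unfolding solution_def
  proof (intro conjI allI impI uv)
    fix b
    have "(\<lambda>t. (norm (indicator {s<..<b} t *\<^sub>R v t))\<^sup>2) = (\<lambda>t. indicator {s<..<b} t * (norm (v t))\<^sup>2)"
      by (auto simp: indicator_def)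
    moreover have "(\<lambda>t. indicator {s<..<b} t *\<^sub>R v t) \<in> borel_measurable lborel" using uv(3) by measurable
    ultimately show "sq_int lborel (\<lambda>t. indicator {s<..<b} t *\<^sub>R v t)"
      using uv(4)[of b] by (simp add: sq_int_def)
    fix \<theta> :: "real \<Rightarrow> real" and w assume \<theta>: "test_fun {s<..<b} \<theta>"
    then have \<theta>': "test_fun {s<..} \<theta>" unfolding test_fun_def by (auto dest: subsetD)
    have *: "indicator {s<..<b} t * (deriv \<theta> t * y) = indicator {s<..} t * (deriv \<theta> t * y)"
      "indicator {s<..<b} t * (\<theta> t * y) = indicator {s<..} t * (\<theta> t * y)" for t y
      using test_fun_deriv_zero[OF \<theta>, of t] test_fun_real(4)[OF \<theta>, of t] by (auto simp: indicator_def)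
    then show "(LINT t|lborel. indicator {s<..<b} t * (deriv \<theta> t * (e (v t) \<bullet> e w)))
        = (LINT t|lborel. indicator {s<..<b} t * (\<theta> t * (gen t (v t) \<bullet> w)))"
      using weak[OF \<theta>', of w] by (simp only: * gen)
  qed
  then show ?thesis by blast
qed

lemma integrable_g:
  assumes v: "v \<in> borel_measurable borel" and sq: "sq_int lborel (\<lambda>t. indicator A t *\<^sub>R v t)" and A: "A \<in> sets borel"
  shows "integrable lborel (\<lambda>t. indicator A t * (norm (g (v t)))\<^sup>2)"
proof -
  obtain K where K: "\<And>x. norm (g x) \<le> norm x * K" using bounded_linear.bounded[OF bounded_linear_g] by blast
  have "continuous_on UNIV (\<lambda>x. norm (g x))"
    by (intro continuous_on_norm linear_continuous_on bounded_linear_g)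
  from measurable_compose[OF v borel_measurable_continuous_onI[OF this]]
  have m: "(\<lambda>t. norm (g (v t))) \<in> borel_measurable borel" .
  show ?thesis
  proof (rule Bochner_Integration.integrable_bound)
    show "integrable lborel (\<lambda>t. K\<^sup>2 * (norm (indicator A t *\<^sub>R v t))\<^sup>2)"
      by (rule integrable_mult_right[OF sq_intD(2)[OF sq]])
    show "(\<lambda>t. indicator A t * (norm (g (v t)))\<^sup>2) \<in> borel_measurable lborel" using m A by measurable
    have "(norm (g (v t)))\<^sup>2 \<le> K\<^sup>2 * (norm (v t))\<^sup>2" for t
      using power_mono[OF K norm_ge_zero, of "v t" 2] by (simp add: power_mult_distrib mult.commute)
    then show "AE t in lborel. norm (indicator A t * (norm (g (v t)))\<^sup>2) \<le> norm (K\<^sup>2 * (norm (indicator A t *\<^sub>R v t))\<^sup>2)"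
      by (intro AE_I2) (auto simp: indicator_def)
  qed
qed

text \<open>The energy equality holds between interior times of an open interval. It is used from
  \<open>t1 > s\<close> to \<open>t\<close>, dissipativity bounds the right hand side, and
  \<open>t1\<close> is sent to \<open>s\<close> using continuity of \<open>u\<close> at
  \<open>s\<close>.\<close>

lemma solution_energy:
  assumes sol: "solution s f u v" and t: "s \<le> t"
  shows "(norm (u t))\<^sup>2 + (LINT \<tau>|lborel. indicator {s<..t} \<tau> * (norm (g (v \<tau>)))\<^sup>2) \<le> (norm f)\<^sup>2"
proof (cases "t = s")
  case True
  then show ?thesis by (simp add: solutionD(2)[OF sol])
next
  case False
  then have st: "s < t" using t by simp
  \<comment> \<open>Any end beyond \<open>t\<close> would do; it makes \<open>t\<close> an interior
    point.\<close>
  define b where "b = t + 1"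
  define I where "I = {s<..<b}"
  define v' where "v' \<tau> = indicator I \<tau> *\<^sub>R v \<tau>" for \<tau>
  define r where "r \<tau> = - (indicator I \<tau> *\<^sub>R gen \<tau> (v \<tau>))" for \<tau>
  have sv: "sq_int lborel v'" unfolding v'_def[abs_def] I_def by (rule solutionD(4)[OF sol])
  have sr: "sq_int lborel r"
    using sq_int_scaleR[OF sq_int_gen[OF solutionD(3,4)[OF sol], of b], of "-1"] by (simp add: r_def[abs_def] I_def)
  have ev': "e (v' \<tau>) = indicator I \<tau> *\<^sub>R e (v \<tau>)" for \<tau> by (simp add: v'_def e.scaleR)
  have weak: "(LINT \<tau>|lborel. deriv \<theta> \<tau> * (e (v' \<tau>) \<bullet> e w)) = - (LINT \<tau>|lborel. \<theta> \<tau> * (r \<tau> \<bullet> w))"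
    if "test_fun I \<theta>" for \<theta> w
    using solutionD(6)[OF sol that[unfolded I_def], of w]
    by (simp add: ev' r_def mult.left_commute[of "indicator I _"] flip: I_def)
  obtain u0 where u0: "continuous_on I u0" "AE \<tau> in lborel. \<tau> \<in> I \<longrightarrow> u0 \<tau> = e (v' \<tau>)"
    and en: "\<And>t1 t2. t1 \<in> I \<Longrightarrow> t2 \<in> I \<Longrightarrow> t1 \<le> t2 \<Longrightarrow>
      (norm (u0 t2))\<^sup>2 - (norm (u0 t1))\<^sup>2 = 2 * (LINT \<tau>|lborel. indicator {t1..t2} \<tau> * (r \<tau> \<bullet> v' \<tau>))"
  proof (rule weak_derivative_energy[of e v' r I])
    show "bounded_linear e" by (rule e)
    show "open I" by (simp add: I_def)
    show "{a..b} \<subseteq> I" if "a \<in> I" "b \<in> I" for a b using that by (auto simp: I_def)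
    fix u0 assume "continuous_on I u0" "AE \<tau> in lborel. \<tau> \<in> I \<longrightarrow> u0 \<tau> = e (v' \<tau>)"
      "\<And>t1 t2. t1 \<in> I \<Longrightarrow> t2 \<in> I \<Longrightarrow> t1 \<le> t2 \<Longrightarrow>
      (norm (u0 t2))\<^sup>2 - (norm (u0 t1))\<^sup>2 = 2 * (LINT \<tau>|lborel. indicator {t1..t2} \<tau> * (r \<tau> \<bullet> v' \<tau>))"
    from that[OF this] show thesis .
  qed (use sv sr weak in auto)
  have u0_eq: "u0 \<tau> = u \<tau>" if "\<tau> \<in> I" for \<tau>
  proof (rule continuous_AE_eq_open[OF _ u0(1) _ _ that])
    show "open I" by (simp add: I_def)
    show "continuous_on I u" by (rule continuous_on_subset[OF solutionD(1)[OF sol]]) (auto simp: I_def)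
    show "AE \<tau> in lborel. \<tau> \<in> I \<longrightarrow> u0 \<tau> = u \<tau>"
      using u0(2) solutionD(5)[OF sol] by eventually_elim (auto simp: ev' I_def)
  qed
  define G where "G \<tau> = indicator I \<tau> *\<^sub>R g (v \<tau>)" for \<tau>
  have iG: "integrable lborel (\<lambda>\<tau>. (norm (G \<tau>))\<^sup>2)"
  proof -
    have "(\<lambda>\<tau>. (norm (G \<tau>))\<^sup>2) = (\<lambda>\<tau>. indicator I \<tau> * (norm (g (v \<tau>)))\<^sup>2)" by (auto simp: G_def indicator_def)
    then show ?thesis using integrable_g[OF solutionD(3,4)[OF sol], of b] by (simp add: I_def)
  qed
  have step: "(norm (u t))\<^sup>2 + (LINT \<tau>|lborel. indicator {t1..t} \<tau> * (norm (G \<tau>))\<^sup>2) \<le> (norm (u t1))\<^sup>2"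
    if t1: "s < t1" "t1 \<le> t" for t1
  proof -
    have I: "t1 \<in> I" "t \<in> I" using t1 st by (auto simp: I_def b_def)
    have "(LINT \<tau>|lborel. indicator {t1..t} \<tau> * (norm (G \<tau>))\<^sup>2) \<le> (LINT \<tau>|lborel. - 2 * (indicator {t1..t} \<tau> * (r \<tau> \<bullet> v' \<tau>)))"
    proof (rule integral_mono)
      have ii: "integrable lborel (\<lambda>\<tau>. indicator {t1..t} \<tau> * p \<tau>)" if "integrable lborel p" for p :: "real \<Rightarrow> real"
        using integrable_mult_indicator[OF _ that, of "{t1..t}"] by simp
      show "integrable lborel (\<lambda>\<tau>. indicator {t1..t} \<tau> * (norm (G \<tau>))\<^sup>2)" by (rule ii[OF iG])
      show "integrable lborel (\<lambda>\<tau>. - 2 * (indicator {t1..t} \<tau> * (r \<tau> \<bullet> v' \<tau>)))"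
        by (intro integrable_mult_right ii sq_int_inner[OF sr sv])
      fix \<tau>
      have "- 2 * (r \<tau> \<bullet> v' \<tau>) = indicator I \<tau> * (2 * (gen \<tau> (v \<tau>) \<bullet> v \<tau>))"
        by (auto simp: r_def v'_def indicator_def)
      moreover have "2 * (gen \<tau> (v \<tau>) \<bullet> v \<tau>) \<ge> (norm (g (v \<tau>)))\<^sup>2"
        using dissipative[of "v \<tau>" \<tau>] by (simp add: gen power2_norm_eq_inner)
      ultimately have "(norm (G \<tau>))\<^sup>2 \<le> - 2 * (r \<tau> \<bullet> v' \<tau>)" by (cases "\<tau> \<in> I") (simp_all add: G_def)
      then show "indicator {t1..t} \<tau> * (norm (G \<tau>))\<^sup>2 \<le> - 2 * (indicator {t1..t} \<tau> * (r \<tau> \<bullet> v' \<tau>))"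
        by (auto simp: indicator_def)
    qed
    also have "\<dots> = - 2 * (LINT \<tau>|lborel. indicator {t1..t} \<tau> * (r \<tau> \<bullet> v' \<tau>))" by simp
    also have "\<dots> = (norm (u t1))\<^sup>2 - (norm (u t))\<^sup>2" using en[OF I t1(2)] unfolding u0_eq[OF I(1)] u0_eq[OF I(2)] by linarith
    finally show ?thesis by simp
  qed
  \<comment> \<open>These times decrease to \<open>s\<close> within \<open>{s<..t}\<close>, so that
    the dissipation integrals converge by dominated convergence.\<close>
  define q where "q n = s + (t - s) / real (Suc n)" for n :: nat
  have q: "s < q n" "q n \<le> t" for n
  proof -
    have "(t - s) / real (Suc n) > 0" using st by simp
    moreover have "(t - s) / real (Suc n) \<le> (t - s) / 1" using st by (intro divide_left_mono) auto
    ultimately show "s < q n" "q n \<le> t" by (simp_all add: q_def)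
  qed
  have ql: "q \<longlonglongrightarrow> s"
  proof -
    have "(\<lambda>n. s + (t - s) * (1 / real (Suc n))) \<longlonglongrightarrow> s + (t - s) * 0"
      by (intro tendsto_intros LIMSEQ_Suc[OF lim_1_over_n])
    then show ?thesis by (simp add: q_def[abs_def])
  qed
  have "(\<lambda>n. LINT \<tau>|lborel. indicator {q n..t} \<tau> * (norm (G \<tau>))\<^sup>2) \<longlonglongrightarrow> (LINT \<tau>|lborel. indicator {s<..t} \<tau> * (norm (G \<tau>))\<^sup>2)"
  proof (rule integral_dominated_convergence[where w = "\<lambda>\<tau>. (norm (G \<tau>))\<^sup>2"])
    show "integrable lborel (\<lambda>\<tau>. (norm (G \<tau>))\<^sup>2)" by (rule iG)
    show "AE \<tau> in lborel. (\<lambda>n. indicator {q n..t} \<tau> * (norm (G \<tau>))\<^sup>2) \<longlonglongrightarrow> indicator {s<..t} \<tau> * (norm (G \<tau>))\<^sup>2"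
    proof (intro AE_I2 tendsto_mult tendsto_const tendsto_eventually)
      fix \<tau>
      show "\<forall>\<^sub>F n in sequentially. indicator {q n..t} \<tau> = (indicator {s<..t} \<tau> :: real)"
      proof (cases "s < \<tau>")
        case True
        from order_tendstoD(2)[OF ql this] show ?thesis by eventually_elim (use True in \<open>auto simp: indicator_def\<close>)
      next
        case False
        then have "\<not> q n \<le> \<tau>" for n using q(1)[of n] by linarith
        then show ?thesis using False by (intro always_eventually) (auto simp: indicator_def)
      qed
    qed
  qed (use borel_measurable_integrable[OF iG] in \<open>auto simp: indicator_def intro!: AE_I2\<close>)
  moreover have "(\<lambda>n. (norm (u (q n)))\<^sup>2) \<longlonglongrightarrow> (norm (u s))\<^sup>2"
  proof (intro tendsto_intros)
    show "(\<lambda>n. u (q n)) \<longlonglongrightarrow> u s"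
      using solutionD(1)[OF sol] ql q(1) unfolding continuous_on_sequentially
      by (auto simp: o_def less_imp_le)
  qed
  ultimately have "(norm (u t))\<^sup>2 + (LINT \<tau>|lborel. indicator {s<..t} \<tau> * (norm (G \<tau>))\<^sup>2) \<le> (norm (u s))\<^sup>2"
    by (intro LIMSEQ_le[OF tendsto_add[OF tendsto_const]]) (use step q in blast)+
  moreover have "indicator {s<..t} \<tau> * (norm (G \<tau>))\<^sup>2 = indicator {s<..t} \<tau> * (norm (g (v \<tau>)))\<^sup>2" for \<tau>
    by (auto simp: G_def I_def b_def indicator_def)
  ultimately show ?thesis by (simp add: solutionD(2)[OF sol])
qed

lemma solution_contraction: "solution s f u v \<Longrightarrow> s \<le> t \<Longrightarrow> norm (u t) \<le> norm f"
proof (rule power2_le_imp_le)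
  assume *: "solution s f u v" "s \<le> t"
  have "0 \<le> (LINT \<tau>|lborel. indicator {s<..t} \<tau> * (norm (g (v \<tau>)))\<^sup>2)"
    by (rule Bochner_Integration.integral_nonneg) simp
  then show "(norm (u t))\<^sup>2 \<le> (norm f)\<^sup>2" using solution_energy[OF *] by linarith
qed simp

section \<open>Uniqueness and the semigroup property\<close>

text \<open>The difference is a solution with initial value zero, and solutions do not increase the
  norm.\<close>

lemma solution_unique:
  assumes "solution s f u v" "solution s f u' v'" "s \<le> t"
  shows "u t = u' t"
  using solution_contraction[OF solution_combination[OF assms(1,2), of "-1"] assms(3)] by simp

text \<open>By uniqueness the choice does not matter for \<open>t\<close> beyond \<open>s\<close>;
  for earlier times the value is arbitrary.\<close>

definition propagator :: "real \<Rightarrow> real \<Rightarrow> 'h \<Rightarrow> 'h" where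
  "propagator t s f = (SOME u. \<exists>v. solution s f u v) t"

lemma propagator_solution: "\<exists>v. solution s f (\<lambda>t. propagator t s f) v"
proof -
  have "\<exists>u. \<exists>v. solution s f u v" by (rule solution_ex)
  from someI_ex[OF this] show ?thesis unfolding propagator_def .
qed

lemma propagator_eq: "solution s f u v \<Longrightarrow> s \<le> t \<Longrightarrow> propagator t s f = u t"
  using propagator_solution solution_unique by metis

text \<open>Linearity is uniqueness applied to a combination of two solutions, and the energy
  inequality makes each operator a contraction.\<close>

lemma bounded_linear_propagator: "s \<le> t \<Longrightarrow> bounded_linear (propagator t s)"
proof (rule bounded_linear_intro[where K = 1])
  assume st: "s \<le> t"
  have comb: "propagator t s (f1 + x *\<^sub>R f2) = propagator t s f1 + x *\<^sub>R propagator t s f2" for f1 f2 x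
  proof -
    obtain v1 v2 where "solution s f1 (\<lambda>t. propagator t s f1) v1" "solution s f2 (\<lambda>t. propagator t s f2) v2"
      using propagator_solution by blast
    from propagator_eq[OF solution_combination[OF this] st] show ?thesis .
  qed
  show "propagator t s (f1 + f2) = propagator t s f1 + propagator t s f2" for f1 f2 using comb[of f1 1 f2] by simp
  have z: "propagator t s 0 = 0" using comb[of 0 "-1" 0] by simp
  show "propagator t s (x *\<^sub>R f) = x *\<^sub>R propagator t s f" for x f using comb[of 0 x f] z by simp
  show "norm (propagator t s f) \<le> norm f * 1" for f
    using propagator_solution[of s f] solution_contraction[OF _ st] by fastforce
qed

lemma propagator_compose:
  assumes "s \<le> \<tau>" "\<tau> \<le> t"
  shows "propagator t \<tau> (propagator \<tau> s f) = propagator t s f"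
proof -
  obtain v where "solution s f (\<lambda>t. propagator t s f) v" using propagator_solution by blast
  from propagator_eq[OF solution_restrict[OF this assms(1)] assms(2)] show ?thesis .
qed

end

section \<open>A Hardy inequality for weak Lebesgue weights\<close>

lemma nn_integral_lborel_translate:
  fixes f :: "'a::euclidean_space \<Rightarrow> ennreal"
  assumes [measurable]: "f \<in> borel_measurable borel"
  shows "(\<integral>\<^sup>+x. f (x + a) \<partial>lborel) = (\<integral>\<^sup>+x. f x \<partial>lborel)"
proof -
  have "(\<integral>\<^sup>+x. f x \<partial>lborel) = (\<integral>\<^sup>+x. f x \<partial>distr lborel borel ((+) a))"
    by (simp add: lborel_distr_plus)
  also have "\<dots> = (\<integral>\<^sup>+x. f (x + a) \<partial>lborel)"
    by (subst nn_integral_distr) (auto simp: add.commute)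
  finally show ?thesis by simp
qed

text \<open>The increment is the integral of the derivative along the segment from \<open>x\<close>
  to \<open>x + k\<close>. Jensen's inequality over the segment, Tonelli's theorem and translation
  invariance remove the parameter; \<open>g\<close> majorizes the length of the gradient.\<close>

lemma translation_difference_le:
  fixes \<psi> g :: "'a::euclidean_space \<Rightarrow> real"
  assumes der: "\<And>x. (\<psi> has_derivative D x) (at x)"
    and bound: "\<And>x k. \<bar>D x k\<bar> \<le> g x * norm k" and g: "continuous_on UNIV g"
  shows "(\<integral>\<^sup>+x. ennreal ((\<psi> (x + k) - \<psi> x)\<^sup>2) \<partial>lborel)
    \<le> ennreal ((norm k)\<^sup>2) * (\<integral>\<^sup>+x. ennreal ((g x)\<^sup>2) \<partial>lborel)"
proof -
  have gm[measurable]: "g \<in> borel_measurable borel" by (rule borel_measurable_continuous_onI[OF g])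
  define \<iota> where "\<iota> t = (indicator {0..1} t :: real)" for t :: real
  have \<iota>: "\<And>t. 0 \<le> \<iota> t" "integrable lborel \<iota>" "(LINT t|lborel. \<iota> t) = 1"
    unfolding \<iota>_def[abs_def] by auto
  have [measurable]: "\<iota> \<in> borel_measurable borel" unfolding \<iota>_def[abs_def] by measurable
  have cg: "continuous_on S (\<lambda>t. g (x + t *\<^sub>R k) * norm k)" for x S
    by (intro continuous_intros continuous_on_compose2[OF g]) auto
  have "ennreal ((\<psi> (x + k) - \<psi> x)\<^sup>2) \<le> (\<integral>\<^sup>+t. ennreal (\<iota> t * (g (x + t *\<^sub>R k) * norm k)\<^sup>2) \<partial>lborel)" for x
  proof -
    have line: "((\<lambda>t. \<psi> (x + t *\<^sub>R k)) has_vector_derivative D (x + t *\<^sub>R k) k) (at t)" for t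
    proof -
      have "((\<lambda>t. \<psi> (x + t *\<^sub>R k)) has_derivative (\<lambda>h. D (x + t *\<^sub>R k) (h *\<^sub>R k))) (at t)"
        by (rule has_derivative_compose[OF _ der]) (auto intro!: derivative_eq_intros)
      moreover have "linear (D (x + t *\<^sub>R k))" using der by (rule has_derivative_linear)
      ultimately show ?thesis unfolding has_vector_derivative_def by (simp add: linear_scale)
    qed
    have ftc: "((\<lambda>t. D (x + t *\<^sub>R k) k) has_integral \<psi> (x + 1 *\<^sub>R k) - \<psi> (x + 0 *\<^sub>R k)) {0..1}"
      by (rule fundamental_theorem_of_calculus) (auto intro: has_vector_derivative_at_within line)
    have i: "integrable lborel (\<lambda>t. indicator {0..1} t *\<^sub>R (g (x + t *\<^sub>R k) * norm k))"
      by (intro borel_integrable_compact compact_Icc cg)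
    have "\<bar>\<psi> (x + k) - \<psi> x\<bar> = norm (integral {0..1} (\<lambda>t. D (x + t *\<^sub>R k) k))"
      using integral_unique[OF ftc] by simp
    also have "\<dots> \<le> integral {0..1} (\<lambda>t. g (x + t *\<^sub>R k) * norm k)"
      by (rule integral_norm_bound_integral)
         (use ftc in \<open>auto simp: bound intro: has_integral_integrable integrable_continuous_real cg\<close>)
    also have "\<dots> = (LINT t|lborel. \<iota> t * (g (x + t *\<^sub>R k) * norm k))"
      using set_borel_integral_eq_integral(2)[unfolded set_integrable_def set_lebesgue_integral_def, OF i]
      by (simp only: \<iota>_def real_scaleR_def)
    finally have "\<bar>\<psi> (x + k) - \<psi> x\<bar>\<^sup>2 \<le> (LINT t|lborel. \<iota> t * (g (x + t *\<^sub>R k) * norm k))\<^sup>2"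
      by (rule power_mono) simp
    then have "(\<psi> (x + k) - \<psi> x)\<^sup>2 \<le> (LINT t|lborel. \<iota> t * (g (x + t *\<^sub>R k) * norm k))\<^sup>2"
      by (simp only: power2_abs)
    then have "ennreal ((\<psi> (x + k) - \<psi> x)\<^sup>2) \<le> ennreal ((LINT t|lborel. \<iota> t * (g (x + t *\<^sub>R k) * norm k))\<^sup>2)"
      by (rule ennreal_leI)
    also have "\<dots> \<le> (\<integral>\<^sup>+t. ennreal (\<iota> t * (g (x + t *\<^sub>R k) * norm k)\<^sup>2) \<partial>lborel)"
      using i by (intro weighted_average_square_le \<iota>) (auto simp: \<iota>_def)
    finally show ?thesis .
  qed
  then have "(\<integral>\<^sup>+x. ennreal ((\<psi> (x + k) - \<psi> x)\<^sup>2) \<partial>lborel)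
      \<le> (\<integral>\<^sup>+x. \<integral>\<^sup>+t. ennreal (\<iota> t * (g (x + t *\<^sub>R k) * norm k)\<^sup>2) \<partial>lborel \<partial>lborel)"
    by (intro nn_integral_mono)
  also have "\<dots> = (\<integral>\<^sup>+t. \<integral>\<^sup>+x. ennreal (\<iota> t * (g (x + t *\<^sub>R k) * norm k)\<^sup>2) \<partial>lborel \<partial>lborel)"
    by (rule lborel_pair.Fubini') measurable
  also have "\<dots> = (\<integral>\<^sup>+t. ennreal (\<iota> t) * (ennreal ((norm k)\<^sup>2) * (\<integral>\<^sup>+x. ennreal ((g x)\<^sup>2) \<partial>lborel)) \<partial>lborel)"
  proof (intro nn_integral_cong)
    fix t
    have "(\<integral>\<^sup>+x. ennreal (\<iota> t * (g (x + t *\<^sub>R k) * norm k)\<^sup>2) \<partial>lborel)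
        = (\<integral>\<^sup>+x. ennreal (\<iota> t) * (ennreal ((norm k)\<^sup>2) * ennreal ((g (x + t *\<^sub>R k))\<^sup>2)) \<partial>lborel)"
      using \<iota>(1)[of t] by (intro nn_integral_cong) (simp add: ennreal_mult power_mult_distrib mult_ac)
    also have "\<dots> = ennreal (\<iota> t) * (ennreal ((norm k)\<^sup>2) * (\<integral>\<^sup>+x. ennreal ((g (x + t *\<^sub>R k))\<^sup>2) \<partial>lborel))"
      by (subst nn_integral_cmult, measurable, subst nn_integral_cmult, measurable)
    also have "(\<integral>\<^sup>+x. ennreal ((g (x + t *\<^sub>R k))\<^sup>2) \<partial>lborel) = (\<integral>\<^sup>+x. ennreal ((g x)\<^sup>2) \<partial>lborel)"
      by (rule nn_integral_lborel_translate) measurable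
    finally show "(\<integral>\<^sup>+x. ennreal (\<iota> t * (g (x + t *\<^sub>R k) * norm k)\<^sup>2) \<partial>lborel)
        = ennreal (\<iota> t) * (ennreal ((norm k)\<^sup>2) * (\<integral>\<^sup>+x. ennreal ((g x)\<^sup>2) \<partial>lborel))" .
  qed
  also have "\<dots> = ennreal ((norm k)\<^sup>2) * (\<integral>\<^sup>+x. ennreal ((g x)\<^sup>2) \<partial>lborel)"
    using \<iota> by (subst nn_integral_multc) (auto simp: nn_integral_eq_integral)
  finally show ?thesis .
qed

text \<open>If a ball has at least twice the measure of the support of \<open>\<psi>\<close>, then at least half of the
  translations by elements of the ball move a point where \<open>\<psi> = 1\<close> out of the support.\<close>

lemma capacity_bound:
  fixes \<psi> g :: "'a::euclidean_space \<Rightarrow> real"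
  assumes der: "\<And>x. (\<psi> has_derivative D x) (at x)"
    and bound: "\<And>x k. \<bar>D x k\<bar> \<le> g x * norm k" and g: "continuous_on UNIV g"
    and E: "E \<in> sets borel" "\<And>x. x \<notin> E \<Longrightarrow> \<psi> x = 0"
    and F: "F \<in> sets borel" "\<And>x. x \<in> F \<Longrightarrow> \<psi> x = 1"
    and r: "r > 0" "2 * emeasure lborel E \<le> emeasure lborel (ball (0::'a) r)"
  shows "emeasure lborel F \<le> ennreal (2 * r\<^sup>2) * (\<integral>\<^sup>+x. ennreal ((g x)\<^sup>2) \<partial>lborel)"
proof -
  define b where "b = unit_ball_vol (real DIM('a)) * r ^ DIM('a)"
  have b: "b > 0" "emeasure lborel (ball (0::'a) r) = ennreal b"
    using r by (auto simp: b_def emeasure_ball)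
  define I where "I = (\<integral>\<^sup>+x. ennreal ((g x)\<^sup>2) \<partial>lborel)"
  have c: "continuous_on UNIV \<psi>"
    using der by (auto intro!: continuous_at_imp_continuous_on has_derivative_continuous)
  have [measurable]: "\<psi> \<in> borel_measurable borel" by (rule borel_measurable_continuous_onI[OF c])
  note [measurable] = E(1) F(1) borel_open[OF open_ball[of "0::'a" r]]
  \<comment> \<open>The squared increments integrated over all shifts in the ball. The gradient
    bounds \<open>J\<close> from above; the points of \<open>F\<close> bound it from below.\<close>
  define J where "J = (\<integral>\<^sup>+k. indicator (ball 0 r) k * (\<integral>\<^sup>+x. ennreal ((\<psi> (x + k) - \<psi> x)\<^sup>2) \<partial>lborel) \<partial>lborel)"
  have "J \<le> (\<integral>\<^sup>+k. (ennreal (r\<^sup>2) * I) * indicator (ball (0::'a) r) k \<partial>lborel)"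
    unfolding J_def
  proof (rule nn_integral_mono)
    fix k :: 'a
    show "indicator (ball 0 r) k * (\<integral>\<^sup>+x. ennreal ((\<psi> (x + k) - \<psi> x)\<^sup>2) \<partial>lborel)
        \<le> (ennreal (r\<^sup>2) * I) * indicator (ball 0 r) k"
    proof (cases "k \<in> ball 0 r")
      case True
      have "(\<integral>\<^sup>+x. ennreal ((\<psi> (x + k) - \<psi> x)\<^sup>2) \<partial>lborel) \<le> ennreal ((norm k)\<^sup>2) * I"
        unfolding I_def by (rule translation_difference_le[OF der bound g])
      also have "\<dots> \<le> ennreal (r\<^sup>2) * I"
        using True by (intro mult_right_mono ennreal_leI power_mono) auto
      finally show ?thesis using True by simp
    qed simp
  qed
  also have "\<dots> = ennreal (r\<^sup>2) * I * ennreal b"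
    using b by (subst nn_integral_cmult_indicator) auto
  finally have upper: "J \<le> ennreal (r\<^sup>2) * I * ennreal b" .
  have "emeasure lborel F * ennreal (b / 2) = (\<integral>\<^sup>+x. indicator F x * ennreal (b / 2) \<partial>lborel)"
    by (subst nn_integral_multc) auto
  also have "\<dots> \<le> (\<integral>\<^sup>+x. (\<integral>\<^sup>+k. indicator (ball 0 r) k * ennreal ((\<psi> (x + k) - \<psi> x)\<^sup>2) \<partial>lborel) \<partial>lborel)"
  proof (rule nn_integral_mono)
    fix x
    show "indicator F x * ennreal (b / 2)
        \<le> (\<integral>\<^sup>+k. indicator (ball 0 r) k * ennreal ((\<psi> (x + k) - \<psi> x)\<^sup>2) \<partial>lborel)"
    proof (cases "x \<in> F")
      case True
      \<comment> \<open>The shifts that leave \<open>x\<close> in the support have the measure of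
        \<open>E\<close>, at most half of the ball; every other shift moves \<open>x\<close> from
        value 1 to value 0.\<close>
      define Ex where "Ex = {k. k + x \<in> E}"
      have [measurable]: "Ex \<in> sets borel" unfolding Ex_def by measurable
      have "emeasure lborel Ex = (\<integral>\<^sup>+k. indicator Ex k \<partial>lborel)" by simp
      also have "\<dots> = (\<integral>\<^sup>+k. indicator E (k + x) \<partial>lborel)"
        by (intro nn_integral_cong) (simp add: Ex_def indicator_def)
      also have "\<dots> = (\<integral>\<^sup>+k. indicator E k \<partial>lborel)"
        by (rule nn_integral_lborel_translate) measurable
      also have "\<dots> = emeasure lborel E" by simp
      finally have Ex: "emeasure lborel Ex = emeasure lborel E" .
      have "2 * emeasure lborel E \<le> ennreal b" using r b by simp
      then have fin: "emeasure lborel E < \<infinity>"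
        by (metis b(2) ennreal_less_top ennreal_mult_eq_top_iff infinity_ennreal_def less_top order_less_le_trans top.not_eq_extremum zero_neq_numeral leD)
      then obtain mE where mE: "emeasure lborel E = ennreal mE" "mE \<ge> 0"
        by (cases "emeasure lborel E" rule: ennreal_cases) auto
      have "ennreal (2 * mE) \<le> ennreal b"
        using \<open>2 * emeasure lborel E \<le> ennreal b\<close> mE by (simp add: ennreal_mult)
      then have mb: "2 * mE \<le> b" using b by (subst (asm) ennreal_le_iff) auto
      have "ennreal (b / 2) \<le> ennreal (b - mE)" using mb by (intro ennreal_leI) simp
      also have "\<dots> \<le> emeasure lborel (ball 0 r - Ex)"
      proof -
        have "emeasure lborel (ball (0::'a) r) \<le> emeasure lborel ((ball 0 r - Ex) \<union> Ex)"
          by (intro emeasure_mono) auto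
        also have "\<dots> \<le> emeasure lborel (ball 0 r - Ex) + emeasure lborel Ex"
          by (intro emeasure_subadditive) auto
        finally have le: "ennreal b \<le> emeasure lborel (ball 0 r - Ex) + ennreal mE"
          unfolding b Ex mE .
        show ?thesis
        proof (cases "emeasure lborel (ball 0 r - Ex)" rule: ennreal_cases)
          case (real z)
          then have "ennreal b \<le> ennreal (z + mE)" using le mE by simp
          then have "b \<le> z + mE" using real(1) mE(2) by (subst (asm) ennreal_le_iff) auto
          then show ?thesis unfolding real(2) by (intro ennreal_leI) simp
        qed simp
      qed
      also have "\<dots> = (\<integral>\<^sup>+k. indicator (ball 0 r - Ex) k \<partial>lborel)" by simp
      also have "\<dots> \<le> (\<integral>\<^sup>+k. indicator (ball 0 r) k * ennreal ((\<psi> (x + k) - \<psi> x)\<^sup>2) \<partial>lborel)"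
      proof (rule nn_integral_mono)
        fix k :: 'a
        have "\<psi> (x + k) = 0" if "k \<notin> Ex" using that E(2)[of "x + k"] by (simp add: Ex_def add.commute)
        then show "indicator (ball 0 r - Ex) k \<le> indicator (ball 0 r) k * ennreal ((\<psi> (x + k) - \<psi> x)\<^sup>2)"
          using F(2)[OF True] by (auto simp: indicator_def)
      qed
      finally show ?thesis using True by simp
    qed simp
  qed
  also have "\<dots> = (\<integral>\<^sup>+k. (\<integral>\<^sup>+x. indicator (ball 0 r) k * ennreal ((\<psi> (x + k) - \<psi> x)\<^sup>2) \<partial>lborel) \<partial>lborel)"
    by (rule lborel_pair.Fubini') measurable
  also have "\<dots> = J"
    unfolding J_def by (intro nn_integral_cong nn_integral_cmult) measurable
  finally have "emeasure lborel F * ennreal (b / 2) \<le> ennreal (r\<^sup>2) * I * ennreal b"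
    using upper by simp
  then have "(emeasure lborel F * ennreal (b / 2)) * ennreal (2 / b) \<le> (ennreal (r\<^sup>2) * I * ennreal b) * ennreal (2 / b)"
    by (rule mult_right_mono) simp
  moreover have "ennreal (b / 2) * ennreal (2 / b) = 1" "ennreal b * ennreal (2 / b) = 2"
    using b by (simp_all add: ennreal_mult[symmetric] flip: ennreal_1)
  ultimately have "emeasure lborel F \<le> ennreal (r\<^sup>2) * I * 2" by (simp add: mult.assoc)
  also have "\<dots> = ennreal (2 * r\<^sup>2) * I" by (simp add: ennreal_mult mult_ac)
  finally show ?thesis unfolding I_def .
qed

section \<open>Capacity of level sets\<close>

text \<open>The piecewise quadratic transition from 0 to 1 on the unit interval. Its derivative is
  the hat function with peak 2 at 1/2.\<close>

definition smooth_step :: "real \<Rightarrow> real" where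
  "smooth_step y = 2 * ((max 0 y)\<^sup>2 - 2 * (max 0 (y - 1/2))\<^sup>2 + (max 0 (y - 1))\<^sup>2)"

definition smooth_step' :: "real \<Rightarrow> real" where
  "smooth_step' y = 4 * (max 0 y - 2 * max 0 (y - 1/2) + max 0 (y - 1))"

lemma smooth_step:
  "(smooth_step has_real_derivative smooth_step' y) (at y)" "continuous_on S smooth_step'"
  "y \<le> 0 \<Longrightarrow> smooth_step y = 0" "1 \<le> y \<Longrightarrow> smooth_step y = 1"
  "\<bar>smooth_step' y\<bar> \<le> 2" "y \<notin> {0<..<1} \<Longrightarrow> smooth_step' y = 0"
proof -
  have d: "((\<lambda>y. (max 0 (y - c))\<^sup>2) has_real_derivative 2 * max 0 (y - c)) (at y)" for c
  proof -
    have "((\<lambda>y. y - c) has_real_derivative 1) (at y)" by (auto intro!: derivative_eq_intros)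
    from DERIV_chain2[OF max_zero_square_deriv this] show ?thesis by simp
  qed
  have "(smooth_step has_real_derivative
      2 * (2 * max 0 y - 2 * (2 * max 0 (y - 1/2)) + 2 * max 0 (y - 1))) (at y)"
    unfolding smooth_step_def[abs_def]
    by (intro DERIV_cmult DERIV_add DERIV_diff max_zero_square_deriv d)
  then show "(smooth_step has_real_derivative smooth_step' y) (at y)"
    by (rule DERIV_cong) (simp add: smooth_step'_def algebra_simps)
  show "continuous_on S smooth_step'"
    unfolding smooth_step'_def[abs_def] by (intro continuous_intros)
  show "y \<le> 0 \<Longrightarrow> smooth_step y = 0" by (simp add: smooth_step_def)
  show "1 \<le> y \<Longrightarrow> smooth_step y = 1" by (simp add: smooth_step_def power2_eq_square algebra_simps)
  show "\<bar>smooth_step' y\<bar> \<le> 2" by (auto simp: smooth_step'_def max_def)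
  show "y \<notin> {0<..<1} \<Longrightarrow> smooth_step' y = 0" by (auto simp: smooth_step'_def max_def)
qed

text \<open>The value of \<open>2 r^2 / m^(2/n)\<close> when the ball of radius \<open>r\<close> in
  dimension \<open>n\<close> has measure \<open>2 m\<close>, as required by
  \<open>capacity_bound\<close> for a support of measure \<open>m\<close>.\<close>

definition capacity_const :: "nat \<Rightarrow> real" where
  "capacity_const n = 2 * (2 / unit_ball_vol (real n)) powr (2 / real n)"

lemma capacity_const_pos: "capacity_const n > 0"
proof -
  have "2 / unit_ball_vol (real n) > 0" by simp
  then show ?thesis unfolding capacity_const_def by (metis mult_pos_pos order_less_irrefl powr_gt_zero zero_less_numeral)
qed

text \<open>The capacity bound is applied to a smooth truncation of \<open>|\<phi>|\<close> between the two heights.\<close>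

lemma level_set_step:
  fixes \<phi> :: "'a::euclidean_space \<Rightarrow> 'b::euclidean_space" and G :: "'a \<Rightarrow> real"
  assumes der: "\<And>x. (\<phi> has_derivative D x) (at x)"
    and bound: "\<And>x k. norm (D x k) \<le> G x * norm k" and G: "continuous_on UNIV G"
    and supp: "compact K" "\<And>x. x \<notin> K \<Longrightarrow> \<phi> x = 0" and l: "l > 0"
  shows "emeasure lborel {x. 2 * l < norm (\<phi> x)}
    \<le> ennreal (9 * capacity_const DIM('a) * (measure lborel {x. l < norm (\<phi> x)}) powr (2 / DIM('a)) / l\<^sup>2) *
      (\<integral>\<^sup>+x. ennreal ((G x)\<^sup>2) * indicator ({x. l < norm (\<phi> x)} - {x. 2 * l < norm (\<phi> x)}) x \<partial>lborel)"
proof -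
  have c\<phi>: "continuous_on UNIV \<phi>"
    using der by (auto intro!: continuous_at_imp_continuous_on has_derivative_continuous)
  define E where "E c = {x. c < norm (\<phi> x)}" for c
  have E_open: "open (E c)" for c
    unfolding E_def by (intro open_Collect_less continuous_intros c\<phi>)
  then have [measurable]: "E c \<in> sets borel" for c by simp
  have E_K: "E l \<subseteq> K" using supp(2) l by (force simp: E_def)
  have fin: "emeasure lborel (E l) < \<infinity>"
    using emeasure_mono[OF E_K, of lborel] emeasure_compact_finite[OF supp(1)] supp(1)
    by (auto simp: compact_imp_closed intro: le_less_trans)
  define m where "m = measure lborel (E l)"
  have m: "emeasure lborel (E l) = ennreal m" "m \<ge> 0"
    using fin by (auto simp: m_def emeasure_eq_ennreal_measure less_top)
  show ?thesis
  proof (cases "m = 0")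
    case True
    have "E (2 * l) \<subseteq> E l" using l by (auto simp: E_def)
    then have "emeasure lborel (E (2 * l)) \<le> 0"
      using emeasure_mono[of "E (2 * l)" "E l" lborel] m True by simp
    then show ?thesis by (simp add: E_def)
  next
    case False
    then have mp: "m > 0" using m by simp
    define n where "n = DIM('a)"
    have n: "n > 0" by (simp add: n_def)
    define \<omega> where "\<omega> = unit_ball_vol (real n)"
    have \<omega>: "\<omega> > 0" by (simp add: \<omega>_def)
    \<comment> \<open>The radius at which the ball has exactly twice the measure of the superlevel
      set at height \<open>l\<close>.\<close>
    define r where "r = (2 * m / \<omega>) powr (1 / real n)"
    have r: "r > 0" using mp \<omega> by (simp add: r_def)
    have rn: "r ^ n = 2 * m / \<omega>"
      using n mp \<omega> r by (simp add: r_def powr_realpow[symmetric] powr_powr)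
    have r2: "2 * r\<^sup>2 = capacity_const n * m powr (2 / real n)"
    proof -
      have "r\<^sup>2 = (2 * m / \<omega>) powr (2 / real n)"
        using r by (simp add: r_def powr_realpow[symmetric] powr_powr)
      also have "\<dots> = (2 / \<omega> * m) powr (2 / real n)" by simp
      also have "\<dots> = (2 / \<omega>) powr (2 / real n) * m powr (2 / real n)" by (rule powr_mult)
      finally show ?thesis by (simp add: capacity_const_def \<omega>_def)
    qed
    \<comment> \<open>An affine function of the squared norm, which unlike the norm is
      differentiable at zeros of \<phi>. It takes the value 0 at height \<open>l\<close> and 1 at
      height \<open>2 * l\<close>.\<close>
    define y where "y x = ((\<phi> x \<bullet> \<phi> x) / l\<^sup>2 - 1) / 3" for x
    define \<psi> where "\<psi> x = smooth_step (y x)" for x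
    define g where "g x = \<bar>smooth_step' (y x)\<bar> * (2 * norm (\<phi> x) * G x / (3 * l\<^sup>2))" for x
    have G0: "G x \<ge> 0" for x
    proof -
      obtain k :: 'a where "k \<in> Basis" using nonempty_Basis by blast
      then show ?thesis using bound[of x k] norm_ge_zero[of "D x k"] by (simp del: norm_ge_zero)
    qed
    have dy: "(y has_derivative (\<lambda>k. 2 * (\<phi> x \<bullet> D x k) / (3 * l\<^sup>2))) (at x)" for x
    proof -
      have "((\<lambda>x. \<phi> x \<bullet> \<phi> x) has_derivative (\<lambda>k. \<phi> x \<bullet> D x k + D x k \<bullet> \<phi> x)) (at x)"
        by (intro has_derivative_inner der)
      then have "((\<lambda>x. ((\<phi> x \<bullet> \<phi> x) - l\<^sup>2) * (1 / (3 * l\<^sup>2))) has_derivative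
          (\<lambda>k. ((\<phi> x \<bullet> D x k + D x k \<bullet> \<phi> x) - 0) * (1 / (3 * l\<^sup>2)))) (at x)"
        by (intro has_derivative_mult_left has_derivative_diff has_derivative_const)
      moreover have "(\<lambda>x. ((\<phi> x \<bullet> \<phi> x) - l\<^sup>2) * (1 / (3 * l\<^sup>2))) = y"
        using l by (auto simp: y_def divide_simps)
      ultimately show ?thesis by (simp add: inner_commute)
    qed
    have d\<psi>: "(\<psi> has_derivative (\<lambda>k. smooth_step' (y x) * (2 * (\<phi> x \<bullet> D x k) / (3 * l\<^sup>2)))) (at x)" for x
      unfolding \<psi>_def[abs_def]
      using has_derivative_compose[OF dy smooth_step(1)[unfolded has_field_derivative_def]] .
    have "emeasure lborel (E (2 * l)) \<le> ennreal (2 * r\<^sup>2) * (\<integral>\<^sup>+x. ennreal ((g x)\<^sup>2) \<partial>lborel)"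
    proof (rule capacity_bound[OF d\<psi>])
      fix x k
      have "\<bar>\<phi> x \<bullet> D x k\<bar> \<le> norm (\<phi> x) * (G x * norm k)"
        using Cauchy_Schwarz_ineq2[of "\<phi> x" "D x k"] mult_left_mono[OF bound[of x k] norm_ge_zero[of "\<phi> x"]] by linarith
      then have "\<bar>2 * (\<phi> x \<bullet> D x k) / (3 * l\<^sup>2)\<bar> \<le> 2 * (norm (\<phi> x) * (G x * norm k)) / (3 * l\<^sup>2)"
        using l by (simp add: abs_mult abs_divide divide_right_mono)
      then have "\<bar>smooth_step' (y x)\<bar> * \<bar>2 * (\<phi> x \<bullet> D x k) / (3 * l\<^sup>2)\<bar>
          \<le> \<bar>smooth_step' (y x)\<bar> * (2 * (norm (\<phi> x) * (G x * norm k)) / (3 * l\<^sup>2))"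
        by (rule mult_left_mono) simp
      then show "\<bar>smooth_step' (y x) * (2 * (\<phi> x \<bullet> D x k) / (3 * l\<^sup>2))\<bar> \<le> g x * norm k"
        unfolding g_def abs_mult[of "smooth_step' (y x)"] by (simp add: mult_ac)
    next
      have "continuous_on UNIV y" unfolding y_def using l by (intro continuous_intros c\<phi>) auto
      then have "continuous_on UNIV (\<lambda>x. smooth_step' (y x))"
        by (rule continuous_on_compose2[OF smooth_step(2)[of UNIV]]) auto
      then show "continuous_on UNIV g"
        unfolding g_def using l by (intro continuous_intros c\<phi> G) auto
    next
      have norm_iff: "l < norm (\<phi> x) \<longleftrightarrow> l\<^sup>2 < \<phi> x \<bullet> \<phi> x" for x
        using l unfolding power2_norm_eq_inner[symmetric] by (auto intro: power_strict_mono power2_less_imp_less)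
      show "\<psi> x = 0" if "x \<notin> E l" for x
        unfolding \<psi>_def using that l by (intro smooth_step) (auto simp: y_def E_def norm_iff divide_simps)
      show "\<psi> x = 1" if "x \<in> E (2 * l)" for x
      proof -
        have "2 * l \<le> norm (\<phi> x)" using that by (simp add: E_def)
        then have "(2 * l)\<^sup>2 \<le> (norm (\<phi> x))\<^sup>2" using l by (intro power_mono) auto
        then have "1 \<le> y x" using l by (simp add: y_def power2_norm_eq_inner field_simps)
        then show ?thesis unfolding \<psi>_def by (rule smooth_step)
      qed
      show "2 * emeasure lborel (E l) \<le> emeasure lborel (ball (0::'a) r)"
      proof -
        have "emeasure lborel (ball (0::'a) r) = ennreal (2 * m)"
          using r rn \<omega> by (subst emeasure_ball) (auto simp: n_def[symmetric] \<omega>_def[symmetric])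
        then show ?thesis using m by (simp add: ennreal_mult)
      qed
    qed (use r in auto)
    also have "\<dots> \<le> ennreal (2 * r\<^sup>2) * (\<integral>\<^sup>+x. ennreal (9 / l\<^sup>2) * (ennreal ((G x)\<^sup>2) * indicator (E l - E (2 * l)) x) \<partial>lborel)"
    proof (intro mult_left_mono nn_integral_mono)
      fix x
      show "ennreal ((g x)\<^sup>2) \<le> ennreal (9 / l\<^sup>2) * (ennreal ((G x)\<^sup>2) * indicator (E l - E (2 * l)) x)"
      proof (cases "y x \<in> {0<..<1}")
        case False
        then have "g x = 0" by (simp add: g_def smooth_step(6))
        then show ?thesis by simp
      next
        case True
        then have "l\<^sup>2 < (norm (\<phi> x))\<^sup>2" "(norm (\<phi> x))\<^sup>2 < (2 * l)\<^sup>2"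
          using l by (auto simp: y_def power2_norm_eq_inner field_simps)
        then have nl: "l < norm (\<phi> x)" "norm (\<phi> x) < 2 * l"
          using l by (auto intro: power2_less_imp_less)
        \<comment> \<open>Slope at most 2 and \<open>norm (\<phi> x) < 2 * l\<close> give the factor
          \<open>8 / 3\<close>, rounded up to 3; its square is the 9 of the statement.\<close>
        have "g x \<le> 2 * (2 * (2 * l) * G x / (3 * l\<^sup>2))"
          unfolding g_def using l nl G0[of x]
          by (intro mult_mono smooth_step divide_right_mono) auto
        also have "\<dots> = (8 / 3) * G x / l" using l by (simp add: power2_eq_square)
        also have "\<dots> \<le> 3 * G x / l" using l G0[of x] by (intro divide_right_mono mult_right_mono) auto
        finally have "g x \<le> 3 * G x / l" .
        moreover have "g x \<ge> 0" unfolding g_def using G0[of x] by simp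
        ultimately have "(g x)\<^sup>2 \<le> (3 * G x / l)\<^sup>2" by (intro power_mono)
        also have "\<dots> = 9 / l\<^sup>2 * (G x)\<^sup>2" by (simp add: power_mult_distrib power_divide)
        finally have "ennreal ((g x)\<^sup>2) \<le> ennreal (9 / l\<^sup>2) * ennreal ((G x)\<^sup>2)"
          by (simp add: ennreal_mult[symmetric] ennreal_leI)
        then show ?thesis using nl by (simp add: E_def)
      qed
    qed simp
    also have "\<dots> = ennreal (2 * r\<^sup>2) * (ennreal (9 / l\<^sup>2) * (\<integral>\<^sup>+x. ennreal ((G x)\<^sup>2) * indicator (E l - E (2 * l)) x \<partial>lborel))"
    proof -
      have [measurable]: "G \<in> borel_measurable borel" by (rule borel_measurable_continuous_onI[OF G])
      show ?thesis by (subst nn_integral_cmult) auto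
    qed
    also have "\<dots> = ennreal (9 * capacity_const n * m powr (2 / real n) / l\<^sup>2) * (\<integral>\<^sup>+x. ennreal ((G x)\<^sup>2) * indicator (E l - E (2 * l)) x \<partial>lborel)"
      unfolding r2 mult.assoc[symmetric] using capacity_const_pos[of n]
      by (simp add: ennreal_mult[symmetric] mult_ac)
    finally show ?thesis unfolding E_def m_def n_def .
  qed
qed

section \<open>Dyadic summation and the weighted inequality\<close>

lemma dyadic_bracket:
  fixes R z :: real
  assumes "R > 0" "R < z"
  obtains j where "2 ^ j * R < z" "z \<le> 2 ^ Suc j * R"
proof -
  obtain n where "z / R < 2 ^ n" using real_arch_pow[of 2 "z / R"] by auto
  then have ex: "z \<le> 2 ^ n * R" using assms by (simp add: pos_divide_less_eq less_imp_le)
  define k where "k = (LEAST n. z \<le> 2 ^ n * R)"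
  have k: "z \<le> 2 ^ k * R" unfolding k_def by (rule LeastI[of "\<lambda>n. z \<le> 2 ^ n * R", OF ex])
  have "k \<noteq> 0"
  proof
    assume "k = 0"
    then show False using k assms by simp
  qed
  then obtain j where j: "k = Suc j" by (cases k) auto
  have "\<not> z \<le> 2 ^ j * R"
    using not_less_Least[of j "\<lambda>n. z \<le> 2 ^ n * R"] j unfolding k_def by simp
  then show ?thesis using k j that[of j] by simp
qed

lemma ennreal_le_suminf:
  fixes f :: "nat \<Rightarrow> ennreal"
  shows "f j \<le> (\<Sum>j. f j)"
  using sum_le_suminf[OF summableI, of "{j}" f] by simp

text \<open>The function is split at the height \<open>R\<close> at which the distribution bound
  equals \<open>m\<close>. Below it the integral over \<open>E\<close> is at most
  \<open>R^2 m\<close>; above it the dyadic layers contribute at most \<open>8 R^2 m\<close>, even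
  without restricting to \<open>E\<close>. Finally \<open>R^2 m = d^2 m^(1 - 2/n)\<close>.\<close>

lemma weak_type_set_integral:
  fixes v :: "'a::euclidean_space \<Rightarrow> 'c::euclidean_space"
  assumes [measurable]: "v \<in> borel_measurable lebesgue" and d: "d > 0" and n: "n \<ge> 3"
    and dist: "\<And>r. r > 0 \<Longrightarrow> emeasure lebesgue {x. r < norm (v x)} \<le> ennreal ((d / r) ^ n)"
    and E: "E \<in> sets lebesgue" "emeasure lebesgue E = ennreal m" "m \<ge> 0"
  shows "(\<integral>\<^sup>+x. ennreal ((norm (v x))\<^sup>2) * indicator E x \<partial>lebesgue) \<le> ennreal (9 * d\<^sup>2 * m powr (1 - 2 / real n))"
proof (cases "m = 0")
  case True
  then have "E \<in> null_sets lebesgue" using E by (auto simp: null_sets_def)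
  then show ?thesis by (simp add: nn_integral_null_set)
next
  case False
  then have m: "m > 0" using E by simp
  note [measurable] = E(1)
  define R where "R = d * m powr (- 1 / real n)"
  have R: "R > 0" using d m by (simp add: R_def)
  have dR: "(d / R) ^ n = m"
  proof -
    have "d / R = m powr (1 / real n)" using d m by (simp add: R_def powr_minus_divide)
    then show ?thesis using m n by (simp add: powr_realpow[symmetric] powr_powr)
  qed
  have R2: "R\<^sup>2 * m = d\<^sup>2 * m powr (1 - 2 / real n)"
  proof -
    have "R\<^sup>2 = d\<^sup>2 * m powr (- 2 / real n)"
      using m by (simp add: R_def power_mult_distrib powr_realpow[symmetric] powr_powr)
    then have "R\<^sup>2 * m = d\<^sup>2 * (m powr (- 2 / real n) * m powr 1)" using m by simp
    also have "m powr (- 2 / real n) * m powr 1 = m powr (1 - 2 / real n)" by (subst powr_add[symmetric]) simp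
    finally show ?thesis .
  qed
  define S where "S j = {x. 2 ^ j * R < norm (v x)}" for j :: nat
  have [measurable]: "S j \<in> sets lebesgue" for j
    using measurable_sets[of "\<lambda>x. norm (v x)" lebesgue borel "{2 ^ j * R<..}"] by (simp add: S_def vimage_def)
  have "(\<integral>\<^sup>+x. ennreal ((norm (v x))\<^sup>2) * indicator E x \<partial>lebesgue)
      \<le> (\<integral>\<^sup>+x. ennreal (R\<^sup>2) * indicator E x + (\<Sum>j. ennreal (4 * (2 ^ j * R)\<^sup>2) * indicator (S j) x) \<partial>lebesgue)"
  proof (rule nn_integral_mono)
    fix x
    have "ennreal ((norm (v x))\<^sup>2) \<le> ennreal (R\<^sup>2) + (\<Sum>j. ennreal (4 * (2 ^ j * R)\<^sup>2) * indicator (S j) x)"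
    proof (cases "R < norm (v x)")
      case False
      then have "ennreal ((norm (v x))\<^sup>2) \<le> ennreal (R\<^sup>2)" by (intro ennreal_leI power_mono) auto
      then show ?thesis by (rule add_increasing2[rotated]) simp
    next
      case True
      then obtain j where j: "2 ^ j * R < norm (v x)" "norm (v x) \<le> 2 ^ Suc j * R"
        using dyadic_bracket[OF R] by blast
      have "(norm (v x))\<^sup>2 \<le> (2 ^ Suc j * R)\<^sup>2" using j by (intro power_mono) auto
      also have "\<dots> = 4 * (2 ^ j * R)\<^sup>2" by (simp add: power_mult_distrib)
      finally have "ennreal ((norm (v x))\<^sup>2) \<le> ennreal (4 * (2 ^ j * R)\<^sup>2) * indicator (S j) x"
        using j by (simp add: S_def ennreal_leI)
      also have "\<dots> \<le> (\<Sum>j. ennreal (4 * (2 ^ j * R)\<^sup>2) * indicator (S j) x)"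
        by (rule ennreal_le_suminf)
      finally show ?thesis by (rule add_increasing[rotated]) simp
    qed
    then show "ennreal ((norm (v x))\<^sup>2) * indicator E x
        \<le> ennreal (R\<^sup>2) * indicator E x + (\<Sum>j. ennreal (4 * (2 ^ j * R)\<^sup>2) * indicator (S j) x)"
      by (cases "x \<in> E") auto
  qed
  also have "\<dots> = ennreal (R\<^sup>2) * emeasure lebesgue E + (\<Sum>j. ennreal (4 * (2 ^ j * R)\<^sup>2) * emeasure lebesgue (S j))"
    by (subst nn_integral_add, measurable, subst nn_integral_suminf, measurable)
       (simp add: nn_integral_cmult_indicator)
  also have "\<dots> \<le> ennreal (R\<^sup>2 * m) + (\<Sum>j. ennreal (4 * (R\<^sup>2 * m) * (1 / 2) ^ j))"
  proof (intro add_mono suminf_le)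
    show "ennreal (R\<^sup>2) * emeasure lebesgue E \<le> ennreal (R\<^sup>2 * m)"
      using E m by (simp add: ennreal_mult)
    fix j
    have "ennreal (4 * (2 ^ j * R)\<^sup>2) * emeasure lebesgue (S j)
        \<le> ennreal (4 * (2 ^ j * R)\<^sup>2) * ennreal ((d / (2 ^ j * R)) ^ n)"
      unfolding S_def using R by (intro mult_left_mono dist) auto
    also have "\<dots> = ennreal (4 * (2 ^ j * R)\<^sup>2 * (d / (2 ^ j * R)) ^ n)"
      using d R by (simp add: ennreal_mult)
    also have "\<dots> \<le> ennreal (4 * (R\<^sup>2 * m) * (1 / 2) ^ j)"
    proof (rule ennreal_leI)
      have "(d / (2 ^ j * R)) ^ n = m * ((1 / 2) ^ j) ^ n"
      proof -
        have "d / (2 ^ j * R) = (d / R) * (1 / 2) ^ j" by (simp add: power_divide)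
        then show ?thesis unfolding dR[symmetric] by (simp only: power_mult_distrib)
      qed
      \<comment> \<open>Here the dimension enters: the layer measures decay like
        \<open>2^(-n j)\<close> against the squared heights \<open>4^j\<close>, and for
        \<open>n\<close> at least 3 a factor \<open>2^(-j)\<close> remains.\<close>
      also have "\<dots> \<le> m * ((1 / 2) ^ j) ^ 3"
        using m n by (intro mult_left_mono power_decreasing) (auto simp: power_le_one)
      finally have "4 * (2 ^ j * R)\<^sup>2 * (d / (2 ^ j * R)) ^ n \<le> 4 * (2 ^ j * R)\<^sup>2 * (m * ((1 / 2) ^ j) ^ 3)"
        by (rule mult_left_mono) simp
      also have "\<dots> = 4 * (R\<^sup>2 * m) * (1 / 2) ^ j"
      proof -
        have "(2::real) ^ j * (1 / 2) ^ j = 1" by (simp add: power_mult_distrib[symmetric])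
        moreover have "x\<^sup>2 * y ^ 3 = (x * y) * (x * y) * y" for x y :: real
          by (simp add: power2_eq_square power3_eq_cube)
        ultimately have "(2 ^ j)\<^sup>2 * ((1 / 2 :: real) ^ j) ^ 3 = (1 / 2) ^ j" by simp
        then show ?thesis by (simp add: power_mult_distrib mult_ac)
      qed
      finally show "4 * (2 ^ j * R)\<^sup>2 * (d / (2 ^ j * R)) ^ n \<le> 4 * (R\<^sup>2 * m) * (1 / 2) ^ j" .
    qed
    finally show "ennreal (4 * (2 ^ j * R)\<^sup>2) * emeasure lebesgue (S j) \<le> ennreal (4 * (R\<^sup>2 * m) * (1 / 2) ^ j)" .
  qed auto
  also have "(\<Sum>j. ennreal (4 * (R\<^sup>2 * m) * (1 / 2) ^ j)) = ennreal (\<Sum>j. 4 * (R\<^sup>2 * m) * (1 / 2) ^ j)"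
    using m by (intro suminf_ennreal2 summable_mult summable_geometric) auto
  also have "(\<Sum>j. 4 * (R\<^sup>2 * m) * (1 / 2 :: real) ^ j) = 8 * (R\<^sup>2 * m)"
    by (subst suminf_mult) (auto simp: suminf_geometric)
  also have "ennreal (R\<^sup>2 * m) + ennreal (8 * (R\<^sup>2 * m)) = ennreal (9 * (R\<^sup>2 * m))"
    using m by (simp add: ennreal_plus[symmetric] del: ennreal_plus)
  finally show ?thesis unfolding R2 by (simp add: mult.assoc)
qed

lemma halving_sum_le:
  fixes a c :: "nat \<Rightarrow> real"
  assumes "\<And>j. 0 \<le> a j" "\<And>j. a (Suc j) \<le> a j / 2 + c j"
  shows "(\<Sum>j<J. a j) \<le> 2 * a 0 + 2 * (\<Sum>j<J. c j)"
proof -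
  \<comment> \<open>Keeping \<open>2 * a J\<close> on the left closes the induction: half of it pays
    for the next summand, the other half is twice the halved term.\<close>
  have "(\<Sum>j<J. a j) + 2 * a J \<le> 2 * a 0 + 2 * (\<Sum>j<J. c j)"
  proof (induction J)
    case (Suc J)
    then show ?case using assms(2)[of J] by simp
  qed simp
  then show ?thesis using assms(1)[of J] by linarith
qed

text \<open>\<open>72 = 2 * 4 * 9\<close>: the 2 comes from summing the halving recursion, the 4
  from the width of a dyadic layer of the field, the 9 from the weak type estimate. The factor 2304
  is that of \<open>level_dichotomy\<close>.\<close>

definition hardy_const :: "nat \<Rightarrow> real" where
  "hardy_const n = 72 * (2304 * capacity_const n)"

lemma hardy_const_pos: "hardy_const n > 0"
  unfolding hardy_const_def using capacity_const_pos[of n] by simp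

text \<open>If \<open>m'\<close> is small compared to \<open>m\<close>, the quantity at the doubled height is halved; otherwise
  it is controlled by the energy between the two levels.\<close>

lemma level_dichotomy:
  fixes m m' l D C :: real
  assumes n: "n \<ge> 3" and m: "0 \<le> m'" "m' \<le> m" and l: "l > 0" and D: "D \<ge> 0" and C: "C \<ge> 0"
    and step: "m' \<le> 9 * C * m powr (2 / real n) / l\<^sup>2 * D"
  shows "(2 * l)\<^sup>2 * m' powr (1 - 2 / real n) \<le> l\<^sup>2 * m powr (1 - 2 / real n) / 2 + 2304 * C * D"
proof -
  define p where "p = 1 - 2 / real n"
  have p: "1 / 3 \<le> p" "p < 1" using n by (auto simp: p_def field_simps)
  have RHS: "0 \<le> l\<^sup>2 * m powr p / 2" "0 \<le> 2304 * C * D" using C D by auto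
  show ?thesis
  proof (cases "m' = 0")
    case True
    then show ?thesis using RHS by (simp add: p_def)
  next
    case False
    then have mp: "m' > 0" "m > 0" using m by auto
    show ?thesis
    \<comment> \<open>The threshold is \<open>8^3\<close>: the exponent \<open>1 - 2/n\<close> is at
      least 1/3, so a drop of the measure by 512 shrinks its power by at least 8, which beats the
      factor 4 gained by doubling the height and leaves one half.\<close>
    proof (cases "m' \<le> m / 512")
      case True
      have "m' powr p \<le> (m / 512) powr p" using True mp p by (intro powr_mono2) auto
      also have "\<dots> = m powr p * (1 / 512) powr p" using mp by (simp add: powr_mult[symmetric])
      also have "\<dots> \<le> m powr p * (1 / 512) powr (1 / 3)"
        using p by (intro mult_left_mono powr_mono') auto
      also have "(1 / 512 :: real) powr (1 / 3) = 1 / 8"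
      proof -
        have "(1 / 512 :: real) = (1 / 8) powr 3" by (simp add: powr_numeral power3_eq_cube)
        then have "(1 / 512 :: real) powr (1 / 3) = ((1 / 8) powr 3) powr (1 / 3)" by (simp only:)
        also have "\<dots> = (1 / 8) powr (3 * (1 / 3))" by (rule powr_powr)
        finally show ?thesis by simp
      qed
      finally have "m' powr p \<le> m powr p / 8" by simp
      then have "(2 * l)\<^sup>2 * m' powr p \<le> (2 * l)\<^sup>2 * (m powr p / 8)" by (intro mult_left_mono) auto
      also have "\<dots> = l\<^sup>2 * m powr p / 2" by (simp add: power_mult_distrib)
      finally show ?thesis using RHS unfolding p_def by linarith
    next
      case False
      have "m' powr p = m' * m' powr (- (2 / real n))"
        using mp powr_add[of m' 1 "- (2 / real n)"] by (simp add: p_def)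
      also have "\<dots> \<le> m' * (m / 512) powr (- (2 / real n))"
        using mp False n by (intro mult_left_mono powr_mono2') auto
      also have "(m / 512) powr (- (2 / real n)) = m powr (- (2 / real n)) * 512 powr (2 / real n)"
        using mp by (simp add: powr_divide powr_minus field_simps)
      also have "m' * (m powr (- (2 / real n)) * 512 powr (2 / real n))
          \<le> m' * (m powr (- (2 / real n)) * 64)"
      proof -
        \<comment> \<open>Since \<open>2/n\<close> is at most 2/3, this power is at most 64, and
          \<open>4 * 9 * 64 = 2304\<close>.\<close>
        have "(512::real) powr (2 / real n) \<le> 512 powr (2 / 3)" using n by (intro powr_mono) (auto simp: field_simps)
        also have "\<dots> = (8 powr 3) powr (2 / 3)" by simp
        also have "\<dots> = 8 powr 2" unfolding powr_powr by simp
        also have "\<dots> = 64" by simp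
        finally show ?thesis using mp by (intro mult_left_mono) auto
      qed
      also have "\<dots> \<le> (9 * C * m powr (2 / real n) / l\<^sup>2 * D) * (m powr (- (2 / real n)) * 64)"
        using step by (intro mult_right_mono) auto
      also have "\<dots> = 576 * C * D / l\<^sup>2 * (m powr (2 / real n) * m powr (- (2 / real n)))" by simp
      also have "m powr (2 / real n) * m powr (- (2 / real n)) = 1"
        using mp by (simp add: powr_add[symmetric])
      finally have "(2 * l)\<^sup>2 * m' powr p \<le> (2 * l)\<^sup>2 * (576 * C * D / l\<^sup>2 * 1)" by (intro mult_left_mono) auto
      also have "\<dots> = 2304 * C * D" using l by (simp add: power_mult_distrib)
      finally show ?thesis using RHS unfolding p_def by linarith
    qed
  qed
qed

text \<open>The weight is integrated over the level sets of \<phi> at the heights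
  \<open>l j = 2^j b\<close>, which leads to the sum of
  \<open>a j = (l j)^2 (m j)^(1 - 2/n)\<close>. By the dichotomy each \<open>a (Suc j)\<close> is at
  most half of \<open>a j\<close> plus a multiple of the energy in the shell between the two
  heights. The shell energies add up to at most the total, and the starting term disappears as
  \<open>b\<close> tends to zero.\<close>

theorem hardy_weak:
  fixes \<phi> :: "'a::euclidean_space \<Rightarrow> 'b::euclidean_space" and G :: "'a \<Rightarrow> real"
    and v :: "'a \<Rightarrow> 'c::euclidean_space"
  assumes n: "DIM('a) \<ge> 3"
    and der: "\<And>x. (\<phi> has_derivative D x) (at x)"
    and bound: "\<And>x k. norm (D x k) \<le> G x * norm k" and G: "continuous_on UNIV G"
    and supp: "compact K" "\<And>x. x \<notin> K \<Longrightarrow> \<phi> x = 0"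
    and Gint: "integrable lborel (\<lambda>x. (G x)\<^sup>2)"
    and v: "v \<in> borel_measurable lebesgue" and d: "d > 0"
    and dist: "\<And>r. r > 0 \<Longrightarrow> emeasure lebesgue {x. r < norm (v x)} \<le> ennreal ((d / r) ^ DIM('a))"
  shows "(\<integral>\<^sup>+x. ennreal ((norm (v x))\<^sup>2 * (norm (\<phi> x))\<^sup>2) \<partial>lebesgue)
    \<le> ennreal (hardy_const DIM('a) * d\<^sup>2 * (LINT x|lborel. (G x)\<^sup>2))"
proof -
  define n where "n = DIM('a)"
  define p where "p = 1 - 2 / real n"
  have p: "p > 0" using n by (simp add: p_def n_def field_simps)
  define C where "C = capacity_const n"
  have C: "C > 0" by (simp add: C_def capacity_const_pos)
  define Dt where "Dt = (LINT x|lborel. (G x)\<^sup>2)"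
  have Dt: "(\<integral>\<^sup>+x. ennreal ((G x)\<^sup>2) \<partial>lborel) = ennreal Dt" "Dt \<ge> 0"
    unfolding Dt_def using Gint by (auto simp: nn_integral_eq_integral intro: Bochner_Integration.integral_nonneg)
  have c\<phi>: "continuous_on S \<phi>" for S
    using der by (auto intro!: continuous_at_imp_continuous_on has_derivative_continuous)
  have [measurable]: "\<phi> \<in> borel_measurable borel" "G \<in> borel_measurable borel"
    by (intro borel_measurable_continuous_onI c\<phi> G)+
  have [measurable]: "\<phi> \<in> borel_measurable lebesgue" by (simp add: measurable_completion)
  note [measurable] = v
  define E where "E c = {x. c < norm (\<phi> x)}" for c
  have E_sets[measurable]: "E c \<in> sets borel" for c
    unfolding E_def by (intro borel_open open_Collect_less continuous_intros c\<phi>)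
  then have E_leb[measurable]: "E c \<in> sets lebesgue" for c by simp
  have E_fin: "emeasure lborel (E c) = ennreal (measure lborel (E c))" "measure lborel (E c) \<le> measure lborel K"
    if "c > 0" for c
  proof -
    have sub: "E c \<subseteq> K" using supp(2) that by (force simp: E_def)
    have Kf: "K \<in> fmeasurable lborel"
      using emeasure_compact_finite[OF supp(1)] supp(1) by (auto simp: fmeasurable_def compact_imp_closed)
    then show "measure lborel (E c) \<le> measure lborel K" by (intro measure_mono_fmeasurable sub) auto
    have "E c \<in> fmeasurable lborel" by (rule fmeasurableI2[OF Kf sub]) simp
    then show "emeasure lborel (E c) = ennreal (measure lborel (E c))"
      by (auto simp: fmeasurable_def emeasure_eq_ennreal_measure)
  qed
  have "bounded (range \<phi>)"
  proof -
    have "range \<phi> \<subseteq> insert 0 (\<phi> ` K)" using supp(2) by auto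
    moreover have "bounded (insert 0 (\<phi> ` K))"
      using compact_imp_bounded[OF compact_continuous_image[OF c\<phi> supp(1)]] by simp
    ultimately show ?thesis by (rule bounded_subset[rotated])
  qed
  then obtain B where B: "\<And>x. norm (\<phi> x) \<le> B" unfolding bounded_iff by blast
  have level: "(\<integral>\<^sup>+x. ennreal ((norm (v x))\<^sup>2 * (norm (\<phi> x))\<^sup>2) * indicator (E b) x \<partial>lebesgue)
      \<le> ennreal (36 * d\<^sup>2 * (2 * (b\<^sup>2 * measure lborel K powr p) + 2 * (2304 * C * Dt)))" if b: "b > 0" for b
  proof -
    define l where "l j = 2 ^ j * b" for j :: nat
    have l: "l j > 0" "l (Suc j) = 2 * l j" for j using b by (auto simp: l_def)
    define m where "m j = measure lborel (E (l j))" for j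
    define Dj where "Dj j = (LINT x|lborel. (G x)\<^sup>2 * indicator (E (l j) - E (l (Suc j))) x)" for j
    have iD: "integrable lborel (\<lambda>x. (G x)\<^sup>2 * indicator (E (l j) - E (l (Suc j))) x)" for j
      using integrable_mult_indicator[OF _ Gint, of "E (l j) - E (l (Suc j))"] by (simp add: mult.commute)
    have Dj0: "Dj j \<ge> 0" for j unfolding Dj_def by (intro Bochner_Integration.integral_nonneg) simp
    have sub: "E (l (Suc j)) \<subseteq> E (l j)" for j using l[of j] by (auto simp: E_def)
    have mS: "m (Suc j) \<le> m j" for j
    proof -
      have "emeasure lborel (E (l (Suc j))) \<le> emeasure lborel (E (l j))"
        by (intro emeasure_mono sub) simp
      then show ?thesis unfolding E_fin(1)[OF l(1)] m_def by (subst (asm) ennreal_le_iff) auto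
    qed
    have step: "m (Suc j) \<le> 9 * C * m j powr (2 / real n) / (l j)\<^sup>2 * Dj j" for j
    proof -
      have "emeasure lborel (E (2 * l j)) \<le> ennreal (9 * capacity_const DIM('a) * (m j) powr (2 / DIM('a)) / (l j)\<^sup>2) *
          (\<integral>\<^sup>+x. ennreal ((G x)\<^sup>2) * indicator (E (l j) - E (2 * l j)) x \<partial>lborel)"
        unfolding E_def m_def by (rule level_set_step[OF der bound G supp l(1)])
      also have "(\<integral>\<^sup>+x. ennreal ((G x)\<^sup>2) * indicator (E (l j) - E (2 * l j)) x \<partial>lborel) = ennreal (Dj j)"
        unfolding Dj_def l(2)[symmetric] using iD
        by (subst nn_integral_eq_integral[symmetric]) (auto intro!: nn_integral_cong simp: indicator_def)
      also have "ennreal (9 * capacity_const DIM('a) * m j powr (2 / DIM('a)) / (l j)\<^sup>2) * ennreal (Dj j)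
          = ennreal (9 * C * m j powr (2 / real n) / (l j)\<^sup>2 * Dj j)"
        unfolding C_def n_def by (rule ennreal_mult''[symmetric]) (rule Dj0)
      finally show ?thesis
        unfolding l(2)[symmetric] E_fin(1)[OF l(1)] m_def[symmetric]
        using C Dj0[of j] by (subst (asm) ennreal_le_iff) auto
    qed
    define a where "a j = (l j)\<^sup>2 * m j powr p" for j
    have a_step: "a (Suc j) \<le> a j / 2 + 2304 * C * Dj j" for j
      unfolding a_def l(2) p_def
      using level_dichotomy[OF _ _ mS l(1) Dj0 less_imp_le[OF C] step, of j] n by (simp add: n_def m_def)
    \<comment> \<open>The shells are disjoint: their indicators telescope to a difference of two
      indicators.\<close>
    have "(\<Sum>j<J. Dj j) \<le> Dt" for J
    proof -
      have "(\<Sum>j<J. Dj j) = (LINT x|lborel. (\<Sum>j<J. (G x)\<^sup>2 * indicator (E (l j) - E (l (Suc j))) x))"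
        unfolding Dj_def by (rule Bochner_Integration.integral_sum[symmetric]) (rule iD)
      also have "\<dots> \<le> (LINT x|lborel. (G x)\<^sup>2)"
      proof (rule integral_mono)
        show "integrable lborel (\<lambda>x. \<Sum>j<J. (G x)\<^sup>2 * indicator (E (l j) - E (l (Suc j))) x)"
          by (intro Bochner_Integration.integrable_sum iD)
        fix x
        have "indicator (E (l j) - E (l (Suc j))) x = - (indicator (E (l (Suc j))) x - indicator (E (l j)) x :: real)" for j
          using sub[of j] by (auto simp: indicator_def)
        then have "(\<Sum>j<J. indicator (E (l j) - E (l (Suc j))) x) = - (indicator (E (l J)) x - indicator (E (l 0)) x :: real)"
          by (simp only: sum_negf sum_lessThan_telescope[of "\<lambda>j. indicator (E (l j)) x"])
        also have "\<dots> \<le> 1" by (simp add: indicator_def)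
        finally have "(G x)\<^sup>2 * (\<Sum>j<J. indicator (E (l j) - E (l (Suc j))) x) \<le> (G x)\<^sup>2 * 1"
          by (rule mult_left_mono) simp
        then show "(\<Sum>j<J. (G x)\<^sup>2 * indicator (E (l j) - E (l (Suc j))) x) \<le> (G x)\<^sup>2"
          by (simp add: sum_distrib_left)
      qed (rule Gint)
      finally show ?thesis unfolding Dt_def .
    qed
    note D_sum = this
    have a0: "a j \<ge> 0" for j by (simp add: a_def)
    \<comment> \<open>All level sets lie in the compact set \<open>K\<close>, so the starting term
      is at most a fixed multiple of \<open>b^2\<close>.\<close>
    have "m 0 powr p \<le> measure lborel K powr p"
      unfolding m_def using E_fin(2)[OF l(1)] p by (intro powr_mono2) auto
    then have a0_le: "a 0 \<le> b\<^sup>2 * measure lborel K powr p" by (simp add: a_def l_def mult_left_mono)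
    have a_sum: "(\<Sum>j<J. a j) \<le> 2 * (b\<^sup>2 * measure lborel K powr p) + 2 * (2304 * C * Dt)" for J
    proof -
      have "(\<Sum>j<J. a j) \<le> 2 * a 0 + 2 * (\<Sum>j<J. 2304 * C * Dj j)" 
        using a0 a_step by (rule halving_sum_le[where c = "\<lambda>j. 2304 * C * Dj j"])
      also have "(\<Sum>j<J. 2304 * C * Dj j) = 2304 * C * (\<Sum>j<J. Dj j)" by (simp add: sum_distrib_left)
      also have "\<dots> \<le> 2304 * C * Dt" using C by (intro mult_left_mono D_sum) auto
      finally show ?thesis using a0_le by linarith
    qed
    \<comment> \<open>As \<phi> is bounded, finitely many layers exhaust it.\<close>
    obtain J where "B / b < 2 ^ J" using real_arch_pow[of 2 "B / b"] by auto
    then have J: "B < 2 ^ J * b" using b by (simp add: pos_divide_less_eq)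
    have "(\<integral>\<^sup>+x. ennreal ((norm (v x))\<^sup>2 * (norm (\<phi> x))\<^sup>2) * indicator (E b) x \<partial>lebesgue)
        \<le> (\<integral>\<^sup>+x. (\<Sum>j<J. ennreal (4 * (l j)\<^sup>2) * (ennreal ((norm (v x))\<^sup>2) * indicator (E (l j)) x)) \<partial>lebesgue)"
    proof (rule nn_integral_mono)
      fix x
      show "ennreal ((norm (v x))\<^sup>2 * (norm (\<phi> x))\<^sup>2) * indicator (E b) x
          \<le> (\<Sum>j<J. ennreal (4 * (l j)\<^sup>2) * (ennreal ((norm (v x))\<^sup>2) * indicator (E (l j)) x))"
      proof (cases "x \<in> E b")
        case True
        then obtain j where j: "2 ^ j * b < norm (\<phi> x)" "norm (\<phi> x) \<le> 2 ^ Suc j * b"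
          using dyadic_bracket[OF b, of "norm (\<phi> x)"] by (auto simp: E_def)
        have "2 ^ j * b < 2 ^ J * b" using j(1) B[of x] J by linarith
        then have jJ: "j < J" using b by simp
        have "(norm (\<phi> x))\<^sup>2 \<le> (2 ^ Suc j * b)\<^sup>2" using j by (intro power_mono) auto
        also have "\<dots> = 4 * (l j)\<^sup>2" by (simp add: l_def power_mult_distrib)
        finally have "(norm (v x))\<^sup>2 * (norm (\<phi> x))\<^sup>2 \<le> (4 * (l j)\<^sup>2) * (norm (v x))\<^sup>2"
          by (subst mult.commute) (rule mult_right_mono, auto)
        then have "ennreal ((norm (v x))\<^sup>2 * (norm (\<phi> x))\<^sup>2) \<le> ennreal (4 * (l j)\<^sup>2) * ennreal ((norm (v x))\<^sup>2)"
          by (simp add: ennreal_mult[symmetric] ennreal_leI)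
        also have "\<dots> = ennreal (4 * (l j)\<^sup>2) * (ennreal ((norm (v x))\<^sup>2) * indicator (E (l j)) x)"
          using j by (simp add: E_def l_def)
        also have "\<dots> \<le> (\<Sum>j<J. ennreal (4 * (l j)\<^sup>2) * (ennreal ((norm (v x))\<^sup>2) * indicator (E (l j)) x))"
          using jJ by (intro member_le_sum) auto
        finally show ?thesis using True by simp
      qed simp
    qed
    also have "\<dots> = (\<Sum>j<J. ennreal (4 * (l j)\<^sup>2) * (\<integral>\<^sup>+x. ennreal ((norm (v x))\<^sup>2) * indicator (E (l j)) x \<partial>lebesgue))"
      by (subst nn_integral_sum, measurable) (intro sum.cong refl nn_integral_cmult, measurable)
    also have "\<dots> \<le> (\<Sum>j<J. ennreal (4 * (l j)\<^sup>2) * ennreal (9 * d\<^sup>2 * m j powr (1 - 2 / real n)))"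
    proof (intro sum_mono mult_left_mono)
      fix j
      show "(\<integral>\<^sup>+x. ennreal ((norm (v x))\<^sup>2) * indicator (E (l j)) x \<partial>lebesgue) \<le> ennreal (9 * d\<^sup>2 * m j powr (1 - 2 / real n))"
      proof (rule weak_type_set_integral[OF v d])
        show "3 \<le> n" using n by (simp add: n_def)
        show "emeasure lebesgue {x. r < norm (v x)} \<le> ennreal ((d / r) ^ n)" if "r > 0" for r
          unfolding n_def by (rule dist[OF that])
        show "emeasure lebesgue (E (l j)) = ennreal (m j)"
          unfolding m_def using E_fin(1)[OF l(1)[of j]] by (simp add: emeasure_completion)
      qed (auto simp: m_def)
    qed simp
    also have "\<dots> = (\<Sum>j<J. ennreal (36 * d\<^sup>2 * a j))"
      by (intro sum.cong refl) (simp add: ennreal_mult[symmetric] a_def p_def mult_ac)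
    also have "\<dots> = ennreal (36 * d\<^sup>2 * (\<Sum>j<J. a j))"
      using a0 by (subst sum_ennreal) (auto simp: sum_distrib_left)
    also have "\<dots> \<le> ennreal (36 * d\<^sup>2 * (2 * (b\<^sup>2 * measure lborel K powr p) + 2 * (2304 * C * Dt)))"
      by (intro ennreal_leI mult_left_mono a_sum) simp
    finally show ?thesis .
  qed
  \<comment> \<open>Restricting to heights above \<open>1 / (N + 1)\<close> loses only the zeros of
    \<phi> in the limit; Fatou's lemma then passes to \<open>b = 0\<close> in the bound.\<close>
  define f where "f N x = ennreal ((norm (v x))\<^sup>2 * (norm (\<phi> x))\<^sup>2) * indicator (E (1 / real (Suc N))) x" for N x
  have f_lim: "(\<lambda>N. f N x) \<longlonglongrightarrow> ennreal ((norm (v x))\<^sup>2 * (norm (\<phi> x))\<^sup>2)" for x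
  proof (cases "\<phi> x = 0")
    case True
    then show ?thesis by (simp add: f_def)
  next
    case False
    then obtain N where N: "1 / real (Suc N) < norm (\<phi> x)" using nat_approx_posE[of "norm (\<phi> x)"] by auto
    have "\<forall>\<^sub>F M in sequentially. f M x = ennreal ((norm (v x))\<^sup>2 * (norm (\<phi> x))\<^sup>2)"
      using eventually_ge_at_top[of N]
    proof eventually_elim
      case (elim M)
      then have "1 / real (Suc M) \<le> 1 / real (Suc N)" by (intro divide_left_mono) auto
      then have "x \<in> E (1 / real (Suc M))" using N by (simp add: E_def)
      then show ?case by (simp add: f_def)
    qed
    then show ?thesis by (rule tendsto_eventually)
  qed
  have "(\<integral>\<^sup>+x. ennreal ((norm (v x))\<^sup>2 * (norm (\<phi> x))\<^sup>2) \<partial>lebesgue) = (\<integral>\<^sup>+x. liminf (\<lambda>N. f N x) \<partial>lebesgue)"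
    by (intro nn_integral_cong lim_imp_Liminf[OF sequentially_bot, symmetric] f_lim)
  also have "\<dots> \<le> liminf (\<lambda>N. \<integral>\<^sup>+x. f N x \<partial>lebesgue)"
    by (rule nn_integral_liminf) (unfold f_def, measurable)
  also have "\<dots> \<le> liminf (\<lambda>N. ennreal (36 * d\<^sup>2 * (2 * ((1 / real (Suc N))\<^sup>2 * measure lborel K powr p) + 2 * (2304 * C * Dt))))"
    unfolding f_def by (intro Liminf_mono always_eventually allI level) simp
  also have "\<dots> = ennreal (36 * d\<^sup>2 * (2 * (0\<^sup>2 * measure lborel K powr p) + 2 * (2304 * C * Dt)))"
    by (intro lim_imp_Liminf sequentially_bot tendsto_intros LIMSEQ_Suc[OF lim_1_over_n])
  also have "36 * d\<^sup>2 * (2 * (0\<^sup>2 * measure lborel K powr p) + 2 * (2304 * C * Dt)) = hardy_const n * d\<^sup>2 * Dt"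
    by (simp add: hardy_const_def C_def)
  finally show ?thesis unfolding n_def Dt_def .
qed

section \<open>Completeness and separability of the solenoidal spaces\<close>

lemma rep_L2_square_integrable: "square_integrable (rep_L2 u)"
  using Quotient3_rep_reflp[OF Quotient3_L2, of u] by (simp add: L2rel_def)

lemma abs_rep_L2: "abs_L2 (rep_L2 u) = u"
  by (rule Quotient3_abs_rep[OF Quotient3_L2])

lemma rep_abs_L2: "square_integrable f \<Longrightarrow> AE x in lebesgue. rep_L2 (abs_L2 f) x = f x"
  using Quotient3_rep_abs[OF Quotient3_L2, of f] by (simp add: L2rel_def)

lemma abs_L2_eqI: "square_integrable f \<Longrightarrow> square_integrable g \<Longrightarrow> AE x in lebesgue. f x = g x \<Longrightarrow> abs_L2 f = abs_L2 g"
  by (rule Quotient3_rel_abs[OF Quotient3_L2]) (simp add: L2rel_def)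

lemma square_integrable_iff_sq_int: "square_integrable f \<longleftrightarrow> sq_int lebesgue f"
  by (simp add: square_integrable_def sq_int_def)

lemma rep_L2_add: "AE x in lebesgue. rep_L2 (u + v) x = rep_L2 u x + rep_L2 v x"
proof -
  have "u + v = abs_L2 (\<lambda>x. rep_L2 u x + rep_L2 v x)"
    by (simp add: abs_L2_add rep_L2_square_integrable abs_rep_L2)
  then show ?thesis
    using rep_abs_L2[OF square_integrable_add[OF rep_L2_square_integrable rep_L2_square_integrable], of u v] by simp
qed

lemma rep_L2_scaleR: "AE x in lebesgue. rep_L2 (c *\<^sub>R u) x = c *\<^sub>R rep_L2 u x"
proof -
  have "c *\<^sub>R u = abs_L2 (\<lambda>x. c *\<^sub>R rep_L2 u x)"
    by (simp add: abs_L2_scaleR rep_L2_square_integrable abs_rep_L2)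
  then show ?thesis
    using rep_abs_L2[OF square_integrable_scaleR[OF rep_L2_square_integrable], of c u] by simp
qed

lemma rep_L2_diff: "AE x in lebesgue. rep_L2 (u - v) x = rep_L2 u x - rep_L2 v x"
  using rep_L2_add[of u "(-1) *\<^sub>R v"] rep_L2_scaleR[of "-1" v]
proof eventually_elim
  case (elim x)
  then show ?case by simp
qed

lemma inner_L2_eq: "u \<bullet> v = (LINT x|lebesgue. rep_L2 u x \<bullet> rep_L2 v x)"
  using inner_L2.abs_eq[of "rep_L2 u" "rep_L2 v"]
  by (simp add: L2rel_def rep_L2_square_integrable abs_rep_L2)

lemma norm_L2_eq: "(norm u)\<^sup>2 = (LINT x|lebesgue. (norm (rep_L2 u x))\<^sup>2)"
  by (simp add: power2_norm_eq_inner inner_L2_eq)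

lemma norm_abs_L2: "square_integrable f \<Longrightarrow> (norm (abs_L2 f))\<^sup>2 = (LINT x|lebesgue. (norm (f x))\<^sup>2)"
  unfolding norm_L2_eq
  by (rule integral_cong_AE) (use rep_abs_L2[of f] rep_L2_square_integrable[of "abs_L2 f"] in
      \<open>auto simp: square_integrable_def elim: AE_mp\<close>)

lemma nn_norm_L2: "(\<integral>\<^sup>+x. ennreal ((norm (rep_L2 u x))\<^sup>2) \<partial>lebesgue) = ennreal ((norm u)\<^sup>2)"
  unfolding norm_L2_eq using rep_L2_square_integrable[of u]
  by (intro nn_integral_eq_integral) (auto simp: square_integrable_def)

lemma nn_norm_diff_L2:
  assumes "square_integrable f"
  shows "(\<integral>\<^sup>+x. ennreal ((norm (rep_L2 u x - f x))\<^sup>2) \<partial>lebesgue) = ennreal ((norm (u - abs_L2 f))\<^sup>2)"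
  unfolding nn_norm_L2[symmetric]
proof (rule nn_integral_cong_AE)
  show "AE x in lebesgue. ennreal ((norm (rep_L2 u x - f x))\<^sup>2) = ennreal ((norm (rep_L2 (u - abs_L2 f) x))\<^sup>2)"
    using rep_L2_diff[of u "abs_L2 f"] rep_abs_L2[OF assms] by eventually_elim simp
qed

text \<open>Distances of classes are square integrals of differences of representatives, so a Cauchy
  sequence of classes is one of functions in the sense of \<open>riesz_fischer\<close>.\<close>

instance L2 :: (euclidean_space, euclidean_space) complete_space
proof
  fix X :: "nat \<Rightarrow> ('a, 'b) L2"
  assume X: "Cauchy X"
  have nn: "(\<integral>\<^sup>+x. ennreal ((norm (rep_L2 (X k) x - rep_L2 (X l) x))\<^sup>2) \<partial>lebesgue) = ennreal ((norm (X k - X l))\<^sup>2)" for k l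
    using nn_norm_diff_L2[OF rep_L2_square_integrable[of "X l"], of "X k"] by (simp add: abs_rep_L2)
  have m: "rep_L2 (X k) \<in> borel_measurable lebesgue" for k
    using rep_L2_square_integrable[of "X k"] by (simp add: square_integrable_def)
  have cau: "\<exists>N. \<forall>k\<ge>N. \<forall>l\<ge>N. (\<integral>\<^sup>+x. ennreal ((norm (rep_L2 (X k) x - rep_L2 (X l) x))\<^sup>2) \<partial>lebesgue) \<le> ennreal \<epsilon>"
    if "\<epsilon> > 0" for \<epsilon>
  proof -
    have "sqrt \<epsilon> > 0" using that by simp
    from CauchyD[OF X this] obtain N where N: "\<And>k l. k \<ge> N \<Longrightarrow> l \<ge> N \<Longrightarrow> norm (X k - X l) < sqrt \<epsilon>" by blast
    show ?thesis
    proof (intro exI allI impI)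
      fix k l assume "N \<le> k" "N \<le> l"
      then have "(norm (X k - X l))\<^sup>2 \<le> (sqrt \<epsilon>)\<^sup>2" by (intro power_mono less_imp_le[OF N]) auto
      then show "(\<integral>\<^sup>+x. ennreal ((norm (rep_L2 (X k) x - rep_L2 (X l) x))\<^sup>2) \<partial>lebesgue) \<le> ennreal \<epsilon>"
        unfolding nn using that by (intro ennreal_leI) simp
    qed
  qed
  obtain g where gm: "g \<in> borel_measurable lebesgue" and g: "\<And>\<epsilon>. \<epsilon> > 0 \<Longrightarrow>
      \<exists>N. \<forall>k\<ge>N. (\<integral>\<^sup>+x. ennreal ((norm (rep_L2 (X k) x - g x))\<^sup>2) \<partial>lebesgue) \<le> ennreal \<epsilon>"
  proof (rule riesz_fischer[of "\<lambda>k. rep_L2 (X k)" lebesgue, OF m cau])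
    fix g assume "g \<in> borel_measurable lebesgue" "\<And>\<epsilon>. \<epsilon> > 0 \<Longrightarrow>
      \<exists>N. \<forall>k\<ge>N. (\<integral>\<^sup>+x. ennreal ((norm (rep_L2 (X k) x - g x))\<^sup>2) \<partial>lebesgue) \<le> ennreal \<epsilon>"
    from that[OF this] show thesis .
  qed
  obtain N1 where N1: "\<And>k. k \<ge> N1 \<Longrightarrow> (\<integral>\<^sup>+x. ennreal ((norm (rep_L2 (X k) x - g x))\<^sup>2) \<partial>lebesgue) \<le> ennreal 1"
    using g[of 1] by auto
  have "sq_int lebesgue (\<lambda>x. rep_L2 (X N1) x - g x)"
    unfolding sq_int_iff_nn using N1[of N1] m gm
    by (auto intro: le_less_trans[OF _ ennreal_one_less_top] borel_measurable_diff)
  then have sg: "square_integrable g"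
    using sq_int_diff[of lebesgue "rep_L2 (X N1)" "\<lambda>x. rep_L2 (X N1) x - g x"] rep_L2_square_integrable[of "X N1"]
    by (simp add: square_integrable_iff_sq_int)
  have "X \<longlonglongrightarrow> abs_L2 g"
  proof (rule LIMSEQ_I)
    fix r :: real assume r: "r > 0"
    then have "(r/2)\<^sup>2 > 0" by simp
    from g[OF this] obtain N where N: "\<And>k. k \<ge> N \<Longrightarrow>
        (\<integral>\<^sup>+x. ennreal ((norm (rep_L2 (X k) x - g x))\<^sup>2) \<partial>lebesgue) \<le> ennreal ((r/2)\<^sup>2)" by blast
    show "\<exists>no. \<forall>n\<ge>no. norm (X n - abs_L2 g) < r"
    proof (intro exI allI impI)
      fix n assume "N \<le> n"
      then have "(norm (X n - abs_L2 g))\<^sup>2 \<le> (r/2)\<^sup>2"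
        using N[of n] unfolding nn_norm_diff_L2[OF sg] by (simp add: ennreal_le_iff)
      then have "norm (X n - abs_L2 g) \<le> r/2" by (rule power2_le_imp_le) (use r in simp)
      then show "norm (X n - abs_L2 g) < r" using r by linarith
    qed
  qed
  then show "convergent X" by (auto simp: convergent_def)
qed

instance L2 :: (euclidean_space, euclidean_space) banach ..

section \<open>Transfer of completeness and separability along isometries\<close>

text \<open>A closed image in a complete space makes the domain complete. It is applied to the
  representation maps of the two solenoidal spaces, whose images are closures.\<close>

lemma complete_space_of_isometry:
  fixes f :: "'a::metric_space \<Rightarrow> 'b::complete_space" and X :: "nat \<Rightarrow> 'a"
  assumes iso: "\<And>x y. dist (f x) (f y) = dist x y" and cl: "closed (range f)" and X: "Cauchy X"
  shows "convergent X"
proof -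
  have "Cauchy (\<lambda>n. f (X n))" using X unfolding Cauchy_def iso .
  then obtain l where l: "(\<lambda>n. f (X n)) \<longlonglongrightarrow> l" using Cauchy_convergent convergent_def by metis
  then have "l \<in> range f" using closed_sequentially[OF cl, of "\<lambda>n. f (X n)" l] by auto
  then obtain x where "l = f x" by blast
  with l have "X \<longlonglongrightarrow> x" unfolding tendsto_iff by (simp add: iso)
  then show ?thesis by (auto simp: convergent_def)
qed

lemma dist_Rep_L2s: "dist (Rep_L2s u) (Rep_L2s v) = dist u v"
  unfolding dist_norm by (simp add: norm_L2s.rep_eq minus_L2s.rep_eq)

lemma dist_Rep_H1s: "dist (Rep_H1s u) (Rep_H1s v) = dist u v"
  unfolding dist_norm by (simp add: norm_H1s.rep_eq minus_H1s.rep_eq)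

lemma range_Rep_L2s: "range Rep_L2s = L2s_set"
  using type_definition.Rep_range[OF type_definition_L2s] .

lemma range_Rep_H1s: "range Rep_H1s = H1s_set"
  using type_definition.Rep_range[OF type_definition_H1s] .

instance L2s :: (finite) complete_space
proof
  fix X :: "nat \<Rightarrow> 'a L2s" assume "Cauchy X"
  then show "convergent X"
    by (rule complete_space_of_isometry[OF dist_Rep_L2s, rotated])
       (simp add: range_Rep_L2s L2s_set_def)
qed

instance L2s :: (finite) banach ..

instance H1s :: (finite) complete_space
proof
  fix X :: "nat \<Rightarrow> 'a H1s" assume "Cauchy X"
  then show "convergent X"
    by (rule complete_space_of_isometry[OF dist_Rep_H1s, rotated])
       (simp add: range_Rep_H1s H1s_set_def)
qed

instance H1s :: (finite) banach ..

text \<open>The basis consists of preimages of balls with rational radii around points of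
  \<open>D\<close>. The centres may lie outside the image of \<open>f\<close>, so a countable set
  dense near the image in the ambient space is enough.\<close>

lemma second_countable_of_isometry:
  fixes f :: "'a::metric_space \<Rightarrow> 'b::metric_space"
  assumes iso: "\<And>x y. dist (f x) (f y) = dist x y" and D: "countable D" "range f \<subseteq> closure D"
  shows "\<exists>B::'a set set. countable B \<and> open = generate_topology B"
proof -
  define B where "B = (\<lambda>(d, q). {x. dist (f x) d < q}) ` (D \<times> \<rat>)"
  have "countable B" unfolding B_def by (intro countable_image countable_SIGMA D countable_rat)
  moreover have "topological_basis B"
  proof (rule topological_basisI)
    have cf: "continuous_on UNIV f"
      unfolding continuous_on_iff iso by auto
    show "open B'" if B: "B' \<in> B" for B'
    proof -
      obtain d q where B': "B' = {x. dist (f x) d < q}" using B by (auto simp: B_def)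
      show ?thesis unfolding B' by (intro open_Collect_less continuous_on_dist cf continuous_on_const)
    qed
    fix O' :: "'a set" and x assume O': "open O'" "x \<in> O'"
    then obtain \<epsilon> where \<epsilon>: "\<epsilon> > 0" "ball x \<epsilon> \<subseteq> O'" using openE by blast
    have "f x \<in> closure D" using D(2) by blast
    then obtain d where d: "d \<in> D" "dist d (f x) < \<epsilon> / 3"
      unfolding closure_approachable using \<epsilon> by (meson divide_pos_pos zero_less_numeral)
    obtain q where q: "q \<in> \<rat>" "\<epsilon> / 3 < q" "q < 2 * \<epsilon> / 3"
      using Rats_dense_in_real[of "\<epsilon> / 3" "2 * \<epsilon> / 3"] \<epsilon> by auto
    show "\<exists>B'\<in>B. x \<in> B' \<and> B' \<subseteq> O'"
    proof (intro bexI[of _ "{x. dist (f x) d < q}"] conjI)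
      show "{x. dist (f x) d < q} \<in> B" using d q by (auto simp: B_def)
      show "x \<in> {x. dist (f x) d < q}" using d q by (simp add: dist_commute)
      show "{x. dist (f x) d < q} \<subseteq> O'"
      proof
        fix y assume "y \<in> {x. dist (f x) d < q}"
        then have "dist (f y) (f x) < \<epsilon>" using d q dist_triangle[of "f y" "f x" d] by simp
        then show "y \<in> O'" using \<epsilon> by (auto simp: iso dist_commute)
      qed
    qed
  qed
  ultimately show ?thesis using topological_basis_imp_subbasis by blast
qed

text \<open>\<open>D\<close> is the set of rational combinations of \<open>D0\<close>, coded as
  lists of coefficient and vector. Its closure is a real subspace because rationals approximate
  reals, hence contains the real span.\<close>

lemma countable_dense_span:
  fixes D0 :: "'v::real_normed_vector set"
  assumes "countable D0"
  obtains D where "countable D" "span D0 \<subseteq> closure D"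
proof -
  define c where "c l = (\<Sum>(q, d)\<leftarrow>l. real_of_rat q *\<^sub>R d)" for l :: "(rat \<times> 'v) list"
  define D where "D = c ` lists (UNIV \<times> D0)"
  have c_append: "c (l1 @ l2) = c l1 + c l2" for l1 l2 by (simp add: c_def)
  have c_scale: "c (map (\<lambda>(q, d). (p * q, d)) l) = real_of_rat p *\<^sub>R c l" for p l
    by (induction l) (auto simp: c_def of_rat_mult scaleR_add_right)
  have D_add: "x + y \<in> D" if "x \<in> D" "y \<in> D" for x y
    using that unfolding D_def by (auto simp: c_append[symmetric] simp del: in_lists_conv_set intro!: imageI append_in_lists_conv[THEN iffD2])
  have D_scale: "real_of_rat p *\<^sub>R x \<in> D" if x: "x \<in> D" for x p
  proof -
    obtain l where l: "l \<in> lists (UNIV \<times> D0)" "x = c l" using x by (auto simp: D_def)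
    have "map (\<lambda>(q, d). (p * q, d)) l \<in> lists (UNIV \<times> D0)" using l(1) by (auto simp: in_lists_conv_set)
    then show ?thesis unfolding D_def l(2) c_scale[symmetric] by (rule imageI)
  qed
  have "countable D" unfolding D_def by (intro countable_image countable_lists countable_SIGMA assms) auto
  moreover have "D0 \<subseteq> D"
  proof
    fix d assume "d \<in> D0"
    then have "c [(1, d)] \<in> D" unfolding D_def by (intro imageI) auto
    then show "d \<in> D" by (simp add: c_def)
  qed
  moreover have "subspace (closure D)"
  proof (rule subspaceI)
    have "c [] \<in> D" unfolding D_def by (intro imageI) auto
    then show "0 \<in> closure D" using closure_subset by (auto simp: c_def)
    show "x + y \<in> closure D" if xy: "x \<in> closure D" "y \<in> closure D" for x y
    proof -
      obtain f g where fg: "\<And>n. f n \<in> D" "f \<longlonglongrightarrow> x" "\<And>n. g n \<in> D" "g \<longlonglongrightarrow> y"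
        using xy unfolding closure_sequential by blast
      then show ?thesis unfolding closure_sequential
        by (intro exI[of _ "\<lambda>n. f n + g n"]) (auto intro: D_add tendsto_add)
    qed
    show "r *\<^sub>R x \<in> closure D" if x: "x \<in> closure D" for r x
    proof -
      obtain f where f: "\<And>n. f n \<in> D" "f \<longlonglongrightarrow> x" using x unfolding closure_sequential by blast
      have "\<exists>p. r < real_of_rat p \<and> real_of_rat p < r + 1 / real (Suc n)" for n
        by (rule of_rat_dense) simp
      then obtain p where p: "\<And>n. r < real_of_rat (p n)" "\<And>n. real_of_rat (p n) < r + 1 / real (Suc n)" by metis
      have "(\<lambda>n. r + 1 / real (Suc n)) \<longlonglongrightarrow> r + 0" by (intro tendsto_intros LIMSEQ_Suc[OF lim_1_over_n])
      then have "(\<lambda>n. r + 1 / real (Suc n)) \<longlonglongrightarrow> r" by simp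
      then have "(\<lambda>n. real_of_rat (p n)) \<longlonglongrightarrow> r"
        by (rule tendsto_sandwich[OF always_eventually always_eventually tendsto_const, rotated 2])
           (simp_all only: less_imp_le p simp_thms)
      then have "(\<lambda>n. real_of_rat (p n) *\<^sub>R f n) \<longlonglongrightarrow> r *\<^sub>R x" by (rule tendsto_scaleR[OF _ f(2)])
      then show ?thesis unfolding closure_sequential
        using D_scale[OF f(1)] by (intro exI[of _ "\<lambda>n. real_of_rat (p n) *\<^sub>R f n"]) auto
    qed
  qed
  ultimately show ?thesis using that span_minimal[of D0 "closure D"] closure_subset by blast
qed

section \<open>Rearrangements and Lorentz norms\<close>

lemma rearrangement_antimono: "s \<le> t \<Longrightarrow> rearrangement f t \<le> rearrangement f s"
  unfolding rearrangement_def
  by (intro Inf_superset_mono) (blast intro: order_trans[OF _ ennreal_leI])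

lemma distribution_fun_antimono:
  fixes f :: "'a::euclidean_space \<Rightarrow> 'b::euclidean_space"
  assumes "f \<in> borel_measurable lebesgue" "r \<le> s"
  shows "distribution_fun f s \<le> distribution_fun f r"
proof -
  have "{x. r < norm (f x)} = (\<lambda>x. norm (f x)) -` {r<..} \<inter> space lebesgue" by auto
  also have "\<dots> \<in> sets lebesgue" using assms by (intro measurable_sets[of _ _ borel]) auto
  finally show ?thesis unfolding distribution_fun_def using assms(2) by (intro emeasure_mono) auto
qed

text \<open>A decreasing function is below its average, so the rearrangement at \<open>t\<close> is
  at most \<delta> divided by \<open>t^(1/q)\<close>. For \<open>t = (2 \<delta> / r)^q\<close> this
  is \<open>r / 2\<close>. The factor 2 makes the inequality with \<open>r\<close> strict, so the
  infimum defining the rearrangement provides an admissible level below \<open>r\<close>.\<close>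

lemma weak_norm_imp_distribution_bound:
  fixes f :: "'a::euclidean_space \<Rightarrow> 'b::euclidean_space"
  assumes f: "f \<in> borel_measurable lebesgue" and q: "q > 0" and \<delta>: "\<delta> > 0" and r: "r > 0"
    and wn: "weak_norm q f \<le> ennreal \<delta>"
  shows "distribution_fun f r \<le> ennreal ((2 * \<delta> / r) powr q)"
proof -
  define t where "t = (2 * \<delta> / r) powr q"
  have t: "t > 0" using \<delta> r by (simp add: t_def)
  have tq: "t powr (1 / q) = 2 * \<delta> / r" using \<delta> r q by (simp add: t_def powr_powr)
  have "rearrangement f t * ennreal t = (\<integral>\<^sup>+\<tau>. rearrangement f t * indicator {0..t} \<tau> \<partial>lborel)"
    using t by (subst nn_integral_cmult_indicator) auto
  also have "\<dots> \<le> (\<integral>\<^sup>+\<tau>\<in>{0..t}. rearrangement f \<tau> \<partial>lborel)"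
    by (intro nn_integral_mono) (auto simp: indicator_def intro: rearrangement_antimono)
  finally have "rearrangement f t * ennreal t \<le> (\<integral>\<^sup>+\<tau>\<in>{0..t}. rearrangement f \<tau> \<partial>lborel)" .
  then have "(rearrangement f t * ennreal t) / ennreal t \<le> average_rearrangement f t"
    unfolding average_rearrangement_def by (rule divide_right_mono_ennreal)
  moreover have "(rearrangement f t * ennreal t) / ennreal t = rearrangement f t"
    using t by (intro ennreal_mult_divide_eq) auto
  ultimately have "rearrangement f t \<le> average_rearrangement f t" by simp
  then have "ennreal (t powr (1 / q)) * rearrangement f t \<le> ennreal (t powr (1 / q)) * average_rearrangement f t"
    by (rule mult_left_mono) simp
  also have "\<dots> \<le> weak_norm q f"
    unfolding weak_norm_def using t by (intro SUP_upper) auto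
  also note wn
  finally have le: "ennreal (2 * \<delta> / r) * rearrangement f t \<le> ennreal \<delta>" unfolding tq .
  have "rearrangement f t < ennreal r"
  proof (rule ccontr)
    assume "\<not> rearrangement f t < ennreal r"
    then have "ennreal (2 * \<delta> / r) * ennreal r \<le> ennreal (2 * \<delta> / r) * rearrangement f t"
      by (intro mult_left_mono) auto
    also note le
    finally have "ennreal (2 * \<delta>) \<le> ennreal \<delta>" using \<delta> r by (simp add: ennreal_mult[symmetric])
    then show False using \<delta> by (subst (asm) ennreal_le_iff) auto
  qed
  then obtain r' where r': "0 \<le> r'" "distribution_fun f r' \<le> ennreal t" "ennreal r' < ennreal r"
    unfolding rearrangement_def Inf_less_iff by auto
  have "r' \<le> r" using r' r by (simp add: ennreal_less_iff)
  then show ?thesis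
    using distribution_fun_antimono[OF f] r'(2) unfolding t_def by (blast intro: order_trans)
qed

text \<open>The rearrangement is at most \<open>M\<close> and vanishes from time \<open>m'\<close>
  on, so its average is at most \<open>M\<close> and at most \<open>M m' / t\<close>. The first
  bound is used on the unit interval, the second beyond it. This makes fields built from test fields
  admissible in the definition of weak* continuity.\<close>

lemma in_lorentz1_bounded_support:
  fixes g :: "'a::euclidean_space \<Rightarrow> 'b::euclidean_space"
  assumes g: "g \<in> borel_measurable lebesgue" and Q: "Q > 1"
    and M: "\<And>x. norm (g x) \<le> M"
    and A: "A \<in> sets lebesgue" "emeasure lebesgue A \<le> ennreal m" "\<And>x. x \<notin> A \<Longrightarrow> g x = 0"
  shows "in_lorentz1 Q g"
proof -
  have M0: "M \<ge> 0" using M[of undefined] norm_ge_zero order_trans by blast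
  define m' where "m' = max m 0"
  have m': "m' \<ge> 0" "emeasure lebesgue A \<le> ennreal m'"
    using A(2) by (auto simp: m'_def max_def ennreal_neg)
  have rM: "rearrangement g \<tau> \<le> ennreal M" for \<tau>
    unfolding rearrangement_def
  proof (rule Inf_lower)
    have "{x. M < norm (g x)} = {}" using M by (auto simp: not_less)
    then show "ennreal M \<in> {ennreal r |r. 0 \<le> r \<and> distribution_fun g r \<le> ennreal \<tau>}"
      using M0 by (auto simp: distribution_fun_def)
  qed
  have r0: "rearrangement g \<tau> = 0" if "m' \<le> \<tau>" for \<tau>
  proof -
    have "distribution_fun g 0 \<le> emeasure lebesgue A"
      unfolding distribution_fun_def by (rule emeasure_mono[OF _ A(1)]) (use A(3) in force)
    also have "\<dots> \<le> ennreal \<tau>" using m' that by (meson ennreal_leI order_trans)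
    finally have "rearrangement g \<tau> \<le> ennreal 0"
      unfolding rearrangement_def by (intro Inf_lower CollectI exI[of _ 0]) simp
    then show ?thesis by simp
  qed
  have int1: "(\<integral>\<^sup>+\<tau>\<in>{0..t}. rearrangement g \<tau> \<partial>lborel) \<le> ennreal M * ennreal t" if "t > 0" for t
  proof -
    have "(\<integral>\<^sup>+\<tau>\<in>{0..t}. rearrangement g \<tau> \<partial>lborel) \<le> (\<integral>\<^sup>+\<tau>. ennreal M * indicator {0..t} \<tau> \<partial>lborel)"
      by (intro nn_integral_mono) (auto simp: indicator_def rM)
    also have "\<dots> = ennreal M * ennreal t" using that by (subst nn_integral_cmult_indicator) auto
    finally show ?thesis .
  qed
  have int2: "(\<integral>\<^sup>+\<tau>\<in>{0..t}. rearrangement g \<tau> \<partial>lborel) \<le> ennreal M * ennreal m'" for t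
  proof -
    have "(\<integral>\<^sup>+\<tau>\<in>{0..t}. rearrangement g \<tau> \<partial>lborel) \<le> (\<integral>\<^sup>+\<tau>. ennreal M * indicator {0..m'} \<tau> \<partial>lborel)"
      by (intro nn_integral_mono) (auto simp: indicator_def rM r0)
    also have "\<dots> = ennreal M * ennreal m'" using m' by (subst nn_integral_cmult_indicator) auto
    finally show ?thesis .
  qed
  have av1: "average_rearrangement g t \<le> ennreal M" if "t > 0" for t
  proof -
    have "average_rearrangement g t \<le> (ennreal M * ennreal t) / ennreal t"
      unfolding average_rearrangement_def by (intro divide_right_mono_ennreal int1 that)
    also have "\<dots> = ennreal M" using that by (intro ennreal_mult_divide_eq) auto
    finally show ?thesis .
  qed
  have av2: "average_rearrangement g t \<le> ennreal (M * m' / t)" if "t > 0" for t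
  proof -
    have "average_rearrangement g t \<le> (ennreal M * ennreal m') / ennreal t"
      unfolding average_rearrangement_def by (intro divide_right_mono_ennreal int2)
    also have "\<dots> = ennreal (M * m' / t)"
      using that M0 m' by (simp add: ennreal_mult[symmetric] divide_ennreal)
    finally show ?thesis .
  qed
  \<comment> \<open>Since \<open>1 < Q\<close>, the exponent lies strictly between -1 and 0:
    \<open>t^s\<close> is integrable near zero and \<open>t^(s - 1)\<close> near infinity.\<close>
  define s where "s = 1 / Q - 1"
  have s: "-1 < s" "s < 0" using Q by (auto simp: s_def)
  have I1: "(\<integral>\<^sup>+t. ennreal (indicator {0..1} t * t powr s) \<partial>lborel) < \<infinity>"
    using nn_integral_has_integral_lebesgue[OF _ has_integral_powr_from_0[OF s(1), of 1]] by simp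
  have I2: "(\<integral>\<^sup>+t. ennreal (indicator {1..} t * t powr (s - 1)) \<partial>lborel) < \<infinity>"
    using nn_integral_has_integral_lebesgue[OF _ has_integral_powr_to_inf[of "s - 1" 1]] s by simp
  have "lorentz1_norm Q g \<le> (\<integral>\<^sup>+t. ennreal M * ennreal (indicator {0..1} t * t powr s)
      + ennreal (M * m') * ennreal (indicator {1..} t * t powr (s - 1)) \<partial>lborel)"
    unfolding lorentz1_norm_def s_def[symmetric]
  proof (rule nn_integral_mono)
    fix t :: real
    show "ennreal (t powr s) * average_rearrangement g t * indicator {0<..} t
        \<le> ennreal M * ennreal (indicator {0..1} t * t powr s)
          + ennreal (M * m') * ennreal (indicator {1..} t * t powr (s - 1))"
    proof (cases "0 < t")
      case t: True
      show ?thesis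
      proof (cases "t \<le> 1")
        case True
        have "ennreal (t powr s) * average_rearrangement g t \<le> ennreal (t powr s) * ennreal M"
          by (intro mult_left_mono av1 t) simp
        then show ?thesis using t True
          by (auto simp: mult.commute intro: add_increasing2)
      next
        case False
        have "ennreal (t powr s) * average_rearrangement g t \<le> ennreal (t powr s) * ennreal (M * m' / t)"
          by (intro mult_left_mono av2 t) simp
        also have "\<dots> = ennreal (M * m' * (t powr s / t))"
          using t M0 m' by (simp add: ennreal_mult[symmetric] mult_ac)
        also have "t powr s / t = t powr (s - 1)" using t by (simp add: powr_diff)
        finally show ?thesis using t False M0 m'
          by (auto simp: ennreal_mult)
      qed
    qed simp
  qed
  also have "\<dots> = ennreal M * (\<integral>\<^sup>+t. ennreal (indicator {0..1} t * t powr s) \<partial>lborel)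
      + ennreal (M * m') * (\<integral>\<^sup>+t. ennreal (indicator {1..} t * t powr (s - 1)) \<partial>lborel)"
    by (subst nn_integral_add, measurable, subst nn_integral_cmult, measurable, subst nn_integral_cmult, measurable)
  also have "\<dots> < \<infinity>" using I1 I2 by (simp add: ennreal_mult_less_top)
  finally show ?thesis using g by (simp add: in_lorentz1_def)
qed

section \<open>Density of step functions\<close>

lemma abs_L2_sum:
  assumes "finite I" "\<And>i. i \<in> I \<Longrightarrow> square_integrable (f i)"
  shows "square_integrable (\<lambda>x. \<Sum>i\<in>I. f i x) \<and> abs_L2 (\<lambda>x. \<Sum>i\<in>I. f i x) = (\<Sum>i\<in>I. abs_L2 (f i))"
  using assms
proof (induction I)
  case empty
  then show ?case by (simp add: square_integrable_zero zero_L2_def)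
next
  case (insert i I)
  then show ?case
    by (simp add: square_integrable_add abs_L2_add)
qed

lemma square_integrable_indicator:
  fixes A :: "'a::euclidean_space set" and y :: "'b::euclidean_space"
  assumes "A \<in> sets borel" "bounded A"
  shows "square_integrable (\<lambda>x. indicator A x *\<^sub>R y)"
  unfolding square_integrable_def
proof
  have A: "A \<in> sets lebesgue" using assms(1) by simp
  then show "(\<lambda>x. indicator A x *\<^sub>R y) \<in> borel_measurable lebesgue" by measurable
  have "emeasure lebesgue A < \<infinity>"
    using emeasure_bounded_finite[OF assms(2)] assms(1) by (simp add: emeasure_completion)
  then have "integrable lebesgue (\<lambda>x. indicator A x * (norm y)\<^sup>2)"
    using A by (intro integrable_mult_left integrable_real_indicator) auto
  moreover have "(\<lambda>x. indicator A x * (norm y)\<^sup>2) = (\<lambda>x. (norm (indicator A x *\<^sub>R y))\<^sup>2)"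
    by (auto simp: indicator_def)
  ultimately show "integrable lebesgue (\<lambda>x. (norm (indicator A x *\<^sub>R y))\<^sup>2)" by simp
qed

text \<open>The half-open cubes of side \<open>1 / (N + 1)\<close> partition the space. A point is
  coded by the integer vector of its cube, and \<open>grid_point\<close> returns the corner of that
  cube, at which functions are sampled.\<close>

definition grid_floor :: "nat \<Rightarrow> real^'n \<Rightarrow> int^'n::finite" where
  "grid_floor N x = (\<chi> i. \<lfloor>real (Suc N) * x $ i\<rfloor>)"

definition grid_point :: "nat \<Rightarrow> int^'n \<Rightarrow> real^'n::finite" where
  "grid_point N z = (\<chi> i. real_of_int (z $ i) / real (Suc N))"

definition grid_cube :: "nat \<Rightarrow> int^'n \<Rightarrow> (real^'n::finite) set" where
  "grid_cube N z = {x. grid_floor N x = z}"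

lemma dist_grid_point: "dist (grid_point N (grid_floor N x)) (x :: real^'n::finite) \<le> real CARD('n) / real (Suc N)"
proof -
  have "\<bar>(grid_point N (grid_floor N x) - x) $ i\<bar> \<le> 1 / real (Suc N)" for i
  proof -
    have "\<bar>real_of_int \<lfloor>real (Suc N) * x $ i\<rfloor> - real (Suc N) * x $ i\<bar> \<le> 1" by linarith
    then have "\<bar>real_of_int \<lfloor>real (Suc N) * x $ i\<rfloor> - real (Suc N) * x $ i\<bar> / real (Suc N) \<le> 1 / real (Suc N)"
      by (intro divide_right_mono) auto
    moreover have "(grid_point N (grid_floor N x) - x) $ i = (real_of_int \<lfloor>real (Suc N) * x $ i\<rfloor> - real (Suc N) * x $ i) / real (Suc N)"
      by (simp add: grid_point_def grid_floor_def diff_divide_distrib)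
    ultimately show ?thesis by (simp add: abs_divide)
  qed
  then have "(\<Sum>i\<in>UNIV. \<bar>(grid_point N (grid_floor N x) - x) $ i\<bar>) \<le> (\<Sum>i\<in>(UNIV::'n set). 1 / real (Suc N))"
    by (intro sum_mono)
  then show ?thesis
    unfolding dist_norm using norm_le_l1_cart[of "grid_point N (grid_floor N x) - x"] by simp
qed

lemma grid_cube: "grid_cube N z \<in> sets borel" "bounded (grid_cube N z)"
proof -
  have "grid_cube N z = (\<Inter>i. {x. \<lfloor>real (Suc N) * x $ i\<rfloor> = z $ i})"
    by (auto simp: grid_cube_def grid_floor_def vec_eq_iff)
  also have "\<dots> \<in> sets borel"
  proof (intro sets.finite_INT)
    fix i :: 'a
    have "(\<lambda>x::real^'a. \<lfloor>real (Suc N) * x $ i\<rfloor>) \<in> borel \<rightarrow>\<^sub>M count_space UNIV"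
      by measurable
    from measurable_sets[OF this, of "{z $ i}"] show "{x. \<lfloor>real (Suc N) * x $ i\<rfloor> = z $ i} \<in> sets borel"
      by (simp add: vimage_def)
  qed auto
  finally show "grid_cube N z \<in> sets borel" .
  have "grid_cube N z \<subseteq> cball (grid_point N z) (real CARD('a) / real (Suc N))"
    using dist_grid_point[of N] by (auto simp: grid_cube_def)
  then show "bounded (grid_cube N z)" by (rule bounded_subset[OF bounded_cball])
qed

lemma finite_bounded_int_vec: "finite {z :: int^'n::finite. \<forall>i. \<bar>z $ i\<bar> \<le> L}"
proof -
  have "{z :: int^'n. \<forall>i. \<bar>z $ i\<bar> \<le> L} \<subseteq> vec_lambda ` (PiE UNIV (\<lambda>_. {-L..L}))"
  proof
    fix z :: "int^'n" assume "z \<in> {z. \<forall>i. \<bar>z $ i\<bar> \<le> L}"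
    then have "vec_nth z \<in> PiE UNIV (\<lambda>_. {-L..L})" by (auto simp: abs_le_iff minus_le_iff)
    then have "vec_lambda (vec_nth z) \<in> vec_lambda ` (PiE UNIV (\<lambda>_. {-L..L}))" by (rule imageI)
    then show "z \<in> vec_lambda ` (PiE UNIV (\<lambda>_. {-L..L}))" by simp
  qed
  then show ?thesis by (rule finite_subset) (intro finite_imageI finite_PiE, auto)
qed

text \<open>Coefficients are left out to keep the family countable: real ones come back through the
  span, rational ones through \<open>countable_dense_span\<close>.\<close>

definition step_fields :: "(real^'n::finite, 'b::euclidean_space) L2 set" where
  "step_fields = (\<lambda>(N, z, b). abs_L2 (\<lambda>x. indicator (grid_cube N z) x *\<^sub>R b)) `
     ((UNIV :: nat set) \<times> (UNIV :: (int^'n) set) \<times> (Basis :: 'b set))"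

lemma countable_step_fields: "countable step_fields"
  unfolding step_fields_def by (intro countable_image countable_SIGMA countable_finite[OF finite_Basis]) auto

lemma indicator_in_span_step_fields:
  "abs_L2 (\<lambda>x. indicator (grid_cube N z) x *\<^sub>R y) \<in> span step_fields"
proof -
  have sq: "square_integrable (\<lambda>x. indicator (grid_cube N z) x *\<^sub>R b)" for b :: 'b
    by (rule square_integrable_indicator[OF grid_cube])
  have "(\<lambda>x. indicator (grid_cube N z) x *\<^sub>R y)
      = (\<lambda>x. \<Sum>b\<in>Basis. (y \<bullet> b) *\<^sub>R (indicator (grid_cube N z) x *\<^sub>R b))"
    by (auto simp: indicator_def euclidean_representation)
  then have "abs_L2 (\<lambda>x. indicator (grid_cube N z) x *\<^sub>R y)
      = (\<Sum>b\<in>Basis. (y \<bullet> b) *\<^sub>R abs_L2 (\<lambda>x. indicator (grid_cube N z) x *\<^sub>R b))"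
    using abs_L2_sum[of Basis "\<lambda>b x. (y \<bullet> b) *\<^sub>R (indicator (grid_cube N z) x *\<^sub>R b)"]
    by (simp only: sq square_integrable_scaleR abs_L2_scaleR finite_Basis)
  also have "\<dots> \<in> span step_fields"
    unfolding step_fields_def by (intro span_sum span_scale span_base image_eqI[of _ _ "(N, z, _)"]) auto
  finally show ?thesis .
qed

text \<open>The function is replaced by its samples at grid points. Uniform continuity makes the
  error small everywhere, and it vanishes outside a bounded set of fixed size, so it is small in the
  square mean.\<close>

lemma continuous_compact_in_closure:
  fixes g :: "real^'n::finite \<Rightarrow> 'b::euclidean_space"
  assumes g: "continuous_on UNIV g" and K: "compact K" "\<And>x. x \<notin> K \<Longrightarrow> g x = 0"
  shows "abs_L2 g \<in> closure (span step_fields)"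
proof -
  have sg: "square_integrable g" by (rule square_integrable_continuous[OF g K])
  obtain R where R: "\<And>x. x \<in> K \<Longrightarrow> norm x \<le> R" using compact_imp_bounded[OF K(1)] unfolding bounded_iff by blast
  have g0: "g x = 0" if "R < norm x" for x using K(2)[of x] R[of x] that by force
  define c where "c = real CARD('n)"
  have c: "c > 0" by (simp add: c_def)
  \<comment> \<open>For every mesh a point and its grid point are at most \<open>c\<close> apart.
    Hence outside \<open>W\<close> both \<open>g\<close> and its samples vanish, and for a point of
    \<open>W\<close> the grid point stays in the larger ball \<open>C\<close>.\<close>
  define C where "C = cball (0 :: real^'n) (R + 2 * c)"
  have uc: "uniformly_continuous_on C g"
    unfolding C_def by (intro compact_uniformly_continuous continuous_on_subset[OF g]) auto
  define W where "W = cball (0 :: real^'n) (R + c)"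
  have Wfin: "emeasure lebesgue W < \<infinity>" and WL: "W \<in> sets lebesgue"
    unfolding W_def using emeasure_bounded_finite[of "cball (0 :: real^'n) (R + c)"] by (auto simp: emeasure_completion)
  define vol where "vol = measure lebesgue W"
  show ?thesis
    unfolding closure_approachable
  proof (intro allI impI)
    fix \<epsilon> :: real assume \<epsilon>: "\<epsilon> > 0"
    have v1: "vol + 1 > 0" by (simp add: vol_def add_nonneg_pos)
    define \<eta> where "\<eta> = \<epsilon> / (2 * sqrt (vol + 1))"
    have \<eta>: "\<eta> > 0" using \<epsilon> v1 by (simp add: \<eta>_def)
    obtain \<delta> where \<delta>: "\<delta> > 0" "\<And>x x'. x \<in> C \<Longrightarrow> x' \<in> C \<Longrightarrow> dist x' x < \<delta> \<Longrightarrow> dist (g x') (g x) < \<eta>"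
      by (rule uniformly_continuous_onE[OF uc \<eta>]) (rule that)
    have "\<delta> / c > 0" using \<delta> c by simp
    then obtain N where "1 / real (Suc N) < \<delta> / c" by (rule nat_approx_posE)
    then have N: "c / real (Suc N) < \<delta>" using c by (simp add: field_simps)
    have cN: "c / real (Suc N) \<le> c" using c by (simp add: divide_le_eq)
    define p where "p x = grid_point N (grid_floor N x)" for x :: "real^'n"
    have dp: "dist (p x) x \<le> c / real (Suc N)" for x
      unfolding p_def c_def by (rule dist_grid_point)
    \<comment> \<open>Cubes with an index beyond \<open>L\<close> have their grid point outside the
      ball that contains the support, so finitely many cubes suffice.\<close>
    define L where "L = \<lceil>real (Suc N) * (\<bar>R\<bar> + 1)\<rceil>"
    define Z where "Z = {z :: int^'n. \<forall>i. \<bar>z $ i\<bar> \<le> L}"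
    have Z: "finite Z" unfolding Z_def by (rule finite_bounded_int_vec)
    define h where "h x = (\<Sum>z\<in>Z. indicator (grid_cube N z) x *\<^sub>R g (grid_point N z))" for x
    have sqi: "square_integrable (\<lambda>x. indicator (grid_cube N z) x *\<^sub>R y)" for z and y :: 'b
      by (rule square_integrable_indicator[OF grid_cube])
    have h_sum: "square_integrable h" "abs_L2 h = (\<Sum>z\<in>Z. abs_L2 (\<lambda>x. indicator (grid_cube N z) x *\<^sub>R g (grid_point N z)))"
      using abs_L2_sum[OF Z, of "\<lambda>z x. indicator (grid_cube N z) x *\<^sub>R g (grid_point N z)"] sqi
      unfolding h_def[abs_def] by blast+
    have h_span: "abs_L2 h \<in> span step_fields"
      unfolding h_sum(2) by (intro span_sum indicator_in_span_step_fields)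
    have h_eq: "h x = g (p x)" for x
    proof -
      have "h x = (\<Sum>z\<in>Z. if z = grid_floor N x then g (grid_point N z) else 0)"
        unfolding h_def by (intro sum.cong) (auto simp: grid_cube_def indicator_def)
      also have "\<dots> = (if grid_floor N x \<in> Z then g (p x) else 0)"
        using Z by (simp add: p_def)
      also have "\<dots> = g (p x)"
      proof (cases "grid_floor N x \<in> Z")
        case False
        then obtain i where i: "\<not> \<bar>grid_floor N x $ i\<bar> \<le> L" by (auto simp: Z_def)
        then have "real_of_int L < real_of_int \<bar>grid_floor N x $ i\<bar>" by linarith
        then have "real (Suc N) * (\<bar>R\<bar> + 1) < \<bar>real_of_int (grid_floor N x $ i)\<bar>"
          unfolding L_def using le_of_int_ceiling[of "real (Suc N) * (\<bar>R\<bar> + 1)"] by linarith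
        then have "\<bar>R\<bar> + 1 < \<bar>real_of_int (grid_floor N x $ i)\<bar> / real (Suc N)"
          by (subst pos_less_divide_eq) (auto simp: mult.commute)
        also have "\<dots> = \<bar>p x $ i\<bar>" by (simp add: p_def grid_point_def abs_divide)
        also have "\<dots> \<le> norm (p x)" by (rule component_le_norm_cart)
        finally have "g (p x) = 0" by (intro g0) simp
        then show ?thesis by simp
      qed simp
      finally show ?thesis .
    qed
    have close: "norm (h x - g x) \<le> \<eta> * indicator W x" for x
    proof (cases "x \<in> W")
      case True
      have "norm (p x) \<le> norm x + c" using dp[of x] cN norm_triangle_ineq2[of "p x" x] by (simp add: dist_norm)
      then have "x \<in> C" "p x \<in> C" using True c by (auto simp: W_def C_def)
      then have "dist (g (p x)) (g x) < \<eta>" using dp[of x] N by (intro \<delta>(2)) auto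
      then show ?thesis using True by (simp add: h_eq dist_norm)
    next
      case False
      then have "R + c < norm x" by (simp add: W_def)
      moreover have "norm x - c \<le> norm (p x)"
        using dp[of x] cN norm_triangle_ineq2[of x "p x"] by (simp add: dist_norm norm_minus_commute)
      ultimately have "g x = 0" "g (p x) = 0" using c by (auto intro!: g0)
      then show ?thesis using False by (simp add: h_eq)
    qed
    have sd: "square_integrable (\<lambda>x. h x - g x)"
      using sq_int_diff[of lebesgue h g] h_sum(1) sg by (simp add: square_integrable_iff_sq_int)
    have ad: "abs_L2 h - abs_L2 g = abs_L2 (\<lambda>x. h x - g x)"
      using abs_L2_add[OF h_sum(1) square_integrable_scaleR[OF sg], of "-1"] abs_L2_scaleR[OF sg, of "-1"] by simp
    have "(dist (abs_L2 h) (abs_L2 g))\<^sup>2 = (LINT x|lebesgue. (norm (h x - g x))\<^sup>2)"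
      unfolding dist_norm ad by (rule norm_abs_L2[OF sd])
    also have "\<dots> \<le> (LINT x|lebesgue. \<eta>\<^sup>2 * indicator W x)"
    proof (rule integral_mono)
      show "integrable lebesgue (\<lambda>x. (norm (h x - g x))\<^sup>2)" using sd by (simp add: square_integrable_def)
      show "integrable lebesgue (\<lambda>x. \<eta>\<^sup>2 * indicator W x)"
        using Wfin WL by (intro integrable_mult_right integrable_real_indicator) auto
      show "(norm (h x - g x))\<^sup>2 \<le> \<eta>\<^sup>2 * indicator W x" for x
        using power_mono[OF close[of x] norm_ge_zero, of 2] by (auto simp: power_mult_distrib indicator_def)
    qed
    also have "\<dots> = \<eta>\<^sup>2 * vol" using Wfin WL by (simp add: vol_def)
    also have "\<dots> \<le> \<eta>\<^sup>2 * (vol + 1)" by (intro mult_left_mono) auto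
    also have "\<dots> = (\<epsilon> / 2)\<^sup>2" using v1 by (simp add: \<eta>_def power_divide power_mult_distrib) (simp add: field_simps)
    finally have "dist (abs_L2 h) (abs_L2 g) \<le> \<epsilon> / 2" by (rule power2_le_imp_le) (use \<epsilon> in simp)
    then have "dist (abs_L2 h) (abs_L2 g) < \<epsilon>" using \<epsilon> by linarith
    then show "\<exists>y\<in>span step_fields. dist y (abs_L2 g) < \<epsilon>" using h_span by blast
  qed
qed

lemma test_field_facts:
  assumes "\<phi> \<in> test_fields"
  obtains K where "compact K" "\<And>x. x \<notin> K \<Longrightarrow> \<phi> x = 0" "\<And>x. x \<notin> K \<Longrightarrow> gradient \<phi> x = 0"
    "continuous_on UNIV \<phi>" "continuous_on UNIV (gradient \<phi>)"
proof -
  define K where "K = closure {x. \<phi> x \<noteq> 0}"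
  have sm: "smooth \<phi>" and K: "compact K"
    using assms by (auto simp: test_fields_def test_fun_def K_def)
  have cont: "continuous_on UNIV (iter_deriv vs \<phi>)" for vs
    using sm by (simp add: smooth_def continuous_at_imp_continuous_on differentiable_imp_continuous_within)
  have out: "\<phi> x = 0" if "x \<notin> K" for x
    using that closure_subset[of "{x. \<phi> x \<noteq> 0}"] unfolding K_def by auto
  have "continuous_on UNIV (partial j \<phi>)" for j
    using cont[of "[axis j 1]"] by (simp add: partial_def[abs_def])
  then have cg: "continuous_on UNIV (gradient \<phi>)"
    unfolding gradient_def[abs_def] by (intro continuous_intros) 
  have og: "gradient \<phi> x = 0" if "x \<notin> K" for x
  proof -
    have "frechet_derivative \<phi> (at x) = frechet_derivative (\<lambda>x. 0) (at x)"
    proof (rule frechet_derivative_transform_within_open)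
      show "\<phi> differentiable at x"
        using sm[unfolded smooth_def, rule_format, of "[]" x] by simp
      show "open (- K)" using K by (simp add: compact_imp_closed open_Compl)
    qed (use that out in auto)
    then show ?thesis by (simp add: gradient_def partial_def vec_eq_iff)
  qed
  show ?thesis using that[OF K out og _ cg] cont[of "[]"] by simp
qed

text \<open>Test fields and their gradients are continuous with compact support, so rational step
  fields approximate both. The sets live in the ambient \<open>L^2\<close> spaces, because step
  fields are not solenoidal.\<close>

lemma separable_solenoidal:
  obtains D1 :: "(real^'n, real^'n) L2 set" and D2 :: "(real^'n, real^'n^'n::finite) L2 set"
  where "countable D1" "countable D2" "L2s_set \<subseteq> closure D1" "H1s_set \<subseteq> closure (D1 \<times> D2)"
proof -
  obtain D1 :: "(real^'n, real^'n) L2 set" where D1: "countable D1" "span step_fields \<subseteq> closure D1"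
    by (rule countable_dense_span[OF countable_step_fields]) (rule that)
  obtain D2 :: "(real^'n, real^'n^'n) L2 set" where D2: "countable D2" "span step_fields \<subseteq> closure D2"
    by (rule countable_dense_span[OF countable_step_fields]) (rule that)
  have in1: "abs_L2 \<phi> \<in> closure D1" if \<phi>: "\<phi> \<in> test_fields" for \<phi> :: "real^'n \<Rightarrow> real^'n"
  proof -
    obtain K where K: "compact K" "\<And>x. x \<notin> K \<Longrightarrow> \<phi> x = 0" "\<And>x. x \<notin> K \<Longrightarrow> gradient \<phi> x = 0"
      "continuous_on UNIV \<phi>" "continuous_on UNIV (gradient \<phi>)"
      by (rule test_field_facts[OF \<phi>]) (rule that)
    have "abs_L2 \<phi> \<in> closure (span step_fields)" by (rule continuous_compact_in_closure[OF K(4,1,2)])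
    then show ?thesis using closure_minimal[OF D1(2) closed_closure] by blast
  qed
  have in2: "abs_L2 (gradient \<phi>) \<in> closure D2" if \<phi>: "\<phi> \<in> test_fields" for \<phi> :: "real^'n \<Rightarrow> real^'n"
  proof -
    obtain K where K: "compact K" "\<And>x. x \<notin> K \<Longrightarrow> \<phi> x = 0" "\<And>x. x \<notin> K \<Longrightarrow> gradient \<phi> x = 0"
      "continuous_on UNIV \<phi>" "continuous_on UNIV (gradient \<phi>)"
      by (rule test_field_facts[OF \<phi>]) (rule that)
    have "abs_L2 (gradient \<phi>) \<in> closure (span step_fields)" by (rule continuous_compact_in_closure[OF K(5,1,3)])
    then show ?thesis using closure_minimal[OF D2(2) closed_closure] by blast
  qed
  have "L2s_set \<subseteq> closure D1"
    unfolding L2s_set_def using in1 by (intro closure_minimal) auto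
  moreover have "H1s_set \<subseteq> closure (D1 \<times> D2)"
    unfolding H1s_set_def using in1 in2 by (intro closure_minimal) (auto simp: closure_Times intro: closed_Times)
  ultimately show ?thesis using that D1 D2 by blast
qed

instance L2s :: (finite) second_countable_topology
proof
  obtain D1 :: "(real^'a, real^'a) L2 set" and D2 :: "(real^'a, real^'a^'a) L2 set"
    where D: "countable D1" "countable D2" "L2s_set \<subseteq> closure D1" "H1s_set \<subseteq> closure (D1 \<times> D2)"
    by (rule separable_solenoidal)
  show "\<exists>B::'a L2s set set. countable B \<and> open = generate_topology B"
    by (rule second_countable_of_isometry[OF dist_Rep_L2s D(1)]) (use D(3) in \<open>simp add: range_Rep_L2s\<close>)
qed

instance H1s :: (finite) second_countable_topology
proof
  obtain D1 :: "(real^'a, real^'a) L2 set" and D2 :: "(real^'a, real^'a^'a) L2 set"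
    where D: "countable D1" "countable D2" "L2s_set \<subseteq> closure D1" "H1s_set \<subseteq> closure (D1 \<times> D2)"
    by (rule separable_solenoidal)
  show "\<exists>B::'a H1s set set. countable B \<and> open = generate_topology B"
    by (rule second_countable_of_isometry[OF dist_Rep_H1s countable_SIGMA[OF D(1) D(2)]])
       (use D(4) in \<open>simp add: range_Rep_H1s\<close>)
qed

section \<open>The embedding and the gradient\<close>

lemma Rep_L2s_add: "Rep_L2s (u + v) = Rep_L2s u + Rep_L2s v" by (rule plus_L2s.rep_eq)
lemma Rep_L2s_scaleR: "Rep_L2s (c *\<^sub>R u) = c *\<^sub>R Rep_L2s u" by (rule scaleR_L2s.rep_eq)

lemma emb_add: "emb (u + v) = emb u + emb v"
  by (simp add: Rep_L2s_inject[symmetric] Rep_L2s_add Rep_L2s_emb plus_H1s.rep_eq)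

lemma emb_scaleR: "emb (c *\<^sub>R u) = c *\<^sub>R emb u"
  by (simp add: Rep_L2s_inject[symmetric] Rep_L2s_scaleR Rep_L2s_emb scaleR_H1s.rep_eq)

lemma grad_add: "grad (u + v) = grad u + grad v"
  by (simp add: grad_def plus_H1s.rep_eq)

lemma grad_scaleR: "grad (c *\<^sub>R u) = c *\<^sub>R grad u"
  by (simp add: grad_def scaleR_H1s.rep_eq)

lemma norm_H1s_eq: "(norm u)\<^sup>2 = (norm (emb u))\<^sup>2 + (norm (grad u))\<^sup>2"
  by (simp add: norm_H1s.rep_eq norm_L2s.rep_eq Rep_L2s_emb grad_def norm_prod_def)

lemma norm_emb_le: "norm (emb u) \<le> norm u"
  by (rule power2_le_imp_le) (simp_all add: norm_H1s_eq)

lemma norm_grad_le: "norm (grad u) \<le> norm u"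
  by (rule power2_le_imp_le) (simp_all add: norm_H1s_eq)

lemma bounded_linear_emb: "bounded_linear emb"
  by (rule bounded_linear_intro[where K = 1]) (simp_all add: emb_add emb_scaleR norm_emb_le)

lemma bounded_linear_grad: "bounded_linear grad"
  by (rule bounded_linear_intro[where K = 1]) (simp_all add: grad_add grad_scaleR norm_grad_le)

definition test_H1s :: "(real^'n \<Rightarrow> real^'n) \<Rightarrow> 'n::finite H1s" where
  "test_H1s \<phi> = Abs_H1s (abs_L2 \<phi>, abs_L2 (gradient \<phi>))"

lemma Rep_test_H1s: "\<phi> \<in> test_fields \<Longrightarrow> Rep_H1s (test_H1s \<phi>) = (abs_L2 \<phi>, abs_L2 (gradient \<phi>))"
  unfolding test_H1s_def
  by (rule Abs_H1s_inverse) (auto simp: H1s_set_def intro!: subsetD[OF closure_subset])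

lemma test_H1s_dense:
  obtains \<phi> where "\<And>k. \<phi> k \<in> test_fields" "(\<lambda>k. test_H1s (\<phi> k)) \<longlonglongrightarrow> (u :: 'n::finite H1s)"
proof -
  have "Rep_H1s u \<in> closure ((\<lambda>\<phi>. (abs_L2 \<phi>, abs_L2 (gradient \<phi>))) ` test_fields)"
    using Rep_H1s[of u] by (simp add: H1s_set_def)
  then obtain q where q: "\<And>k. q k \<in> (\<lambda>\<phi>. (abs_L2 \<phi>, abs_L2 (gradient \<phi>))) ` test_fields" "q \<longlonglongrightarrow> Rep_H1s u"
    unfolding closure_sequential by blast
  have "\<forall>k. \<exists>\<phi>. \<phi> \<in> test_fields \<and> q k = (abs_L2 \<phi>, abs_L2 (gradient \<phi>))" using q(1) by blast
  from choice[OF this] obtain \<phi> where \<phi>: "\<And>k. \<phi> k \<in> test_fields" "\<And>k. q k = (abs_L2 (\<phi> k), abs_L2 (gradient (\<phi> k)))"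
    by blast
  have "(\<lambda>k. Rep_H1s (test_H1s (\<phi> k))) \<longlonglongrightarrow> Rep_H1s u" using q(2) by (simp add: Rep_test_H1s \<phi>(1) \<phi>(2)[symmetric])
  then have "(\<lambda>k. test_H1s (\<phi> k)) \<longlonglongrightarrow> u" unfolding tendsto_iff by (simp add: dist_Rep_H1s)
  then show ?thesis using that \<phi>(1) by blast
qed

lemma emb_dense: "closure (range emb) = (UNIV :: 'n::finite L2s set)"
proof -
  have "f \<in> closure (range emb)" for f :: "'n L2s"
  proof -
    have "Rep_L2s f \<in> closure (abs_L2 ` test_fields)" using Rep_L2s[of f] by (simp add: L2s_set_def)
    then obtain q where q: "\<And>k. q k \<in> abs_L2 ` test_fields" "q \<longlonglongrightarrow> Rep_L2s f"
      unfolding closure_sequential by blast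
    have "\<forall>k. \<exists>\<phi>. \<phi> \<in> test_fields \<and> q k = abs_L2 \<phi>" using q(1) by blast
    from choice[OF this] obtain \<phi> where \<phi>: "\<And>k. \<phi> k \<in> test_fields" "\<And>k. q k = abs_L2 (\<phi> k)" by blast
    have "(\<lambda>k. Rep_L2s (emb (test_H1s (\<phi> k)))) \<longlonglongrightarrow> Rep_L2s f"
      using q(2) by (simp add: Rep_L2s_emb Rep_test_H1s \<phi>(1) \<phi>(2)[symmetric])
    then have "(\<lambda>k. emb (test_H1s (\<phi> k))) \<longlonglongrightarrow> f" unfolding tendsto_iff by (simp add: dist_Rep_L2s)
    then show ?thesis unfolding closure_sequential by (intro exI[of _ "\<lambda>k. emb (test_H1s (\<phi> k))"]) simp
  qed
  then show ?thesis by blast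
qed

section \<open>The bilinear form\<close>

text \<open>The rank-one matrix lets both transport terms of the form be written as Frobenius
  products with a gradient, so that estimates reduce to \<open>norm_outer\<close>.\<close>

definition outer :: "real^'n \<Rightarrow> real^'m \<Rightarrow> real^'m^'n" where
  "outer a b = (\<chi> i k. a $ i * b $ k)"

lemma inner_outer: "A \<bullet> outer a b = (\<Sum>i\<in>UNIV. \<Sum>k\<in>UNIV. a $ i * b $ k * A $ i $ k)"
  by (simp add: inner_vec_def outer_def mult.commute)

lemma inner_outer_mv: "A \<bullet> outer a b = a \<bullet> (A *v b)"
  by (simp add: inner_outer inner_vec_def[of a] matrix_vector_mult_def sum_distrib_left mult_ac)

lemma inner_outer_vm: "A \<bullet> outer a b = b \<bullet> (a v* A)"
  unfolding inner_outer by (subst sum.swap) (simp add: inner_vec_def[of b] vector_matrix_mult_def sum_distrib_left mult_ac)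

lemma norm_outer: "norm (outer a b) = norm a * norm b"
proof -
  have "(norm (outer a b))\<^sup>2 = (\<Sum>i\<in>UNIV. \<Sum>k\<in>UNIV. (a $ i * a $ i) * (b $ k * b $ k))"
    unfolding power2_norm_eq_inner inner_outer by (simp add: outer_def mult_ac)
  also have "\<dots> = (norm a * norm b)\<^sup>2"
    unfolding power_mult_distrib power2_norm_eq_inner by (simp add: inner_vec_def sum_product)
  finally show ?thesis by (rule power2_eq_imp_eq) auto
qed

lemma outer_add_right: "outer a (b + c) = outer a b + outer a c"
  and outer_add_left: "outer (b + c) a = outer b a + outer c a"
  and outer_scaleR_right: "outer a (r *\<^sub>R b) = r *\<^sub>R outer a b"
  and outer_scaleR_left: "outer (r *\<^sub>R b) a = r *\<^sub>R outer b a"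
  by (auto simp: outer_def vec_eq_iff algebra_simps)

lemma borel_measurable_outer:
  fixes f :: "'a \<Rightarrow> real^'n" and g :: "'a \<Rightarrow> real^'m"
  assumes [measurable]: "f \<in> borel_measurable M" "g \<in> borel_measurable M"
  shows "(\<lambda>x. outer (f x) (g x)) \<in> borel_measurable M"
proof -
  have "(\<lambda>p. outer (fst p) (snd p)) \<in> borel_measurable (borel :: ((real^'n) \<times> (real^'m)) measure)"
    unfolding outer_def by (intro borel_measurable_continuous_onI continuous_intros)
  from measurable_compose[OF _ this, of "\<lambda>x. (f x, g x)" M] show ?thesis by simp
qed

lemma H1s_fun_eq: "H1s_fun u = rep_L2 (fst (Rep_H1s u))"
  by (simp add: H1s_fun_def Rep_L2s_emb)

lemma square_integrable_H1s: "square_integrable (H1s_fun u)" "square_integrable (H1s_grad u)"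
  by (simp_all add: H1s_fun_def H1s_grad_def rep_L2_square_integrable)

lemma measurable_H1s_fun: "H1s_fun u \<in> borel_measurable lebesgue"
  using square_integrable_H1s(1)[of u] by (simp add: square_integrable_def)

lemma H1s_fun_add: "AE x in lebesgue. H1s_fun (u + w) x = H1s_fun u x + H1s_fun w x"
  unfolding H1s_fun_eq using rep_L2_add[of "fst (Rep_H1s u)" "fst (Rep_H1s w)"] by (simp add: plus_H1s.rep_eq)

lemma H1s_fun_scaleR: "AE x in lebesgue. H1s_fun (c *\<^sub>R u) x = c *\<^sub>R H1s_fun u x"
  unfolding H1s_fun_eq using rep_L2_scaleR[of c "fst (Rep_H1s u)"] by (simp add: scaleR_H1s.rep_eq)

lemma grad_test_H1s: "\<phi> \<in> test_fields \<Longrightarrow> grad (test_H1s \<phi>) = abs_L2 (gradient \<phi>)"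
  by (simp add: grad_def Rep_test_H1s)

lemma H1s_fun_test: "\<phi> \<in> test_fields \<Longrightarrow> AE x in lebesgue. H1s_fun (test_H1s \<phi>) x = \<phi> x"
  unfolding H1s_fun_eq by (simp add: Rep_test_H1s rep_abs_L2 square_integrable_test_field)

section \<open>Hardy weights\<close>

text \<open>Multiplication by \<open>v\<close> maps the energy space to \<open>L^2\<close> with a
  bound by the gradient alone. The nonnegative integral includes finiteness, so the products are
  square integrable without a separate condition.\<close>

definition hardy_weight :: "real \<Rightarrow> (real^'n \<Rightarrow> real^'n::finite) \<Rightarrow> bool" where
  "hardy_weight \<kappa> v \<longleftrightarrow> v \<in> borel_measurable lebesgue \<and>
     (\<forall>u. (\<integral>\<^sup>+x. ennreal ((norm (v x))\<^sup>2 * (norm (H1s_fun u x))\<^sup>2) \<partial>lebesgue) \<le> ennreal ((\<kappa> * norm (grad u))\<^sup>2))"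

text \<open>The operator norm is at most the Frobenius norm: the square of \<open>D k\<close> is the
  pairing of the gradient with the rank-one matrix of \<open>k\<close> and
  \<open>D k\<close>.\<close>

lemma norm_directional_derivative_le:
  fixes \<phi> :: "real^'n \<Rightarrow> real^'n::finite"
  assumes "\<phi> differentiable (at x)"
  shows "norm (frechet_derivative \<phi> (at x) k) \<le> norm (gradient \<phi> x) * norm k"
proof -
  define D where "D = frechet_derivative \<phi> (at x)"
  have "linear D" unfolding D_def using assms by (simp add: linear_frechet_derivative)
  then have "D k = (\<Sum>j\<in>UNIV. k $ j *\<^sub>R D (axis j 1))"
    using basis_expansion[of k] by (metis (no_types, lifting) linear_scale linear_sum sum.cong scalar_mult_eq_scaleR)
  then have Dk: "D k = k v* gradient \<phi> x"
    by (simp add: vec_eq_iff vector_matrix_mult_def gradient_def partial_def D_def mult.commute)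
  have "(norm (D k))\<^sup>2 = D k \<bullet> (k v* gradient \<phi> x)" unfolding power2_norm_eq_inner Dk ..
  also have "\<dots> = gradient \<phi> x \<bullet> outer k (D k)"
    by (rule inner_outer_vm[symmetric])
  also have "\<dots> \<le> norm (gradient \<phi> x) * (norm k * norm (D k))"
    using norm_cauchy_schwarz[of "gradient \<phi> x" "outer k (D k)"] by (simp add: norm_outer)
  finally have "norm (D k) * norm (D k) \<le> (norm (gradient \<phi> x) * norm k) * norm (D k)"
    by (simp add: power2_eq_square mult_ac)
  then show ?thesis unfolding D_def[symmetric] by (cases "D k = 0") (auto simp: mult_le_cancel_right)
qed

lemma AE_subsequence_L2:
  fixes u :: "('a::euclidean_space, 'b::euclidean_space) L2"
  assumes "X \<longlonglongrightarrow> u"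
  obtains r :: "nat \<Rightarrow> nat" where "strict_mono r" "AE x in lebesgue. (\<lambda>k. rep_L2 (X (r k)) x) \<longlonglongrightarrow> rep_L2 u x"
proof -
  define q where "q k x = (norm (rep_L2 (X k) x - rep_L2 u x))\<^sup>2" for k x
  have sq: "square_integrable (\<lambda>x. rep_L2 (X k) x - rep_L2 u x)" for k
    using sq_int_diff[of lebesgue "rep_L2 (X k)" "rep_L2 u"] rep_L2_square_integrable[of "X k"] rep_L2_square_integrable[of u]
    by (simp add: square_integrable_iff_sq_int)
  have int: "integrable lebesgue (q k)" for k
    using sq[of k] by (simp add: square_integrable_def q_def[abs_def])
  have "(LINT x|lebesgue. q k x) = (norm (X k - u))\<^sup>2" for k
  proof -
    have "(LINT x|lebesgue. q k x) = (LINT x|lebesgue. (norm (rep_L2 (X k - u) x))\<^sup>2)"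
    proof (rule integral_cong_AE)
      show "q k \<in> borel_measurable lebesgue" using int by auto
      show "(\<lambda>x. (norm (rep_L2 (X k - u) x))\<^sup>2) \<in> borel_measurable lebesgue"
        using rep_L2_square_integrable[of "X k - u"] by (auto simp: square_integrable_def)
      show "AE x in lebesgue. q k x = (norm (rep_L2 (X k - u) x))\<^sup>2"
        using rep_L2_diff[of "X k" u] by eventually_elim (simp add: q_def)
    qed
    then show ?thesis by (simp add: norm_L2_eq)
  qed
  moreover have "(\<lambda>k. (norm (X k - u))\<^sup>2) \<longlonglongrightarrow> 0"
    using tendsto_power[OF tendsto_norm[OF LIM_zero[OF assms]], of 2] by simp
  ultimately have lim: "(\<lambda>k. LINT x|lebesgue. norm (q k x)) \<longlonglongrightarrow> 0" by (simp add: q_def)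
  obtain r :: "nat \<Rightarrow> nat" where r: "strict_mono r" "AE x in lebesgue. (\<lambda>k. q (r k) x) \<longlonglongrightarrow> 0"
    using tendsto_L1_AE_subseq[OF int lim] by blast
  have "AE x in lebesgue. (\<lambda>k. rep_L2 (X (r k)) x) \<longlonglongrightarrow> rep_L2 u x"
    using r(2)
  proof eventually_elim
    case (elim x)
    have "(\<lambda>k. norm (rep_L2 (X (r k)) x - rep_L2 u x)) \<longlonglongrightarrow> 0"
      using tendsto_real_sqrt[OF elim] by (simp add: q_def)
    then show ?case by (rule LIM_zero_cancel[OF tendsto_norm_zero_cancel])
  qed
  with r(1) show ?thesis by (rule that)
qed

text \<open>For test fields this is \<open>hardy_weak\<close> with the Frobenius norm of the
  gradient as majorant. A general element is the limit of test fields, almost everywhere along a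
  subsequence; Fatou's lemma handles the weighted side and the gradient norms converge.\<close>

lemma hardy_weight_of_distribution_bound:
  fixes v :: "real^'n \<Rightarrow> real^'n::finite"
  assumes n: "CARD('n) \<ge> 3" and v: "v \<in> borel_measurable lebesgue" and d: "d > 0"
    and dist: "\<And>r. r > 0 \<Longrightarrow> emeasure lebesgue {x. r < norm (v x)} \<le> ennreal ((d / r) ^ CARD('n))"
  shows "hardy_weight (sqrt (hardy_const CARD('n)) * d) v"
  unfolding hardy_weight_def
proof (intro conjI allI v)
  fix u :: "'n H1s"
  define K where "K = hardy_const CARD('n) * d\<^sup>2"
  have K: "K \<ge> 0" using hardy_const_pos[of "CARD('n)"] by (simp add: K_def)
  have test: "(\<integral>\<^sup>+x. ennreal ((norm (v x))\<^sup>2 * (norm (H1s_fun (test_H1s \<phi>) x))\<^sup>2) \<partial>lebesgue)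
      \<le> ennreal (K * (norm (grad (test_H1s \<phi>)))\<^sup>2)" if \<phi>: "\<phi> \<in> test_fields" for \<phi>
  proof -
    obtain C where C: "compact C" "\<And>x. x \<notin> C \<Longrightarrow> \<phi> x = 0" "\<And>x. x \<notin> C \<Longrightarrow> gradient \<phi> x = 0"
      "continuous_on UNIV \<phi>" "continuous_on UNIV (gradient \<phi>)"
      by (rule test_field_facts[OF \<phi>]) (rule that)
    have df: "\<phi> differentiable (at x)" for x
      using \<phi> by (auto simp: test_fields_def test_fun_def smooth_def dest: spec[of _ "[]"])
    have cn: "continuous_on UNIV (\<lambda>x. (norm (gradient \<phi> x))\<^sup>2)" using C(5) by (intro continuous_intros)
    have gm: "(\<lambda>x. (norm (gradient \<phi> x))\<^sup>2) \<in> borel_measurable lborel"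
      using borel_measurable_continuous_onI[OF cn] by simp
    have il: "integrable lborel (\<lambda>x. (norm (gradient \<phi> x))\<^sup>2)"
      using square_integrable_test_field(2)[OF \<phi>] integrable_completion[OF gm] by (simp add: square_integrable_def)
    have "(\<integral>\<^sup>+x. ennreal ((norm (v x))\<^sup>2 * (norm (H1s_fun (test_H1s \<phi>) x))\<^sup>2) \<partial>lebesgue)
        = (\<integral>\<^sup>+x. ennreal ((norm (v x))\<^sup>2 * (norm (\<phi> x))\<^sup>2) \<partial>lebesgue)"
      by (rule nn_integral_cong_AE) (use H1s_fun_test[OF \<phi>] in \<open>eventually_elim, simp\<close>)
    also have "\<dots> \<le> ennreal (hardy_const DIM(real^'n) * d\<^sup>2 * (LINT x|lborel. (norm (gradient \<phi> x))\<^sup>2))"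
    proof (rule hardy_weak)
      show "DIM(real^'n) \<ge> 3" using n by simp
      show "(\<phi> has_derivative frechet_derivative \<phi> (at x)) (at x)" for x
        using df by (simp add: frechet_derivative_works)
      show "norm (frechet_derivative \<phi> (at x) k) \<le> norm (gradient \<phi> x) * norm k" for x k
        by (rule norm_directional_derivative_le[OF df])
      show "continuous_on UNIV (\<lambda>x. norm (gradient \<phi> x))" using C(5) by (intro continuous_intros)
      show "emeasure lebesgue {x. r < norm (v x)} \<le> ennreal ((d / r) ^ DIM(real^'n))" if "r > 0" for r
        using dist[OF that] by simp
    qed (use C v d il in auto)
    also have "(LINT x|lborel. (norm (gradient \<phi> x))\<^sup>2) = (norm (grad (test_H1s \<phi>)))\<^sup>2"
      by (simp add: grad_test_H1s[OF \<phi>] norm_abs_L2 square_integrable_test_field(2)[OF \<phi>] integral_completion[OF gm])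
    finally show ?thesis by (simp add: K_def)
  qed
  obtain \<phi> where \<phi>: "\<And>k. \<phi> k \<in> test_fields" "(\<lambda>k. test_H1s (\<phi> k)) \<longlonglongrightarrow> u"
    by (rule test_H1s_dense)  (rule that)
  have "(\<lambda>k. Rep_H1s (test_H1s (\<phi> k))) \<longlonglongrightarrow> Rep_H1s u"
    using \<phi>(2) unfolding tendsto_iff by (simp add: dist_Rep_H1s)
  then have "(\<lambda>k. fst (Rep_H1s (test_H1s (\<phi> k)))) \<longlonglongrightarrow> fst (Rep_H1s u)" by (rule tendsto_fst)
  then obtain r :: "nat \<Rightarrow> nat" where r: "strict_mono r"
      "AE x in lebesgue. (\<lambda>k. rep_L2 (fst (Rep_H1s (test_H1s (\<phi> (r k))))) x) \<longlonglongrightarrow> rep_L2 (fst (Rep_H1s u)) x"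
    by (rule AE_subsequence_L2) (rule that)
  define u' where "u' k = test_H1s (\<phi> (r k))" for k
  have ae: "AE x in lebesgue. (\<lambda>k. H1s_fun (u' k) x) \<longlonglongrightarrow> H1s_fun u x"
    using r(2) by (simp add: H1s_fun_eq u'_def)
  have u': "u' \<longlonglongrightarrow> u" unfolding u'_def using LIMSEQ_subseq_LIMSEQ[OF \<phi>(2) r(1)] by (simp add: o_def)
  define q where "q w x = ennreal ((norm (v x))\<^sup>2 * (norm (H1s_fun w x))\<^sup>2)" for w x
  have qm: "q w \<in> borel_measurable lebesgue" for w
    unfolding q_def[abs_def] using v measurable_H1s_fun[of w] by measurable
  have lg: "(\<lambda>k. ennreal (K * (norm (grad (u' k)))\<^sup>2)) \<longlonglongrightarrow> ennreal (K * (norm (grad u))\<^sup>2)"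
    by (intro tendsto_ennrealI tendsto_intros bounded_linear.tendsto[OF bounded_linear_grad] u')
  have "(\<integral>\<^sup>+x. q u x \<partial>lebesgue) = (\<integral>\<^sup>+x. liminf (\<lambda>k. q (u' k) x) \<partial>lebesgue)"
  proof (rule nn_integral_cong_AE)
    show "AE x in lebesgue. q u x = liminf (\<lambda>k. q (u' k) x)"
      using ae
    proof eventually_elim
      case (elim x)
      have "(\<lambda>k. q (u' k) x) \<longlonglongrightarrow> q u x"
        unfolding q_def by (intro tendsto_ennrealI tendsto_intros elim)
      then show ?case by (simp add: lim_imp_Liminf)
    qed
  qed
  also have "\<dots> \<le> liminf (\<lambda>k. \<integral>\<^sup>+x. q (u' k) x \<partial>lebesgue)"
    by (rule nn_integral_liminf[OF qm])
  also have "\<dots> \<le> liminf (\<lambda>k. ennreal (K * (norm (grad (u' k)))\<^sup>2))"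
    by (intro Liminf_mono always_eventually allI) (auto simp: q_def u'_def intro: test \<phi>(1))
  also have "\<dots> = ennreal (K * (norm (grad u))\<^sup>2)" using lg by (simp add: lim_imp_Liminf)
  also have "K * (norm (grad u))\<^sup>2 = (sqrt (hardy_const CARD('n)) * d * norm (grad u))\<^sup>2"
    using hardy_const_pos[of "CARD('n)"] by (simp add: K_def power_mult_distrib less_imp_le)
  finally show "(\<integral>\<^sup>+x. ennreal ((norm (v x))\<^sup>2 * (norm (H1s_fun u x))\<^sup>2) \<partial>lebesgue)
      \<le> ennreal ((sqrt (hardy_const CARD('n)) * d * norm (grad u))\<^sup>2)" by (simp add: q_def)
qed

section \<open>The transport terms as inner products\<close>

text \<open>The field \<open>v \<otimes> u\<close> as an element of \<open>L^2\<close>;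
  \<open>cotransport\<close> is its transpose. Two versions are needed because the gradient matrix
  has entries \<open>\<partial>\<^sub>j u\<^sub>k\<close>: in the first transport term the index of
  \<open>v\<close> meets the derivative, in the second the index of \<open>u\<close> does.\<close>

definition transport :: "(real^'n \<Rightarrow> real^'n) \<Rightarrow> 'n::finite H1s \<Rightarrow> (real^'n, real^'n^'n) L2" where
  "transport v u = abs_L2 (\<lambda>x. outer (v x) (H1s_fun u x))"

definition cotransport :: "(real^'n \<Rightarrow> real^'n) \<Rightarrow> 'n::finite H1s \<Rightarrow> (real^'n, real^'n^'n) L2" where
  "cotransport v u = abs_L2 (\<lambda>x. outer (H1s_fun u x) (v x))"

context
  fixes v :: "real^'n \<Rightarrow> real^'n::finite" and \<kappa> :: real
  assumes hw: "hardy_weight \<kappa> v" and \<kappa>: "\<kappa> \<ge> 0"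
begin

lemma measurable_weight: "v \<in> borel_measurable lebesgue"
  using hw by (simp add: hardy_weight_def)

lemma square_integrable_weight_outer:
  "square_integrable (\<lambda>x. outer (v x) (H1s_fun u x))" "square_integrable (\<lambda>x. outer (H1s_fun u x) (v x))"
proof -
  have "(\<integral>\<^sup>+x. ennreal ((norm (v x) * norm (H1s_fun u x))\<^sup>2) \<partial>lebesgue) < \<infinity>"
    using hw le_less_trans[OF _ ennreal_less_top] by (auto simp: hardy_weight_def power_mult_distrib)
  then show "square_integrable (\<lambda>x. outer (v x) (H1s_fun u x))" "square_integrable (\<lambda>x. outer (H1s_fun u x) (v x))"
    unfolding square_integrable_iff_sq_int sq_int_iff_nn norm_outer
    by (auto intro!: borel_measurable_outer measurable_weight measurable_H1s_fun simp: mult.commute)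
qed

lemma norm_transport_le: "norm (transport v u) \<le> \<kappa> * norm (grad u)"
  and norm_cotransport_le: "norm (cotransport v u) \<le> \<kappa> * norm (grad u)"
proof -
  have nn: "ennreal ((norm (abs_L2 f))\<^sup>2) = (\<integral>\<^sup>+x. ennreal ((norm (f x))\<^sup>2) \<partial>lebesgue)"
    if "square_integrable f" for f :: "real^'n \<Rightarrow> real^'n^'n"
    using that by (simp add: norm_abs_L2 square_integrable_iff_sq_int sq_int_nn_eq)
  have "ennreal ((norm (transport v u))\<^sup>2) \<le> ennreal ((\<kappa> * norm (grad u))\<^sup>2)"
      "ennreal ((norm (cotransport v u))\<^sup>2) \<le> ennreal ((\<kappa> * norm (grad u))\<^sup>2)"
    unfolding transport_def cotransport_def nn[OF square_integrable_weight_outer(1)] nn[OF square_integrable_weight_outer(2)]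
    using hw by (simp_all add: norm_outer hardy_weight_def power_mult_distrib mult.commute)
  then show "norm (transport v u) \<le> \<kappa> * norm (grad u)" "norm (cotransport v u) \<le> \<kappa> * norm (grad u)"
    using \<kappa> by (auto simp: ennreal_le_iff intro: power2_le_imp_le)
qed

lemma transport_add: "transport v (u + w) = transport v u + transport v w"
  and cotransport_add: "cotransport v (u + w) = cotransport v u + cotransport v w"
  unfolding transport_def cotransport_def
  by (subst abs_L2_add[symmetric], rule square_integrable_weight_outer, rule square_integrable_weight_outer,
      rule abs_L2_eqI, rule square_integrable_weight_outer, rule square_integrable_add,
      rule square_integrable_weight_outer, rule square_integrable_weight_outer,
      use H1s_fun_add[of u w] in \<open>eventually_elim, simp add: outer_add_right outer_add_left\<close>)+

lemma transport_scaleR: "transport v (c *\<^sub>R u) = c *\<^sub>R transport v u"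
  and cotransport_scaleR: "cotransport v (c *\<^sub>R u) = c *\<^sub>R cotransport v u"
  unfolding transport_def cotransport_def
  by (subst abs_L2_scaleR[symmetric], rule square_integrable_weight_outer,
      rule abs_L2_eqI, rule square_integrable_weight_outer, rule square_integrable_scaleR,
      rule square_integrable_weight_outer,
      use H1s_fun_scaleR[of c u] in \<open>eventually_elim, simp add: outer_scaleR_right outer_scaleR_left\<close>)+

text \<open>All three terms become inner products of elements of \<open>L^2\<close> depending
  linearly and boundedly on \<open>u\<close> and \<open>w\<close>, from which bilinearity, bounds
  and continuity of the form follow.\<close>

lemma form_eq: "form v u w = grad u \<bullet> grad w + grad u \<bullet> transport v w - grad w \<bullet> cotransport v u"
proof -
  have L: "g \<bullet> abs_L2 f = (LINT x|lebesgue. rep_L2 g x \<bullet> f x)" if f: "square_integrable f"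
    for g :: "(real^'n, real^'n^'n) L2" and f
    unfolding inner_L2_eq
  proof (rule integral_cong_AE)
    show "(\<lambda>x. rep_L2 g x \<bullet> rep_L2 (abs_L2 f) x) \<in> borel_measurable lebesgue"
      "(\<lambda>x. rep_L2 g x \<bullet> f x) \<in> borel_measurable lebesgue"
      using f rep_L2_square_integrable[of g] rep_L2_square_integrable[of "abs_L2 f"]
      by (auto simp: square_integrable_def)
    show "AE x in lebesgue. rep_L2 g x \<bullet> rep_L2 (abs_L2 f) x = rep_L2 g x \<bullet> f x"
      using rep_abs_L2[OF f] by eventually_elim simp
  qed
  have "grad u \<bullet> transport v w = (LINT x|lebesgue. (\<Sum>j\<in>UNIV. v x $ j *\<^sub>R H1s_grad u x $ j) \<bullet> H1s_fun w x)"
    unfolding transport_def L[OF square_integrable_weight_outer(1)] H1s_grad_def[symmetric]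
    by (intro Bochner_Integration.integral_cong refl)
       (simp add: inner_outer inner_sum_left inner_vec_def[of "H1s_grad _ _ $ _"] sum_distrib_left mult_ac)
  moreover have "grad w \<bullet> cotransport v u
      = (\<Sum>j\<in>UNIV. \<Sum>k\<in>UNIV. LINT x|lebesgue. v x $ j * H1s_fun u x $ k * H1s_grad w x $ k $ j)"
  proof -
    \<comment> \<open>Integrability of the single entries allows the double sum of integrals in the
      definition of the form to be collected into one integral.\<close>
    have int: "integrable lebesgue (\<lambda>x. v x $ j * H1s_fun u x $ k * H1s_grad w x $ k $ j)" for j k
    proof -
      have o: "sq_int lebesgue (\<lambda>x. outer (H1s_fun u x) (v x))" and g: "sq_int lebesgue (H1s_grad w)"
        using square_integrable_weight_outer(2) square_integrable_H1s(2) by (auto simp: square_integrable_iff_sq_int)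
      have comp: "sq_int lebesgue (\<lambda>x. f x $ k $ j)" if f: "sq_int lebesgue f" for f :: "real^'n \<Rightarrow> real^'n^'n"
      proof (rule sq_int_bound[OF f, where C = 1])
        have "(\<lambda>A::real^'n^'n. A $ k $ j) \<in> borel_measurable borel"
          by (intro borel_measurable_continuous_onI continuous_intros)
        from measurable_compose[OF sq_intD(1)[OF f] this] show "(\<lambda>x. f x $ k $ j) \<in> borel_measurable lebesgue" .
        show "norm (f x $ k $ j) \<le> 1 * norm (f x)" for x
          using order_trans[OF component_le_norm_cart[of "f x $ k" j] Finite_Cartesian_Product.norm_nth_le] by simp
      qed
      from sq_int_inner[OF comp[OF o] comp[OF g]] show ?thesis by (simp add: outer_def mult_ac)
    qed
    have "(\<Sum>j\<in>UNIV. \<Sum>k\<in>UNIV. LINT x|lebesgue. v x $ j * H1s_fun u x $ k * H1s_grad w x $ k $ j)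
        = (LINT x|lebesgue. (\<Sum>j\<in>UNIV. \<Sum>k\<in>UNIV. v x $ j * H1s_fun u x $ k * H1s_grad w x $ k $ j))"
      using int by (simp add: Bochner_Integration.integral_sum Bochner_Integration.integrable_sum)
    also have "\<dots> = grad w \<bullet> cotransport v u"
      unfolding cotransport_def L[OF square_integrable_weight_outer(2)] H1s_grad_def[symmetric]
    proof (intro Bochner_Integration.integral_cong refl)
      show "(\<Sum>j\<in>UNIV. \<Sum>k\<in>UNIV. v x $ j * H1s_fun u x $ k * H1s_grad w x $ k $ j)
          = H1s_grad w x \<bullet> outer (H1s_fun u x) (v x)" for x
        unfolding inner_outer by (subst sum.swap) (simp add: mult_ac)
    qed
    finally show ?thesis by simp
  qed
  ultimately show ?thesis by (simp add: form_def)
qed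

lemma form_add_left: "form v (u + u') w = form v u w + form v u' w"
  by (simp add: form_eq grad_add cotransport_add inner_add_left inner_add_right)

lemma form_add_right: "form v u (w + w') = form v u w + form v u w'"
  by (simp add: form_eq grad_add transport_add inner_add_left inner_add_right)

lemma form_scale_left: "form v (c *\<^sub>R u) w = c * form v u w"
  by (simp add: form_eq grad_scaleR cotransport_scaleR algebra_simps)

lemma form_scale_right: "form v u (c *\<^sub>R w) = c * form v u w"
  by (simp add: form_eq grad_scaleR transport_scaleR algebra_simps)

lemma form_perturbation: "\<bar>form v u w - grad u \<bullet> grad w\<bar> \<le> 2 * \<kappa> * norm (grad u) * norm (grad w)"
proof -
  have "\<bar>grad u \<bullet> transport v w\<bar> \<le> norm (grad u) * (\<kappa> * norm (grad w))"
    by (rule order_trans[OF Cauchy_Schwarz_ineq2 mult_left_mono[OF norm_transport_le norm_ge_zero]])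
  moreover have "\<bar>grad w \<bullet> cotransport v u\<bar> \<le> norm (grad w) * (\<kappa> * norm (grad u))"
    by (rule order_trans[OF Cauchy_Schwarz_ineq2 mult_left_mono[OF norm_cotransport_le norm_ge_zero]])
  ultimately show ?thesis by (simp add: form_eq mult_ac)
qed

lemma form_bound: "\<bar>form v u w\<bar> \<le> (1 + 2 * \<kappa>) * norm (grad u) * norm (grad w)"
  using form_perturbation[of u w] Cauchy_Schwarz_ineq2[of "grad u" "grad w"] by (simp add: algebra_simps)

text \<open>The perturbation is at most \<open>2 \<kappa>\<close> times the squared gradient norm,
  hence at most half of the leading term.\<close>

lemma form_coercive: "\<kappa> \<le> 1/4 \<Longrightarrow> form v u u \<ge> (norm (grad u))\<^sup>2 / 2"
  using form_perturbation[of u u] mult_right_mono[of \<kappa> "1/4" "(norm (grad u))\<^sup>2"]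
  by (simp add: dot_square_norm power2_eq_square)

lemma bounded_linear_form: "bounded_linear (form v u)"
proof (rule bounded_linear_intro[where K = "(1 + 2 * \<kappa>) * norm (grad u)"])
  show "norm (form v u w) \<le> norm w * ((1 + 2 * \<kappa>) * norm (grad u))" for w
    using form_bound[of u w] mult_left_mono[OF norm_grad_le[of w], of "(1 + 2 * \<kappa>) * norm (grad u)"] \<kappa>
    by (simp add: mult_ac)
qed (simp_all add: form_add_right form_scale_right)

lemma blinfun_apply_L_op: "blinfun_apply (L_op v u) w = form v u w"
  by (simp add: L_op_def bounded_linear_Blinfun_apply[OF bounded_linear_form])

lemma form_tendsto:
  assumes u: "U \<longlonglongrightarrow> u" and w: "W \<longlonglongrightarrow> w"
  shows "(\<lambda>k. form v (U k) (W k)) \<longlonglongrightarrow> form v u w"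
proof -
  have bt: "bounded_linear (transport v)" "bounded_linear (cotransport v)"
    using order_trans[OF norm_transport_le mult_left_mono[OF norm_grad_le \<kappa>]]
      order_trans[OF norm_cotransport_le mult_left_mono[OF norm_grad_le \<kappa>]]
    by (auto intro!: bounded_linear_intro[where K = \<kappa>] transport_add transport_scaleR cotransport_add cotransport_scaleR
        simp: mult.commute)
  show ?thesis
    unfolding form_eq by (intro tendsto_intros bounded_linear.tendsto[OF bounded_linear_grad]
        bounded_linear.tendsto[OF bt(1)] bounded_linear.tendsto[OF bt(2)] u w)
qed

text \<open>On test fields \<open>v\<close> is paired with a continuous vector field of compact
  support, which does not involve the representatives chosen in \<open>L^2\<close>. In this shape
  weak* continuity of \<open>V\<close> applies.\<close>

lemma form_test:
  assumes \<phi>: "\<phi> \<in> test_fields" and \<psi>: "\<psi> \<in> test_fields"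
  shows "form v (test_H1s \<phi>) (test_H1s \<psi>) = grad (test_H1s \<phi>) \<bullet> grad (test_H1s \<psi>)
    + (LINT x|lebesgue. v x \<bullet> (gradient \<phi> x *v \<psi> x)) - (LINT x|lebesgue. v x \<bullet> (\<phi> x v* gradient \<psi> x))"
proof -
  have sq: "square_integrable f" if "square_integrable g" "f \<in> borel_measurable lebesgue" "AE x in lebesgue. g x = f x"
    for f g :: "real^'n \<Rightarrow> real^'n^'n"
  proof -
    have "integrable lebesgue (\<lambda>x. (norm (f x))\<^sup>2)"
    proof (rule integrable_cong_AE_imp)
      show "integrable lebesgue (\<lambda>x. (norm (g x))\<^sup>2)" using that(1) by (simp add: square_integrable_def)
      show "(\<lambda>x. (norm (f x))\<^sup>2) \<in> borel_measurable lebesgue" using that(2) by measurable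
      show "AE x in lebesgue. (norm (g x))\<^sup>2 = (norm (f x))\<^sup>2" using that(3) by eventually_elim simp
    qed
    then show ?thesis using that(2) by (simp add: square_integrable_def)
  qed
  have m: "\<phi> \<in> borel_measurable lebesgue" "\<psi> \<in> borel_measurable lebesgue"
    using square_integrable_test_field(1)[OF \<phi>] square_integrable_test_field(1)[OF \<psi>] by (auto simp: square_integrable_def)
  have ae1: "AE x in lebesgue. outer (v x) (H1s_fun (test_H1s \<psi>) x) = outer (v x) (\<psi> x)"
    using H1s_fun_test[OF \<psi>] by eventually_elim simp
  have ae2: "AE x in lebesgue. outer (H1s_fun (test_H1s \<phi>) x) (v x) = outer (\<phi> x) (v x)"
    using H1s_fun_test[OF \<phi>] by eventually_elim simp
  have s1: "square_integrable (\<lambda>x. outer (v x) (\<psi> x))"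
    by (rule sq[OF square_integrable_weight_outer(1) borel_measurable_outer[OF measurable_weight m(2)] ae1])
  have s2: "square_integrable (\<lambda>x. outer (\<phi> x) (v x))"
    by (rule sq[OF square_integrable_weight_outer(2) borel_measurable_outer[OF m(1) measurable_weight] ae2])
  have t1: "transport v (test_H1s \<psi>) = abs_L2 (\<lambda>x. outer (v x) (\<psi> x))"
    unfolding transport_def by (rule abs_L2_eqI[OF square_integrable_weight_outer(1) s1 ae1])
  have t2: "cotransport v (test_H1s \<phi>) = abs_L2 (\<lambda>x. outer (\<phi> x) (v x))"
    unfolding cotransport_def by (rule abs_L2_eqI[OF square_integrable_weight_outer(2) s2 ae2])
  have L: "abs_L2 g \<bullet> abs_L2 f = (LINT x|lebesgue. g x \<bullet> f x)"
    if "square_integrable f" "square_integrable g" for g f :: "real^'n \<Rightarrow> real^'n^'n"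
    by (rule inner_L2.abs_eq) (use that in \<open>auto simp: L2rel_def\<close>)
  show ?thesis
    unfolding form_eq t1 t2 grad_test_H1s[OF \<phi>] grad_test_H1s[OF \<psi>]
      L[OF s1 square_integrable_test_field(2)[OF \<phi>]] L[OF s2 square_integrable_test_field(2)[OF \<psi>]] inner_outer_mv[of "gradient \<phi> _"] inner_outer_vm[of "gradient \<psi> _"] ..
qed

end

section \<open>The evolution family\<close>

text \<open>For each set of a countable basis the preimage is a Borel set up to a null set. The
  union of these countably many null sets is null, and off it the function is Borel.\<close>

lemma borel_representative:
  fixes f :: "'a \<Rightarrow> 'b::second_countable_topology"
  assumes f: "f \<in> borel_measurable (completion M)"
  obtains f' where "f' \<in> borel_measurable M" "AE x in M. f x = f' x"
proof -
  obtain B :: "'b set set" where B: "countable B" "topological_basis B" using ex_countable_basis by blast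
  have bo: "borel = sigma UNIV B" by (rule borel_eq_countable_basis[OF B])
  have "\<exists>S N'. N' \<in> null_sets M \<and> S \<in> sets M \<and> f -` X \<inter> space M - N' = S - N'" if "X \<in> B" for X
  proof -
    have "f -` X \<inter> space (completion M) \<in> sets (completion M)"
      by (rule measurable_sets[OF f]) (use topological_basis_open[OF B(2) that] in simp)
    then obtain S N N' where "f -` X \<inter> space M = S \<union> N" "N \<subseteq> N'" "N' \<in> null_sets M" "S \<in> sets M"
      by (auto elim: sets_completionE)
    then show ?thesis by (intro exI[of _ S] exI[of _ N']) auto
  qed
  then obtain S N' where SN: "\<And>X. X \<in> B \<Longrightarrow> N' X \<in> null_sets M" "\<And>X. X \<in> B \<Longrightarrow> S X \<in> sets M"
      "\<And>X. X \<in> B \<Longrightarrow> f -` X \<inter> space M - N' X = S X - N' X" by metis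
  define N where "N = (\<Union>X\<in>B. N' X)"
  have N: "N \<in> null_sets M" unfolding N_def by (rule null_sets_UN'[OF B(1) SN(1)])
  \<comment> \<open>A constant value on the exceptional set keeps all preimages measurable; which
    constant is irrelevant.\<close>
  define f' where "f' x = (if x \<in> N then undefined else f x)" for x
  have "f' \<in> measurable M (sigma UNIV B)"
  proof (rule measurable_measure_of)
    fix X assume X: "X \<in> B"
    have "f' -` X \<inter> space M = (S X - N) \<union> (if undefined \<in> X then N else {})"
      using SN(3)[OF X] X sets.sets_into_space[OF null_setsD2[OF N]] sets.sets_into_space[OF SN(2)[OF X]]
      by (auto simp: f'_def N_def split: if_splits)
    also have "\<dots> \<in> sets M" using SN(2)[OF X] null_setsD2[OF N] by auto
    finally show "f' -` X \<inter> space M \<in> sets M" .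
  qed auto
  then have "f' \<in> borel_measurable M" unfolding bo .
  moreover have "AE x in M. f x = f' x"
    using AE_not_in[OF N] by eventually_elim (simp add: f'_def)
  ultimately show ?thesis by (rule that)
qed

text \<open>Passage from integrals over \<open>lebesgue_on I\<close>, as in the Cauchy problem, to
  \<open>lborel\<close>. Since Lebesgue measure is complete, \<open>p\<close> inherits measurability
  on \<open>I\<close> from the Borel function \<open>q\<close>.\<close>

lemma lebesgue_on_integral_eq:
  fixes p q :: "real \<Rightarrow> real"
  assumes I: "I \<in> sets borel" and q: "q \<in> borel_measurable borel" and ae: "AE t in lborel. t \<in> I \<longrightarrow> p t = q t"
  shows "(LINT t|lebesgue_on I. p t) = (LINT t|lborel. indicator I t * q t)"
proof -
  have IL: "I \<in> sets lebesgue" using I by simp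
  have m: "(\<lambda>t. indicator I t * q t) \<in> borel_measurable lborel" using I q by measurable
  have ae': "AE t in lebesgue. indicator I t * q t = indicator I t * p t"
    unfolding AE_completion_iff using ae
  proof eventually_elim
    case (elim t)
    then show ?case by (cases "t \<in> I") simp_all
  qed
  have "(LINT t|lebesgue_on I. p t) = (LINT t|lebesgue. indicator I t * p t)"
    using IL by (simp add: integral_restrict_space)
  also have "\<dots> = (LINT t|lebesgue. indicator I t * q t)"
  proof (rule integral_cong_AE)
    show "(\<lambda>t. indicator I t * p t) \<in> borel_measurable lebesgue"
      by (rule borel_measurable_AE[OF measurable_completion[OF m] ae'])
    show "AE t in lebesgue. indicator I t * p t = indicator I t * q t" using ae' by eventually_elim (rule sym)
  qed (rule measurable_completion[OF m])
  also have "\<dots> = (LINT t|lborel. indicator I t * q t)" by (rule integral_completion[OF m])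
  finally show ?thesis .
qed

lemma AE_lebesgue_on_iff:
  "I \<in> sets borel \<Longrightarrow> (AE t in lebesgue_on I. P t) \<longleftrightarrow> (AE t in lborel. t \<in> I \<longrightarrow> P t)"
  by (subst AE_restrict_space_iff) (simp_all add: AE_completion_iff)

lemma bochner_L2_of_borel:
  fixes h :: "real \<Rightarrow> 'x::real_normed_vector"
  assumes I: "I \<in> sets borel" and h: "h \<in> borel_measurable borel"
    and int: "integrable lborel (\<lambda>t. indicator I t * (norm (h t))\<^sup>2)"
  shows "bochner_L2 I h"
  unfolding bochner_L2_def
proof
  show "h \<in> borel_measurable (lebesgue_on I)"
    by (rule measurable_restrict_space1[OF measurable_completion]) (use h in simp)
  have "(\<lambda>t. indicator I t * (norm (h t))\<^sup>2) \<in> borel_measurable lborel" using int by auto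
  then show "integrable (lebesgue_on I) (\<lambda>t. (norm (h t))\<^sup>2)"
    using I int by (subst integrable_restrict_space) (simp_all add: integrable_completion)
qed

section \<open>Measurability of the form in time\<close>

lemma in_lorentz1_continuous_compact_support:
  fixes g :: "'a::euclidean_space \<Rightarrow> 'b::euclidean_space"
  assumes g: "continuous_on UNIV g" and K: "compact K" "\<And>x. x \<notin> K \<Longrightarrow> g x = 0" and Q: "Q > 1"
  shows "in_lorentz1 Q g"
proof -
  have "compact (g ` K)" by (rule compact_continuous_image[OF continuous_on_subset[OF g] K(1)]) simp
  then obtain L where L: "\<And>x. x \<in> K \<Longrightarrow> norm (g x) \<le> L"
    using compact_imp_bounded[of "g ` K"] unfolding bounded_iff by auto
  have "norm (g x) \<le> max L 0" for x using L[of x] K(2)[of x] by (cases "x \<in> K") auto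
  moreover have "g \<in> borel_measurable lebesgue"
    using borel_measurable_continuous_onI[OF g] by (simp add: measurable_completion)
  moreover have "K \<in> sets lebesgue" using K(1) by (simp add: borel_compact)
  moreover have "emeasure lebesgue K \<le> ennreal (measure lebesgue K)"
  proof -
    have "emeasure lebesgue K < \<infinity>"
      using emeasure_bounded_finite[OF compact_imp_bounded[OF K(1)]] K(1) by (simp add: borel_compact)
    then show ?thesis by (simp add: emeasure_eq_ennreal_measure)
  qed
  ultimately show ?thesis using K(2) by (intro in_lorentz1_bounded_support[OF _ Q]) auto
qed

text \<open>Both drift integrals pair \<open>V t\<close> with a fixed continuous field of compact
  support, an element of the predual with exponent \<open>n / (n - 1)\<close>. The interval is open
  because the Hardy bound is available only for positive times.\<close>

lemma form_test_continuous:
  fixes V :: "real \<Rightarrow> real^'n \<Rightarrow> real^'n::finite"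
  assumes n: "CARD('n) \<ge> 3" and V: "weak_star_continuous (real CARD('n)) V"
    and hw: "\<And>t. t > 0 \<Longrightarrow> hardy_weight \<kappa> (V t)" and \<kappa>: "\<kappa> \<ge> 0"
    and \<phi>: "\<phi> \<in> test_fields" and \<psi>: "\<psi> \<in> test_fields"
  shows "continuous_on {0<..} (\<lambda>t. form (V t) (test_H1s \<phi>) (test_H1s \<psi>))"
proof -
  obtain C where C: "compact C" "\<And>x. x \<notin> C \<Longrightarrow> \<phi> x = 0" "\<And>x. x \<notin> C \<Longrightarrow> gradient \<phi> x = 0"
    "continuous_on UNIV \<phi>" "continuous_on UNIV (gradient \<phi>)"
    by (rule test_field_facts[OF \<phi>]) (rule that)
  obtain D where D: "compact D" "\<And>x. x \<notin> D \<Longrightarrow> \<psi> x = 0" "\<And>x. x \<notin> D \<Longrightarrow> gradient \<psi> x = 0"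
    "continuous_on UNIV \<psi>" "continuous_on UNIV (gradient \<psi>)"
    by (rule test_field_facts[OF \<psi>]) (rule that)
  have Q: "real CARD('n) / (real CARD('n) - 1) > 1" using n by (simp add: field_simps)
  have pairing: "continuous_on {0<..} (\<lambda>t. LINT x|lebesgue. V t x \<bullet> g x)"
    if "continuous_on UNIV g" "compact K" "\<And>x. x \<notin> K \<Longrightarrow> g x = 0" for g :: "real^'n \<Rightarrow> real^'n" and K
    using V in_lorentz1_continuous_compact_support[OF that Q] unfolding weak_star_continuous_def
    by (auto intro: continuous_on_subset)
  have "continuous_on {0<..} (\<lambda>t. grad (test_H1s \<phi>) \<bullet> grad (test_H1s \<psi>)
    + (LINT x|lebesgue. V t x \<bullet> (gradient \<phi> x *v \<psi> x)) - (LINT x|lebesgue. V t x \<bullet> (\<phi> x v* gradient \<psi> x)))"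
  proof (intro continuous_intros pairing)
    show "continuous_on UNIV (\<lambda>x. gradient \<phi> x *v \<psi> x)"
      unfolding matrix_vector_mult_def by (intro continuous_intros C D)
    show "continuous_on UNIV (\<lambda>x. \<phi> x v* gradient \<psi> x)"
      unfolding vector_matrix_mult_def by (intro continuous_intros C D)
    show "compact C" "compact C" by (rule C)+
  qed (simp_all add: C(2,3))
  then show ?thesis
    by (rule continuous_on_cong[THEN iffD2, OF refl, rotated]) (simp add: form_test[OF hw \<kappa> \<phi> \<psi>])
qed

text \<open>Nothing is known about \<open>V t\<close> for \<open>t \<le> 0\<close>, where any coercive form will do.\<close>

definition flow_form :: "(real \<Rightarrow> real^'n \<Rightarrow> real^'n::finite) \<Rightarrow> real \<Rightarrow> 'n H1s \<Rightarrow> 'n H1s \<Rightarrow> real" where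
  "flow_form V t u w = (if t > 0 then form (V t) u w + emb u \<bullet> emb w else u \<bullet> w)"

text \<open>At each positive time the form is the limit of its values on test fields approximating
  \<open>u\<close> and \<open>w\<close>, and these approximations do not depend on \<open>t\<close>;
  a pointwise limit of measurable functions is measurable.\<close>

lemma flow_form_measurable:
  fixes V :: "real \<Rightarrow> real^'n \<Rightarrow> real^'n::finite"
  assumes n: "CARD('n) \<ge> 3" and V: "weak_star_continuous (real CARD('n)) V"
    and hw: "\<And>t. t > 0 \<Longrightarrow> hardy_weight \<kappa> (V t)" and \<kappa>: "\<kappa> \<ge> 0"
  shows "(\<lambda>t. flow_form V t u w) \<in> borel_measurable borel"
proof -
  obtain \<phi> where \<phi>: "\<And>k. \<phi> k \<in> test_fields" "(\<lambda>k. test_H1s (\<phi> k)) \<longlonglongrightarrow> u"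
    by (rule test_H1s_dense) (rule that)
  obtain \<psi> where \<psi>: "\<And>k. \<psi> k \<in> test_fields" "(\<lambda>k. test_H1s (\<psi> k)) \<longlonglongrightarrow> w"
    by (rule test_H1s_dense) (rule that)
  define F where "F k t = (if t > 0 then form (V t) (test_H1s (\<phi> k)) (test_H1s (\<psi> k)) else 0)" for k t
  have Fm: "F k \<in> borel_measurable borel" for k
  proof -
    have "(\<lambda>t. indicator {0<..} t *\<^sub>R form (V t) (test_H1s (\<phi> k)) (test_H1s (\<psi> k))) \<in> borel_measurable borel"
      by (rule borel_measurable_continuous_on_indicator[OF _ form_test_continuous[OF n V hw \<kappa> \<phi>(1) \<psi>(1)]]) auto
    also have "(\<lambda>t. indicator {0<..} t *\<^sub>R form (V t) (test_H1s (\<phi> k)) (test_H1s (\<psi> k))) = F k"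
      by (auto simp: F_def indicator_def)
    finally show ?thesis .
  qed
  have "(\<lambda>t. if t > 0 then form (V t) u w else 0) \<in> borel_measurable borel"
  proof (rule borel_measurable_LIMSEQ_real[OF _ Fm])
    show "(\<lambda>k. F k t) \<longlonglongrightarrow> (if t > 0 then form (V t) u w else 0)" for t
      unfolding F_def using form_tendsto[OF hw \<kappa> \<phi>(2) \<psi>(2), of t] by (cases "t > 0") auto
  qed
  then have "(\<lambda>t. (if t > 0 then form (V t) u w else 0) + (if t > 0 then emb u \<bullet> emb w else u \<bullet> w)) \<in> borel_measurable borel"
    by measurable
  also have "(\<lambda>t. (if t > 0 then form (V t) u w else 0) + (if t > 0 then emb u \<bullet> emb w else u \<bullet> w)) = (\<lambda>t. flow_form V t u w)"
    by (auto simp: flow_form_def)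
  finally show ?thesis .
qed

text \<open>With \<kappa> = 1/4 the form dominates half of the squared gradient norm. Adding the
  \<open>L^2\<close> inner product gives coercivity with constant 1/2 in the full norm, and the
  unshifted part is exactly the dissipativity condition for the gradient.\<close>

lemma flow_dissipative_family:
  fixes V :: "real \<Rightarrow> real^'n \<Rightarrow> real^'n::finite"
  assumes n: "CARD('n) \<ge> 3" and V: "weak_star_continuous (real CARD('n)) V"
    and hw: "\<And>t. t > 0 \<Longrightarrow> hardy_weight (1/4) (V t)"
  shows "dissipative_family emb (flow_form V) 3 (1/2) grad"
proof -
  have \<kappa>: "(0::real) \<le> 1/4" by simp
  have inner_H1s: "u \<bullet> w = emb u \<bullet> emb w + grad u \<bullet> grad w" for u w :: "'n H1s"
    by (simp add: inner_H1s.rep_eq inner_L2s.rep_eq Rep_L2s_emb grad_def inner_prod_def)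
  have diss: "(norm (grad u))\<^sup>2 \<le> 2 * (flow_form V t u u - (norm (emb u))\<^sup>2)" for t u
  proof (cases "t > 0")
    case True
    then show ?thesis using form_coercive[OF hw \<kappa>, of t u] by (simp add: flow_form_def power2_norm_eq_inner)
  next
    case False
    then show ?thesis by (simp add: flow_form_def power2_norm_eq_inner inner_H1s)
  qed
  show ?thesis
  proof (intro dissipative_family.intro coercive_family.intro dissipative_family_axioms.intro)
    fix t x :: real and u u' w w' :: "'n H1s"
    show "bounded_linear emb" by (rule bounded_linear_emb)
    show "closure (range emb) = (UNIV :: 'n L2s set)" by (rule emb_dense)
    show "flow_form V t (u + u') w = flow_form V t u w + flow_form V t u' w"
      by (simp add: flow_form_def form_add_left[OF hw \<kappa>] emb_add inner_add_left)
    show "flow_form V t u (w + w') = flow_form V t u w + flow_form V t u w'"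
      by (simp add: flow_form_def form_add_right[OF hw \<kappa>] emb_add inner_add_right)
    show "flow_form V t (x *\<^sub>R u) w = x * flow_form V t u w"
      by (simp add: flow_form_def form_scale_left[OF hw \<kappa>] emb_scaleR distrib_left)
    show "flow_form V t u (x *\<^sub>R w) = x * flow_form V t u w"
      by (simp add: flow_form_def form_scale_right[OF hw \<kappa>] emb_scaleR distrib_left)
    \<comment> \<open>At positive times the form contributes \<open>1 + 2 \<kappa> = 3/2\<close> and
      the inner product of the embeddings 1; the bound 3 is the sum rounded up.\<close>
    show "\<bar>flow_form V t u w\<bar> \<le> 3 * norm u * norm w"
    proof -
      have p: "norm u * norm w \<ge> 0" by simp
      have "\<bar>u \<bullet> w\<bar> \<le> norm u * norm w" by (rule Cauchy_Schwarz_ineq2)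
      moreover have "\<bar>emb u \<bullet> emb w\<bar> \<le> norm u * norm w"
        by (rule order_trans[OF Cauchy_Schwarz_ineq2]) (intro mult_mono norm_emb_le, auto)
      moreover have "norm (grad u) * norm (grad w) \<le> norm u * norm w" by (intro mult_mono norm_grad_le) auto
      moreover have "\<bar>form (V t) u w\<bar> \<le> 3/2 * (norm (grad u) * norm (grad w))" if "t > 0"
        using form_bound[OF hw[OF that] \<kappa>, of u w] by simp
      ultimately show ?thesis unfolding flow_form_def using p by (cases "t > 0") auto
    qed
    show "1/2 * (norm u)\<^sup>2 \<le> flow_form V t u u"
      using diss[of u t] zero_le_power2[of "norm (emb u)"] unfolding norm_H1s_eq by argo
    show "(\<lambda>t. flow_form V t u w) \<in> borel_measurable borel"
      by (rule flow_form_measurable[OF n V hw \<kappa>])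
    show "bounded_linear grad" by (rule bounded_linear_grad)
    show "(norm (grad u))\<^sup>2 \<le> 2 * (flow_form V t u u - (norm (emb u))\<^sup>2)" by (rule diss)
  qed simp
qed

text \<open>The supremum over positive times bounds the weak norm at each of them, and passing from
  the weak norm to the distribution function costs the factor 2 in front of \<delta>.\<close>

lemma flow_hardy_weight:
  fixes V :: "real \<Rightarrow> real^'n \<Rightarrow> real^'n::finite"
  assumes n: "CARD('n) \<ge> 3" and V: "basic_flow V" and \<delta>: "\<delta> > 0" "flow_norm V \<le> ennreal \<delta>" and t: "t > 0"
  shows "hardy_weight (sqrt (hardy_const CARD('n)) * (2 * \<delta>)) (V t)"
proof (rule hardy_weight_of_distribution_bound[OF n])
  show m: "V t \<in> borel_measurable lebesgue"
    using V t unfolding basic_flow_def weak_star_continuous_def in_weak_L_def by auto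
  show "2 * \<delta> > 0" using \<delta> by simp
  fix r :: real assume r: "r > 0"
  have "weak_norm (real CARD('n)) (V t) \<le> flow_norm V"
    unfolding flow_norm_def using t by (intro SUP_upper) simp
  then have "weak_norm (real CARD('n)) (V t) \<le> ennreal \<delta>" using \<delta>(2) by (rule order_trans)
  from weak_norm_imp_distribution_bound[OF m _ \<delta>(1) r this]
  show "emeasure lebesgue {x. r < norm (V t x)} \<le> ennreal ((2 * \<delta> / r) ^ CARD('n))"
    using \<delta> r by (simp add: distribution_fun_def powr_realpow)
qed

section \<open>Agreement with the Cauchy problem\<close>

context
  fixes V :: "real \<Rightarrow> real^'n \<Rightarrow> real^'n::finite"
  assumes n: "CARD('n) \<ge> 3" and V: "weak_star_continuous (real CARD('n)) V"
    and hw: "\<And>t. t > 0 \<Longrightarrow> hardy_weight (1/4) (V t)"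
begin

interpretation F: dissipative_family emb "flow_form V" 3 "1/2" grad
  by (rule flow_dissipative_family[OF n V hw])

lemma gen_form: "t > 0 \<Longrightarrow> F.gen t u \<bullet> w = form (V t) u w"
  by (simp add: F.gen flow_form_def)

text \<open>\<open>blinfun_inner_left\<close> is the Riesz isomorphism; it returns from
  representatives in the energy space to functionals in its dual.\<close>

lemma gen_L_op: "t > 0 \<Longrightarrow> blinfun_inner_left (F.gen t u) = L_op (V t) u"
  by (rule blinfun_eqI) (simp add: blinfun_apply_L_op[OF hw] gen_form inner_commute[of _ "F.gen t u"])

text \<open>The derivative is the Riesz image of \<open>- F.gen t (v t)\<close>. It is square
  integrable together with \<open>v\<close>, since the generator is bounded uniformly in time and
  the Riesz map does not increase norms.\<close>

lemma cauchy_solution_of_solution: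
  assumes s: "s \<ge> 0" and sol: "F.solution s f u v"
  shows "cauchy_solution V s f u v (\<lambda>t. blinfun_inner_left (- F.gen t (v t)))"
  unfolding cauchy_solution_def regularity_class_def
proof (intro conjI allI impI)
  note [measurable] = F.solutionD(3)[OF sol] F.gen_measurable[OF F.solutionD(3)[OF sol]]
  have [measurable]: "emb \<in> borel_measurable borel"
    by (intro borel_measurable_continuous_onI linear_continuous_on bounded_linear_emb)
  show "continuous_on {s..} u" "u s = f" by (rule F.solutionD[OF sol])+
  show "AE t in lebesgue_on {s<..}. u t = emb (v t)"
    using F.solutionD(5)[OF sol] by (simp add: AE_lebesgue_on_iff)
  show "AE t in lebesgue_on {s<..}. blinfun_inner_left (- F.gen t (v t)) + L_op (V t) (v t) = 0"
  proof -
    have "blinfun_inner_left (- F.gen t (v t)) + L_op (V t) (v t) = 0" if "s < t" for t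
      using s that gen_L_op[of t "v t", symmetric] by (simp, intro blinfun_eqI, simp add: plus_blinfun.rep_eq)
    then show ?thesis by (simp add: AE_lebesgue_on_iff)
  qed
  fix b assume b: "s < b"
  have ind: "(\<lambda>t. (norm (indicator {s<..<b} t *\<^sub>R h t))\<^sup>2) = (\<lambda>t. indicator {s<..<b} t * (norm (h t))\<^sup>2)" for h :: "real \<Rightarrow> 'n H1s"
    by (auto simp: indicator_def)
  show "bochner_L2 {s<..<b} v"
    using sq_intD(2)[OF F.solutionD(4)[OF sol, of b]] unfolding ind
    by (intro bochner_L2_of_borel) auto
  show "bochner_L2 {s<..<b} (\<lambda>t. blinfun_inner_left (- F.gen t (v t)))"
  proof (rule bochner_L2_of_borel)
    have "blinfun_inner_left \<in> borel_measurable (borel :: 'n H1s measure)"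
      by (intro borel_measurable_continuous_onI linear_continuous_on bounded_linear_blinfun_inner_left)
    from measurable_compose[OF _ this, of "\<lambda>t. - F.gen t (v t)" borel]
    show m: "(\<lambda>t. blinfun_inner_left (- F.gen t (v t))) \<in> borel_measurable borel" by measurable
    have ig: "integrable lborel (\<lambda>t. indicator {s<..<b} t * (norm (F.gen t (v t)))\<^sup>2)"
      using sq_intD(2)[OF F.sq_int_gen[OF F.solutionD(3,4)[OF sol], of b]] unfolding ind by simp
    show "integrable lborel (\<lambda>t. indicator {s<..<b} t * (norm (blinfun_inner_left (- F.gen t (v t))))\<^sup>2)"
    proof (rule Bochner_Integration.integrable_bound[OF ig])
      have [measurable]: "(\<lambda>t. norm (blinfun_inner_left (- F.gen t (v t)))) \<in> borel_measurable borel"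
        by (rule measurable_compose[OF m borel_measurable_norm])
      show "(\<lambda>t. indicator {s<..<b} t * (norm (blinfun_inner_left (- F.gen t (v t))))\<^sup>2) \<in> borel_measurable lborel"
        by measurable
      have "norm (blinfun_inner_left y) \<le> norm y" for y :: "'n H1s"
        by (rule norm_blinfun_bound) (auto simp: mult.commute intro: order_trans[OF Cauchy_Schwarz_ineq2])
      from power_mono[OF this norm_ge_zero, of "- F.gen _ _" 2]
      show "AE t in lborel. norm (indicator {s<..<b} t * (norm (blinfun_inner_left (- F.gen t (v t))))\<^sup>2)
          \<le> norm (indicator {s<..<b} t * (norm (F.gen t (v t)))\<^sup>2)"
        by (intro AE_I2) (simp add: indicator_def)
    qed
  qed simp
  show "weak_time_deriv s b u (\<lambda>t. blinfun_inner_left (- F.gen t (v t)))"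
    unfolding weak_time_deriv_def
  proof (intro allI impI)
    fix \<theta> :: "real \<Rightarrow> real" and w assume \<theta>: "test_fun {s<..<b} \<theta>"
    have [measurable]: "\<theta> \<in> borel_measurable borel" "deriv \<theta> \<in> borel_measurable borel"
      by (intro borel_measurable_continuous_onI test_fun_real(2,3)[OF \<theta>])+
    have "(LINT t|lebesgue_on {s<..<b}. deriv \<theta> t * (u t \<bullet> emb w))
        = (LINT t|lborel. indicator {s<..<b} t * (deriv \<theta> t * (emb (v t) \<bullet> emb w)))"
    proof (rule lebesgue_on_integral_eq)
      show "AE t in lborel. t \<in> {s<..<b} \<longrightarrow> deriv \<theta> t * (u t \<bullet> emb w) = deriv \<theta> t * (emb (v t) \<bullet> emb w)"
        using F.solutionD(5)[OF sol] by eventually_elim simp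
    qed auto
    also have "\<dots> = (LINT t|lborel. indicator {s<..<b} t * (\<theta> t * (F.gen t (v t) \<bullet> w)))"
      by (rule F.solutionD(6)[OF sol \<theta>])
    also have "\<dots> = (LINT t|lebesgue_on {s<..<b}. \<theta> t * (F.gen t (v t) \<bullet> w))"
      by (rule lebesgue_on_integral_eq[symmetric]) auto
    finally show "(LINT t|lebesgue_on {s<..<b}. deriv \<theta> t * (u t \<bullet> emb w))
        = - (LINT t|lebesgue_on {s<..<b}. \<theta> t * blinfun_apply (blinfun_inner_left (- F.gen t (v t))) w)"
      by (simp add: inner_commute[of w])
  qed
qed

text \<open>In the Cauchy problem \<open>v\<close> is Lebesgue measurable on each bounded interval,
  while the working notion demands one Borel function on the line. A Borel representative agrees
  almost everywhere, so no integral changes, and the equation replaces \<open>d t\<close> by the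
  generator.\<close>

lemma solution_of_cauchy_solution:
  assumes s: "s \<ge> 0" and sol: "cauchy_solution V s f u v d"
  shows "\<exists>v'. F.solution s f u v'"
proof -
  have cont: "continuous_on {s..} u" "u s = f"
    and emb_v: "AE t in lborel. s < t \<longrightarrow> u t = emb (v t)"
    and L2: "\<And>b. s < b \<Longrightarrow> bochner_L2 {s<..<b} v"
    and weak: "\<And>b. s < b \<Longrightarrow> weak_time_deriv s b u d"
    and eq: "AE t in lborel. s < t \<longrightarrow> d t + L_op (V t) (v t) = 0"
    using sol by (auto simp: cauchy_solution_def regularity_class_def AE_lebesgue_on_iff)
  have vm: "(\<lambda>t. indicator {s<..<b} t *\<^sub>R v t) \<in> borel_measurable lebesgue" if "s < b" for b
    using L2[OF that] by (simp add: bochner_L2_def borel_measurable_restrict_space_iff)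
  \<comment> \<open>Measurability on the half-line is obtained as the limit over an exhaustion by
    bounded intervals.\<close>
  have "(\<lambda>t. indicator {s<..} t *\<^sub>R v t) \<in> borel_measurable lebesgue"
  proof (rule borel_measurable_LIMSEQ_metric)
    show "(\<lambda>t. indicator {s<..<s + 1 + real k} t *\<^sub>R v t) \<in> borel_measurable lebesgue" for k by (rule vm) simp
    fix t
    obtain N where N: "t - s - 1 < real N" using reals_Archimedean2 by blast
    have "\<forall>\<^sub>F k in sequentially. indicator {s<..<s + 1 + real k} t *\<^sub>R v t = indicator {s<..} t *\<^sub>R v t"
      using eventually_ge_at_top[of N]
    proof eventually_elim
      case (elim k)
      then have "t < s + 1 + real k" using N by linarith
      then show ?case by (simp add: indicator_def)
    qed
    then show "(\<lambda>k. indicator {s<..<s + 1 + real k} t *\<^sub>R v t) \<longlonglongrightarrow> indicator {s<..} t *\<^sub>R v t"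
      by (rule tendsto_eventually)
  qed
  then obtain v' where v': "v' \<in> borel_measurable lborel" "AE t in lborel. indicator {s<..} t *\<^sub>R v t = v' t"
    by (rule borel_representative) (rule that)
  have v'm[measurable]: "v' \<in> borel_measurable borel" using v'(1) by simp
  have ae: "AE t in lborel. s < t \<longrightarrow> v t = v' t" using v'(2) by eventually_elim auto
  note [measurable] = F.gen_measurable[OF v'm]
  have [measurable]: "emb \<in> borel_measurable borel"
    by (intro borel_measurable_continuous_onI linear_continuous_on bounded_linear_emb)
  have "F.solution s f u v'"
    unfolding F.solution_def
  proof (intro conjI allI impI cont v'm)
    show "AE t in lborel. s < t \<longrightarrow> u t = emb (v' t)" using emb_v ae by eventually_elim simp
    fix b
    show "sq_int lborel (\<lambda>t. indicator {s<..<b} t *\<^sub>R v' t)"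
    proof (cases "s < b")
      case True
      have m: "(\<lambda>t. indicator {s<..<b} t * (norm (v' t))\<^sup>2) \<in> borel_measurable lborel" by measurable
      have "integrable lebesgue (\<lambda>t. indicator {s<..<b} t * (norm (v t))\<^sup>2)"
        using L2[OF True] by (simp add: bochner_L2_def integrable_restrict_space)
      then have "integrable lebesgue (\<lambda>t. indicator {s<..<b} t * (norm (v' t))\<^sup>2)"
      proof (rule integrable_cong_AE_imp)
        show "AE t in lebesgue. indicator {s<..<b} t * (norm (v t))\<^sup>2 = indicator {s<..<b} t * (norm (v' t))\<^sup>2"
          unfolding AE_completion_iff using ae by eventually_elim (auto simp: indicator_def)
      qed (rule measurable_completion[OF m])
      then have "integrable lborel (\<lambda>t. indicator {s<..<b} t * (norm (v' t))\<^sup>2)" by (simp only: integrable_completion[OF m])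
      moreover have "(\<lambda>t. (norm (indicator {s<..<b} t *\<^sub>R v' t))\<^sup>2) = (\<lambda>t. indicator {s<..<b} t * (norm (v' t))\<^sup>2)"
        by (auto simp: indicator_def)
      moreover have "(\<lambda>t. indicator {s<..<b} t *\<^sub>R v' t) \<in> borel_measurable lborel" by measurable
      ultimately show ?thesis by (simp add: sq_int_def)
    qed (simp add: sq_int_def)
    fix \<theta> :: "real \<Rightarrow> real" and w assume \<theta>: "test_fun {s<..<b} \<theta>"
    show "(LINT t|lborel. indicator {s<..<b} t * (deriv \<theta> t * (emb (v' t) \<bullet> emb w)))
        = (LINT t|lborel. indicator {s<..<b} t * (\<theta> t * (F.gen t (v' t) \<bullet> w)))"
    proof (cases "s < b")
      case True
      have [measurable]: "\<theta> \<in> borel_measurable borel" "deriv \<theta> \<in> borel_measurable borel"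
        by (intro borel_measurable_continuous_onI test_fun_real(2,3)[OF \<theta>])+
      have "(LINT t|lborel. indicator {s<..<b} t * (deriv \<theta> t * (emb (v' t) \<bullet> emb w)))
          = (LINT t|lebesgue_on {s<..<b}. deriv \<theta> t * (u t \<bullet> emb w))"
      proof (rule lebesgue_on_integral_eq[symmetric])
        show "AE t in lborel. t \<in> {s<..<b} \<longrightarrow> deriv \<theta> t * (u t \<bullet> emb w) = deriv \<theta> t * (emb (v' t) \<bullet> emb w)"
          using emb_v ae by eventually_elim simp
      qed auto
      also have "\<dots> = - (LINT t|lebesgue_on {s<..<b}. \<theta> t * blinfun_apply (d t) w)"
        using weak[OF True] \<theta> by (simp add: weak_time_deriv_def)
      also have "(LINT t|lebesgue_on {s<..<b}. \<theta> t * blinfun_apply (d t) w)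
          = (LINT t|lborel. indicator {s<..<b} t * - (\<theta> t * (F.gen t (v' t) \<bullet> w)))"
      proof (rule lebesgue_on_integral_eq)
        show "AE t in lborel. t \<in> {s<..<b} \<longrightarrow> \<theta> t * blinfun_apply (d t) w = - (\<theta> t * (F.gen t (v' t) \<bullet> w))"
          using eq ae
        proof eventually_elim
          case (elim t)
          show ?case
          proof
            assume t: "t \<in> {s<..<b}"
            then have "d t = - L_op (V t) (v' t)" using elim by (simp add: add_eq_0_iff2)
            then have "blinfun_apply (d t) w = - form (V t) (v' t) w"
              using t s by (simp add: uminus_blinfun.rep_eq blinfun_apply_L_op[OF hw])
            then show "\<theta> t * blinfun_apply (d t) w = - (\<theta> t * (F.gen t (v' t) \<bullet> w))"
              using t s by (simp add: gen_form)
          qed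
        qed
      qed auto
      finally show ?thesis by simp
    qed simp
  qed
  then show ?thesis by blast
qed

text \<open>The propagator of the dissipative family. Uniqueness within the class of the Cauchy
  problem reduces to uniqueness of working solutions, because every Cauchy solution has a
  representative of that kind.\<close>

lemma evolution_family_ex:
  "\<exists>T :: real \<Rightarrow> real \<Rightarrow> ('n L2s \<Rightarrow>\<^sub>L 'n L2s).
      (\<forall>s\<ge>0. \<forall>f.
        (\<exists>v d.
          cauchy_solution V s f (\<lambda>t. blinfun_apply (T t s) f) v d \<and>
          bochner_L2 {s<..} (\<lambda>t. grad (v t)) \<and>
          (\<forall>t\<ge>s. (norm (blinfun_apply (T t s) f))\<^sup>2
             + (LINT \<tau>|lebesgue_on {s..t}. (norm (grad (v \<tau>)))\<^sup>2) \<le> (norm f)\<^sup>2)) \<and>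
        ((\<lambda>t. norm (blinfun_apply (T t s) f - f)) \<longlongrightarrow> 0) (at_right s) \<and>
        (\<forall>u v d. cauchy_solution V s f u v d \<longrightarrow> (\<forall>t\<ge>s. u t = blinfun_apply (T t s) f)) \<and>
        bochner_Linf {s<..} (\<lambda>t. blinfun_apply (T t s) f)) \<and>
      (\<forall>s \<tau> t. 0 \<le> s \<and> s \<le> \<tau> \<and> \<tau> \<le> t \<longrightarrow> T t \<tau> o\<^sub>L T \<tau> s = T t s)"
\<comment> \<open>The zero operator for \<open>t < s\<close> is only a default: the Cauchy problem
  looks at times from \<open>s\<close> on.\<close>
proof (rule exI[of _ "\<lambda>t s. if s \<le> t then Blinfun (F.propagator t s) else 0"], intro conjI allI impI)
  let ?T = "\<lambda>t s. if s \<le> t then Blinfun (F.propagator t s) else 0"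
  have T: "blinfun_apply (?T t s) f = F.propagator t s f" if "s \<le> t" for t s f
    using that by (simp add: bounded_linear_Blinfun_apply[OF F.bounded_linear_propagator])
  show "?T t \<tau> o\<^sub>L ?T \<tau> s = ?T t s" if "0 \<le> s \<and> s \<le> \<tau> \<and> \<tau> \<le> t" for s \<tau> t
    by (rule blinfun_eqI) (use that T F.propagator_compose in \<open>simp del: if_split_asm add: blinfun_apply_blinfun_compose\<close>)
  fix s :: real and f :: "'n L2s" assume s: "s \<ge> 0"
  define u where "u t = blinfun_apply (?T t s) f" for t
  have sol: "\<exists>v. F.solution s f u v"
  proof -
    obtain v where v: "F.solution s f (\<lambda>t. F.propagator t s f) v" using F.propagator_solution by blast
    have uT: "u t = F.propagator t s f" if "s \<le> t" for t unfolding u_def by (rule T[OF that])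
    have "F.solution s f u v"
      unfolding F.solution_def
    proof (intro conjI allI impI F.solutionD(3,4,6)[OF v])
      show "continuous_on {s..} u"
        by (rule continuous_on_cong[THEN iffD2, OF refl _ F.solutionD(1)[OF v]]) (simp add: uT)
      show "u s = f" using uT[of s] F.solutionD(2)[OF v] by simp
      show "AE t in lborel. s < t \<longrightarrow> u t = emb (v t)" using F.solutionD(5)[OF v] by eventually_elim (simp add: uT)
    qed
    then show ?thesis by blast
  qed
  then obtain v where v: "F.solution s f u v" by blast
  note [measurable] = F.solutionD(3)[OF v]
  define G where "G t = (norm (grad (v t)))\<^sup>2" for t
  have grad_v: "(\<lambda>t. grad (v t)) \<in> borel_measurable borel"
    by (rule measurable_compose[OF F.solutionD(3)[OF v]])
       (intro borel_measurable_continuous_onI linear_continuous_on bounded_linear_grad)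
  have [measurable]: "G \<in> borel_measurable borel"
    unfolding G_def[abs_def] using measurable_compose[OF grad_v borel_measurable_norm] by measurable
  have iG: "integrable lborel (\<lambda>\<tau>. indicator {s<..t} \<tau> * G \<tau>)" for t
  proof -
    have "integrable lborel (\<lambda>\<tau>. indicator {s<..<t + 1} \<tau> * (norm (grad (v \<tau>)))\<^sup>2)"
      by (rule F.integrable_g[OF F.solutionD(3,4)[OF v]]) simp
    then show ?thesis
      by (rule Bochner_Integration.integrable_bound) (measurable, auto simp: G_def indicator_def)
  qed
  have en: "(norm (u t))\<^sup>2 + (LINT \<tau>|lborel. indicator {s<..t} \<tau> * G \<tau>) \<le> (norm f)\<^sup>2" if "s \<le> t" for t
    unfolding G_def by (rule F.solution_energy[OF v that])
  show "\<exists>v d. cauchy_solution V s f (\<lambda>t. blinfun_apply (?T t s) f) v d \<and>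
          bochner_L2 {s<..} (\<lambda>t. grad (v t)) \<and>
          (\<forall>t\<ge>s. (norm (blinfun_apply (?T t s) f))\<^sup>2
             + (LINT \<tau>|lebesgue_on {s..t}. (norm (grad (v \<tau>)))\<^sup>2) \<le> (norm f)\<^sup>2)"
    unfolding u_def[symmetric]
  proof (intro exI conjI allI impI)
    show "cauchy_solution V s f u v (\<lambda>t. blinfun_inner_left (- F.gen t (v t)))"
      by (rule cauchy_solution_of_solution[OF s v])
    show "bochner_L2 {s<..} (\<lambda>t. grad (v t))"
    proof (rule bochner_L2_of_borel)
      \<comment> \<open>The dissipation on each bounded interval is at most
        \<open>(norm f)^2\<close>; Fatou's lemma over growing intervals carries this bound to the
        half-line.\<close>
      have "(\<integral>\<^sup>+t. ennreal (indicator {s<..} t * G t) \<partial>lborel)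
          = (\<integral>\<^sup>+t. liminf (\<lambda>k. ennreal (indicator {s<..s + real k} t * G t)) \<partial>lborel)"
      proof (intro nn_integral_cong)
        fix t
        obtain N where N: "t - s < real N" using reals_Archimedean2 by blast
        have "\<forall>\<^sub>F k in sequentially. ennreal (indicator {s<..s + real k} t * G t) = ennreal (indicator {s<..} t * G t)"
          using eventually_ge_at_top[of N]
        proof eventually_elim
          case (elim k)
          then have "t \<le> s + real k" using N by linarith
          then show ?case by (simp add: indicator_def)
        qed
        then have "(\<lambda>k. ennreal (indicator {s<..s + real k} t * G t)) \<longlonglongrightarrow> ennreal (indicator {s<..} t * G t)"
          by (rule tendsto_eventually)
        then show "ennreal (indicator {s<..} t * G t) = liminf (\<lambda>k. ennreal (indicator {s<..s + real k} t * G t))"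
          by (simp add: lim_imp_Liminf)
      qed
      also have "\<dots> \<le> liminf (\<lambda>k. \<integral>\<^sup>+t. ennreal (indicator {s<..s + real k} t * G t) \<partial>lborel)"
        by (rule nn_integral_liminf) measurable
      also have "\<dots> \<le> liminf (\<lambda>k. ennreal ((norm f)\<^sup>2))"
      proof (intro Liminf_mono always_eventually allI)
        fix k :: nat
        have "(LINT \<tau>|lborel. indicator {s<..s + real k} \<tau> * G \<tau>) \<le> (norm f)\<^sup>2"
          using en[of "s + real k"] zero_le_power2[of "norm (u (s + real k))"] by linarith
        moreover have "(\<integral>\<^sup>+t. ennreal (indicator {s<..s + real k} t * G t) \<partial>lborel)
            = ennreal (LINT \<tau>|lborel. indicator {s<..s + real k} \<tau> * G \<tau>)"
          by (rule nn_integral_eq_integral[OF iG]) (simp add: G_def)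
        ultimately show "(\<integral>\<^sup>+t. ennreal (indicator {s<..s + real k} t * G t) \<partial>lborel) \<le> ennreal ((norm f)\<^sup>2)"
          by (simp add: ennreal_leI)
      qed
      also have "\<dots> < \<infinity>" by (simp add: Liminf_const)
      finally have "integrable lborel (\<lambda>t. indicator {s<..} t * G t)"
        by (intro integrableI_bounded) (measurable, simp add: G_def)
      then show "integrable lborel (\<lambda>t. indicator {s<..} t * (norm (grad (v t)))\<^sup>2)" by (simp add: G_def)
    qed (simp, rule grad_v)
    fix t assume t: "s \<le> t"
    \<comment> \<open>The statement integrates over the closed interval, the energy estimate over
      the half-open one; they differ by a null set.\<close>
    have "(LINT \<tau>|lebesgue_on {s..t}. (norm (grad (v \<tau>)))\<^sup>2) = (LINT \<tau>|lborel. indicator {s..t} \<tau> * G \<tau>)"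
      by (rule lebesgue_on_integral_eq) (simp, measurable, simp add: G_def)
    also have "\<dots> = (LINT \<tau>|lborel. indicator {s<..t} \<tau> * G \<tau>)"
    proof (rule integral_cong_AE)
      show "AE \<tau> in lborel. indicator {s..t} \<tau> * G \<tau> = indicator {s<..t} \<tau> * G \<tau>"
        using AE_lborel_singleton[of s] by eventually_elim (auto simp: indicator_def)
    qed measurable
    finally show "(norm (u t))\<^sup>2 + (LINT \<tau>|lebesgue_on {s..t}. (norm (grad (v \<tau>)))\<^sup>2) \<le> (norm f)\<^sup>2"
      using en[OF t] by simp
  qed
  show "((\<lambda>t. norm (blinfun_apply (?T t s) f - f)) \<longlongrightarrow> 0) (at_right s)"
    unfolding u_def[symmetric]
  proof -
    have "(u \<longlongrightarrow> u s) (at s within {s..})"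
      using F.solutionD(1)[OF v] by (simp add: continuous_on_def)
    then have "(u \<longlongrightarrow> u s) (at_right s)" by (rule tendsto_within_subset) auto
    from tendsto_norm_zero[OF LIM_zero[OF this]] show "((\<lambda>t. norm (u t - f)) \<longlongrightarrow> 0) (at_right s)"
      by (simp add: F.solutionD(2)[OF v])
  qed
  show "u' t = blinfun_apply (?T t s) f" if cs: "cauchy_solution V s f u' v' d'" and st: "s \<le> t" for u' v' d' t
  proof -
    obtain v'' where "F.solution s f u' v''" using solution_of_cauchy_solution[OF s cs] by blast
    from F.propagator_eq[OF this st] show ?thesis unfolding T[OF st] by simp
  qed
  show "bochner_Linf {s<..} (\<lambda>t. blinfun_apply (?T t s) f)"
    unfolding u_def[symmetric] bochner_Linf_def
  proof (intro conjI exI)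
    have "(\<lambda>t. indicator {s<..} t *\<^sub>R u t) \<in> borel_measurable borel"
      by (rule borel_measurable_continuous_on_indicator) (auto intro: continuous_on_subset[OF F.solutionD(1)[OF v]])
    then show "u \<in> borel_measurable (lebesgue_on {s<..})"
      by (simp add: borel_measurable_restrict_space_iff measurable_completion)
    show "AE t in lebesgue_on {s<..}. norm (u t) \<le> norm f"
      using F.solution_contraction[OF v] by (simp add: AE_lebesgue_on_iff)
  qed
qed

end

theorem theorem2p1:
  assumes "CARD('n::finite) \<ge> 3"
  shows "\<exists>\<delta>>0. \<forall>V :: real \<Rightarrow> real^'n \<Rightarrow> real^'n.
    basic_flow V \<and> flow_norm V \<le> ennreal \<delta> \<longrightarrow>
    (\<exists>T :: real \<Rightarrow> real \<Rightarrow> ('n L2s \<Rightarrow>\<^sub>L 'n L2s).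
      (\<forall>s\<ge>0. \<forall>f.
        (\<exists>v d.
          cauchy_solution V s f (\<lambda>t. blinfun_apply (T t s) f) v d \<and>
          bochner_L2 {s<..} (\<lambda>t. grad (v t)) \<and>
          (\<forall>t\<ge>s. (norm (blinfun_apply (T t s) f))\<^sup>2
             + (LINT \<tau>|lebesgue_on {s..t}. (norm (grad (v \<tau>)))\<^sup>2) \<le> (norm f)\<^sup>2)) \<and>
        ((\<lambda>t. norm (blinfun_apply (T t s) f - f)) \<longlongrightarrow> 0) (at_right s) \<and>
        (\<forall>u v d. cauchy_solution V s f u v d \<longrightarrow> (\<forall>t\<ge>s. u t = blinfun_apply (T t s) f)) \<and>
        bochner_Linf {s<..} (\<lambda>t. blinfun_apply (T t s) f)) \<and>
      (\<forall>s \<tau> t. 0 \<le> s \<and> s \<le> \<tau> \<and> \<tau> \<le> t \<longrightarrow> T t \<tau> o\<^sub>L T \<tau> s = T t s))"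
proof -
  \<comment> \<open>Chosen so that the Hardy bound with \<open>d = 2 \<delta>\<close> has norm
    exactly 1/4, the largest value for which the two transport terms together cost half of the
    gradient term.\<close>
  define \<delta> where "\<delta> = 1 / (8 * sqrt (hardy_const CARD('n)))"
  have h: "sqrt (hardy_const CARD('n)) > 0" using hardy_const_pos[of "CARD('n)"] by simp
  have \<delta>: "\<delta> > 0" using h by (simp add: \<delta>_def)
  have \<kappa>: "sqrt (hardy_const CARD('n)) * (2 * \<delta>) = 1/4" using h by (simp add: \<delta>_def)
  show ?thesis
  proof (rule exI[of _ \<delta>], rule conjI[OF \<delta>], intro allI impI, elim conjE, rule evolution_family_ex[OF assms])
    fix V :: "real \<Rightarrow> real^'n \<Rightarrow> real^'n" and t :: real
    assume V: "basic_flow V" "flow_norm V \<le> ennreal \<delta>"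
    then show "weak_star_continuous (real CARD('n)) V" by (simp add: basic_flow_def)
    show "hardy_weight (1/4) (V t)" if "t > 0"
      using flow_hardy_weight[OF assms V(1) \<delta> V(2) that] by (simp only: \<kappa>)
  qed
qed

end
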